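(* Let $(R,\mathfrak m,k)$ be a commutative noetherian local ring with $\mathfrak m$-adic completion $\widehat R$. Write $\widehat R=Q/(f)$, where $(Q,\mathfrak n,k)$ is a complete regular local ring and $f=f_1,\ldots,f_n\in\mathfrak n^2$ minimally generates $(f)$. If $Q\to\widehat R$ admits an embedded deformation, then $\mathsf V(R)$ is contained in a hyperplane of $\mathbb P_k^{n-1}$.
   Context: $Q\to\widehat R$ admits an embedded deformation if there are $g_1,\ldots,g_n\in\mathfrak n^2$ with $\widehat R\cong Q/(g_1,\ldots,g_n)$ and $g_n$ regular on $Q/(g_1,\ldots,g_{n-1})$. Let $E=\mathrm{Kos}^Q(f)=Q\langle\xi_1,\ldots,\xi_n\mid\partial\xi_i=f_i\rangle$ be the Koszul complex, a DG $Q$-algebra (exterior algebra on $\xi_i$ of homological degree $1$, $\partial\xi_i=f_i$). Regard $\widehat R$-modules as DG $E$-modules via $E\to\mathrm H_0(E)=\widehat R$. Let $\mathcal S=Q[\chi_1,\ldots,\chi_n]$ with $\chi_i$ of cohomological degree $2$, and $\Gamma=\bigoplus_i\mathrm{Hom}_Q(\mathcal S^i,Q)$ with basis $\{y^{(H)}\}_{H\in\mathbb N^n}$ dual to the monomials $\chi^H$, an $\mathcal S$-module via $\chi_i y^{(H)}=y^{(H-e_i)}$ if $h_i\ge1$ and $0$ otherwise. For a DG $E$-module $M$ choose a quasi-isomorphism of DG $E$-modules $F\to M$ with $F$ semiprojective over $Q$; then $U_E(F)$, the graded module $E\otimes_Q\Gamma\otimes_QF$ with differential $\partial^E\otimes1\otimes1+1\otimes1\otimes\partial^F+\sum_i(1\otimes\chi_i\otimes\lambda_i-\lambda_i\otimes\chi_i\otimes1)$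 ($\lambda_i$ = left multiplication by $\xi_i$), is a semiprojective resolution of $M$ over $E$ and a DG $\mathcal S$-module through $\Gamma$; so $\mathrm{Ext}^*_E(M,N)=\mathrm H(\mathrm{Hom}_E(U_E(F),N))$ is a graded $\mathcal S$-module, independently of the choice of $F$. Put $\mathcal A=\mathcal S\otimes_Qk=k[\chi_1,\ldots,\chi_n]$ and $\mathbb P^{n-1}_k=\mathrm{Proj}\,\mathcal A$ (homogeneous primes not containing $\mathcal A^{>0}$). Then $\mathsf V(R)=\mathsf V_R(R,k)=\mathrm{Supp}^+_{\mathcal A}(\mathrm{Ext}_E^*(\widehat R,k))$, where for a DG $\mathcal A$-module $X$, $\mathrm{Supp}^+_{\mathcal A}X=\{p\in\mathrm{Proj}\,\mathcal A: X\otimes^{\mathbf L}_{\mathcal A}\kappa(p)\not\simeq0\}$ with $\kappa(p)=\mathcal A_p/p\mathcal A_p$ (homogeneous localization). A hyperplane is the vanishing locus of a nonzero $k$-linear form in $\chi_1,\ldots,\chi_n$. *)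

theory Defs
  imports "HOL-Library.Poly_Mapping" "HOL-Library.Multiset"
    "HOL-Library.Extended_Nat" "HOL-Algebra.Ring_Divisibility" "HOL-Algebra.Ideal_Product"
begin

section \<open>Local rings\<close>

definition noetherian_local_ring :: "('a, 'b) ring_scheme \<Rightarrow> 'a set \<Rightarrow> bool" where
  "noetherian_local_ring R \<mm> \<longleftrightarrow>
     cring R \<and> noetherian_ring R \<and> maximalideal \<mm> R \<and> (\<forall>I. maximalideal I R \<longrightarrow> I = \<mm>)"

fun ideal_pow :: "('a, 'b) ring_scheme \<Rightarrow> 'a set \<Rightarrow> nat \<Rightarrow> 'a set" where
  "ideal_pow R I 0 = carrier R"
| "ideal_pow R I (Suc i) = ideal_prod R I (ideal_pow R I i)"

text \<open>The inverse limit of the rings \<open>R/\<mm>\<^sup>i\<close>.  The cosets \<open>x i\<close> and \<open>x (Suc i)\<close> are compatible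
  iff the former contains the latter.\<close>

definition adic_completion :: "('a, 'b) ring_scheme \<Rightarrow> 'a set \<Rightarrow> (nat \<Rightarrow> 'a set) ring" where
  "adic_completion R \<mm> =
    (let q = (\<lambda>i. R Quot (ideal_pow R \<mm> i)) in
     \<lparr>carrier = {x. \<forall>i. x i \<in> carrier (q i) \<and> x (Suc i) \<subseteq> x i},
      mult = (\<lambda>x y i. x i \<otimes>\<^bsub>q i\<^esub> y i),
      one = (\<lambda>i. \<one>\<^bsub>q i\<^esub>),
      zero = (\<lambda>i. \<zero>\<^bsub>q i\<^esub>),
      add = (\<lambda>x y i. x i \<oplus>\<^bsub>q i\<^esub> y i)\<rparr>)"

definition adically_complete :: "('a, 'b) ring_scheme \<Rightarrow> 'a set \<Rightarrow> bool" where
  "adically_complete R \<mm> \<longleftrightarrow>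
     bij_betw (\<lambda>r i. ideal_pow R \<mm> i +>\<^bsub>R\<^esub> r) (carrier R) (carrier (adic_completion R \<mm>))"

definition krull_dim :: "('a, 'b) ring_scheme \<Rightarrow> enat" where
  "krull_dim R = Sup {enat l | l. \<exists>P. (\<forall>i\<le>l. primeideal (P i) R) \<and> (\<forall>i<l. P i \<subset> P (Suc i))}"

definition regular_local_ring :: "('a, 'b) ring_scheme \<Rightarrow> 'a set \<Rightarrow> bool" where
  "regular_local_ring Q \<nn> \<longleftrightarrow> noetherian_local_ring Q \<nn> \<and>
     (\<exists>G. finite G \<and> G \<subseteq> carrier Q \<and> genideal Q G = \<nn> \<and> enat (card G) = krull_dim Q)"

definition minimally_generates ::
    "('a, 'b) ring_scheme \<Rightarrow> nat \<Rightarrow> (nat \<Rightarrow> 'a) \<Rightarrow> 'a set \<Rightarrow> bool" where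
  "minimally_generates Q n f I \<longleftrightarrow> f ` {..<n} \<subseteq> carrier Q \<and> genideal Q (f ` {..<n}) = I \<and>
     (\<forall>i<n. f i \<notin> genideal Q (f ` ({..<n} - {i})))"

text \<open>The isomorphism \<open>Q/(g) \<cong> S\<close> is one of \<open>Q\<close>-algebras: it is compatible with \<open>\<pi> : Q \<rightarrow> S\<close>.
  The generators are \<open>g\<^sub>0, \<dots>, g\<^sub>m\<close>, so there is at least one; the last is the regular one.\<close>

definition embedded_deformation ::
    "('a, 'b) ring_scheme \<Rightarrow> 'a set \<Rightarrow> ('c, 'd) ring_scheme \<Rightarrow> ('a \<Rightarrow> 'c) \<Rightarrow> bool" where
  "embedded_deformation Q \<nn> S \<pi> \<longleftrightarrow>
     (\<exists>(m::nat) g. (\<forall>i\<le>m. g i \<in> ideal_pow Q \<nn> 2) \<and>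
        (\<exists>h \<in> ring_iso (Q Quot genideal Q (g ` {..m})) S.
           \<forall>q\<in>carrier Q. h (genideal Q (g ` {..m}) +>\<^bsub>Q\<^esub> q) = \<pi> q) \<and>
        (let B = Q Quot genideal Q (g ` {..<m}) in
           \<forall>x\<in>carrier B. (genideal Q (g ` {..<m}) +>\<^bsub>Q\<^esub> g m) \<otimes>\<^bsub>B\<^esub> x = \<zero>\<^bsub>B\<^esub> \<longrightarrow> x = \<zero>\<^bsub>B\<^esub>))"


section \<open>Differential graded rings and modules\<close>

text \<open>A graded object is an abelian group together with a decomposition as the internal direct sum
  of the subgroups \<open>grade M i\<close>.  All degrees are homological: the differential lowers the degree by
  one, and cohomological degree \<open>i\<close> is \<open>grade M (- i)\<close>.  As in \<^theory>\<open>HOL-Algebra.Module\<close>, modules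
  inherit from rings the record fields \<open>mult\<close> and \<open>one\<close>, which carry no meaning for them.\<close>

record 'a dg = "'a ring" +
  grade :: "int \<Rightarrow> 'a set"
  diff :: "'a \<Rightarrow> 'a"

record ('a, 'm) dgm = "'m dg" +
  act :: "'a \<Rightarrow> 'm \<Rightarrow> 'm"

text \<open>\<open>(-1)\<^sup>i x\<close>\<close>

definition signed :: "('m, 'b) ring_scheme \<Rightarrow> int \<Rightarrow> 'm \<Rightarrow> 'm" where
  "signed M i x = (if even i then x else \<ominus>\<^bsub>M\<^esub> x)"

definition is_decomposition :: "('m, 'b) dg_scheme \<Rightarrow> 'm \<Rightarrow> (int \<Rightarrow> 'm) \<Rightarrow> bool" where
  "is_decomposition M x c \<longleftrightarrow> (\<forall>i. c i \<in> grade M i) \<and> finite {i. c i \<noteq> \<zero>\<^bsub>M\<^esub>} \<and>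
     x = finsum M c {i. c i \<noteq> \<zero>\<^bsub>M\<^esub>}"

definition component :: "('m, 'b) dg_scheme \<Rightarrow> 'm \<Rightarrow> int \<Rightarrow> 'm" where
  "component M x = (THE c. is_decomposition M x c)"

text \<open>The additive map with \<open>x \<mapsto> (-1)\<^sup>i x\<close> for \<open>x\<close> of degree \<open>i\<close>.\<close>

definition parity_twist :: "('m, 'b) dg_scheme \<Rightarrow> 'm \<Rightarrow> 'm" where
  "parity_twist M x =
     finsum M (\<lambda>i. signed M i (component M x i)) {i. component M x i \<noteq> \<zero>\<^bsub>M\<^esub>}"

locale dg_group = abelian_group M for M :: "('m, 'b) dg_scheme" (structure) +
  assumes grade_subgroup: "additive_subgroup (grade M i) M"
    and decomposition: "x \<in> carrier M \<Longrightarrow> \<exists>!c. is_decomposition M x c"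
    and diff_grade: "x \<in> grade M i \<Longrightarrow> diff M x \<in> grade M (i - 1)"
    and diff_closed: "x \<in> carrier M \<Longrightarrow> diff M x \<in> carrier M"
    and diff_add: "\<lbrakk>x \<in> carrier M; y \<in> carrier M\<rbrakk> \<Longrightarrow> diff M (x \<oplus> y) = diff M x \<oplus> diff M y"
    and diff_diff: "x \<in> carrier M \<Longrightarrow> diff M (diff M x) = \<zero>"

locale dg_ring = ring A + dg_group A for A :: "('a, 'b) dg_scheme" (structure) +
  assumes one_grade: "\<one> \<in> grade A 0"
    and mult_grade: "\<lbrakk>a \<in> grade A i; b \<in> grade A j\<rbrakk> \<Longrightarrow> a \<otimes> b \<in> grade A (i + j)"
    and leibniz: "\<lbrakk>a \<in> grade A i; b \<in> carrier A\<rbrakk> \<Longrightarrow>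
      diff A (a \<otimes> b) = (diff A a \<otimes> b) \<oplus> signed A i (a \<otimes> diff A b)"

locale dg_module = A?: dg_ring A + M?: dg_group M
  for A :: "('a, 'b) dg_scheme" (structure) and M :: "('a, 'm, 'c) dgm_scheme" (structure) +
  assumes act_closed: "\<lbrakk>a \<in> carrier A; x \<in> carrier M\<rbrakk> \<Longrightarrow> act M a x \<in> carrier M"
    and act_l_distr: "\<lbrakk>a \<in> carrier A; b \<in> carrier A; x \<in> carrier M\<rbrakk> \<Longrightarrow>
      act M (a \<oplus>\<^bsub>A\<^esub> b) x = act M a x \<oplus>\<^bsub>M\<^esub> act M b x"
    and act_r_distr: "\<lbrakk>a \<in> carrier A; x \<in> carrier M; y \<in> carrier M\<rbrakk> \<Longrightarrow>
      act M a (x \<oplus>\<^bsub>M\<^esub> y) = act M a x \<oplus>\<^bsub>M\<^esub> act M a y"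
    and act_assoc: "\<lbrakk>a \<in> carrier A; b \<in> carrier A; x \<in> carrier M\<rbrakk> \<Longrightarrow>
      act M (a \<otimes>\<^bsub>A\<^esub> b) x = act M a (act M b x)"
    and act_one: "x \<in> carrier M \<Longrightarrow> act M \<one>\<^bsub>A\<^esub> x = x"
    and act_grade: "\<lbrakk>a \<in> grade A i; x \<in> grade M j\<rbrakk> \<Longrightarrow> act M a x \<in> grade M (i + j)"
    and act_leibniz: "\<lbrakk>a \<in> grade A i; x \<in> carrier M\<rbrakk> \<Longrightarrow>
      diff M (act M a x) = act M (diff A a) x \<oplus>\<^bsub>M\<^esub> signed M i (act M a (diff M x))"

definition dg_hom ::
    "('a, 'b) dg_scheme \<Rightarrow> ('a, 'm, 'c) dgm_scheme \<Rightarrow> ('a, 'n, 'd) dgm_scheme \<Rightarrow> ('m \<Rightarrow> 'n) \<Rightarrow> bool"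
  where
  "dg_hom A M N \<alpha> \<longleftrightarrow> \<alpha> \<in> carrier M \<rightarrow> carrier N \<and>
     (\<forall>x\<in>carrier M. \<forall>y\<in>carrier M. \<alpha> (x \<oplus>\<^bsub>M\<^esub> y) = \<alpha> x \<oplus>\<^bsub>N\<^esub> \<alpha> y) \<and>
     (\<forall>a\<in>carrier A. \<forall>x\<in>carrier M. \<alpha> (act M a x) = act N a (\<alpha> x)) \<and>
     (\<forall>i. \<alpha> ` grade M i \<subseteq> grade N i) \<and>
     (\<forall>x\<in>carrier M. \<alpha> (diff M x) = diff N (\<alpha> x))"


subsection \<open>Homology\<close>

definition cycles :: "('m, 'b) dg_scheme \<Rightarrow> 'm set" where
  "cycles M = {x \<in> carrier M. diff M x = \<zero>\<^bsub>M\<^esub>}"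

definition boundaries :: "('m, 'b) dg_scheme \<Rightarrow> 'm set" where
  "boundaries M = diff M ` carrier M"

text \<open>The action is well defined on homology classes for scalars \<open>a\<close> that are cycles; below, homology
  is regarded as a module only over rings with zero differential.\<close>

definition homology :: "('a, 'm, 'b) dgm_scheme \<Rightarrow> ('a, 'm set) dgm" where
  "homology M =
    \<lparr>carrier = (\<lambda>z. boundaries M +>\<^bsub>M\<^esub> z) ` cycles M,
     mult = undefined, one = undefined,
     zero = boundaries M,
     add = set_add M,
     grade = (\<lambda>i. (\<lambda>z. boundaries M +>\<^bsub>M\<^esub> z) ` (cycles M \<inter> grade M i)),
     diff = (\<lambda>_. boundaries M),
     act = (\<lambda>a X. boundaries M <+>\<^bsub>M\<^esub> act M a ` X)\<rparr>"

text \<open>For a map \<open>\<alpha>\<close> commuting with the differentials, \<open>X \<mapsto> boundaries N + \<alpha>(X)\<close> is the map induced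
  on homology.\<close>

definition quasi_iso :: "('m, 'b) dg_scheme \<Rightarrow> ('n, 'c) dg_scheme \<Rightarrow> ('m \<Rightarrow> 'n) \<Rightarrow> bool" where
  "quasi_iso M N \<alpha> \<longleftrightarrow>
     bij_betw (\<lambda>X. boundaries N <+>\<^bsub>N\<^esub> \<alpha> ` X)
       ((\<lambda>z. boundaries M +>\<^bsub>M\<^esub> z) ` cycles M) ((\<lambda>z. boundaries N +>\<^bsub>N\<^esub> z) ` cycles N)"

definition acyclic_dg :: "('m, 'b) dg_scheme \<Rightarrow> bool" where
  "acyclic_dg M \<longleftrightarrow> cycles M = boundaries M"


subsection \<open>Homomorphism complexes\<close>

definition hom_degree ::
    "('a, 'b) dg_scheme \<Rightarrow> ('a, 'm, 'c) dgm_scheme \<Rightarrow> ('a, 'n, 'd) dgm_scheme \<Rightarrow> int \<Rightarrow> ('m \<Rightarrow> 'n) set"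
  where
  "hom_degree A M N i = {\<phi> \<in> carrier M \<rightarrow>\<^sub>E carrier N.
     (\<forall>x\<in>carrier M. \<forall>y\<in>carrier M. \<phi> (x \<oplus>\<^bsub>M\<^esub> y) = \<phi> x \<oplus>\<^bsub>N\<^esub> \<phi> y) \<and>
     (\<forall>j. \<forall>a\<in>grade A j. \<forall>x\<in>carrier M. \<phi> (act M a x) = signed N (i * j) (act N a (\<phi> x))) \<and>
     (\<forall>j. \<phi> ` grade M j \<subseteq> grade N (i + j))}"

text \<open>The direct sum of the \<open>hom_degree A M N i\<close>.  With \<open>\<epsilon>\<close> the parity twist one has
  \<open>\<epsilon> \<circ> \<phi> \<circ> \<epsilon> = (-1)\<^sup>i \<phi>\<close> for \<open>\<phi>\<close> of degree \<open>i\<close>, so that the differential is the usual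
  \<open>\<phi> \<mapsto> \<partial> \<circ> \<phi> - (-1)\<^sup>i \<phi> \<circ> \<partial>\<close> on such \<open>\<phi>\<close>.\<close>

definition hom_complex ::
    "('a, 'b) dg_scheme \<Rightarrow> ('a, 'm, 'c) dgm_scheme \<Rightarrow> ('a, 'n, 'd) dgm_scheme \<Rightarrow> ('m \<Rightarrow> 'n) dg"
  where
  "hom_complex A M N =
    \<lparr>carrier = {\<phi> \<in> extensional (carrier M). \<exists>I \<psi>. finite I \<and> (\<forall>i\<in>I. \<psi> i \<in> hom_degree A M N i) \<and>
        (\<forall>x\<in>carrier M. \<phi> x = finsum N (\<lambda>i. \<psi> i x) I)},
     mult = undefined, one = undefined,
     zero = (\<lambda>x\<in>carrier M. \<zero>\<^bsub>N\<^esub>),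
     add = (\<lambda>\<phi> \<psi>. \<lambda>x\<in>carrier M. \<phi> x \<oplus>\<^bsub>N\<^esub> \<psi> x),
     grade = hom_degree A M N,
     diff = (\<lambda>\<phi>. \<lambda>x\<in>carrier M.
        diff N (\<phi> x) \<ominus>\<^bsub>N\<^esub> parity_twist N (\<phi> (parity_twist M (diff M x))))\<rparr>"


subsection \<open>Semiprojective modules\<close>

text \<open>\<open>Hom\<^sub>A(P, -)\<close> preserves surjective quasi-isomorphisms.  The test modules range over those
  carried by subsets of \<open>nat \<times> 'a \<times> 'm \<Rightarrow> 'a\<close>.  This is no restriction: up to isomorphism they include
  \<open>P\<close> and a semifree resolution \<open>G \<rightarrow> P\<close> by a surjection (\<open>G\<close> consists of finitely supported functions
  to \<open>A\<close> on a basis of cardinality at most \<open>\<bar>nat \<times> 'a \<times> 'm\<bar>\<close>), and lifting the identity of \<open>P\<close>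
  along it makes \<open>P\<close> a retract of \<open>G\<close>, hence semiprojective with respect to all modules.\<close>

definition semiprojective :: "('a, 'b) dg_scheme \<Rightarrow> ('a, 'm, 'c) dgm_scheme \<Rightarrow> bool" where
  "semiprojective A P \<longleftrightarrow> dg_module A P \<and>
     (\<forall>(M :: ('a, nat \<times> 'a \<times> 'm \<Rightarrow> 'a) dgm) (N :: ('a, nat \<times> 'a \<times> 'm \<Rightarrow> 'a) dgm) \<beta>.
        dg_module A M \<and> dg_module A N \<and> dg_hom A M N \<beta> \<and>
        \<beta> ` carrier M = carrier N \<and> quasi_iso M N \<beta> \<longrightarrow>
        compose (carrier P) \<beta> ` carrier (hom_complex A P M) = carrier (hom_complex A P N) \<and>
        quasi_iso (hom_complex A P M) (hom_complex A P N) (compose (carrier P) \<beta>))"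


subsection \<open>Tensor products over graded-commutative rings\<close>

text \<open>The tensor product is the free abelian group on \<open>carrier M \<times> carrier N\<close> modulo the subgroup
  \<open>tensor_rel A M N\<close>; a left module is a right module by \<open>x a = (-1)\<^bsup>|a||x|\<^esup> a x\<close>.\<close>

inductive_set tensor_rel ::
    "('a, 'b) dg_scheme \<Rightarrow> ('a, 'm, 'c) dgm_scheme \<Rightarrow> ('a, 'n, 'd) dgm_scheme \<Rightarrow> (('m \<times> 'n) \<Rightarrow>\<^sub>0 int) set"
  for A and M and N where
  zero: "0 \<in> tensor_rel A M N"
| diff: "\<lbrakk>r \<in> tensor_rel A M N; s \<in> tensor_rel A M N\<rbrakk> \<Longrightarrow> r - s \<in> tensor_rel A M N"
| add_left: "\<lbrakk>x \<in> carrier M; x' \<in> carrier M; y \<in> carrier N\<rbrakk> \<Longrightarrow>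
    frag_of (x \<oplus>\<^bsub>M\<^esub> x', y) - frag_of (x, y) - frag_of (x', y) \<in> tensor_rel A M N"
| add_right: "\<lbrakk>x \<in> carrier M; y \<in> carrier N; y' \<in> carrier N\<rbrakk> \<Longrightarrow>
    frag_of (x, y \<oplus>\<^bsub>N\<^esub> y') - frag_of (x, y) - frag_of (x, y') \<in> tensor_rel A M N"
| balanced: "\<lbrakk>a \<in> grade A i; x \<in> grade M j; y \<in> carrier N\<rbrakk> \<Longrightarrow>
    frag_of (signed M (i * j) (act M a x), y) - frag_of (x, act N a y) \<in> tensor_rel A M N"

definition tensor_class ::
    "('a, 'b) dg_scheme \<Rightarrow> ('a, 'm, 'c) dgm_scheme \<Rightarrow> ('a, 'n, 'd) dgm_scheme \<Rightarrow>
      (('m \<times> 'n) \<Rightarrow>\<^sub>0 int) \<Rightarrow> (('m \<times> 'n) \<Rightarrow>\<^sub>0 int) set" where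
  "tensor_class A M N c = {c + r | r. r \<in> tensor_rel A M N}"

definition tensor_product ::
    "('a, 'b) dg_scheme \<Rightarrow> ('a, 'm, 'c) dgm_scheme \<Rightarrow> ('a, 'n, 'd) dgm_scheme \<Rightarrow>
      ('a, (('m \<times> 'n) \<Rightarrow>\<^sub>0 int) set) dgm" where
  "tensor_product A M N =
    \<lparr>carrier = {tensor_class A M N c | c. Poly_Mapping.keys c \<subseteq> carrier M \<times> carrier N},
     mult = undefined, one = undefined,
     zero = tensor_rel A M N,
     add = (\<lambda>X Y. {c + d | c d. c \<in> X \<and> d \<in> Y}),
     grade = (\<lambda>k. {tensor_class A M N c | c. Poly_Mapping.keys c \<subseteq> (\<Union>i. grade M i \<times> grade N (k - i))}),
     diff = (\<lambda>X. \<Union>c\<in>X. tensor_class A M N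
       (frag_extend (\<lambda>(x, y). frag_of (diff M x, y) + frag_of (parity_twist M x, diff N y)) c)),
     act = (\<lambda>a X. \<Union>c\<in>X. tensor_class A M N (frag_extend (\<lambda>(x, y). frag_of (act M a x, y)) c))\<rparr>"

text \<open>\<open>X \<otimes>\<^sup>L\<^sub>A K \<noteq> 0\<close>, computed with a semiprojective resolution \<open>P \<rightarrow> X\<close>.  Any two such resolutions
  are homotopy equivalent, and the type of \<open>P\<close> is large enough to hold a semifree one.\<close>

definition derived_tensor_nonzero ::
    "('a, 'b) dg_scheme \<Rightarrow> ('a, 'x, 'c) dgm_scheme \<Rightarrow> ('a, 'y, 'd) dgm_scheme \<Rightarrow> bool" where
  "derived_tensor_nonzero A X K \<longleftrightarrow>
     (\<exists>(P :: ('a, nat \<times> 'a \<times> 'x \<Rightarrow> 'a) dgm) \<rho>.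
        semiprojective A P \<and> dg_hom A P X \<rho> \<and> quasi_iso P X \<rho> \<and> \<not> acyclic_dg (tensor_product A P K))"


section \<open>Homogeneous primes and support\<close>

text \<open>In this section \<open>A\<close> is a commutative graded ring, that is, a DG ring with zero differential
  concentrated in even degrees.\<close>

definition homogeneous_ideal :: "('a, 'b) dg_scheme \<Rightarrow> 'a set \<Rightarrow> bool" where
  "homogeneous_ideal A p \<longleftrightarrow> ideal p A \<and> (\<forall>x\<in>p. \<forall>i. component A x i \<in> p)"

text \<open>Positive cohomological degrees are negative homological degrees.\<close>

definition irrelevant_ideal :: "('a, 'b) dg_scheme \<Rightarrow> 'a set" where
  "irrelevant_ideal A = {x \<in> carrier A. \<forall>i\<ge>0. component A x i = \<zero>\<^bsub>A\<^esub>}"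

definition Proj :: "('a, 'b) dg_scheme \<Rightarrow> 'a set set" where
  "Proj A = {p. primeideal p A \<and> homogeneous_ideal A p \<and> \<not> irrelevant_ideal A \<subseteq> p}"

definition denominators :: "('a, 'b) dg_scheme \<Rightarrow> 'a set \<Rightarrow> 'a set" where
  "denominators A p = {s \<in> carrier A - p. \<exists>i. s \<in> grade A i}"

definition fraction_rel :: "('a, 'b) dg_scheme \<Rightarrow> 'a set \<Rightarrow> (('a \<times> 'a) \<times> ('a \<times> 'a)) set" where
  "fraction_rel A p = {((a, s), (b, t)). a \<in> carrier A \<and> b \<in> carrier A \<and>
     s \<in> denominators A p \<and> t \<in> denominators A p \<and>
     (\<exists>u\<in>denominators A p. u \<otimes>\<^bsub>A\<^esub> ((a \<otimes>\<^bsub>A\<^esub> t) \<ominus>\<^bsub>A\<^esub> (b \<otimes>\<^bsub>A\<^esub> s)) = \<zero>\<^bsub>A\<^esub>)}"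

definition fraction :: "('a, 'b) dg_scheme \<Rightarrow> 'a set \<Rightarrow> 'a \<Rightarrow> 'a \<Rightarrow> ('a \<times> 'a) set" where
  "fraction A p a s = fraction_rel A p `` {(a, s)}"

definition homogeneous_localization :: "('a, 'b) dg_scheme \<Rightarrow> 'a set \<Rightarrow> ('a \<times> 'a) set dg" where
  "homogeneous_localization A p =
    \<lparr>carrier = {fraction A p a s | a s. a \<in> carrier A \<and> s \<in> denominators A p},
     mult = (\<lambda>X Y. \<Union>(a, s)\<in>X. \<Union>(b, t)\<in>Y. fraction A p (a \<otimes>\<^bsub>A\<^esub> b) (s \<otimes>\<^bsub>A\<^esub> t)),
     one = fraction A p \<one>\<^bsub>A\<^esub> \<one>\<^bsub>A\<^esub>,
     zero = fraction A p \<zero>\<^bsub>A\<^esub> \<one>\<^bsub>A\<^esub>,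
     add = (\<lambda>X Y. \<Union>(a, s)\<in>X. \<Union>(b, t)\<in>Y.
       fraction A p ((a \<otimes>\<^bsub>A\<^esub> t) \<oplus>\<^bsub>A\<^esub> (b \<otimes>\<^bsub>A\<^esub> s)) (s \<otimes>\<^bsub>A\<^esub> t)),
     grade = (\<lambda>i. {fraction A p a s | a s j.
       s \<in> denominators A p \<and> s \<in> grade A j \<and> a \<in> grade A (i + j)}),
     diff = (\<lambda>_. fraction A p \<zero>\<^bsub>A\<^esub> \<one>\<^bsub>A\<^esub>)\<rparr>"

text \<open>\<open>\<kappa>(p) = A\<^sub>p/pA\<^sub>p\<close>, as a DG \<open>A\<close>-module.\<close>

definition residue_module :: "('a, 'b) dg_scheme \<Rightarrow> 'a set \<Rightarrow> ('a, ('a \<times> 'a) set set) dgm" where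
  "residue_module A p =
    (let L = homogeneous_localization A p;
         I = genideal L {fraction A p a \<one>\<^bsub>A\<^esub> | a. a \<in> p};
         K = L Quot I in
     \<lparr>carrier = carrier K, mult = mult K, one = one K, zero = zero K, add = add K,
      grade = (\<lambda>i. (\<lambda>x. I +>\<^bsub>L\<^esub> x) ` grade L i),
      diff = (\<lambda>_. zero K),
      act = (\<lambda>a x. (I +>\<^bsub>L\<^esub> fraction A p a \<one>\<^bsub>A\<^esub>) \<otimes>\<^bsub>K\<^esub> x)\<rparr>)"

definition Supp_plus :: "('a, 'b) dg_scheme \<Rightarrow> ('a, 'x, 'c) dgm_scheme \<Rightarrow> 'a set set" where
  "Supp_plus A X = {p \<in> Proj A. derived_tensor_nonzero A X (residue_module A p)}"


section \<open>Polynomial rings of cohomology operators\<close>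

text \<open>A multiset \<open>H\<close> of indices below \<open>n\<close> stands for the monomial \<open>\<chi>\<^sup>H\<close>; it has cohomological degree \<open>2|H|\<close>.\<close>

definition op_ring :: "('a, 'b) ring_scheme \<Rightarrow> nat \<Rightarrow> (nat multiset \<Rightarrow> 'a) dg" where
  "op_ring R n =
    (let C = {s. (\<forall>H. s H \<in> carrier R) \<and> finite {H. s H \<noteq> \<zero>\<^bsub>R\<^esub>} \<and>
                 (\<forall>H. s H \<noteq> \<zero>\<^bsub>R\<^esub> \<longrightarrow> set_mset H \<subseteq> {..<n})} in
     \<lparr>carrier = C,
      mult = (\<lambda>s t H. \<Oplus>\<^bsub>R\<^esub>G\<in>{G. G \<subseteq># H}. s G \<otimes>\<^bsub>R\<^esub> t (H - G)),
      one = (\<lambda>H. if H = {#} then \<one>\<^bsub>R\<^esub> else \<zero>\<^bsub>R\<^esub>),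
      zero = (\<lambda>H. \<zero>\<^bsub>R\<^esub>),
      add = (\<lambda>s t H. s H \<oplus>\<^bsub>R\<^esub> t H),
      grade = (\<lambda>i. {s \<in> C. \<forall>H. s H \<noteq> \<zero>\<^bsub>R\<^esub> \<longrightarrow> i = - 2 * int (size H)}),
      diff = (\<lambda>_ _. \<zero>\<^bsub>R\<^esub>)\<rparr>)"

definition linear_form :: "('a, 'b) ring_scheme \<Rightarrow> nat \<Rightarrow> (nat \<Rightarrow> 'a) \<Rightarrow> nat multiset \<Rightarrow> 'a" where
  "linear_form R n c = (\<lambda>H. if \<exists>i<n. H = {#i#} then c (THE i. H = {#i#}) else \<zero>\<^bsub>R\<^esub>)"

definition hyperplane :: "('a, 'b) ring_scheme \<Rightarrow> nat \<Rightarrow> (nat multiset \<Rightarrow> 'a) set set \<Rightarrow> bool" where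
  "hyperplane k n Z \<longleftrightarrow>
     (\<exists>c. (\<forall>i<n. c i \<in> carrier k) \<and> (\<exists>i<n. c i \<noteq> \<zero>\<^bsub>k\<^esub>) \<and>
          Z = {p \<in> Proj (op_ring k n). linear_form k n c \<in> p})"


section \<open>The Koszul complex\<close>

text \<open>The coefficient of \<open>\<xi>\<^sub>J = \<xi>\<^bsub>j\<^sub>1\<^esub> \<cdots> \<xi>\<^bsub>j\<^sub>r\<^esub>\<close>, \<open>J = {j\<^sub>1 < \<dots> < j\<^sub>r}\<close>, in an element \<open>e\<close> of \<open>E\<close> is \<open>e J\<close>.
  One has \<open>\<xi>\<^sub>J \<xi>\<^sub>K = (-1)\<^bsup>inversions J K\<^esup> \<xi>\<^bsub>J \<union> K\<^esub>\<close> for disjoint \<open>J\<close>, \<open>K\<close>.\<close>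

definition inversions :: "nat set \<Rightarrow> nat set \<Rightarrow> int" where
  "inversions J K = int (card {(j, k). j \<in> J \<and> k \<in> K \<and> k < j})"

definition koszul :: "('q, 'b) ring_scheme \<Rightarrow> nat \<Rightarrow> (nat \<Rightarrow> 'q) \<Rightarrow> (nat set \<Rightarrow> 'q) dg" where
  "koszul Q n f =
    (let C = {e. (\<forall>J. e J \<in> carrier Q) \<and> (\<forall>J. \<not> J \<subseteq> {..<n} \<longrightarrow> e J = \<zero>\<^bsub>Q\<^esub>)} in
     \<lparr>carrier = C,
      mult = (\<lambda>d e J. \<Oplus>\<^bsub>Q\<^esub>K\<in>Pow J. signed Q (inversions K (J - K)) (d K \<otimes>\<^bsub>Q\<^esub> e (J - K))),
      one = (\<lambda>J. if J = {} then \<one>\<^bsub>Q\<^esub> else \<zero>\<^bsub>Q\<^esub>),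
      zero = (\<lambda>J. \<zero>\<^bsub>Q\<^esub>),
      add = (\<lambda>d e J. d J \<oplus>\<^bsub>Q\<^esub> e J),
      grade = (\<lambda>i. {e \<in> C. \<forall>J. e J \<noteq> \<zero>\<^bsub>Q\<^esub> \<longrightarrow> i = int (card J)}),
      diff = (\<lambda>e J. \<Oplus>\<^bsub>Q\<^esub>j\<in>{..<n} - J. signed Q (inversions {j} J) (f j \<otimes>\<^bsub>Q\<^esub> e (insert j J)))\<rparr>)"

definition kos_const :: "('q, 'b) ring_scheme \<Rightarrow> 'q \<Rightarrow> nat set \<Rightarrow> 'q" where
  "kos_const Q q = (\<lambda>J. if J = {} then q else \<zero>\<^bsub>Q\<^esub>)"

definition kos_xi :: "('q, 'b) ring_scheme \<Rightarrow> nat \<Rightarrow> nat set \<Rightarrow> 'q" where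
  "kos_xi Q i = (\<lambda>J. if J = {i} then \<one>\<^bsub>Q\<^esub> else \<zero>\<^bsub>Q\<^esub>)"

text \<open>A ring \<open>B\<close> with a ring homomorphism \<open>\<phi> : Q \<rightarrow> B\<close> that annihilates \<open>(f)\<close>, as a DG module over
  \<open>E\<close> through \<open>E \<rightarrow> H\<^sub>0(E) = Q/(f) \<rightarrow> B\<close>.\<close>

definition inflation :: "('c, 'b) ring_scheme \<Rightarrow> ('q \<Rightarrow> 'c) \<Rightarrow> (nat set \<Rightarrow> 'q, 'c) dgm" where
  "inflation B \<phi> =
    \<lparr>carrier = carrier B, mult = mult B, one = one B, zero = zero B, add = add B,
     grade = (\<lambda>i. if i = 0 then carrier B else {\<zero>\<^bsub>B\<^esub>}),
     diff = (\<lambda>_. \<zero>\<^bsub>B\<^esub>),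
     act = (\<lambda>e b. \<phi> (e {}) \<otimes>\<^bsub>B\<^esub> b)\<rparr>"

definition degree_zero_ring :: "('q, 'b) ring_scheme \<Rightarrow> 'q dg" where
  "degree_zero_ring Q =
    \<lparr>carrier = carrier Q, mult = mult Q, one = one Q, zero = zero Q, add = add Q,
     grade = (\<lambda>i. if i = 0 then carrier Q else {\<zero>\<^bsub>Q\<^esub>}),
     diff = (\<lambda>_. \<zero>\<^bsub>Q\<^esub>)\<rparr>"

definition restrict_scalars ::
    "('q, 'b) ring_scheme \<Rightarrow> (nat set \<Rightarrow> 'q, 'm, 'c) dgm_scheme \<Rightarrow> ('q, 'm) dgm" where
  "restrict_scalars Q F =
    \<lparr>carrier = carrier F, mult = mult F, one = one F, zero = zero F, add = add F,
     grade = grade F, diff = diff F,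
     act = (\<lambda>q. act F (kos_const Q q))\<rparr>"


subsection \<open>The resolution \<open>U\<^sub>E(F)\<close>\<close>

text \<open>Since \<open>E\<close> and \<open>\<Gamma>\<close> are free over \<open>Q\<close> on the \<open>\<xi>\<^sub>J\<close> and the \<open>y\<^bsup>(H)\<^esup>\<close>, an element of
  \<open>E \<otimes>\<^sub>Q \<Gamma> \<otimes>\<^sub>Q F\<close> is a finite sum of terms \<open>\<xi>\<^sub>J \<otimes> y\<^bsup>(H)\<^esup> \<otimes> u J H\<close> with \<open>u J H \<in> F\<close>.  The four
  summands of the differential are those of
  \<open>\<partial>\<^sup>E \<otimes> 1 \<otimes> 1 + 1 \<otimes> 1 \<otimes> \<partial>\<^sup>F + \<Sum>\<^sub>i 1 \<otimes> \<chi>\<^sub>i \<otimes> \<lambda>\<^sub>i - \<Sum>\<^sub>i \<lambda>\<^sub>i \<otimes> \<chi>\<^sub>i \<otimes> 1\<close>; by the sign rule for tensor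
  products of maps, the odd maps \<open>\<partial>\<^sup>F\<close> and \<open>\<lambda>\<^sub>i\<close> on \<open>F\<close> acquire the sign \<open>(-1)\<^bsup>|J|\<^esup>\<close> in passing
  \<open>\<xi>\<^sub>J\<close>.  As \<open>\<chi>\<^sub>i y\<^bsup>(H + e\<^sub>i)\<^esup> = y\<^bsup>(H)\<^esup>\<close>, the coefficient at \<open>y\<^bsup>(H)\<^esup>\<close> after applying \<open>\<chi>\<^sub>i\<close> is the
  one at \<open>add_mset i H\<close> before.\<close>

definition UE ::
    "('q, 'b) ring_scheme \<Rightarrow> nat \<Rightarrow> (nat \<Rightarrow> 'q) \<Rightarrow> (nat set \<Rightarrow> 'q, 'm, 'c) dgm_scheme \<Rightarrow>
      (nat set \<Rightarrow> 'q, nat set \<Rightarrow> nat multiset \<Rightarrow> 'm) dgm" where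
  "UE Q n f F =
    (let C = {u. (\<forall>J H. u J H \<in> carrier F) \<and> finite {(J, H). u J H \<noteq> \<zero>\<^bsub>F\<^esub>} \<and>
                 (\<forall>J H. u J H \<noteq> \<zero>\<^bsub>F\<^esub> \<longrightarrow> J \<subseteq> {..<n} \<and> set_mset H \<subseteq> {..<n})} in
     \<lparr>carrier = C,
      mult = undefined, one = undefined,
      zero = (\<lambda>J H. \<zero>\<^bsub>F\<^esub>),
      add = (\<lambda>u v J H. u J H \<oplus>\<^bsub>F\<^esub> v J H),
      grade = (\<lambda>i. {u \<in> C. \<forall>J H. u J H \<in> grade F (i - int (card J) - 2 * int (size H))}),
      diff = (\<lambda>u J H.
        (\<Oplus>\<^bsub>F\<^esub>j\<in>{..<n} - J. signed F (inversions {j} J) (act F (kos_const Q (f j)) (u (insert j J) H)))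
        \<oplus>\<^bsub>F\<^esub> signed F (int (card J)) (diff F (u J H))
        \<oplus>\<^bsub>F\<^esub> (\<Oplus>\<^bsub>F\<^esub>i\<in>{..<n}. signed F (int (card J)) (act F (kos_xi Q i) (u J (add_mset i H))))
        \<ominus>\<^bsub>F\<^esub> (\<Oplus>\<^bsub>F\<^esub>i\<in>J. signed F (inversions {i} (J - {i})) (u (J - {i}) (add_mset i H)))),
      act = (\<lambda>e u J H. \<Oplus>\<^bsub>F\<^esub>K\<in>Pow J.
        signed F (inversions K (J - K)) (act F (kos_const Q (e K)) (u (J - K) H)))\<rparr>)"

text \<open>The action of \<open>\<S>\<close> through \<open>\<Gamma>\<close>: \<open>\<chi>\<^sup>G y\<^bsup>(H + G)\<^esup> = y\<^bsup>(H)\<^esup>\<close>.\<close>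

definition UE_op ::
    "('q, 'b) ring_scheme \<Rightarrow> (nat set \<Rightarrow> 'q, 'm, 'c) dgm_scheme \<Rightarrow> (nat multiset \<Rightarrow> 'q) \<Rightarrow>
      (nat set \<Rightarrow> nat multiset \<Rightarrow> 'm) \<Rightarrow> nat set \<Rightarrow> nat multiset \<Rightarrow> 'm" where
  "UE_op Q F s u = (\<lambda>J H. \<Oplus>\<^bsub>F\<^esub>G\<in>{G. s G \<noteq> \<zero>\<^bsub>Q\<^esub>}. act F (kos_const Q (s G)) (u J (H + G)))"

text \<open>\<open>Ext\<^sub>E(M, N) = H(Hom\<^sub>E(U\<^sub>E(F), N))\<close> as a graded \<open>\<S>\<close>-module, where \<open>F \<rightarrow> M\<close> is the chosen
  quasi-isomorphism.\<close>

definition Ext_E ::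
    "('q, 'b) ring_scheme \<Rightarrow> nat \<Rightarrow> (nat \<Rightarrow> 'q) \<Rightarrow> (nat set \<Rightarrow> 'q, 'm, 'c) dgm_scheme \<Rightarrow>
      (nat set \<Rightarrow> 'q, 'k, 'd) dgm_scheme \<Rightarrow>
      (nat multiset \<Rightarrow> 'q, ((nat set \<Rightarrow> nat multiset \<Rightarrow> 'm) \<Rightarrow> 'k) set) dgm" where
  "Ext_E Q n f F N =
    (let T = hom_complex (koszul Q n f) (UE Q n f F) N in
     homology
      \<lparr>carrier = carrier T, mult = mult T, one = one T, zero = zero T, add = add T,
       grade = grade T, diff = diff T,
       act = (\<lambda>s \<phi>. \<lambda>u\<in>carrier (UE Q n f F). \<phi> (UE_op Q F s u))\<rparr>)"

text \<open>A DG \<open>\<S>\<close>-module annihilated by \<open>\<nn>\<close>, as a module over \<open>\<A> = \<S> \<otimes>\<^sub>Q k\<close>: the action of \<open>a\<close> is the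
  common action of all \<open>s \<in> \<S>\<close> that reduce to \<open>a\<close>.\<close>

definition reduce_scalars ::
    "('q, 'b) ring_scheme \<Rightarrow> 'q set \<Rightarrow> nat \<Rightarrow> (nat multiset \<Rightarrow> 'q, 'x, 'c) dgm_scheme \<Rightarrow>
      (nat multiset \<Rightarrow> 'q set, 'x) dgm" where
  "reduce_scalars Q \<nn> n X =
    \<lparr>carrier = carrier X, mult = mult X, one = one X, zero = zero X, add = add X,
     grade = grade X, diff = diff X,
     act = (\<lambda>a x. THE y. \<exists>s\<in>carrier (op_ring Q n). (\<lambda>H. \<nn> +>\<^bsub>Q\<^esub> s H) = a \<and> act X s x = y)\<rparr>"

text \<open>\<open>V(R) = Supp\<^sup>+ Ext\<^sub>E(R', k)\<close>, with \<open>R'\<close> the completion, inside \<open>Proj k[\<chi>\<^sub>1, \<dots>, \<chi>\<^sub>n]\<close> for \<open>k = Q/\<nn>\<close>, computed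
  with the chosen \<open>F\<close>.\<close>

definition cohomological_support ::
    "('q, 'b) ring_scheme \<Rightarrow> 'q set \<Rightarrow> nat \<Rightarrow> (nat \<Rightarrow> 'q) \<Rightarrow> (nat set \<Rightarrow> 'q, 'm, 'c) dgm_scheme \<Rightarrow>
      (nat multiset \<Rightarrow> 'q set) set set" where
  "cohomological_support Q \<nn> n f F =
     (let k = inflation (Q Quot \<nn>) (\<lambda>q. \<nn> +>\<^bsub>Q\<^esub> q) in
      Supp_plus (op_ring (Q Quot \<nn>) n) (reduce_scalars Q \<nn> n (Ext_E Q n f F k)))"

text \<open>\<open>F\<close> with \<open>\<alpha> : F \<rightarrow> M\<close> is admissible for computing \<open>Ext\<^sub>E(M, -)\<close> by \<open>U\<^sub>E(F)\<close>.\<close>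

definition Q_semiprojective_resolution ::
    "('q, 'b) ring_scheme \<Rightarrow> nat \<Rightarrow> (nat \<Rightarrow> 'q) \<Rightarrow> (nat set \<Rightarrow> 'q, 'm, 'c) dgm_scheme \<Rightarrow>
      (nat set \<Rightarrow> 'q, 'n, 'd) dgm_scheme \<Rightarrow> ('m \<Rightarrow> 'n) \<Rightarrow> bool" where
  "Q_semiprojective_resolution Q n f F M \<alpha> \<longleftrightarrow>
     dg_module (koszul Q n f) F \<and>
     semiprojective (degree_zero_ring Q) (restrict_scalars Q F) \<and>
     dg_hom (koszul Q n f) F M \<alpha> \<and> quasi_iso F M \<alpha>"

end

theory Submission
  imports Defs
begin

text \<open>Let \<open>I = (f) = (g\<^sub>0, \<dots>, g\<^sub>m)\<close> and \<open>J = (g\<^sub>0, \<dots>, g\<^bsub>m-1\<^esub>)\<close>.  As \<open>g\<^sub>m\<close> is regular on \<open>Q/J\<close>, there is a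
  \<open>Q\<close>-linear map \<open>\<theta> : I \<rightarrow> Q/I\<close> that kills \<open>J\<close> and sends \<open>g\<^sub>m\<close> to \<open>1\<close>; write \<open>\<theta>(f\<^sub>i)\<close> as the class of \<open>c\<^sub>i\<close>,
  where some \<open>c\<^sub>i\<close> is a unit.  Put \<open>\<delta> = \<partial> + \<Sum> \<chi>\<^sub>i \<lambda>\<^sub>i\<close> on \<open>F[\<chi>]\<close>, so that \<open>\<delta>\<^sup>2 = \<Sum> f\<^sub>i \<chi>\<^sub>i\<close>.  Composing \<open>\<delta>\<close>
  with a graded lift \<open>F \<rightarrow> Q\<close> of \<open>\<alpha> : F \<rightarrow> Q/I\<close> and then with \<open>\<theta>\<close> produces a null-homotopy of
  \<open>\<Sum> c\<^sub>i \<chi>\<^sub>i \<alpha>\<close>.  Since \<open>F\<close> is semiprojective over \<open>Q\<close>, it lifts along \<open>\<alpha>\<close> to a family \<open>\<sigma>\<close> with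
  \<open>\<sigma>\<delta> + \<delta>\<sigma> = \<Sum> c\<^sub>i \<chi>\<^sub>i\<close>, which makes the nonzero linear form \<open>\<Sum> c\<^sub>i \<chi>\<^sub>i\<close> act as zero on \<open>Ext\<^sub>E(Q/I, k)\<close>.
  A form that annihilates a module lies in every prime \<open>p\<close> of its support: it would otherwise be both
  null-homotopic and invertible on the tensor product with \<open>\<kappa>(p)\<close>.\<close>

section \<open>Graded groups\<close>

text \<open>Semiprojectivity over \<open>Q\<close> gives no control over the action of the \<xi>_i
  on \<open>F\<close>. So \<sigma> is not sought as an \<open>E\<close>-linear homotopy, but as a
  power series in the \<chi>_i whose coefficients are \<open>Q\<close>-linear endomorphisms of
  \<open>F\<close>. This suffices because the \<xi>_i and the f_i act as zero on the target
  \<open>N\<close>: an \<open>E\<close>-linear map from \<open>U\<close> to \<open>N\<close> is the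
  same thing as a family of \<open>Q\<close>-linear maps F \<rightarrow> N indexed by monomials, and
  on such families the differential of the Hom complex is, up to sign, composition with \<delta>.

  The map Q \<rightarrow> Q/I is surjective but in general not a quasi-isomorphism, so \<alpha>
  cannot be lifted to Q directly. It is lifted to the two-term complex I \<rightarrow> Q, and the
  component in Q is kept. This component is not a chain map: composed with \<delta> it takes values
  in I, and \<theta> evaluates exactly this defect.

  \<open>semiprojective\<close> tests only against modules carried by
  \<open>nat \<times> 'a \<times> 'm \<Rightarrow> 'a\<close>. This is the origin of the injections
  into that type and of the pairs of distinct scalars from which they are built.\<close>

definition additive_map :: "('m, 'b) ring_scheme \<Rightarrow> ('n, 'c) ring_scheme \<Rightarrow> ('m \<Rightarrow> 'n) \<Rightarrow> bool" where
  "additive_map M N \<phi> \<longleftrightarrow> \<phi> \<in> carrier M \<rightarrow> carrier N \<and>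
     (\<forall>x\<in>carrier M. \<forall>y\<in>carrier M. \<phi> (x \<oplus>\<^bsub>M\<^esub> y) = \<phi> x \<oplus>\<^bsub>N\<^esub> \<phi> y)"

lemma additive_map_closed: "additive_map M N \<phi> \<Longrightarrow> x \<in> carrier M \<Longrightarrow> \<phi> x \<in> carrier N"
  by (auto simp: additive_map_def)

lemma additive_map_add:
  "additive_map M N \<phi> \<Longrightarrow> x \<in> carrier M \<Longrightarrow> y \<in> carrier M \<Longrightarrow> \<phi> (x \<oplus>\<^bsub>M\<^esub> y) = \<phi> x \<oplus>\<^bsub>N\<^esub> \<phi> y"
  by (auto simp: additive_map_def)

lemma additive_map_hom:
  assumes "abelian_group M" "abelian_group N" "additive_map M N \<phi>"
  shows "abelian_group_hom M N \<phi>"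
  using assms unfolding additive_map_def
  by (intro abelian_group_homI) (auto intro!: group_hom.intro group_hom_axioms.intro
        abelian_group.a_group simp: hom_def)

lemma additive_map_zero:
  assumes "abelian_group M" "abelian_group N" "additive_map M N \<phi>"
  shows "\<phi> \<zero>\<^bsub>M\<^esub> = \<zero>\<^bsub>N\<^esub>"
  by (rule abelian_group_hom.hom_zero[OF additive_map_hom[OF assms]])

lemma additive_map_neg:
  assumes "abelian_group M" "abelian_group N" "additive_map M N \<phi>" "x \<in> carrier M"
  shows "\<phi> (\<ominus>\<^bsub>M\<^esub> x) = \<ominus>\<^bsub>N\<^esub> \<phi> x"
  using abelian_group_hom.hom_a_inv[OF additive_map_hom[OF assms(1-3)]] assms(4) by blast

lemma additive_map_minus:
  assumes "abelian_group M" "abelian_group N" "additive_map M N \<phi>" "x \<in> carrier M" "y \<in> carrier M"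
  shows "\<phi> (x \<ominus>\<^bsub>M\<^esub> y) = \<phi> x \<ominus>\<^bsub>N\<^esub> \<phi> y"
  using assms by (simp add: a_minus_def additive_map_add[OF assms(3)] additive_map_neg[OF assms(1-3)]
      abelian_group.a_inv_closed)

lemma additive_map_signed:
  assumes "abelian_group M" "abelian_group N" "additive_map M N \<phi>" "x \<in> carrier M"
  shows "\<phi> (signed M i x) = signed N i (\<phi> x)"
  using additive_map_neg[OF assms] by (simp add: signed_def)

lemma additive_map_finsum:
  assumes "abelian_group M" "abelian_group N" "additive_map M N \<phi>" "c \<in> A \<rightarrow> carrier M"
  shows "\<phi> (\<Oplus>\<^bsub>M\<^esub>i\<in>A. c i) = (\<Oplus>\<^bsub>N\<^esub>i\<in>A. \<phi> (c i))"
proof -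
  interpret M: abelian_group M by fact
  interpret N: abelian_group N by fact
  note z = additive_map_zero[OF assms(1-3)]
  show ?thesis
  proof (cases "finite A")
    case True
    then show ?thesis using assms(4)
    proof (induction A)
      case empty
      then show ?case by (simp add: z)
    next
      case (insert a A)
      have "\<phi> (c a \<oplus>\<^bsub>M\<^esub> finsum M c A) = \<phi> (c a) \<oplus>\<^bsub>N\<^esub> \<phi> (finsum M c A)"
        using insert by (intro additive_map_add[OF assms(3)]) auto
      moreover have "finsum N (\<lambda>i. \<phi> (c i)) (insert a A) = \<phi> (c a) \<oplus>\<^bsub>N\<^esub> finsum N (\<lambda>i. \<phi> (c i)) A"
        using insert additive_map_closed[OF assms(3)] by (intro N.finsum_insert) auto
      ultimately show ?case using insert by simp
    qed
  qed (simp add: z)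
qed

section \<open>Signs and finite sums in an abelian group\<close>

context abelian_group
begin

lemma signed_closed [simp, intro]: "x \<in> carrier G \<Longrightarrow> signed G i x \<in> carrier G"
  by (simp add: signed_def)

lemma signed_zero [simp]: "signed G i \<zero> = \<zero>"
  by (simp add: signed_def)

lemma signed_add: "x \<in> carrier G \<Longrightarrow> y \<in> carrier G \<Longrightarrow> signed G i (x \<oplus> y) = signed G i x \<oplus> signed G i y"
  by (simp add: signed_def minus_add)

lemma signed_neg: "x \<in> carrier G \<Longrightarrow> signed G i (\<ominus> x) = \<ominus> signed G i x"
  by (simp add: signed_def)

lemma signed_signed: "x \<in> carrier G \<Longrightarrow> signed G i (signed G j x) = signed G (i + j) x"
  by (auto simp: signed_def)

lemma signed_even: "even i \<Longrightarrow> signed G i x = x"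
  by (simp add: signed_def)

lemma signed_eq_zero_iff: "x \<in> carrier G \<Longrightarrow> signed G i x = \<zero> \<longleftrightarrow> x = \<zero>"
  by (auto simp: signed_def)

lemma neg_zero [simp]: "\<ominus> \<zero> = \<zero>"
  by (metis a_inv_closed r_neg l_zero zero_closed)

lemma minus_eq_zero_iff: "x \<in> carrier G \<Longrightarrow> y \<in> carrier G \<Longrightarrow> x \<ominus> y = \<zero> \<longleftrightarrow> x = y"
  by (metis a_minus_def local.minus_unique minus_minus r_neg a_inv_closed a_comm)

lemma add_idem_zero: "x \<in> carrier G \<Longrightarrow> x \<oplus> x = x \<Longrightarrow> x = \<zero>"
  by simp

lemma finsum_neutral_cong:
  assumes "finite A" "B \<subseteq> A" "\<And>i. i \<in> B \<Longrightarrow> c i = d i" "\<And>i. i \<in> A - B \<Longrightarrow> c i = \<zero>" "c \<in> A \<rightarrow> carrier G"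
  shows "finsum G c A = finsum G d B"
proof -
  have "finsum G d B = finsum G c B"
    using assms by (intro finsum_cong') auto
  also have "\<dots> = finsum G c A"
    using assms by (intro add.finprod_mono_neutral_cong_left) auto
  finally show ?thesis by simp
qed

lemma finsum_all_zero: "(\<And>i. i \<in> A \<Longrightarrow> c i = \<zero>) \<Longrightarrow> finsum G c A = \<zero>"
  by (rule add.finprod_one_eqI)

lemma finsum_single:
  assumes "finite A" "\<And>i. i \<in> A - {a} \<Longrightarrow> c i = \<zero>" "a \<in> A" "c a \<in> carrier G"
  shows "finsum G c A = c a"
proof -
  have "finsum G c A = finsum G c {a}"
    using assms by (intro finsum_neutral_cong) (auto, metis DiffI singletonD zero_closed)
  then show ?thesis using assms by simp
qed

lemma finsum_neg:
  assumes "c \<in> A \<rightarrow> carrier G"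
  shows "finsum G (\<lambda>i. \<ominus> c i) A = \<ominus> finsum G c A"
proof -
  have "additive_map G G (\<lambda>x. \<ominus> x)" by (auto simp: additive_map_def minus_add)
  from additive_map_finsum[OF _ _ this assms] show ?thesis by (simp add: abelian_group_axioms)
qed

lemma finsum_minus:
  assumes "c \<in> A \<rightarrow> carrier G" "d \<in> A \<rightarrow> carrier G"
  shows "finsum G (\<lambda>i. c i \<ominus> d i) A = finsum G c A \<ominus> finsum G d A"
proof -
  have "finsum G (\<lambda>i. c i \<oplus> \<ominus> d i) A = finsum G c A \<oplus> finsum G (\<lambda>i. \<ominus> d i) A"
    using assms by (intro finsum_addf) auto
  then show ?thesis using assms finsum_neg[of d A] by (simp add: a_minus_def)
qed

lemma finsum_Sigma:
  assumes "finite A" "\<And>i. i \<in> A \<Longrightarrow> finite (B i)" "\<And>i j. i \<in> A \<Longrightarrow> j \<in> B i \<Longrightarrow> c i j \<in> carrier G"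
  shows "finsum G (\<lambda>i. finsum G (c i) (B i)) A = finsum G (\<lambda>(i, j). c i j) (Sigma A B)"
  using assms
proof (induction A)
  case (insert a A)
  have 1: "finsum G (c a) (B a) = finsum G (\<lambda>(i, j). c i j) ({a} \<times> B a)"
  proof -
    have "finsum G (\<lambda>(i, j). c i j) (Pair a ` B a) = finsum G (\<lambda>j. (\<lambda>(i, j). c i j) (a, j)) (B a)"
      using insert by (intro finsum_reindex) (auto simp: inj_on_def)
    moreover have "{a} \<times> B a = Pair a ` B a" by auto
    ultimately show ?thesis by simp
  qed
  have "finsum G (\<lambda>(i, j). c i j) (Sigma (insert a A) B)
      = finsum G (\<lambda>(i, j). c i j) ({a} \<times> B a \<union> Sigma A B)"
    by (rule arg_cong[where f = "finsum G _"]) auto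
  also have "\<dots> = finsum G (\<lambda>(i, j). c i j) ({a} \<times> B a) \<oplus> finsum G (\<lambda>(i, j). c i j) (Sigma A B)"
    using insert by (intro finsum_Un_disjoint) auto
  finally show ?case
    using insert by (subst finsum_insert) (auto simp: 1[symmetric] intro!: finsum_closed)
qed simp

end

locale graded_group = abelian_group M for M :: "('m, 'b) dg_scheme" (structure) +
  assumes grade_subgroup: "additive_subgroup (grade M i) M"
    and decomposition: "x \<in> carrier M \<Longrightarrow> \<exists>!c. is_decomposition M x c"
begin

lemma grade_closed: "x \<in> grade M i \<Longrightarrow> x \<in> carrier M"
  by (rule additive_subgroup.a_Hcarr[OF grade_subgroup])

lemma grade_zero [simp]: "\<zero> \<in> grade M i"
  by (rule additive_subgroup.zero_closed[OF grade_subgroup])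

lemma grade_add: "x \<in> grade M i \<Longrightarrow> y \<in> grade M i \<Longrightarrow> x \<oplus> y \<in> grade M i"
  by (rule additive_subgroup.a_closed[OF grade_subgroup])

lemma grade_neg: "x \<in> grade M i \<Longrightarrow> \<ominus> x \<in> grade M i"
  using additive_subgroup.a_inv_closed[OF grade_subgroup] abelian_group_axioms by blast

lemma grade_minus: "x \<in> grade M i \<Longrightarrow> y \<in> grade M i \<Longrightarrow> x \<ominus> y \<in> grade M i"
  by (simp add: a_minus_def grade_add grade_neg)

lemma grade_signed: "x \<in> grade M i \<Longrightarrow> signed M j x \<in> grade M i"
  by (simp add: signed_def grade_neg)

lemma grade_finsum: "(\<And>j. j \<in> A \<Longrightarrow> c j \<in> grade M i) \<Longrightarrow> finsum M c A \<in> grade M i"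
proof (induction A rule: infinite_finite_induct)
  case (insert a A)
  then have "finsum M c (insert a A) = c a \<oplus> finsum M c A"
    by (intro finsum_insert) (auto intro: grade_closed)
  with insert show ?case by (auto intro: grade_add)
qed auto

lemma component_eq: "is_decomposition M x c \<Longrightarrow> x \<in> carrier M \<Longrightarrow> component M x = c"
  unfolding component_def using decomposition by (blast intro: the1_equality)

lemma is_decomposition_component: "x \<in> carrier M \<Longrightarrow> is_decomposition M x (component M x)"
  unfolding component_def using decomposition by (rule theI')

lemma is_decompositionI:
  assumes "finite I" "\<And>i. i \<in> I \<Longrightarrow> c i \<in> grade M i"
  shows "is_decomposition M (finsum M c I) (\<lambda>i. if i \<in> I then c i else \<zero>)"
proof -
  have "finsum M c I = finsum M (\<lambda>i. if i \<in> I then c i else \<zero>) {i. (if i \<in> I then c i else \<zero>) \<noteq> \<zero>}"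
    using assms by (intro finsum_neutral_cong) (auto intro: grade_closed)
  moreover have "finite {i. (if i \<in> I then c i else \<zero>) \<noteq> \<zero>}"
    by (rule finite_subset[OF _ assms(1)]) auto
  ultimately show ?thesis using assms(2) by (auto simp: is_decomposition_def)
qed

lemma finsum_grades_closed: "(\<And>i. i \<in> I \<Longrightarrow> c i \<in> grade M i) \<Longrightarrow> finsum M c I \<in> carrier M"
  by (auto intro!: finsum_closed intro: grade_closed)

lemma component_finsum:
  assumes "finite I" "\<And>i. i \<in> I \<Longrightarrow> c i \<in> grade M i"
  shows "component M (finsum M c I) = (\<lambda>i. if i \<in> I then c i else \<zero>)"
  using component_eq[OF is_decompositionI[OF assms] finsum_grades_closed] assms by blast

lemma component_grade:
  assumes "x \<in> grade M i"
  shows "component M x = (\<lambda>j. if j = i then x else \<zero>)"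
  using component_finsum[of "{i}" "\<lambda>_. x"] assms by (simp add: grade_closed)

lemma finsum_zero_components:
  assumes "finite I" "\<And>i. i \<in> I \<Longrightarrow> c i \<in> grade M i" "finsum M c I = \<zero>" "i \<in> I"
  shows "c i = \<zero>"
proof -
  have "(\<lambda>i. if i \<in> I then c i else \<zero>) = (\<lambda>j. if j = 0 then \<zero> else \<zero>)"
    using component_finsum[OF assms(1,2)] component_grade[of \<zero> 0] assms(3) by simp
  then show ?thesis using assms(4) by (metis (full_types))
qed

lemma component_in_grade: "x \<in> carrier M \<Longrightarrow> component M x i \<in> grade M i"
  using is_decomposition_component by (auto simp: is_decomposition_def)

lemma finite_component: "x \<in> carrier M \<Longrightarrow> finite {i. component M x i \<noteq> \<zero>}"
  using is_decomposition_component by (auto simp: is_decomposition_def)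

lemma finsum_component: "x \<in> carrier M \<Longrightarrow> finsum M (component M x) {i. component M x i \<noteq> \<zero>} = x"
  using is_decomposition_component by (auto simp: is_decomposition_def)

lemma finsum_component_superset:
  assumes "x \<in> carrier M" "finite I" "{i. component M x i \<noteq> \<zero>} \<subseteq> I"
  shows "finsum M (component M x) I = x"
proof -
  have "finsum M (component M x) I = finsum M (component M x) {i. component M x i \<noteq> \<zero>}"
    using assms by (intro finsum_neutral_cong) (auto intro: grade_closed component_in_grade)
  then show ?thesis using assms finsum_component by simp
qed

lemma graded_induct [consumes 1, case_names grade add]:
  assumes "x \<in> carrier M" "\<And>i x. x \<in> grade M i \<Longrightarrow> P x"
    "\<And>x y. x \<in> carrier M \<Longrightarrow> y \<in> carrier M \<Longrightarrow> P x \<Longrightarrow> P y \<Longrightarrow> P (x \<oplus> y)"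
  shows "P x"
proof -
  have "P (finsum M c I)" if "finite I" "\<And>i. i \<in> I \<Longrightarrow> c i \<in> grade M i" for I c
    using that
  proof (induction I)
    case empty
    then show ?case using assms(2)[of \<zero> 0] by simp
  next
    case (insert a I)
    then have "finsum M c (insert a I) = c a \<oplus> finsum M c I"
      by (intro finsum_insert) (auto intro: grade_closed)
    with insert show ?case
      by (metis assms(2,3) finsum_grades_closed grade_closed insertCI)
  qed
  from this[of "{i. component M x i \<noteq> \<zero>}" "component M x"] assms(1) show ?thesis
    by (simp add: finsum_component finite_component component_in_grade)
qed

lemma component_add:
  assumes "x \<in> carrier M" "y \<in> carrier M"
  shows "component M (x \<oplus> y) i = component M x i \<oplus> component M y i"
proof -
  let ?I = "{i. component M x i \<noteq> \<zero>} \<union> {i. component M y i \<noteq> \<zero>}"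
  have fin: "finite ?I" using assms by (simp add: finite_component)
  have "finsum M (\<lambda>i. component M x i \<oplus> component M y i) ?I
      = finsum M (component M x) ?I \<oplus> finsum M (component M y) ?I"
    using assms by (intro finsum_addf) (auto intro: grade_closed component_in_grade)
  also have "\<dots> = x \<oplus> y"
    using assms fin by (subst (1 2) finsum_component_superset) auto
  finally have "component M (x \<oplus> y) i = (if i \<in> ?I then component M x i \<oplus> component M y i else \<zero>)"
    using component_finsum[OF fin, of "\<lambda>i. component M x i \<oplus> component M y i"] assms
    by (simp add: grade_add component_in_grade)
  then show ?thesis by auto
qed

lemma parity_twist_finsum:
  assumes "finite I" "\<And>i. i \<in> I \<Longrightarrow> c i \<in> grade M i"
  shows "parity_twist M (finsum M c I) = finsum M (\<lambda>i. signed M i (c i)) I"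
proof -
  have "component M (finsum M c I) = (\<lambda>i. if i \<in> I then c i else \<zero>)"
    using component_finsum[OF assms(1), of c] assms(2) by blast
  then show ?thesis
    unfolding parity_twist_def
    using assms by (intro finsum_neutral_cong[symmetric]) (auto intro: grade_closed)
qed

lemma parity_twist_grade: "x \<in> grade M i \<Longrightarrow> parity_twist M x = signed M i x"
  using parity_twist_finsum[of "{i}" "\<lambda>_. x"] by (simp add: grade_closed)

lemma parity_twist_closed: "x \<in> carrier M \<Longrightarrow> parity_twist M x \<in> carrier M"
  unfolding parity_twist_def by (auto intro!: finsum_closed intro: grade_closed component_in_grade)

lemma parity_twist_eq:
  assumes "x \<in> carrier M" "finite I" "{i. component M x i \<noteq> \<zero>} \<subseteq> I"
  shows "parity_twist M x = finsum M (\<lambda>i. signed M i (component M x i)) I"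
  using parity_twist_finsum[OF assms(2), of "component M x"] finsum_component_superset[OF assms] assms(1)
  by (simp add: component_in_grade)

lemma parity_twist_add:
  assumes "x \<in> carrier M" "y \<in> carrier M"
  shows "parity_twist M (x \<oplus> y) = parity_twist M x \<oplus> parity_twist M y"
proof -
  let ?I = "{i. component M x i \<noteq> \<zero>} \<union> {i. component M y i \<noteq> \<zero>} \<union> {i. component M (x \<oplus> y) i \<noteq> \<zero>}"
  have fin: "finite ?I" using assms by (simp add: finite_component)
  have c: "component M x i \<in> carrier M" "component M y i \<in> carrier M" for i
    using assms by (auto intro: grade_closed component_in_grade)
  have "parity_twist M (x \<oplus> y) = finsum M (\<lambda>i. signed M i (component M x i) \<oplus> signed M i (component M y i)) ?I"
    using assms fin by (subst parity_twist_eq[of _ ?I]) (auto simp: component_add signed_add c)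
  also have "\<dots> = finsum M (\<lambda>i. signed M i (component M x i)) ?I \<oplus> finsum M (\<lambda>i. signed M i (component M y i)) ?I"
    using c by (intro finsum_addf) auto
  also have "\<dots> = parity_twist M x \<oplus> parity_twist M y"
    using assms fin by (subst (1 2) parity_twist_eq[of _ ?I]) auto
  finally show ?thesis .
qed

lemma additive_parity_twist: "additive_map M M (parity_twist M)"
  by (auto simp: additive_map_def parity_twist_add parity_twist_closed)

lemma parity_twist_twist: "x \<in> carrier M \<Longrightarrow> parity_twist M (parity_twist M x) = x"
proof (induction x rule: graded_induct)
  case (grade i x)
  then show ?case
    using parity_twist_grade[OF grade_signed[OF grade]]
    by (simp add: parity_twist_grade signed_signed grade_closed signed_even)
next
  case (add x y)
  then show ?case by (simp add: parity_twist_add parity_twist_closed)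
qed

end

lemma (in dg_group) graded_group: "graded_group M"
  by (intro graded_group.intro graded_group_axioms.intro abelian_group_axioms grade_subgroup decomposition)

text \<open>The axioms of \<open>dg_group\<close> are taken in stages because \<open>U\<close>
  enters as a graded group with an additive map of degree -1; the vanishing of the square of the
  differential is established on the Hom complex out of \<open>U\<close> instead.\<close>

locale graded_diff_group = graded_group M for M :: "('m, 'b) dg_scheme" (structure) +
  assumes diff_grade: "x \<in> grade M i \<Longrightarrow> diff M x \<in> grade M (i - 1)"
    and diff_closed: "x \<in> carrier M \<Longrightarrow> diff M x \<in> carrier M"
    and diff_add: "\<lbrakk>x \<in> carrier M; y \<in> carrier M\<rbrakk> \<Longrightarrow> diff M (x \<oplus> y) = diff M x \<oplus> diff M y"
begin

lemma additive_diff: "additive_map M M (diff M)"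
  by (auto simp: additive_map_def diff_add diff_closed)

lemmas diff_zero = additive_map_zero[OF abelian_group_axioms abelian_group_axioms additive_diff]
lemmas diff_minus = additive_map_minus[OF abelian_group_axioms abelian_group_axioms additive_diff]

end

lemma (in dg_group) graded_diff_group: "graded_diff_group M"
  by (intro graded_diff_group.intro graded_diff_group_axioms.intro graded_group diff_grade diff_closed diff_add)

sublocale dg_group \<subseteq> graded_diff_group M
  by (rule graded_diff_group)

section \<open>Homomorphism complexes\<close>

text \<open>\<open>hom_degree\<close> without linearity over the DG ring. Signs, degrees and the
  independence of different degrees concern the additive structure alone, and
  \<open>hom_diff\<close> of a linear map is at first known only to be graded.\<close>

definition graded_map :: "('m, 'b) dg_scheme \<Rightarrow> ('n, 'c) dg_scheme \<Rightarrow> int \<Rightarrow> ('m \<Rightarrow> 'n) set" where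
  "graded_map M N i = {\<phi> \<in> carrier M \<rightarrow>\<^sub>E carrier N. additive_map M N \<phi> \<and> (\<forall>j. \<phi> ` grade M j \<subseteq> grade N (i + j))}"

definition hom_diff :: "('m, 'b) dg_scheme \<Rightarrow> ('n, 'c) dg_scheme \<Rightarrow> ('m \<Rightarrow> 'n) \<Rightarrow> 'm \<Rightarrow> 'n" where
  "hom_diff M N \<phi> = (\<lambda>x\<in>carrier M.
     diff N (\<phi> x) \<ominus>\<^bsub>N\<^esub> parity_twist N (\<phi> (parity_twist M (diff M x))))"

lemma hom_complex_simps:
  "zero (hom_complex A M N) = (\<lambda>x\<in>carrier M. \<zero>\<^bsub>N\<^esub>)"
  "add (hom_complex A M N) = (\<lambda>\<phi> \<psi>. \<lambda>x\<in>carrier M. \<phi> x \<oplus>\<^bsub>N\<^esub> \<psi> x)"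
  "grade (hom_complex A M N) = hom_degree A M N"
  "diff (hom_complex A M N) = hom_diff M N"
  by (simp_all add: hom_complex_def hom_diff_def fun_eq_iff)

lemma hom_complex_carrier:
  "\<phi> \<in> carrier (hom_complex A M N) \<longleftrightarrow> \<phi> \<in> extensional (carrier M) \<and>
    (\<exists>I \<psi>. finite I \<and> (\<forall>i\<in>I. \<psi> i \<in> hom_degree A M N i) \<and>
        (\<forall>x\<in>carrier M. \<phi> x = finsum N (\<lambda>i. \<psi> i x) I))"
  by (simp add: hom_complex_def)

lemma hom_degree_graded_map: "\<phi> \<in> hom_degree A M N i \<Longrightarrow> \<phi> \<in> graded_map M N i"
  by (auto simp: hom_degree_def graded_map_def additive_map_def)

lemma graded_map_additive: "\<phi> \<in> graded_map M N i \<Longrightarrow> additive_map M N \<phi>"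
  by (auto simp: graded_map_def)

lemma graded_map_closed: "\<phi> \<in> graded_map M N i \<Longrightarrow> x \<in> carrier M \<Longrightarrow> \<phi> x \<in> carrier N"
  by (auto simp: graded_map_def)

lemma graded_map_grade: "\<phi> \<in> graded_map M N i \<Longrightarrow> x \<in> grade M j \<Longrightarrow> \<phi> x \<in> grade N (i + j)"
  by (auto simp: graded_map_def)

lemma graded_map_ext: "\<phi> \<in> graded_map M N i \<Longrightarrow> \<phi> \<in> extensional (carrier M)"
  by (auto simp: graded_map_def PiE_def)

lemma graded_mapI:
  assumes "additive_map M N \<phi>" "\<And>x j. x \<in> grade M j \<Longrightarrow> \<phi> x \<in> grade N (i + j)" "\<phi> \<in> extensional (carrier M)"
  shows "\<phi> \<in> graded_map M N i"
  using assms by (auto simp: graded_map_def additive_map_def PiE_def)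

locale graded_pair = M: graded_diff_group M + N: graded_diff_group N
  for M :: "('m, 'b) dg_scheme" and N :: "('n, 'c) dg_scheme"
begin

lemmas ab = M.abelian_group_axioms N.abelian_group_axioms

lemmas map_add = additive_map_add[OF graded_map_additive]
lemmas map_signed = additive_map_signed[OF ab graded_map_additive]
lemmas map_finsum = additive_map_finsum[OF ab graded_map_additive]

text \<open>For \<open>x\<close> of degree j the two twists contribute (-1)^j and (-1)^(i+j), which
  differ by the sign (-1)^i.\<close>

lemma map_twist:
  assumes "\<phi> \<in> graded_map M N i" "x \<in> carrier M"
  shows "\<phi> (parity_twist M x) = signed N i (parity_twist N (\<phi> x))"
  using assms(2)
proof (induction x rule: M.graded_induct)
  case (grade j x)
  have "\<phi> (signed M j x) = signed N j (\<phi> x)"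
    using grade assms(1) by (simp add: map_signed M.grade_closed)
  moreover have "\<phi> x \<in> grade N (i + j)" "\<phi> x \<in> carrier N"
    using grade assms(1) by (auto intro: graded_map_grade graded_map_closed M.grade_closed)
  moreover have "signed N j (\<phi> x) = signed N (i + (i + j)) (\<phi> x)" by (simp add: signed_def)
  ultimately show ?case using grade
    by (simp add: M.parity_twist_grade N.parity_twist_grade N.signed_signed)
next
  case (add x y)
  then show ?case using assms(1)
    by (simp add: M.parity_twist_add N.parity_twist_add map_add M.parity_twist_closed N.parity_twist_closed
        N.signed_add graded_map_closed)
qed

text \<open>The twist before and the twist after \<phi> cancel up to (-1)^i, so the conjugated
  formula becomes the usual differential on homogeneous maps.\<close>

lemma hom_diff_eq:
  assumes "\<phi> \<in> graded_map M N i" "x \<in> carrier M"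
  shows "hom_diff M N \<phi> x = diff N (\<phi> x) \<ominus>\<^bsub>N\<^esub> signed N i (\<phi> (diff M x))"
proof -
  have "\<phi> (diff M x) \<in> carrier N"
    using assms by (auto intro: graded_map_closed M.diff_closed)
  then have "parity_twist N (signed N i (parity_twist N (\<phi> (diff M x)))) = signed N i (\<phi> (diff M x))"
    using additive_map_signed[OF N.abelian_group_axioms N.abelian_group_axioms N.additive_parity_twist,
        of "parity_twist N (\<phi> (diff M x))" i]
    by (simp add: N.parity_twist_closed N.parity_twist_twist)
  then show ?thesis
    using assms map_twist[OF assms(1) M.diff_closed[OF assms(2)]] by (simp add: hom_diff_def)
qed

lemma hom_diff_closed: "\<phi> \<in> carrier M \<rightarrow> carrier N \<Longrightarrow> x \<in> carrier M \<Longrightarrow> hom_diff M N \<phi> x \<in> carrier N"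
  unfolding hom_diff_def
  by (simp, intro N.minus_closed) (auto intro!: N.diff_closed N.parity_twist_closed M.parity_twist_closed M.diff_closed)

lemma hom_diff_ext: "hom_diff M N \<phi> \<in> extensional (carrier M)"
  by (simp add: hom_diff_def)

lemma hom_diff_graded_map:
  assumes "\<phi> \<in> graded_map M N i"
  shows "hom_diff M N \<phi> \<in> graded_map M N (i - 1)"
proof (rule graded_mapI)
  show "hom_diff M N \<phi> \<in> extensional (carrier M)" by (rule hom_diff_ext)
  show "additive_map M N (hom_diff M N \<phi>)"
    unfolding additive_map_def
  proof (intro conjI ballI)
    show "hom_diff M N \<phi> \<in> carrier M \<rightarrow> carrier N"
      using assms by (auto intro: hom_diff_closed graded_map_closed)
    fix x y assume xy: "x \<in> carrier M" "y \<in> carrier M"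
    note c = graded_map_closed[OF assms] M.diff_closed N.diff_closed
    show "hom_diff M N \<phi> (x \<oplus>\<^bsub>M\<^esub> y) = hom_diff M N \<phi> x \<oplus>\<^bsub>N\<^esub> hom_diff M N \<phi> y"
      using xy by (simp add: hom_diff_eq[OF assms] map_add[OF assms] M.diff_add N.diff_add c N.signed_add
          a_minus_def N.minus_add N.a_ac)
  qed
  fix x j assume x: "x \<in> grade M j"
  have "diff N (\<phi> x) \<in> grade N (i - 1 + j)"
    using N.diff_grade[OF graded_map_grade[OF assms x]] by (simp add: algebra_simps)
  moreover have "\<phi> (diff M x) \<in> grade N (i - 1 + j)"
    using graded_map_grade[OF assms M.diff_grade[OF x]] by (simp add: algebra_simps)
  ultimately show "hom_diff M N \<phi> x \<in> grade N (i - 1 + j)"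
    using x by (simp add: hom_diff_eq[OF assms] M.grade_closed N.grade_minus N.grade_signed)
qed

lemma hom_diff_finsum:
  assumes "x \<in> carrier M" "\<And>y. y \<in> carrier M \<Longrightarrow> \<phi> y = finsum N (\<lambda>i. \<psi> i y) I"
    "\<And>i. i \<in> I \<Longrightarrow> \<psi> i \<in> carrier M \<rightarrow> carrier N"
  shows "hom_diff M N \<phi> x = finsum N (\<lambda>i. hom_diff M N (\<psi> i) x) I"
proof -
  let ?y = "parity_twist M (diff M x)"
  have y: "?y \<in> carrier M" by (intro M.parity_twist_closed M.diff_closed assms)
  have c: "\<psi> i z \<in> carrier N" if "i \<in> I" "z \<in> carrier M" for i z using assms(3) that by auto
  have "hom_diff M N \<phi> x = finsum N (\<lambda>i. diff N (\<psi> i x)) I \<ominus>\<^bsub>N\<^esub> finsum N (\<lambda>i. parity_twist N (\<psi> i ?y)) I"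
    using assms(1) y c
    by (simp add: hom_diff_def assms(2)
        additive_map_finsum[OF N.abelian_group_axioms N.abelian_group_axioms N.additive_diff]
        additive_map_finsum[OF N.abelian_group_axioms N.abelian_group_axioms N.additive_parity_twist])
  also have "\<dots> = finsum N (\<lambda>i. diff N (\<psi> i x) \<ominus>\<^bsub>N\<^esub> parity_twist N (\<psi> i ?y)) I"
    using assms(1) y c by (intro N.finsum_minus[symmetric]) (auto intro: N.diff_closed N.parity_twist_closed)
  finally show ?thesis using assms(1) by (simp add: hom_diff_def)
qed

lemma hom_diff_add:
  assumes "x \<in> carrier M" "\<phi> \<in> carrier M \<rightarrow> carrier N" "\<psi> \<in> carrier M \<rightarrow> carrier N"
  shows "hom_diff M N (\<lambda>x\<in>carrier M. \<phi> x \<oplus>\<^bsub>N\<^esub> \<psi> x) x = hom_diff M N \<phi> x \<oplus>\<^bsub>N\<^esub> hom_diff M N \<psi> x"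
proof -
  have "hom_diff M N (\<lambda>x\<in>carrier M. \<phi> x \<oplus>\<^bsub>N\<^esub> \<psi> x) x =
      finsum N (\<lambda>i. hom_diff M N (if i then \<phi> else \<psi>) x) {True, False}"
    using assms by (intro hom_diff_finsum) (auto simp: Pi_iff)
  then show ?thesis using assms by (simp add: hom_diff_closed)
qed

text \<open>On \<open>x\<close> of degree j the values \<open>z i x\<close> lie in the distinct
  degrees i + j, so a vanishing sum forces each of them to vanish. Additivity extends this to all
  \<open>x\<close>.\<close>

lemma graded_map_independent:
  assumes "finite I" "\<And>i. i \<in> I \<Longrightarrow> z i \<in> graded_map M N i"
    and zero: "\<And>x. x \<in> carrier M \<Longrightarrow> finsum N (\<lambda>i. z i x) I = \<zero>\<^bsub>N\<^esub>"
    and "i \<in> I" "x \<in> carrier M"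
  shows "z i x = \<zero>\<^bsub>N\<^esub>"
  using assms(5)
proof (induction x rule: M.graded_induct)
  case (grade j x)
  have inj: "inj_on (\<lambda>k. k - j) ((\<lambda>k. k + j) ` I)" by (auto simp: inj_on_def)
  have "finsum N (\<lambda>k. z (k - j) x) ((\<lambda>k. k + j) ` I) = finsum N (\<lambda>i. z i x) I"
    using graded_map_closed[OF assms(2) M.grade_closed[OF grade]]
    by (subst N.finsum_reindex) (auto simp: inj_on_def)
  also have "\<dots> = \<zero>\<^bsub>N\<^esub>" using zero grade M.grade_closed by blast
  finally have "z (i + j - j) x = \<zero>\<^bsub>N\<^esub>"
    using assms(1,4) graded_map_grade[OF assms(2) grade]
    by (intro N.finsum_zero_components[of "(\<lambda>k. k + j) ` I" "\<lambda>k. z (k - j) x"]) auto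
  then show ?case by simp
next
  case (add x y)
  then show ?case using map_add[OF assms(2)[OF assms(4)]] by simp
qed

text \<open>Independence applied to the family \<open>z\<close> with \<open>w\<close> subtracted in
  degree \<open>d\<close>; the index set is enlarged by \<open>d\<close>, with zero maps as default
  values.\<close>

lemma graded_map_component:
  assumes "finite I" "\<And>i. i \<in> I \<Longrightarrow> z i \<in> graded_map M N i" "w \<in> graded_map M N d"
    and sum: "\<And>x. x \<in> carrier M \<Longrightarrow> finsum N (\<lambda>i. z i x) I = w x" and x: "x \<in> carrier M"
  shows "(if d \<in> I then z d x else \<zero>\<^bsub>N\<^esub>) = w x"
proof -
  let ?u = "\<lambda>i. \<lambda>x\<in>carrier M. (if i \<in> I then z i x else \<zero>\<^bsub>N\<^esub>) \<ominus>\<^bsub>N\<^esub> (if i = d then w x else \<zero>\<^bsub>N\<^esub>)"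
  have c: "z i x \<in> carrier N" if "i \<in> I" "x \<in> carrier M" for i x
    using assms(2) that by (blast intro: graded_map_closed)
  have cw: "w x \<in> carrier N" if "x \<in> carrier M" for x
    using assms(3) that by (blast intro: graded_map_closed)
  have gr: "?u i \<in> graded_map M N i" for i
  proof (rule graded_mapI)
    have "(if i \<in> I then z i (x \<oplus>\<^bsub>M\<^esub> y) else \<zero>\<^bsub>N\<^esub>) =
      (if i \<in> I then z i x else \<zero>\<^bsub>N\<^esub>) \<oplus>\<^bsub>N\<^esub> (if i \<in> I then z i y else \<zero>\<^bsub>N\<^esub>)"
      "(if i = d then w (x \<oplus>\<^bsub>M\<^esub> y) else \<zero>\<^bsub>N\<^esub>) =
      (if i = d then w x else \<zero>\<^bsub>N\<^esub>) \<oplus>\<^bsub>N\<^esub> (if i = d then w y else \<zero>\<^bsub>N\<^esub>)"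
      if "x \<in> carrier M" "y \<in> carrier M" for x y
      using that map_add[OF assms(2)] map_add[OF assms(3)] by auto
    then show "additive_map M N (?u i)"
      unfolding additive_map_def using c cw
      by (auto simp: a_minus_def N.minus_add N.a_ac)
    show "?u i x \<in> grade N (i + j)" if "x \<in> grade M j" for x j
      using that assms(2,3) by (auto intro!: N.grade_minus dest: graded_map_grade M.grade_closed)
  qed auto
  have "?u d x = \<zero>\<^bsub>N\<^esub>"
  proof (rule graded_map_independent[of "insert d I" ?u])
    fix x assume x: "x \<in> carrier M"
    have "finsum N (\<lambda>i. ?u i x) (insert d I) =
      finsum N (\<lambda>i. if i \<in> I then z i x else \<zero>\<^bsub>N\<^esub>) (insert d I) \<ominus>\<^bsub>N\<^esub>
      finsum N (\<lambda>i. if i = d then w x else \<zero>\<^bsub>N\<^esub>) (insert d I)"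
      using x c cw by (simp only: restrict_apply' N.finsum_minus[symmetric], intro N.finsum_minus) auto
    also have "finsum N (\<lambda>i. if i \<in> I then z i x else \<zero>\<^bsub>N\<^esub>) (insert d I) = finsum N (\<lambda>i. z i x) I"
      using assms(1) c x by (intro N.finsum_neutral_cong) auto
    also have "finsum N (\<lambda>i. if i = d then w x else \<zero>\<^bsub>N\<^esub>) (insert d I) = w x"
      using assms(1) cw x by (subst N.finsum_single[of _ d]) auto
    finally show "finsum N (\<lambda>i. ?u i x) (insert d I) = \<zero>\<^bsub>N\<^esub>"
      using sum x cw by (simp add: N.minus_eq_zero_iff)
  qed (use assms(1) gr x in auto)
  then show ?thesis using x c cw by (auto simp: N.minus_eq_zero_iff split: if_splits)
qed

end

text \<open>Only closure of the action on \<open>M\<close> and additivity of the action on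
  \<open>N\<close> are required, so that the locale applies to \<open>U\<close> with no verification
  of the remaining module axioms.\<close>

locale hom_setting = graded_pair M N
  for A :: "('a, 'd) dg_scheme" and M :: "('a, 'm, 'b) dgm_scheme" and N :: "('a, 'n, 'c) dgm_scheme" +
  assumes act_M_closed: "a \<in> grade A j \<Longrightarrow> x \<in> carrier M \<Longrightarrow> act M a x \<in> carrier M"
    and act_N: "a \<in> grade A j \<Longrightarrow> additive_map N N (act N a)"
begin

abbreviation "T \<equiv> hom_complex A M N"

lemma hom_degreeI:
  assumes "\<phi> \<in> graded_map M N i"
    "\<And>j a x. a \<in> grade A j \<Longrightarrow> x \<in> carrier M \<Longrightarrow> \<phi> (act M a x) = signed N (i * j) (act N a (\<phi> x))"
  shows "\<phi> \<in> hom_degree A M N i"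
  using assms by (auto simp: hom_degree_def graded_map_def additive_map_def)

lemma hom_degree_act:
  "\<phi> \<in> hom_degree A M N i \<Longrightarrow> a \<in> grade A j \<Longrightarrow> x \<in> carrier M \<Longrightarrow>
     \<phi> (act M a x) = signed N (i * j) (act N a (\<phi> x))"
  by (auto simp: hom_degree_def)

lemma zero_hom_degree: "(\<lambda>x\<in>carrier M. \<zero>\<^bsub>N\<^esub>) \<in> hom_degree A M N i"
proof (rule hom_degreeI)
  show "(\<lambda>x\<in>carrier M. \<zero>\<^bsub>N\<^esub>) \<in> graded_map M N i"
    by (rule graded_mapI) (auto simp: additive_map_def M.grade_closed)
  fix j a x assume "a \<in> grade A j" "x \<in> carrier M"
  then show "(\<lambda>x\<in>carrier M. \<zero>\<^bsub>N\<^esub>) (act M a x) = signed N (i * j) (act N a ((\<lambda>x\<in>carrier M. \<zero>\<^bsub>N\<^esub>) x))"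
    using additive_map_zero[OF N.abelian_group_axioms N.abelian_group_axioms act_N]
    by (simp add: act_M_closed)
qed

lemma add_hom_degree:
  assumes "\<phi> \<in> hom_degree A M N i" "\<psi> \<in> hom_degree A M N i"
  shows "(\<lambda>x\<in>carrier M. \<phi> x \<oplus>\<^bsub>N\<^esub> \<psi> x) \<in> hom_degree A M N i"
proof (rule hom_degreeI)
  note g = assms[THEN hom_degree_graded_map]
  note c = g[THEN graded_map_closed]
  show "(\<lambda>x\<in>carrier M. \<phi> x \<oplus>\<^bsub>N\<^esub> \<psi> x) \<in> graded_map M N i"
  proof (rule graded_mapI)
    show "additive_map M N (\<lambda>x\<in>carrier M. \<phi> x \<oplus>\<^bsub>N\<^esub> \<psi> x)"
      using c by (auto simp: additive_map_def map_add[OF g(1)] map_add[OF g(2)] N.a_ac)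
    show "(\<lambda>x\<in>carrier M. \<phi> x \<oplus>\<^bsub>N\<^esub> \<psi> x) x \<in> grade N (i + j)" if "x \<in> grade M j" for x j
      using that g by (auto intro!: N.grade_add dest: graded_map_grade M.grade_closed)
  qed auto
  fix j a x assume ax: "a \<in> grade A j" "x \<in> carrier M"
  show "(\<lambda>x\<in>carrier M. \<phi> x \<oplus>\<^bsub>N\<^esub> \<psi> x) (act M a x) = signed N (i * j) (act N a ((\<lambda>x\<in>carrier M. \<phi> x \<oplus>\<^bsub>N\<^esub> \<psi> x) x))"
    using ax c hom_degree_act[OF assms(1) ax] hom_degree_act[OF assms(2) ax]
      additive_map_closed[OF act_N[OF ax(1)]]
    by (simp add: act_M_closed additive_map_add[OF act_N[OF ax(1)]] N.signed_add)
qed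

lemma neg_hom_degree:
  assumes "\<phi> \<in> hom_degree A M N i"
  shows "(\<lambda>x\<in>carrier M. \<ominus>\<^bsub>N\<^esub> \<phi> x) \<in> hom_degree A M N i"
proof (rule hom_degreeI)
  note g = hom_degree_graded_map[OF assms]
  note c = graded_map_closed[OF g]
  show "(\<lambda>x\<in>carrier M. \<ominus>\<^bsub>N\<^esub> \<phi> x) \<in> graded_map M N i"
  proof (rule graded_mapI)
    show "additive_map M N (\<lambda>x\<in>carrier M. \<ominus>\<^bsub>N\<^esub> \<phi> x)"
      using c by (auto simp: additive_map_def map_add[OF g] N.minus_add)
    show "(\<lambda>x\<in>carrier M. \<ominus>\<^bsub>N\<^esub> \<phi> x) x \<in> grade N (i + j)" if "x \<in> grade M j" for x j
      using that g by (auto intro!: N.grade_neg dest: graded_map_grade M.grade_closed)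
  qed auto
  fix j a x assume ax: "a \<in> grade A j" "x \<in> carrier M"
  show "(\<lambda>x\<in>carrier M. \<ominus>\<^bsub>N\<^esub> \<phi> x) (act M a x) = signed N (i * j) (act N a ((\<lambda>x\<in>carrier M. \<ominus>\<^bsub>N\<^esub> \<phi> x) x))"
    using ax c hom_degree_act[OF assms(1) ax]
      additive_map_closed[OF act_N[OF ax(1)]]
      additive_map_neg[OF N.abelian_group_axioms N.abelian_group_axioms act_N[OF ax(1)], of "\<phi> x"]
    by (simp add: act_M_closed N.signed_neg)
qed

lemma carrier_T_closed: "\<phi> \<in> carrier T \<Longrightarrow> \<phi> \<in> carrier M \<rightarrow> carrier N"
  unfolding hom_complex_carrier
  by (auto intro!: N.finsum_closed dest!: hom_degree_graded_map graded_map_closed)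

lemma hom_degree_T: "\<phi> \<in> hom_degree A M N i \<Longrightarrow> \<phi> \<in> carrier T"
  unfolding hom_complex_carrier
  using hom_degree_graded_map[of \<phi> A M N i]
  by (auto intro!: exI[of _ "{i}"] exI[of _ "\<lambda>_. \<phi>"] graded_map_ext simp: graded_map_closed)

text \<open>Padding with zero maps allows a prescribed \<open>I0\<close> inside the index set, so
  that two elements can be written over a common index set or a wanted degree can be forced to
  occur.\<close>

lemma T_finsumE:
  assumes "\<phi> \<in> carrier T" "finite I0"
  obtains I \<psi> where "finite I" "I0 \<subseteq> I" "\<And>i. \<psi> i \<in> hom_degree A M N i"
    "\<And>x. x \<in> carrier M \<Longrightarrow> \<phi> x = finsum N (\<lambda>i. \<psi> i x) I"
proof -
  from assms(1) obtain I \<psi> where *: "finite I" "\<And>i. i \<in> I \<Longrightarrow> \<psi> i \<in> hom_degree A M N i"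
    "\<And>x. x \<in> carrier M \<Longrightarrow> \<phi> x = finsum N (\<lambda>i. \<psi> i x) I"
    unfolding hom_complex_carrier by blast
  let ?\<psi> = "\<lambda>i. if i \<in> I then \<psi> i else (\<lambda>x\<in>carrier M. \<zero>\<^bsub>N\<^esub>)"
  have "\<phi> x = finsum N (\<lambda>i. ?\<psi> i x) (I \<union> I0)" if "x \<in> carrier M" for x
  proof -
    have "finsum N (\<lambda>i. ?\<psi> i x) (I \<union> I0) = finsum N (\<lambda>i. \<psi> i x) I"
      using *(1) assms(2) graded_map_closed[OF hom_degree_graded_map[OF *(2)] that]
      by (intro N.finsum_neutral_cong) (auto simp: that)
    with * that show ?thesis by simp
  qed
  moreover have "?\<psi> i \<in> hom_degree A M N i" for i
    using *(2) zero_hom_degree by auto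
  ultimately show ?thesis using that[of "I \<union> I0" ?\<psi>] *(1) assms(2) by blast
qed

lemma T_I:
  assumes "finite I" "\<And>i. i \<in> I \<Longrightarrow> \<psi> i \<in> hom_degree A M N i" "\<phi> \<in> extensional (carrier M)"
    "\<And>x. x \<in> carrier M \<Longrightarrow> \<phi> x = finsum N (\<lambda>i. \<psi> i x) I"
  shows "\<phi> \<in> carrier T"
  using assms unfolding hom_complex_carrier by blast

lemma T_add_closed:
  assumes "\<phi> \<in> carrier T" "\<psi> \<in> carrier T"
  shows "\<phi> \<oplus>\<^bsub>T\<^esub> \<psi> \<in> carrier T"
proof -
  from T_finsumE[OF assms(1) finite.emptyI] obtain I u where
    u: "finite I" "\<And>i. u i \<in> hom_degree A M N i" "\<And>x. x \<in> carrier M \<Longrightarrow> \<phi> x = finsum N (\<lambda>i. u i x) I"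
    by auto
  from T_finsumE[OF assms(2) u(1)] obtain J v where
    v: "finite J" "I \<subseteq> J" "\<And>i. v i \<in> hom_degree A M N i" "\<And>x. x \<in> carrier M \<Longrightarrow> \<psi> x = finsum N (\<lambda>i. v i x) J"
    by auto
  let ?u = "\<lambda>i. if i \<in> I then u i else (\<lambda>x\<in>carrier M. \<zero>\<^bsub>N\<^esub>)"
  have u': "?u i \<in> hom_degree A M N i" for i using u zero_hom_degree by auto
  note cu = u'[THEN hom_degree_graded_map, THEN graded_map_closed]
  note cu2 = u(2)[THEN hom_degree_graded_map, THEN graded_map_closed]
  note cv = v(3)[THEN hom_degree_graded_map, THEN graded_map_closed]
  show ?thesis
  proof (rule T_I[OF v(1), of "\<lambda>i. \<lambda>x\<in>carrier M. ?u i x \<oplus>\<^bsub>N\<^esub> v i x"])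
    fix x assume x: "x \<in> carrier M"
    have "\<phi> x = finsum N (\<lambda>i. ?u i x) J"
      unfolding u(3)[OF x] using v(1,2) x cu2 by (intro N.finsum_neutral_cong[symmetric]) auto
    then have "\<phi> x \<oplus>\<^bsub>N\<^esub> \<psi> x = finsum N (\<lambda>i. ?u i x \<oplus>\<^bsub>N\<^esub> v i x) J"
      unfolding v(4)[OF x] using x cu cv by (simp only:, intro N.finsum_addf[symmetric]) auto
    also have "\<dots> = finsum N (\<lambda>i. (\<lambda>x\<in>carrier M. ?u i x \<oplus>\<^bsub>N\<^esub> v i x) x) J" using x by simp
    finally show "(\<phi> \<oplus>\<^bsub>T\<^esub> \<psi>) x = finsum N (\<lambda>i. (\<lambda>x\<in>carrier M. ?u i x \<oplus>\<^bsub>N\<^esub> v i x) x) J"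
      using x by (simp add: hom_complex_simps)
  qed (use add_hom_degree[OF u' v(3)] in \<open>simp_all add: hom_complex_simps\<close>)
qed

lemma T_neg_closed:
  assumes "\<phi> \<in> carrier T"
  shows "(\<lambda>x\<in>carrier M. \<ominus>\<^bsub>N\<^esub> \<phi> x) \<in> carrier T"
proof -
  from T_finsumE[OF assms(1) finite.emptyI] obtain I u where
    u: "finite I" "\<And>i. u i \<in> hom_degree A M N i" "\<And>x. x \<in> carrier M \<Longrightarrow> \<phi> x = finsum N (\<lambda>i. u i x) I"
    by auto
  note cu = u(2)[THEN hom_degree_graded_map, THEN graded_map_closed]
  show ?thesis
  proof (rule T_I[OF u(1), of "\<lambda>i. \<lambda>x\<in>carrier M. \<ominus>\<^bsub>N\<^esub> u i x"])
    fix x assume x: "x \<in> carrier M"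
    then show "(\<lambda>x\<in>carrier M. \<ominus>\<^bsub>N\<^esub> \<phi> x) x = finsum N (\<lambda>i. (\<lambda>x\<in>carrier M. \<ominus>\<^bsub>N\<^esub> u i x) x) I"
      using cu by (simp add: u(3) N.finsum_neg)
  qed (use neg_hom_degree[OF u(2)] in auto)
qed

lemma T_ext: "\<phi> \<in> carrier T \<Longrightarrow> \<phi> \<in> extensional (carrier M)"
  by (simp add: hom_complex_carrier)

lemma T_abelian_group: "abelian_group T"
proof (rule abelian_groupI)
  fix \<phi> \<psi> assume "\<phi> \<in> carrier T" "\<psi> \<in> carrier T"
  then show "\<phi> \<oplus>\<^bsub>T\<^esub> \<psi> \<in> carrier T" by (rule T_add_closed)
next
  show "\<zero>\<^bsub>T\<^esub> \<in> carrier T"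
    unfolding hom_complex_simps by (rule hom_degree_T[OF zero_hom_degree])
next
  fix \<phi> assume \<phi>: "\<phi> \<in> carrier T"
  show "\<exists>\<psi>\<in>carrier T. \<psi> \<oplus>\<^bsub>T\<^esub> \<phi> = \<zero>\<^bsub>T\<^esub>"
    using T_neg_closed[OF \<phi>] carrier_T_closed[OF \<phi>]
    by (intro bexI[of _ "\<lambda>x\<in>carrier M. \<ominus>\<^bsub>N\<^esub> \<phi> x"]) (auto simp: hom_complex_simps N.l_neg Pi_iff)
next
  fix \<phi> assume \<phi>: "\<phi> \<in> carrier T"
  show "\<zero>\<^bsub>T\<^esub> \<oplus>\<^bsub>T\<^esub> \<phi> = \<phi>"
    using carrier_T_closed[OF \<phi>] T_ext[OF \<phi>]
    by (intro extensionalityI[of _ "carrier M"]) (auto simp: hom_complex_simps Pi_iff)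
next
  fix \<phi> \<psi> assume "\<phi> \<in> carrier T" "\<psi> \<in> carrier T"
  then show "\<phi> \<oplus>\<^bsub>T\<^esub> \<psi> = \<psi> \<oplus>\<^bsub>T\<^esub> \<phi>"
    using carrier_T_closed by (auto simp: hom_complex_simps fun_eq_iff restrict_def Pi_iff intro: N.a_comm)
next
  fix \<phi> \<psi> \<eta> assume "\<phi> \<in> carrier T" "\<psi> \<in> carrier T" "\<eta> \<in> carrier T"
  then show "\<phi> \<oplus>\<^bsub>T\<^esub> \<psi> \<oplus>\<^bsub>T\<^esub> \<eta> = \<phi> \<oplus>\<^bsub>T\<^esub> (\<psi> \<oplus>\<^bsub>T\<^esub> \<eta>)"
    using carrier_T_closed by (auto simp: hom_complex_simps fun_eq_iff restrict_def Pi_iff intro: N.a_assoc)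
qed

text \<open>A bounding element \<eta> may be inhomogeneous. Comparing components in each degree
  shows that every homogeneous summand is bounded by one homogeneous component of \<eta>, which
  makes homology of the Hom complex respect degrees.\<close>

lemma hom_boundary_component:
  assumes "finite I" "\<And>i. i \<in> I \<Longrightarrow> z i \<in> graded_map M N i" "\<eta> \<in> carrier T"
    and eq: "\<And>x. x \<in> carrier M \<Longrightarrow> finsum N (\<lambda>i. z i x) I = hom_diff M N \<eta> x" and i: "i \<in> I"
  shows "\<exists>\<eta>'\<in>hom_degree A M N (i + 1). hom_diff M N \<eta>' = z i"
proof -
  from T_finsumE[OF assms(3) finite_imageI[OF assms(1), of "\<lambda>i. i + 1"]] obtain J u where
    u: "finite J" "(\<lambda>i. i + 1) ` I \<subseteq> J" "\<And>i. u i \<in> hom_degree A M N i"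
      "\<And>x. x \<in> carrier M \<Longrightarrow> \<eta> x = finsum N (\<lambda>i. u i x) J"
    by auto
  note gu = u(3)[THEN hom_degree_graded_map]
  \<comment> \<open>The differential lowers degrees by one, so the component of \<eta> in degree j
    is compared with the summand in degree j - 1.\<close>
  let ?J = "(\<lambda>j. j - 1) ` J"
  let ?z = "\<lambda>i. if i \<in> I then z i else (\<lambda>x\<in>carrier M. \<zero>\<^bsub>N\<^esub>)"
  have IJ: "I \<subseteq> ?J" using u(2) by force
  have gd: "hom_diff M N (u (i + 1)) \<in> graded_map M N i" for i
    using hom_diff_graded_map[OF gu[of "i + 1"]] by simp
  have gz: "?z i \<in> graded_map M N i" for i
    using assms(2) hom_degree_graded_map[OF zero_hom_degree] by auto
  let ?w = "\<lambda>i. \<lambda>x\<in>carrier M. ?z i x \<ominus>\<^bsub>N\<^esub> hom_diff M N (u (i + 1)) x"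
  have gw: "?w i \<in> graded_map M N i" for i
  proof (rule graded_mapI)
    note c = gz[THEN graded_map_closed] gd[THEN graded_map_closed]
    show "additive_map M N (?w i)"
      using c by (auto simp: additive_map_def map_add[OF gz] map_add[OF gd] a_minus_def N.minus_add N.a_ac)
    show "?w i x \<in> grade N (i + j)" if "x \<in> grade M j" for x j
      using M.grade_closed[OF that] N.grade_minus[OF graded_map_grade[OF gz that] graded_map_grade[OF gd that]]
      by (simp only: restrict_apply')
  qed auto
  have "?w i x = \<zero>\<^bsub>N\<^esub>" if "x \<in> carrier M" for x
  proof (rule graded_map_independent[of ?J ?w])
    fix x assume x: "x \<in> carrier M"
    note c = gz[THEN graded_map_closed, OF x] gd[THEN graded_map_closed, OF x]
    have "finsum N (\<lambda>i. ?w i x) ?J = finsum N (\<lambda>i. ?z i x) ?J \<ominus>\<^bsub>N\<^esub> finsum N (\<lambda>i. hom_diff M N (u (i + 1)) x) ?J"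
      using x c by (simp only: restrict_apply', intro N.finsum_minus) auto
    also have "finsum N (\<lambda>i. ?z i x) ?J = finsum N (\<lambda>i. z i x) I"
      using u(1) IJ c by (intro N.finsum_neutral_cong) (auto simp: x)
    also have "finsum N (\<lambda>i. hom_diff M N (u (i + 1)) x) ?J = finsum N (\<lambda>j. hom_diff M N (u j) x) J"
      using c by (subst N.finsum_reindex) (auto simp: inj_on_def)
    also have "\<dots> = hom_diff M N \<eta> x"
      using u(4) x gu by (intro hom_diff_finsum[symmetric]) (auto intro: graded_map_closed)
    finally show "finsum N (\<lambda>i. ?w i x) ?J = \<zero>\<^bsub>N\<^esub>"
      using eq[OF x] carrier_T_closed[OF assms(3)] x
      by (simp add: N.minus_eq_zero_iff hom_diff_closed)
  qed (use u(1) gw IJ i that in auto)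
  then have "z i x = hom_diff M N (u (i + 1)) x" if "x \<in> carrier M" for x
    using that i N.minus_eq_zero_iff graded_map_closed[OF gz[of i]] graded_map_closed[OF gd[of i]] by auto
  moreover have "z i \<in> extensional (carrier M)" using assms(2) i by (blast intro: graded_map_ext)
  ultimately have "hom_diff M N (u (i + 1)) = z i"
    using hom_diff_ext by (metis extensionalityI)
  then show ?thesis using u(3) by blast
qed

lemma T_diff_additive:
  "\<phi> \<in> carrier T \<Longrightarrow> \<psi> \<in> carrier T \<Longrightarrow> hom_diff M N (\<phi> \<oplus>\<^bsub>T\<^esub> \<psi>) = (\<lambda>x\<in>carrier M. hom_diff M N \<phi> x \<oplus>\<^bsub>N\<^esub> hom_diff M N \<psi> x)"
  using carrier_T_closed hom_diff_ext
  by (intro extensionalityI[of _ "carrier M"]) (auto simp: hom_complex_simps hom_diff_add)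

end

section \<open>Quasi-isomorphisms, transport of structure and kernels\<close>

text \<open>A differential without a grading. Cosets of boundaries and the maps induced on them need
  no more, and this is the form in which Hom complexes enter.\<close>

locale diff_group = abelian_group M for M :: "('m, 'b) dg_scheme" (structure) +
  assumes diff_closed: "x \<in> carrier M \<Longrightarrow> diff M x \<in> carrier M"
    and diff_add: "\<lbrakk>x \<in> carrier M; y \<in> carrier M\<rbrakk> \<Longrightarrow> diff M (x \<oplus> y) = diff M x \<oplus> diff M y"
    and diff_diff: "x \<in> carrier M \<Longrightarrow> diff M (diff M x) = \<zero>"
begin

lemma additive_diff: "additive_map M M (diff M)"
  by (auto simp: additive_map_def diff_add diff_closed)

lemmas diff_zero = additive_map_zero[OF abelian_group_axioms abelian_group_axioms additive_diff]
lemmas diff_neg = additive_map_neg[OF abelian_group_axioms abelian_group_axioms additive_diff]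
lemmas diff_minus = additive_map_minus[OF abelian_group_axioms abelian_group_axioms additive_diff]

lemma boundaries_subgroup: "abelian_subgroup (boundaries M) M"
proof (rule abelian_subgroupI3)
  show "additive_subgroup (boundaries M) M"
  proof (intro additive_subgroup.intro add.subgroupI)
    show "boundaries M \<subseteq> carrier M" by (auto simp: boundaries_def diff_closed)
    show "boundaries M \<noteq> {}" by (auto simp: boundaries_def)
    fix a b assume "a \<in> boundaries M" "b \<in> boundaries M"
    then obtain x y where *: "x \<in> carrier M" "y \<in> carrier M" "a = diff M x" "b = diff M y"
      by (auto simp: boundaries_def)
    then have "\<ominus> a = diff M (\<ominus> x)" "a \<oplus> b = diff M (x \<oplus> y)"
      by (auto simp: diff_neg diff_add)
    with * show "\<ominus> a \<in> boundaries M" "a \<oplus> b \<in> boundaries M"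
      by (auto simp: boundaries_def)
  qed
qed (rule abelian_group_axioms)

lemma boundaries_cycles: "boundaries M \<subseteq> cycles M"
  by (auto simp: boundaries_def cycles_def diff_closed diff_diff)

lemma cycles_closed: "z \<in> cycles M \<Longrightarrow> z \<in> carrier M"
  by (simp add: cycles_def)

lemma coset_eq_iff:
  assumes "z \<in> carrier M" "w \<in> carrier M"
  shows "boundaries M +> z = boundaries M +> w \<longleftrightarrow> z \<ominus> w \<in> boundaries M"
proof -
  interpret B: abelian_subgroup "boundaries M" M by (rule boundaries_subgroup)
  have "z \<ominus> w \<in> boundaries M \<longleftrightarrow> z \<in> boundaries M +> w"
    unfolding a_minus_def using assms by (intro B.a_rcos_module[symmetric])
  also have "\<dots> \<longleftrightarrow> boundaries M +> z = boundaries M +> w"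
    using assms B.a_repr_independence' B.a_rcos_self by metis
  finally show ?thesis by simp
qed

end

lemma (in dg_group) diff_group: "diff_group M"
  by (intro diff_group.intro diff_group_axioms.intro abelian_group_axioms diff_closed diff_add diff_diff)

section \<open>Quasi-isomorphisms in terms of cycles and boundaries\<close>

lemma induced_map_coset:
  assumes "diff_group M" "diff_group N" "additive_map M N \<beta>"
    "\<And>x. x \<in> carrier M \<Longrightarrow> \<beta> (diff M x) = diff N (\<beta> x)" "z \<in> carrier M"
  shows "boundaries N <+>\<^bsub>N\<^esub> \<beta> ` (boundaries M +>\<^bsub>M\<^esub> z) = boundaries N +>\<^bsub>N\<^esub> \<beta> z"
proof -
  interpret M: diff_group M by fact
  interpret N: diff_group N by fact
  interpret BN: abelian_subgroup "boundaries N" N by (rule N.boundaries_subgroup)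
  interpret BM: abelian_subgroup "boundaries M" M by (rule M.boundaries_subgroup)
  have b: "\<beta> b \<in> boundaries N" if "b \<in> boundaries M" for b
    using that assms(4) additive_map_closed[OF assms(3)] by (auto simp: boundaries_def)
  have bz: "\<beta> z \<in> carrier N" using assms by (auto intro: additive_map_closed)
  show ?thesis
  proof (intro equalityI subsetI)
    fix y assume "y \<in> boundaries N <+>\<^bsub>N\<^esub> \<beta> ` (boundaries M +>\<^bsub>M\<^esub> z)"
    then obtain b c where bc: "b \<in> boundaries N" "c \<in> boundaries M" "y = b \<oplus>\<^bsub>N\<^esub> \<beta> (c \<oplus>\<^bsub>M\<^esub> z)"
      by (auto simp: set_add_def' a_r_coset_def')
    then have y: "y = (b \<oplus>\<^bsub>N\<^esub> \<beta> c) \<oplus>\<^bsub>N\<^esub> \<beta> z"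
      using additive_map_add[OF assms(3)] assms(5) bz b by (simp add: N.a_assoc)
    have "b \<oplus>\<^bsub>N\<^esub> \<beta> c \<in> boundaries N" using b bc by blast
    then show "y \<in> boundaries N +>\<^bsub>N\<^esub> \<beta> z"
      unfolding a_r_coset_def' y by blast
  next
    fix y assume "y \<in> boundaries N +>\<^bsub>N\<^esub> \<beta> z"
    then obtain b where "b \<in> boundaries N" "y = b \<oplus>\<^bsub>N\<^esub> \<beta> z" by (auto simp: a_r_coset_def')
    moreover have "z \<in> boundaries M +>\<^bsub>M\<^esub> z" using assms(5) by (rule BM.a_rcos_self)
    ultimately show "y \<in> boundaries N <+>\<^bsub>N\<^esub> \<beta> ` (boundaries M +>\<^bsub>M\<^esub> z)"
      by (auto simp: set_add_def')
  qed
qed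

text \<open>The map induced on homology is additive, so its injectivity can be tested at the zero
  class; this removes cosets from all later arguments.\<close>

lemma quasi_iso_iff:
  assumes "diff_group M" "diff_group N" "additive_map M N \<beta>"
    "\<And>x. x \<in> carrier M \<Longrightarrow> \<beta> (diff M x) = diff N (\<beta> x)"
  shows "quasi_iso M N \<beta> \<longleftrightarrow>
    (\<forall>z\<in>cycles M. \<beta> z \<in> boundaries N \<longrightarrow> z \<in> boundaries M) \<and>
    (\<forall>w\<in>cycles N. \<exists>z\<in>cycles M. w \<ominus>\<^bsub>N\<^esub> \<beta> z \<in> boundaries N)"
proof -
  interpret M: diff_group M by fact
  interpret N: diff_group N by fact
  note c = additive_map_closed[OF assms(3)]
  note ind = induced_map_coset[OF assms]
  note minus = additive_map_minus[OF M.abelian_group_axioms N.abelian_group_axioms assms(3)]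
  have cyc: "\<beta> z \<in> cycles N" if "z \<in> cycles M" for z
    using that assms(4)[of z] c additive_map_zero[OF M.abelian_group_axioms N.abelian_group_axioms assms(3)]
    by (auto simp: cycles_def)
  have cyc_minus: "z \<ominus>\<^bsub>M\<^esub> w \<in> cycles M" if "z \<in> cycles M" "w \<in> cycles M" for z w
    using that by (auto simp: cycles_def M.diff_minus M.minus_eq_zero_iff)
  have zc: "\<zero>\<^bsub>M\<^esub> \<in> cycles M" by (auto simp: cycles_def M.diff_zero)
  let ?h = "\<lambda>X. boundaries N <+>\<^bsub>N\<^esub> \<beta> ` X"
  have "inj_on ?h ((\<lambda>z. boundaries M +>\<^bsub>M\<^esub> z) ` cycles M) \<longleftrightarrow>
      (\<forall>z\<in>cycles M. \<forall>w\<in>cycles M. \<beta> z \<ominus>\<^bsub>N\<^esub> \<beta> w \<in> boundaries N \<longrightarrow> z \<ominus>\<^bsub>M\<^esub> w \<in> boundaries M)"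
    by (auto simp: inj_on_def ind M.cycles_closed M.coset_eq_iff N.coset_eq_iff c)
  also have "\<dots> \<longleftrightarrow> (\<forall>z\<in>cycles M. \<beta> z \<in> boundaries N \<longrightarrow> z \<in> boundaries M)"
  proof safe
    fix z assume *: "\<forall>z\<in>cycles M. \<forall>w\<in>cycles M. \<beta> z \<ominus>\<^bsub>N\<^esub> \<beta> w \<in> boundaries N \<longrightarrow> z \<ominus>\<^bsub>M\<^esub> w \<in> boundaries M"
      "z \<in> cycles M" "\<beta> z \<in> boundaries N"
    then have "\<beta> z \<ominus>\<^bsub>N\<^esub> \<beta> \<zero>\<^bsub>M\<^esub> \<in> boundaries N"
      using c[OF M.cycles_closed[OF *(2)]]
        additive_map_zero[OF M.abelian_group_axioms N.abelian_group_axioms assms(3)]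
      by (simp add: a_minus_def)
    then have "z \<ominus>\<^bsub>M\<^esub> \<zero>\<^bsub>M\<^esub> \<in> boundaries M"
      using zc * by blast
    then show "z \<in> boundaries M" using M.cycles_closed[OF *(2)] by (simp add: a_minus_def)
  next
    fix z w assume *: "\<forall>z\<in>cycles M. \<beta> z \<in> boundaries N \<longrightarrow> z \<in> boundaries M"
      "z \<in> cycles M" "w \<in> cycles M" "\<beta> z \<ominus>\<^bsub>N\<^esub> \<beta> w \<in> boundaries N"
    then show "z \<ominus>\<^bsub>M\<^esub> w \<in> boundaries M"
      using cyc_minus[of z w] minus M.cycles_closed by auto
  qed
  finally have inj: "inj_on ?h ((\<lambda>z. boundaries M +>\<^bsub>M\<^esub> z) ` cycles M) \<longleftrightarrow>
      (\<forall>z\<in>cycles M. \<beta> z \<in> boundaries N \<longrightarrow> z \<in> boundaries M)" .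
  have im: "?h ` ((\<lambda>z. boundaries M +>\<^bsub>M\<^esub> z) ` cycles M) = (\<lambda>z. boundaries N +>\<^bsub>N\<^esub> \<beta> z) ` cycles M"
    by (auto simp: ind M.cycles_closed image_image)
  have sub: "(\<lambda>z. boundaries N +>\<^bsub>N\<^esub> \<beta> z) ` cycles M \<subseteq> (\<lambda>z. boundaries N +>\<^bsub>N\<^esub> z) ` cycles N"
    using cyc by auto
  have "(\<lambda>z. boundaries N +>\<^bsub>N\<^esub> \<beta> z) ` cycles M = (\<lambda>z. boundaries N +>\<^bsub>N\<^esub> z) ` cycles N \<longleftrightarrow>
    (\<forall>w\<in>cycles N. \<exists>z\<in>cycles M. boundaries N +>\<^bsub>N\<^esub> w = boundaries N +>\<^bsub>N\<^esub> \<beta> z)"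
    using sub by (auto simp: image_iff set_eq_iff subset_iff)
  also have "\<dots> \<longleftrightarrow> (\<forall>w\<in>cycles N. \<exists>z\<in>cycles M. w \<ominus>\<^bsub>N\<^esub> \<beta> z \<in> boundaries N)"
    using N.coset_eq_iff c M.cycles_closed N.cycles_closed by (simp add: Ball_def Bex_def cong: conj_cong)
  finally show ?thesis
    unfolding quasi_iso_def bij_betw_def inj im by blast
qed

lemma dg_hom_additive: "dg_hom A M N \<beta> \<Longrightarrow> additive_map M N \<beta>"
  by (auto simp: dg_hom_def additive_map_def)

text \<open>The copy of \<open>M\<close> along an injection \<iota>. It moves a module of any type
  into the type over which the test modules in \<open>semiprojective\<close> range.\<close>

definition transport :: "('m \<Rightarrow> 't) \<Rightarrow> ('a, 'm, 'c) dgm_scheme \<Rightarrow> ('a, 't) dgm" where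
  "transport \<iota> M =
    (let i = the_inv_into (carrier M) \<iota> in
     \<lparr>carrier = \<iota> ` carrier M, mult = undefined, one = undefined, zero = \<iota> \<zero>\<^bsub>M\<^esub>,
      add = (\<lambda>x y. \<iota> (i x \<oplus>\<^bsub>M\<^esub> i y)), grade = (\<lambda>j. \<iota> ` grade M j),
      diff = (\<lambda>x. \<iota> (diff M (i x))), act = (\<lambda>a x. \<iota> (act M a (i x)))\<rparr>)"

lemma transport_simps:
  assumes "inj_on \<iota> (carrier M)"
  shows "carrier (transport \<iota> M) = \<iota> ` carrier M" "\<zero>\<^bsub>transport \<iota> M\<^esub> = \<iota> \<zero>\<^bsub>M\<^esub>"
    "grade (transport \<iota> M) j = \<iota> ` grade M j"
    "x \<in> carrier M \<Longrightarrow> y \<in> carrier M \<Longrightarrow> \<iota> x \<oplus>\<^bsub>transport \<iota> M\<^esub> \<iota> y = \<iota> (x \<oplus>\<^bsub>M\<^esub> y)"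
    "x \<in> carrier M \<Longrightarrow> diff (transport \<iota> M) (\<iota> x) = \<iota> (diff M x)"
    "x \<in> carrier M \<Longrightarrow> act (transport \<iota> M) a (\<iota> x) = \<iota> (act M a x)"
  using assms by (simp_all add: transport_def Let_def the_inv_into_f_f)

lemma transport_dg_module:
  assumes "dg_module A M" and inj: "inj_on \<iota> (carrier M)"
  shows "dg_module A (transport \<iota> M)"
proof -
  interpret dg_module A M by fact
  let ?M = "transport \<iota> M"
  note s = transport_simps[OF inj]
  have ag: "abelian_group ?M"
  proof (rule abelian_groupI)
    fix x assume "x \<in> carrier ?M"
    then obtain y where "y \<in> carrier M" "x = \<iota> y" by (auto simp: s)
    then show "\<exists>y\<in>carrier ?M. y \<oplus>\<^bsub>?M\<^esub> x = \<zero>\<^bsub>?M\<^esub>"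
      by (intro bexI[of _ "\<iota> (\<ominus>\<^bsub>M\<^esub> y)"]) (auto simp: s M.l_neg)
  qed (auto simp: s M.a_ac)
  then interpret T: abelian_group ?M .
  have add: "additive_map M ?M \<iota>" by (auto simp: additive_map_def s)
  note neg = additive_map_neg[OF M.abelian_group_axioms ag add]
  note sgn = additive_map_signed[OF M.abelian_group_axioms ag add]
  note sum = additive_map_finsum[OF M.abelian_group_axioms ag add]
  have gc: "\<And>x j. x \<in> grade M j \<Longrightarrow> x \<in> carrier M" by (rule M.grade_closed)
  have zero_iff: "\<iota> x = \<iota> \<zero>\<^bsub>M\<^esub> \<longleftrightarrow> x = \<zero>\<^bsub>M\<^esub>" if "x \<in> carrier M" for x
    using inj that by (auto simp: inj_on_def)
  have dec: "is_decomposition ?M (\<iota> x) (\<lambda>j. \<iota> (c j)) \<longleftrightarrow> is_decomposition M x c"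
    if "x \<in> carrier M" "\<And>j. c j \<in> carrier M" for x c
  proof -
    have g: "\<iota> (c j) \<in> \<iota> ` grade M j \<longleftrightarrow> c j \<in> grade M j" for j
      by (rule inj_on_image_mem_iff[OF inj that(2)]) (use gc in blast)
    have "\<iota> x = \<iota> (finsum M c {j. c j \<noteq> \<zero>\<^bsub>M\<^esub>}) \<longleftrightarrow> x = finsum M c {j. c j \<noteq> \<zero>\<^bsub>M\<^esub>}"
      using inj that by (intro inj_on_eq_iff[of \<iota> "carrier M"]) auto
    then show ?thesis
      using that by (simp add: is_decomposition_def s g zero_iff sum[symmetric])
  qed
  have "dg_group ?M"
  proof (intro dg_group.intro dg_group_axioms.intro ag)
    fix i
    show "additive_subgroup (grade ?M i) ?M"
      by (intro additive_subgroup.intro T.add.subgroupI)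
        (auto simp: s neg[symmetric] M.grade_neg M.grade_add gc, use M.grade_zero[of i] in blast)
  next
    fix x assume "x \<in> carrier ?M"
    then obtain y where y: "y \<in> carrier M" "x = \<iota> y" by (auto simp: s)
    show "\<exists>!c. is_decomposition ?M x c"
    proof (rule ex_ex1I)
      show "\<exists>c. is_decomposition ?M x c"
        using dec[OF y(1), of "component M y"] y M.is_decomposition_component[OF y(1)]
          M.component_in_grade[OF y(1)] gc by blast
      have "c = (\<lambda>j. \<iota> (component M y j))" if c: "is_decomposition ?M x c" for c
      proof -
        define c' where "c' = (\<lambda>j. the_inv_into (carrier M) \<iota> (c j))"
        have *: "c' j \<in> carrier M \<and> c j = \<iota> (c' j)" for j
        proof -
          have "c j \<in> \<iota> ` grade M j" using c by (auto simp: is_decomposition_def s)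
          then obtain z where "z \<in> grade M j" "c j = \<iota> z" by auto
          then show ?thesis using inj gc by (auto simp: c'_def the_inv_into_f_f)
        qed
        have "is_decomposition M y c'"
          using dec[OF y(1), of c'] c y(2) * by (metis (no_types, lifting) ext)
        then show ?thesis using M.component_eq[OF _ y(1)] * by auto
      qed
      then show "\<And>c d. is_decomposition ?M x c \<Longrightarrow> is_decomposition ?M x d \<Longrightarrow> c = d" by blast
    qed
  next
    fix x i assume "x \<in> grade ?M i"
    then show "diff ?M x \<in> grade ?M (i - 1)" by (auto simp: s gc intro: M.diff_grade)
  next
    fix x assume "x \<in> carrier ?M"
    then show "diff ?M x \<in> carrier ?M" by (auto simp: s intro: M.diff_closed)
  next
    fix x y assume "x \<in> carrier ?M" "y \<in> carrier ?M"
    then show "diff ?M (x \<oplus>\<^bsub>?M\<^esub> y) = diff ?M x \<oplus>\<^bsub>?M\<^esub> diff ?M y"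
      by (auto simp: s M.diff_add M.diff_closed)
  next
    fix x assume "x \<in> carrier ?M"
    then show "diff ?M (diff ?M x) = \<zero>\<^bsub>?M\<^esub>" by (auto simp: s M.diff_diff M.diff_closed)
  qed
  then show ?thesis
  proof (intro dg_module.intro dg_module_axioms.intro A.dg_ring_axioms)
    fix a i x assume "a \<in> grade A i" "x \<in> carrier ?M"
    then show "diff ?M (act ?M a x) = act ?M (diff A a) x \<oplus>\<^bsub>?M\<^esub> signed ?M i (act ?M a (diff ?M x))"
      using A.grade_closed
      by (auto simp: s act_closed M.diff_closed A.diff_closed act_leibniz sgn[symmetric])
  next
    fix a i x j assume "a \<in> grade A i" "x \<in> grade ?M j"
    then show "act ?M a x \<in> grade ?M (i + j)" by (auto simp: s gc intro: act_grade)
  qed (auto simp: s act_closed act_l_distr act_r_distr act_assoc act_one)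
qed

lemma dg_hom_transport:
  assumes "dg_module A M" and inj: "inj_on \<iota> (carrier M)"
  shows "dg_hom A M (transport \<iota> M) \<iota>"
  using assms by (auto simp: dg_hom_def transport_simps[OF inj])

lemma dg_hom_transport_inv:
  assumes "dg_module A M" and inj: "inj_on \<iota> (carrier M)"
  shows "dg_hom A (transport \<iota> M) M (the_inv_into (carrier M) \<iota>)"
proof -
  interpret dg_module A M by fact
  show ?thesis
    using inj by (auto simp: dg_hom_def transport_simps[OF inj] the_inv_into_f_f act_closed M.diff_closed
        M.grade_closed)
qed

lemma dg_hom_comp: "dg_hom A L M \<beta> \<Longrightarrow> dg_hom A M N \<gamma> \<Longrightarrow> dg_hom A L N (\<lambda>x. \<gamma> (\<beta> x))"
  unfolding dg_hom_def by (auto simp: Pi_iff image_subset_iff)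

lemma dg_module_setting:
  assumes "dg_module A P" "dg_module A M"
  shows "hom_setting A P M"
proof -
  interpret P: dg_module A P by fact
  interpret M: dg_module A M by fact
  show ?thesis
    by (intro hom_setting.intro graded_pair.intro hom_setting_axioms.intro P.M.graded_diff_group M.M.graded_diff_group)
      (auto simp: additive_map_def P.act_closed M.act_closed M.act_r_distr P.A.grade_closed)
qed

lemma hom_degree_comp:
  assumes "dg_module A P" "dg_module A M" "dg_module A N" "dg_hom A M N \<gamma>" "\<phi> \<in> hom_degree A P M d"
  shows "(\<lambda>x\<in>carrier P. \<gamma> (\<phi> x)) \<in> hom_degree A P N d"
proof -
  interpret P: dg_module A P by fact
  interpret M: dg_module A M by fact
  interpret N: dg_module A N by fact
  have c: "\<phi> x \<in> carrier M" if "x \<in> carrier P" for x using assms(5) that by (auto simp: hom_degree_def)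
  have g: "\<gamma> y \<in> carrier N" if "y \<in> carrier M" for y using assms(4) that by (auto simp: dg_hom_def)
  have "\<gamma> (signed M e (act M a (\<phi> x))) = signed N e (act N a (\<gamma> (\<phi> x)))"
    if "x \<in> carrier P" "a \<in> carrier A" for e a x
    using additive_map_signed[OF M.M.abelian_group_axioms N.M.abelian_group_axioms dg_hom_additive[OF assms(4)]]
      that c assms(4) M.act_closed by (auto simp: dg_hom_def)
  then show ?thesis
    using assms(4,5) c g P.act_closed P.M.grade_closed P.A.grade_closed
    unfolding hom_degree_def dg_hom_def
    by (auto simp: image_subset_iff)
qed

lemma quasi_iso_transport:
  assumes M: "dg_module A M" and N: "dg_module A N" and \<beta>: "dg_hom A M N \<beta>"
    and i: "inj_on \<iota> (carrier M)" and k: "inj_on \<kappa> (carrier N)" and q: "quasi_iso M N \<beta>"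
  shows "quasi_iso (transport \<iota> M) (transport \<kappa> N) (\<lambda>x. \<kappa> (\<beta> (the_inv_into (carrier M) \<iota> x)))"
proof -
  let ?\<beta> = "\<lambda>x. \<kappa> (\<beta> (the_inv_into (carrier M) \<iota> x))"
  interpret M: dg_module A M by fact
  interpret N: dg_module A N by fact
  interpret M': dg_module A "transport \<iota> M" by (rule transport_dg_module[OF M i])
  interpret N': dg_module A "transport \<kappa> N" by (rule transport_dg_module[OF N k])
  have dh: "dg_hom A (transport \<iota> M) (transport \<kappa> N) ?\<beta>"
    by (rule dg_hom_comp[OF dg_hom_comp[OF dg_hom_transport_inv[OF M i] \<beta>] dg_hom_transport[OF N k]])
  note iM = inj_on_eq_iff[OF i] and iN = inj_on_eq_iff[OF k]
  note s = transport_simps[OF i] transport_simps[OF k]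
  have cyc: "cycles (transport \<iota> M) = \<iota> ` cycles M" "cycles (transport \<kappa> N) = \<kappa> ` cycles N"
    by (auto simp: cycles_def s iM iN M.M.diff_closed N.M.diff_closed)
  have bd: "boundaries (transport \<iota> M) = \<iota> ` boundaries M" "boundaries (transport \<kappa> N) = \<kappa> ` boundaries N"
    by (auto simp: boundaries_def s image_image)
  have bc: "boundaries M \<subseteq> carrier M" "boundaries N \<subseteq> carrier N"
    by (auto simp: boundaries_def M.M.diff_closed N.M.diff_closed)
  have cc: "cycles M \<subseteq> carrier M" "cycles N \<subseteq> carrier N" by (auto simp: cycles_def)
  have \<beta>c: "\<beta> x \<in> carrier N" if "x \<in> carrier M" for x using \<beta> that by (auto simp: dg_hom_def)
  have mem: "\<iota> x \<in> \<iota> ` S \<longleftrightarrow> x \<in> S" if "x \<in> carrier M" "S \<subseteq> carrier M" for x S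
    using inj_on_image_mem_iff[OF i that] .
  have mem': "\<kappa> x \<in> \<kappa> ` S \<longleftrightarrow> x \<in> S" if "x \<in> carrier N" "S \<subseteq> carrier N" for x S
    using inj_on_image_mem_iff[OF k that] .
  have minus: "\<kappa> x \<ominus>\<^bsub>transport \<kappa> N\<^esub> \<kappa> y = \<kappa> (x \<ominus>\<^bsub>N\<^esub> y)" if "x \<in> carrier N" "y \<in> carrier N" for x y
    using additive_map_minus[OF N.M.abelian_group_axioms N'.M.abelian_group_axioms
        dg_hom_additive[OF dg_hom_transport[OF N k]] that] by simp
  have inv: "the_inv_into (carrier M) \<iota> (\<iota> x) = x" if "x \<in> carrier M" for x
    using i that by (simp add: the_inv_into_f_f)
  have q': "(\<forall>z\<in>cycles M. \<beta> z \<in> boundaries N \<longrightarrow> z \<in> boundaries M) \<and>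
    (\<forall>w\<in>cycles N. \<exists>z\<in>cycles M. w \<ominus>\<^bsub>N\<^esub> \<beta> z \<in> boundaries N)"
    using quasi_iso_iff[OF M.M.diff_group N.M.diff_group dg_hom_additive[OF \<beta>]] q \<beta>
    by (auto simp: dg_hom_def)
  have "quasi_iso (transport \<iota> M) (transport \<kappa> N) ?\<beta> \<longleftrightarrow>
    (\<forall>z\<in>cycles (transport \<iota> M). ?\<beta> z \<in> boundaries (transport \<kappa> N) \<longrightarrow> z \<in> boundaries (transport \<iota> M)) \<and>
    (\<forall>w\<in>cycles (transport \<kappa> N). \<exists>z\<in>cycles (transport \<iota> M). w \<ominus>\<^bsub>transport \<kappa> N\<^esub> ?\<beta> z \<in> boundaries (transport \<kappa> N))"
    using quasi_iso_iff[OF M'.M.diff_group N'.M.diff_group dg_hom_additive[OF dh]] dh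
    by (auto simp: dg_hom_def)
  also have "\<dots>"
    unfolding cyc bd using q' cc bc
    by (auto simp: inv mem mem' \<beta>c minus subset_iff)
  finally show ?thesis .
qed

section \<open>Lifting along semiprojective modules\<close>

text \<open>After transport, \<beta> is an admissible test map, so composition with it is onto
  between the Hom complexes. The preimage obtained there can be inhomogeneous; its component of
  degree \<open>d\<close> is already a lift because \<psi> has degree \<open>d\<close>.\<close>

theorem semiprojective_lift:
  fixes P :: "('a, 'm, 'c) dgm_scheme" and \<iota> :: "'x \<Rightarrow> nat \<times> 'a \<times> 'm \<Rightarrow> 'a"
    and \<kappa> :: "'y \<Rightarrow> nat \<times> 'a \<times> 'm \<Rightarrow> 'a"
  assumes sp: "semiprojective A P" and M: "dg_module A M" and N: "dg_module A N"
    and \<beta>: "dg_hom A M N \<beta>" "\<beta> ` carrier M = carrier N" "quasi_iso M N \<beta>"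
    and i: "inj_on \<iota> (carrier M)" and k: "inj_on \<kappa> (carrier N)"
    and \<psi>: "\<psi> \<in> hom_degree A P N d"
  shows "\<exists>\<phi>\<in>hom_degree A P M d. \<forall>x\<in>carrier P. \<beta> (\<phi> x) = \<psi> x"
proof -
  let ?M = "transport \<iota> M" and ?N = "transport \<kappa> N"
  let ?i = "the_inv_into (carrier M) \<iota>"
  let ?\<beta> = "\<lambda>x. \<kappa> (\<beta> (?i x))"
  have P: "dg_module A P" using sp by (simp add: semiprojective_def)
  note M' = transport_dg_module[OF M i] and N' = transport_dg_module[OF N k]
  have dh: "dg_hom A ?M ?N ?\<beta>"
    by (rule dg_hom_comp[OF dg_hom_comp[OF dg_hom_transport_inv[OF M i] \<beta>(1)] dg_hom_transport[OF N k]])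
  have "?\<beta> (\<iota> x) = \<kappa> (\<beta> x)" if "x \<in> carrier M" for x
    using i that by (simp add: the_inv_into_f_f)
  then have "?\<beta> ` carrier ?M = \<kappa> ` (\<beta> ` carrier M)"
    unfolding transport_simps(1)[OF i] image_image by (intro image_cong) auto
  then have surj: "?\<beta> ` carrier ?M = carrier ?N"
    by (simp only: \<beta>(2) transport_simps(1)[OF k])
  have "compose (carrier P) ?\<beta> ` carrier (hom_complex A P ?M) = carrier (hom_complex A P ?N)"
    using sp M' N' dh surj quasi_iso_transport[OF M N \<beta>(1) i k \<beta>(3)] unfolding semiprojective_def by blast
  moreover interpret PM: hom_setting A P ?M by (rule dg_module_setting[OF P M'])
  interpret PN: hom_setting A P ?N by (rule dg_module_setting[OF P N'])
  have \<psi>': "(\<lambda>x\<in>carrier P. \<kappa> (\<psi> x)) \<in> hom_degree A P ?N d"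
    by (rule hom_degree_comp[OF P N N' dg_hom_transport[OF N k] \<psi>])
  ultimately obtain \<phi> where \<phi>: "\<phi> \<in> carrier (hom_complex A P ?M)"
    "compose (carrier P) ?\<beta> \<phi> = (\<lambda>x\<in>carrier P. \<kappa> (\<psi> x))"
    using PN.hom_degree_T[OF \<psi>'] by (metis (no_types, lifting) imageE)
  \<comment> \<open>Asking for \<open>d\<close> in the index set guarantees that \<open>u d\<close>
    is one of the summands.\<close>
  from PM.T_finsumE[OF \<phi>(1), of "{d}"] obtain J u where u: "finite J" "{d} \<subseteq> J"
    "\<And>j. u j \<in> hom_degree A P ?M j" "\<And>x. x \<in> carrier P \<Longrightarrow> \<phi> x = finsum ?M (\<lambda>j. u j x) J"
    by auto
  have u': "(\<lambda>x\<in>carrier P. ?\<beta> (u j x)) \<in> hom_degree A P ?N j" for j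
    by (rule hom_degree_comp[OF P M' N' dh u(3)])
  note uc = graded_map_closed[OF hom_degree_graded_map[OF u(3)]]
  have "finsum ?N (\<lambda>j. (\<lambda>x\<in>carrier P. ?\<beta> (u j x)) x) J = (\<lambda>x\<in>carrier P. \<kappa> (\<psi> x)) x" if x: "x \<in> carrier P" for x
  proof -
    have "?\<beta> (\<phi> x) = finsum ?N (\<lambda>j. ?\<beta> (u j x)) J"
      unfolding u(4)[OF x]
      by (rule additive_map_finsum[OF PM.N.abelian_group_axioms PN.N.abelian_group_axioms dg_hom_additive[OF dh]])
        (auto intro: uc x)
    moreover have "?\<beta> (\<phi> x) = \<kappa> (\<psi> x)"
      using fun_cong[OF \<phi>(2), of x] x by (simp add: compose_def)
    ultimately show ?thesis using x by simp
  qed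
  then have eq: "?\<beta> (u d x) = \<kappa> (\<psi> x)" if "x \<in> carrier P" for x
    using PN.graded_map_component[OF u(1) hom_degree_graded_map[OF u'] hom_degree_graded_map[OF \<psi>'], of x] that u(2)
    by auto
  let ?\<phi> = "\<lambda>x\<in>carrier P. ?i (u d x)"
  have "?\<phi> \<in> hom_degree A P M d"
    by (rule hom_degree_comp[OF P M' M dg_hom_transport_inv[OF M i] u(3)])
  moreover have "\<beta> (?\<phi> x) = \<psi> x" if x: "x \<in> carrier P" for x
  proof -
    have "?\<phi> x \<in> carrier M" using calculation x by (auto simp: hom_degree_def)
    then have "\<beta> (?\<phi> x) \<in> carrier N" "\<psi> x \<in> carrier N" using \<beta>(1) \<psi> x by (auto simp: hom_degree_def dg_hom_def)
    then show ?thesis using eq[OF x] x k by (auto simp: inj_on_def)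
  qed
  ultimately show ?thesis by blast
qed

section \<open>Kernels of maps to complexes with zero differential\<close>

definition kernel_dgm :: "('a, 'm, 'c) dgm_scheme \<Rightarrow> ('x, 'b) ring_scheme \<Rightarrow> ('m \<Rightarrow> 'x) \<Rightarrow> ('a, 'm) dgm" where
  "kernel_dgm P X \<rho> =
     \<lparr>carrier = {x \<in> carrier P. \<rho> x = \<zero>\<^bsub>X\<^esub>}, mult = undefined, one = undefined, zero = \<zero>\<^bsub>P\<^esub>,
      add = add P, grade = (\<lambda>i. {x \<in> grade P i. \<rho> x = \<zero>\<^bsub>X\<^esub>}), diff = diff P, act = act P\<rparr>"

lemma kernel_dgm_simps:
  "carrier (kernel_dgm P X \<rho>) = {x \<in> carrier P. \<rho> x = \<zero>\<^bsub>X\<^esub>}" "zero (kernel_dgm P X \<rho>) = \<zero>\<^bsub>P\<^esub>"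
  "add (kernel_dgm P X \<rho>) = add P" "grade (kernel_dgm P X \<rho>) i = {x \<in> grade P i. \<rho> x = \<zero>\<^bsub>X\<^esub>}"
  "diff (kernel_dgm P X \<rho>) = diff P" "act (kernel_dgm P X \<rho>) = act P"
  by (simp_all add: kernel_dgm_def)

text \<open>\<open>X\<close> is only an abelian group here, so homogeneity of the kernel has to be
  supplied as the assumption \<open>comp\<close>. The last two conclusions are there because
  additive inverses are defined through the carrier: signs and differences in the kernel have to be
  compared with those in \<open>P\<close>.\<close>

lemma kernel_dg_module:
  assumes "dg_module A P" "abelian_group X" and \<rho>: "additive_map P X \<rho>"
    and act: "\<And>a x. a \<in> carrier A \<Longrightarrow> x \<in> carrier P \<Longrightarrow> \<rho> x = \<zero>\<^bsub>X\<^esub> \<Longrightarrow> \<rho> (act P a x) = \<zero>\<^bsub>X\<^esub>"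
    and diff: "\<And>x. x \<in> carrier P \<Longrightarrow> \<rho> x = \<zero>\<^bsub>X\<^esub> \<Longrightarrow> \<rho> (diff P x) = \<zero>\<^bsub>X\<^esub>"
    and comp: "\<And>x i. x \<in> carrier P \<Longrightarrow> \<rho> x = \<zero>\<^bsub>X\<^esub> \<Longrightarrow> \<rho> (component P x i) = \<zero>\<^bsub>X\<^esub>"
  shows "dg_module A (kernel_dgm P X \<rho>)"
    and "\<And>x i. x \<in> carrier (kernel_dgm P X \<rho>) \<Longrightarrow> signed (kernel_dgm P X \<rho>) i x = signed P i x"
    and "\<And>x y. x \<in> carrier (kernel_dgm P X \<rho>) \<Longrightarrow> y \<in> carrier (kernel_dgm P X \<rho>) \<Longrightarrow>
       x \<ominus>\<^bsub>kernel_dgm P X \<rho>\<^esub> y = x \<ominus>\<^bsub>P\<^esub> y"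
proof -
  interpret dg_module A P by fact
  interpret X: abelian_group X by fact
  let ?K = "kernel_dgm P X \<rho>"
  note s = kernel_dgm_simps
  note radd = additive_map_add[OF \<rho>] and rzero = additive_map_zero[OF M.abelian_group_axioms X.abelian_group_axioms \<rho>]
    and rneg = additive_map_neg[OF M.abelian_group_axioms X.abelian_group_axioms \<rho>]
  have ag: "abelian_group ?K"
  proof (rule abelian_groupI)
    fix x assume "x \<in> carrier ?K"
    then show "\<exists>y\<in>carrier ?K. y \<oplus>\<^bsub>?K\<^esub> x = \<zero>\<^bsub>?K\<^esub>"
      by (intro bexI[of _ "\<ominus>\<^bsub>P\<^esub> x"]) (auto simp: s M.l_neg rneg)
  qed (auto simp: s M.a_ac radd rzero)
  have id: "additive_map ?K P (\<lambda>x. x)" by (auto simp: additive_map_def s)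
  note neg = additive_map_neg[OF ag M.abelian_group_axioms id]
  note sgn = additive_map_signed[OF ag M.abelian_group_axioms id]
  note sum = additive_map_finsum[OF ag M.abelian_group_axioms id]
  show sgn': "\<And>x i. x \<in> carrier ?K \<Longrightarrow> signed ?K i x = signed P i x" using sgn by blast
  show "\<And>x y. x \<in> carrier ?K \<Longrightarrow> y \<in> carrier ?K \<Longrightarrow> x \<ominus>\<^bsub>?K\<^esub> y = x \<ominus>\<^bsub>P\<^esub> y"
    by (rule additive_map_minus[OF ag M.abelian_group_axioms id])
  have dec: "is_decomposition ?K x c \<longleftrightarrow> is_decomposition P x c \<and> (\<forall>i. \<rho> (c i) = \<zero>\<^bsub>X\<^esub>)"
    for x c
  proof -
    have "finsum ?K c {j. c j \<noteq> \<zero>\<^bsub>P\<^esub>} = finsum P c {j. c j \<noteq> \<zero>\<^bsub>P\<^esub>}"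
      if "\<forall>i. c i \<in> grade P i" "\<forall>i. \<rho> (c i) = \<zero>\<^bsub>X\<^esub>"
      using that by (intro sum) (auto simp: s intro: M.grade_closed)
    then show ?thesis by (auto simp: is_decomposition_def s)
  qed
  have "dg_group ?K"
  proof (intro dg_group.intro dg_group_axioms.intro ag)
    fix i
    interpret K: abelian_group ?K by (rule ag)
    show "additive_subgroup (grade ?K i) ?K"
      by (intro additive_subgroup.intro K.add.subgroupI)
        (auto simp: s neg rneg radd rzero M.grade_closed intro: M.grade_neg M.grade_add intro!: exI[of _ "\<zero>\<^bsub>P\<^esub>"])
  next
    fix x assume x: "x \<in> carrier ?K"
    then have "x \<in> carrier P" by (simp add: s)
    then show "\<exists>!c. is_decomposition ?K x c"
      using dec M.is_decomposition_component M.component_eq comp x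
      by (intro ex1I[of _ "component P x"]) (auto simp: s)
  qed (auto simp: s M.diff_closed M.diff_add M.diff_diff diff M.grade_closed intro: M.diff_grade)
  then show "dg_module A ?K"
  proof (intro dg_module.intro dg_module_axioms.intro A.dg_ring_axioms)
    fix a i x assume a: "a \<in> grade A i" and x: "x \<in> carrier ?K"
    then have "act ?K a (diff ?K x) \<in> carrier ?K"
      using A.grade_closed by (auto simp: s act_closed M.diff_closed diff act)
    from sgn'[OF this] show "diff ?K (act ?K a x) = act ?K (diff A a) x \<oplus>\<^bsub>?K\<^esub> signed ?K i (act ?K a (diff ?K x))"
      using a x act_leibniz by (simp add: s)
  next
    fix a i x j assume a: "a \<in> grade A i" and x: "x \<in> grade ?K j"
    then show "act ?K a x \<in> grade ?K (i + j)"
      using A.grade_closed by (auto simp: s M.grade_closed intro: act_grade act)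
  qed (auto simp: s act_closed act_l_distr act_r_distr act_assoc act_one act)
qed

text \<open>For acyclic \<open>M\<close> the map M \<rightarrow> 0 is a surjective
  quasi-isomorphism. Hence so is the induced map from Hom(P, M) to Hom(P, 0), and every cycle of
  Hom(P, M) is a boundary.\<close>

theorem semiprojective_cycle_boundary:
  fixes P :: "('a, 'm, 'c) dgm_scheme" and \<iota> :: "'x \<Rightarrow> nat \<times> 'a \<times> 'm \<Rightarrow> 'a"
  assumes sp: "semiprojective A P" and M: "dg_module A M" and i: "inj_on \<iota> (carrier M)"
    and ac: "\<And>z. z \<in> carrier M \<Longrightarrow> diff M z = \<zero>\<^bsub>M\<^esub> \<Longrightarrow> \<exists>w\<in>carrier M. diff M w = z"
    and \<psi>: "\<psi> \<in> hom_degree A P M d" and cyc: "\<And>x. x \<in> carrier P \<Longrightarrow> hom_diff P M \<psi> x = \<zero>\<^bsub>M\<^esub>"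
  shows "\<exists>\<phi>\<in>hom_degree A P M (d + 1). hom_diff P M \<phi> = \<psi>"
proof -
  let ?M = "transport \<iota> M"
  \<comment> \<open>The zero module, obtained as the kernel of the identity so that it is carried by
    the same type as \<open>?M\<close>.\<close>
  let ?N = "kernel_dgm ?M ?M (\<lambda>x. x)"
  have P: "dg_module A P" using sp by (simp add: semiprojective_def)
  note M' = transport_dg_module[OF M i]
  interpret M: dg_module A M by fact
  interpret M': dg_module A ?M by (rule M')
  have N': "dg_module A ?N"
    by (rule kernel_dg_module[OF M' M'.M.abelian_group_axioms])
      (use additive_map_zero[OF M'.M.abelian_group_axioms M'.M.abelian_group_axioms]
          M'.M.component_grade[OF M'.M.grade_zero[of 0]] in
        \<open>auto simp: additive_map_def M'.M.diff_zero M'.act_r_distr M'.act_closed\<close>)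
  have N0: "carrier ?N = {\<zero>\<^bsub>?M\<^esub>}" "\<zero>\<^bsub>?N\<^esub> = \<zero>\<^bsub>?M\<^esub>" by (auto simp: kernel_dgm_simps)
  let ?\<beta> = "\<lambda>_. \<zero>\<^bsub>?M\<^esub>"
  interpret N: dg_module A ?N by (rule N')
  have dh: "dg_hom A ?M ?N ?\<beta>"
    using N.act_closed N.M.diff_closed by (auto simp: dg_hom_def kernel_dgm_simps)
  have surj: "?\<beta> ` carrier ?M = carrier ?N" unfolding N0 by auto
  have bnd: "z \<in> boundaries ?M" if z: "z \<in> cycles ?M" for z
  proof -
    from z obtain y where y: "y \<in> carrier M" "z = \<iota> y" "\<iota> (diff M y) = \<iota> \<zero>\<^bsub>M\<^esub>"
      by (auto simp: cycles_def transport_simps[OF i])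
    then have "diff M y = \<zero>\<^bsub>M\<^esub>" using i M.M.diff_closed by (auto simp: inj_on_def)
    from ac[OF y(1) this] obtain w where w: "w \<in> carrier M" "diff M w = y" by blast
    then have "z = diff ?M (\<iota> w)" using y(2) by (simp add: transport_simps[OF i])
    with w(1) show ?thesis by (auto simp: boundaries_def transport_simps(1)[OF i])
  qed
  have q: "quasi_iso ?M ?N ?\<beta>"
  proof (subst quasi_iso_iff[OF M'.M.diff_group N.M.diff_group dg_hom_additive[OF dh]], goal_cases)
    case 2
    have "\<zero>\<^bsub>?M\<^esub> \<in> cycles ?M" by (simp add: cycles_def M'.M.diff_zero)
    moreover have "w \<ominus>\<^bsub>?N\<^esub> \<zero>\<^bsub>?M\<^esub> \<in> boundaries ?N" if "w \<in> cycles ?N" for w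
    proof -
      have "w = \<zero>\<^bsub>?N\<^esub>" using that by (auto simp: cycles_def N0)
      then have "w \<ominus>\<^bsub>?N\<^esub> \<zero>\<^bsub>?M\<^esub> = \<zero>\<^bsub>?N\<^esub>" unfolding N0(2)[symmetric] by (simp add: a_minus_def)
      moreover have "\<zero>\<^bsub>?N\<^esub> \<in> boundaries ?N"
        unfolding boundaries_def using N.M.diff_zero by (metis image_eqI N.M.zero_closed)
      ultimately show ?thesis by simp
    qed
    ultimately show ?case using bnd by blast
  qed (use dh in \<open>auto simp: dg_hom_def\<close>)
  let ?T = "hom_complex A P ?M" and ?S = "hom_complex A P ?N"
  interpret PM: hom_setting A P ?M by (rule dg_module_setting[OF P M'])
  interpret PM0: hom_setting A P M by (rule dg_module_setting[OF P M])
  interpret T: abelian_group ?T by (rule PM.T_abelian_group)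
  have qT: "quasi_iso ?T ?S (compose (carrier P) ?\<beta>)"
    using sp M' N' dh surj q unfolding semiprojective_def by blast
  define \<psi>' where "\<psi>' = (\<lambda>x\<in>carrier P. \<iota> (\<psi> x))"
  have \<psi>': "\<psi>' \<in> hom_degree A P ?M d"
    unfolding \<psi>'_def by (rule hom_degree_comp[OF P M M' dg_hom_transport[OF M i] \<psi>])
  have \<iota>diff: "hom_diff P ?M (\<lambda>x\<in>carrier P. \<iota> (\<phi> x)) x = \<iota> (hom_diff P M \<phi> x)"
    if \<phi>: "\<phi> \<in> hom_degree A P M e" and x: "x \<in> carrier P" for \<phi> x e
  proof -
    have g: "(\<lambda>x\<in>carrier P. \<iota> (\<phi> x)) \<in> graded_map P ?M e"
      by (rule hom_degree_graded_map[OF hom_degree_comp[OF P M M' dg_hom_transport[OF M i] \<phi>]])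
    note g0 = hom_degree_graded_map[OF \<phi>]
    note c = graded_map_closed[OF g0]
    have am: "additive_map M ?M \<iota>" by (rule dg_hom_additive[OF dg_hom_transport[OF M i]])
    show ?thesis
      using x c PM.M.diff_closed M.M.diff_closed
        additive_map_minus[OF M.M.abelian_group_axioms M'.M.abelian_group_axioms am]
        additive_map_signed[OF M.M.abelian_group_axioms M'.M.abelian_group_axioms am]
      by (simp add: PM.hom_diff_eq[OF g] PM0.hom_diff_eq[OF g0] transport_simps[OF i])
  qed
  have \<psi>'cyc: "hom_diff P ?M \<psi>' = \<zero>\<^bsub>?T\<^esub>"
    using \<iota>diff[OF \<psi>] cyc PM.hom_diff_ext
    by (intro extensionalityI[of _ "carrier P"]) (auto simp: \<psi>'_def hom_complex_simps transport_simps[OF i])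
  have z0: "hom_diff P ?M \<zero>\<^bsub>?T\<^esub> = \<zero>\<^bsub>?T\<^esub>"
    using PM.hom_diff_eq[OF hom_degree_graded_map[OF PM.zero_hom_degree]] PM.hom_diff_ext PM.M.diff_closed
    by (intro extensionalityI[of _ "carrier P"])
      (auto simp: hom_complex_simps M'.M.diff_zero a_minus_def)
  have zcyc: "\<psi>' \<in> cycles ?T" "\<zero>\<^bsub>?T\<^esub> \<in> cycles ?T"
    using \<psi>'cyc z0 PM.hom_degree_T[OF \<psi>'] by (auto simp: cycles_def hom_complex_simps(4))
  have sub: "boundaries ?T +>\<^bsub>?T\<^esub> z \<subseteq> extensional (carrier P)" "boundaries ?T +>\<^bsub>?T\<^esub> z \<noteq> {}" for z
    using T.zero_closed by (auto simp: a_r_coset_def' boundaries_def hom_complex_simps(2))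
  have cmp: "compose (carrier P) ?\<beta> \<phi> = (\<lambda>x\<in>carrier P. \<zero>\<^bsub>?M\<^esub>)" for \<phi> :: "'m \<Rightarrow> nat \<times> 'a \<times> 'm \<Rightarrow> 'a"
    by (simp add: compose_def)
  have img: "compose (carrier P) ?\<beta> ` S = {\<lambda>x\<in>carrier P. \<zero>\<^bsub>?M\<^esub>}" if "S \<noteq> {}"
    for S :: "('m \<Rightarrow> nat \<times> 'a \<times> 'm \<Rightarrow> 'a) set"
    unfolding image_def cmp using that by blast
  \<comment> \<open>Both classes are sent to the same class, since composition with the zero map is
    constant; injectivity on homology identifies them.\<close>
  have "boundaries ?T +>\<^bsub>?T\<^esub> \<psi>' = boundaries ?T +>\<^bsub>?T\<^esub> \<zero>\<^bsub>?T\<^esub>"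
  proof (rule inj_onD)
    show "inj_on (\<lambda>X. boundaries ?S <+>\<^bsub>?S\<^esub> compose (carrier P) ?\<beta> ` X)
        ((\<lambda>z. boundaries ?T +>\<^bsub>?T\<^esub> z) ` cycles ?T)"
      using qT unfolding quasi_iso_def bij_betw_def by blast
    show "boundaries ?S <+>\<^bsub>?S\<^esub> compose (carrier P) ?\<beta> ` (boundaries ?T +>\<^bsub>?T\<^esub> \<psi>') =
        boundaries ?S <+>\<^bsub>?S\<^esub> compose (carrier P) ?\<beta> ` (boundaries ?T +>\<^bsub>?T\<^esub> \<zero>\<^bsub>?T\<^esub>)"
      unfolding img[OF sub(2)] ..
  qed (intro imageI zcyc)+
  moreover have "\<psi>' \<in> boundaries ?T +>\<^bsub>?T\<^esub> \<psi>'"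
  proof -
    have "\<zero>\<^bsub>?T\<^esub> \<in> boundaries ?T"
      unfolding boundaries_def hom_complex_simps(4) using z0[symmetric] T.zero_closed by (rule image_eqI)
    moreover have "\<zero>\<^bsub>?T\<^esub> \<oplus>\<^bsub>?T\<^esub> \<psi>' = \<psi>'" using PM.hom_degree_T[OF \<psi>'] by simp
    ultimately show ?thesis unfolding a_r_coset_def' by (intro UN_I[of "\<zero>\<^bsub>?T\<^esub>"]) simp_all
  qed
  ultimately obtain \<eta> where \<eta>: "\<eta> \<in> carrier ?T" "\<psi>' = hom_diff P ?M \<eta> \<oplus>\<^bsub>?T\<^esub> \<zero>\<^bsub>?T\<^esub>"
    unfolding a_r_coset_def' boundaries_def hom_complex_simps(4) by blast
  have eq: "\<psi>' x = hom_diff P ?M \<eta> x" if "x \<in> carrier P" for x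
    using \<eta>(2) that PM.hom_diff_closed[OF PM.carrier_T_closed[OF \<eta>(1)] that] by (simp add: hom_complex_simps)
  \<comment> \<open>The element \<eta> bounding \<psi>' may be inhomogeneous; its part in degree d +
    1 is extracted.\<close>
  obtain \<eta>' where \<eta>': "\<eta>' \<in> hom_degree A P ?M (d + 1)" "hom_diff P ?M \<eta>' = \<psi>'"
  proof -
    have "finsum ?M (\<lambda>_. \<psi>' x) {d} = hom_diff P ?M \<eta> x" if "x \<in> carrier P" for x
      using eq[OF that] graded_map_closed[OF hom_degree_graded_map[OF \<psi>'] that] by simp
    from PM.hom_boundary_component[of "{d}" "\<lambda>_. \<psi>'", OF _ _ \<eta>(1) this]
    show ?thesis using that hom_degree_graded_map[OF \<psi>'] by blast
  qed
  let ?\<phi> = "\<lambda>x\<in>carrier P. the_inv_into (carrier M) \<iota> (\<eta>' x)"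
  have \<phi>: "?\<phi> \<in> hom_degree A P M (d + 1)"
    by (rule hom_degree_comp[OF P M' M dg_hom_transport_inv[OF M i] \<eta>'(1)])
  have *: "\<iota> (?\<phi> x) = \<eta>' x" if "x \<in> carrier P" for x
    using that graded_map_closed[OF hom_degree_graded_map[OF \<eta>'(1)] that] i
    by (auto simp: transport_simps[OF i] the_inv_into_f_f)
  have "(\<lambda>x\<in>carrier P. \<iota> (?\<phi> x)) = \<eta>'"
    using * graded_map_ext[OF hom_degree_graded_map[OF \<eta>'(1)]]
    by (intro extensionalityI[of _ "carrier P"]) auto
  then have "\<iota> (hom_diff P M ?\<phi> x) = \<iota> (\<psi> x)" if "x \<in> carrier P" for x
    using \<iota>diff[OF \<phi> that] \<eta>'(2) that by (simp add: \<psi>'_def)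
  moreover have "hom_diff P M ?\<phi> x \<in> carrier M" "\<psi> x \<in> carrier M" if "x \<in> carrier P" for x
    using that graded_map_closed[OF PM0.hom_diff_graded_map[OF hom_degree_graded_map[OF \<phi>]]]
      graded_map_closed[OF hom_degree_graded_map[OF \<psi>]] by blast+
  ultimately have "hom_diff P M ?\<phi> = \<psi>"
    using i PM0.hom_diff_ext graded_map_ext[OF hom_degree_graded_map[OF \<psi>]]
    by (intro extensionalityI[of _ "carrier P"]) (auto simp: inj_on_def)
  with \<phi> show ?thesis by blast
qed

text \<open>As \<open>X\<close> has zero differential it equals its homology, so every element of
  \<open>X\<close> is the image of a cycle. If a kernel element \<open>z\<close> is the boundary of
  \<open>w\<close>, subtracting from \<open>w\<close> a cycle with the same image moves
  \<open>w\<close> into the kernel without changing its boundary.\<close>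

theorem quasi_iso_kernel:
  assumes P: "dg_module A P" and X: "abelian_group X" and \<rho>: "additive_map P X \<rho>"
    and dX: "\<And>x. x \<in> carrier X \<Longrightarrow> diff X x = \<zero>\<^bsub>X\<^esub>"
    and \<rho>d: "\<And>x. x \<in> carrier P \<Longrightarrow> \<rho> (diff P x) = diff X (\<rho> x)"
    and q: "quasi_iso P X \<rho>"
  shows "\<rho> ` carrier P = carrier X"
    and "z \<in> carrier P \<Longrightarrow> \<rho> z = \<zero>\<^bsub>X\<^esub> \<Longrightarrow> diff P z = \<zero>\<^bsub>P\<^esub> \<Longrightarrow> \<exists>w\<in>carrier P. \<rho> w = \<zero>\<^bsub>X\<^esub> \<and> diff P w = z"
proof -
  interpret dg_module A P by fact
  interpret X: diff_group X
    using X dX by (intro diff_group.intro diff_group_axioms.intro)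
     (auto simp: abelian_group.axioms abelian_monoid.zero_closed abelian_monoid.l_zero abelian_monoid.a_closed)
  have B: "boundaries X = {\<zero>\<^bsub>X\<^esub>}" using dX by (auto simp: boundaries_def image_iff)
  have Z: "cycles X = carrier X" using dX by (auto simp: cycles_def)
  note c = additive_map_closed[OF \<rho>]
  have q': "(\<forall>z\<in>cycles P. \<rho> z \<in> boundaries X \<longrightarrow> z \<in> boundaries P) \<and>
      (\<forall>w\<in>cycles X. \<exists>z\<in>cycles P. w \<ominus>\<^bsub>X\<^esub> \<rho> z \<in> boundaries X)"
    using quasi_iso_iff[OF M.diff_group X.diff_group_axioms \<rho> \<rho>d] q by blast
  then have inj: "z \<in> cycles P \<Longrightarrow> \<rho> z = \<zero>\<^bsub>X\<^esub> \<Longrightarrow> z \<in> boundaries P" for z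
    unfolding B by blast
  have surj: "\<exists>z\<in>cycles P. w = \<rho> z" if w: "w \<in> carrier X" for w
  proof -
    from q' w obtain z where "z \<in> cycles P" "w \<ominus>\<^bsub>X\<^esub> \<rho> z = \<zero>\<^bsub>X\<^esub>" unfolding B Z by blast
    moreover from this have "\<rho> z \<in> carrier X" using c by (simp add: cycles_def)
    ultimately show ?thesis using w by (auto simp: X.minus_eq_zero_iff)
  qed
  show "\<rho> ` carrier P = carrier X" using surj c by (fastforce simp: cycles_def)
  assume z: "z \<in> carrier P" "\<rho> z = \<zero>\<^bsub>X\<^esub>" "diff P z = \<zero>\<^bsub>P\<^esub>"
  then obtain w where w: "w \<in> carrier P" "diff P w = z" using inj[of z] by (auto simp: cycles_def boundaries_def)
  obtain y where y: "y \<in> cycles P" "\<rho> w = \<rho> y" using surj[OF c[OF w(1)]] by auto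
  moreover have "z \<ominus>\<^bsub>P\<^esub> \<zero>\<^bsub>P\<^esub> = z" using z(1) by (simp add: a_minus_def)
  ultimately have "\<rho> (w \<ominus>\<^bsub>P\<^esub> y) = \<zero>\<^bsub>X\<^esub>" "diff P (w \<ominus>\<^bsub>P\<^esub> y) = z"
    using w c additive_map_minus[OF M.abelian_group_axioms X \<rho>]
    by (auto simp: cycles_def X.minus_eq_zero_iff M.diff_minus)
  then show "\<exists>w\<in>carrier P. \<rho> w = \<zero>\<^bsub>X\<^esub> \<and> diff P w = z" using w y by (intro bexI[of _ "w \<ominus>\<^bsub>P\<^esub> y"]) (auto simp: cycles_def)
qed

text \<open>The uniqueness half of a direct sum decomposition. It is what makes the kernel of a
  graded map into \<open>X\<close> homogeneous, and for homology it can be checked without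
  constructing decompositions of classes.\<close>

definition independent_grades :: "('x, 'b) dg_scheme \<Rightarrow> bool" where
  "independent_grades X \<longleftrightarrow> (\<forall>I c. finite I \<and> (\<forall>i\<in>I. c i \<in> grade X i \<inter> carrier X) \<and>
     finsum X c I = \<zero>\<^bsub>X\<^esub> \<longrightarrow> (\<forall>i\<in>I. c i = \<zero>\<^bsub>X\<^esub>))"

lemma independent_gradesD:
  "independent_grades X \<Longrightarrow> finite I \<Longrightarrow> (\<And>i. i \<in> I \<Longrightarrow> c i \<in> grade X i \<inter> carrier X) \<Longrightarrow>
     finsum X c I = \<zero>\<^bsub>X\<^esub> \<Longrightarrow> i \<in> I \<Longrightarrow> c i = \<zero>\<^bsub>X\<^esub>"
  unfolding independent_grades_def by blast

text \<open>Since \<open>l\<close> annihilates \<open>X\<close>, multiplication by \<open>l\<close>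
  maps \<open>P\<close> into the kernel of \<rho>. It is a chain map of even degree, and the kernel
  of the quasi-isomorphism \<rho> is acyclic, so it is null-homotopic by semiprojectivity.\<close>

theorem semiprojective_null_homotopy:
  fixes A :: "('a, 'b) dg_scheme" and P :: "('a, 'm, 'c) dgm_scheme" and X :: "('a, 'x, 'd) dgm_scheme"
  assumes sp: "semiprojective A P" and X: "abelian_group X"
    and dX: "\<And>x. x \<in> carrier X \<Longrightarrow> diff X x = \<zero>\<^bsub>X\<^esub>"
    and indep: "independent_grades X"
    and \<rho>: "dg_hom A P X \<rho>" "quasi_iso P X \<rho>"
    and l: "l \<in> grade A e" "even e" "diff A l = \<zero>\<^bsub>A\<^esub>"
    and comm: "\<And>a. a \<in> carrier A \<Longrightarrow> a \<otimes>\<^bsub>A\<^esub> l = l \<otimes>\<^bsub>A\<^esub> a"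
    and ann: "\<And>x. x \<in> carrier X \<Longrightarrow> act X l x = \<zero>\<^bsub>X\<^esub>"
    and uv: "(u :: 'a) \<noteq> v"
  shows "\<exists>h\<in>hom_degree A P P (e + 1). \<forall>x\<in>carrier P. diff P (h x) \<oplus>\<^bsub>P\<^esub> h (diff P x) = act P l x"
proof -
  have P: "dg_module A P" using sp by (simp add: semiprojective_def)
  interpret dg_module A P by fact
  interpret X: abelian_group X by fact
  have \<rho>add: "additive_map P X \<rho>" by (rule dg_hom_additive[OF \<rho>(1)])
  note \<rho>c = additive_map_closed[OF \<rho>add]
  have \<rho>0: "\<rho> \<zero>\<^bsub>P\<^esub> = \<zero>\<^bsub>X\<^esub>" by (rule additive_map_zero[OF M.abelian_group_axioms X \<rho>add])
  have \<rho>act: "\<rho> (act P a x) = act X a (\<rho> x)" if "a \<in> carrier A" "x \<in> carrier P" for a x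
    using \<rho>(1) that by (auto simp: dg_hom_def)
  have \<rho>d: "\<rho> (diff P x) = diff X (\<rho> x)" if "x \<in> carrier P" for x
    using \<rho>(1) that by (auto simp: dg_hom_def)
  have \<rho>g: "\<rho> x \<in> grade X i" if "x \<in> grade P i" for x i
    using \<rho>(1) that unfolding dg_hom_def by blast
  have act0: "act P a \<zero>\<^bsub>P\<^esub> = \<zero>\<^bsub>P\<^esub>" if "a \<in> carrier A" for a
    using additive_map_zero[OF M.abelian_group_axioms M.abelian_group_axioms, of "act P a"] that act_closed act_r_distr
    by (auto simp: additive_map_def)
  have Xact0: "act X a \<zero>\<^bsub>X\<^esub> = \<zero>\<^bsub>X\<^esub>" if "a \<in> carrier A" for a
    using \<rho>act[OF that M.zero_closed] act0[OF that] \<rho>0 by simp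
  have lc: "l \<in> carrier A" using l(1) by (rule A.grade_closed)
  let ?K = "kernel_dgm P X \<rho>"
  \<comment> \<open>The images of the components of \<open>x\<close> lie in different grades of
    \<open>X\<close> and add up to zero. The index \<open>i\<close> is inserted so that it belongs
    to the index set even if its component vanishes.\<close>
  have kernel_comp: "\<rho> (component P x i) = \<zero>\<^bsub>X\<^esub>" if x: "x \<in> carrier P" "\<rho> x = \<zero>\<^bsub>X\<^esub>" for x i
  proof -
    let ?I = "insert i {i. component P x i \<noteq> \<zero>\<^bsub>P\<^esub>}"
    have fin: "finite ?I" using M.finite_component[OF x(1)] by simp
    have g: "component P x i \<in> grade P i" for i using M.component_in_grade[OF x(1)] .
    have "finsum X (\<lambda>i. \<rho> (component P x i)) ?I = \<rho> (finsum P (component P x) ?I)"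
      by (rule additive_map_finsum[symmetric, OF M.abelian_group_axioms X \<rho>add]) (auto intro: M.grade_closed g)
    also have "\<dots> = \<zero>\<^bsub>X\<^esub>"
      using M.finsum_component_superset[OF x(1) fin subset_insertI] x(2) by simp
    finally show ?thesis
      using fin g by (intro independent_gradesD[OF indep, of ?I "\<lambda>i. \<rho> (component P x i)" i]) (auto intro: \<rho>g \<rho>c M.grade_closed)
  qed
  note kernel = kernel_dg_module[OF P X \<rho>add _ _ kernel_comp]
  have kact: "\<rho> (act P a x) = \<zero>\<^bsub>X\<^esub>" if "a \<in> carrier A" "x \<in> carrier P" "\<rho> x = \<zero>\<^bsub>X\<^esub>" for a x
    using that \<rho>act Xact0 by simp
  have kd: "\<rho> (diff P x) = \<zero>\<^bsub>X\<^esub>" if "x \<in> carrier P" for x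
    using that \<rho>d dX \<rho>c by simp
  have K: "dg_module A ?K" by (rule kernel(1)) (auto intro: kact kd)
  have Ksig: "signed ?K i x = signed P i x" if "x \<in> carrier ?K" for i x
    by (rule kernel(2)) (auto intro: kact kd that)
  have Kmin: "x \<ominus>\<^bsub>?K\<^esub> y = x \<ominus>\<^bsub>P\<^esub> y" if "x \<in> carrier ?K" "y \<in> carrier ?K" for x y
    by (rule kernel(3)) (auto intro: kact kd that)
  interpret PK: hom_setting A P ?K by (rule dg_module_setting[OF P K])
  interpret K: dg_module A ?K by (rule K)
  note ks = kernel_dgm_simps
  have lK: "act P l x \<in> carrier ?K" if "x \<in> carrier P" for x
    using that lc \<rho>act ann \<rho>c by (simp add: ks act_closed)
  let ?l = "\<lambda>x\<in>carrier P. act P l x"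
  have lgr: "?l \<in> graded_map P ?K e"
  proof (rule graded_mapI)
    show "additive_map P ?K ?l"
      using lK lc by (auto simp: additive_map_def act_r_distr kernel_dgm_simps(3))
    show "?l x \<in> grade ?K (e + j)" if "x \<in> grade P j" for x j
      using that lK[OF M.grade_closed[OF that]] act_grade[OF l(1) that] M.grade_closed[OF that]
      by (auto simp: ks)
  qed auto
  have ldeg: "?l \<in> hom_degree A P ?K e"
  proof (rule PK.hom_degreeI[OF lgr])
    fix j a x assume a: "a \<in> grade A j" and x: "x \<in> carrier P"
    have ac: "a \<in> carrier A" using a by (rule A.grade_closed)
    have "act P l (act P a x) = act P a (act P l x)"
      using act_assoc[OF lc ac x] act_assoc[OF ac lc x] comm[OF ac] by simp
    moreover have "signed ?K (e * j) y = y" for y using l(2) by (simp add: signed_def)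
    ultimately show "?l (act P a x) = signed ?K (e * j) (act ?K a (?l x))"
      using x ac by (simp add: act_closed ks)
  qed
  have zl: "act P \<zero>\<^bsub>A\<^esub> x = \<zero>\<^bsub>P\<^esub>" if "x \<in> carrier P" for x
    using act_l_distr[of "\<zero>\<^bsub>A\<^esub>" "\<zero>\<^bsub>A\<^esub>" x] that act_closed[of "\<zero>\<^bsub>A\<^esub>" x]
    by (intro M.add_idem_zero) auto
  have "hom_diff P ?K ?l x = \<zero>\<^bsub>?K\<^esub>" if x: "x \<in> carrier P" for x
  proof -
    have "diff P (act P l x) = act P l (diff P x)"
      using act_leibniz[OF l(1) x] l(2,3) x lc zl by (simp add: M.signed_even act_closed M.diff_closed)
    then have "hom_diff P ?K ?l x = act P l (diff P x) \<ominus>\<^bsub>?K\<^esub> act P l (diff P x)"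
      using PK.hom_diff_eq[OF lgr x] x l(2) by (simp add: M.diff_closed ks(5) signed_def)
    then show ?thesis using lK[OF M.diff_closed[OF x]] by (simp add: PK.N.minus_eq_zero_iff)
  qed
  \<comment> \<open>An element is encoded by its indicator function on \<open>'m\<close>, with the
    two values \<open>u\<close> and \<open>v\<close>.\<close>
  moreover have "inj_on (\<lambda>x (n :: nat, b :: 'a, y). if y = x then u else v) (carrier ?K)"
    using uv by (auto simp: inj_on_def fun_eq_iff split: if_splits)
  moreover have "\<exists>w\<in>carrier ?K. diff ?K w = z" if "z \<in> carrier ?K" "diff ?K z = \<zero>\<^bsub>?K\<^esub>" for z
    using quasi_iso_kernel(2)[OF P X \<rho>add dX \<rho>d \<rho>(2), of z] that by (auto simp: ks)
  ultimately obtain h where h: "h \<in> hom_degree A P ?K (e + 1)" "hom_diff P ?K h = ?l"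
    using semiprojective_cycle_boundary[OF sp K _ _ ldeg] by blast
  note hg = hom_degree_graded_map[OF h(1)]
  note hc = graded_map_closed[OF hg]
  have hcP: "h x \<in> carrier P" if "x \<in> carrier P" for x using hc[OF that] by (simp add: ks)
  have "h \<in> hom_degree A P P (e + 1)"
  proof -
    have "h \<in> carrier P \<rightarrow>\<^sub>E carrier P" using hcP graded_map_ext[OF hg] by (auto simp: PiE_def)
    moreover have "h (x \<oplus>\<^bsub>P\<^esub> y) = h x \<oplus>\<^bsub>P\<^esub> h y" if "x \<in> carrier P" "y \<in> carrier P" for x y
      using PK.map_add[OF hg that] by (simp add: ks)
    moreover have "h x \<in> grade P (e + 1 + j)" if "x \<in> grade P j" for x j
      using graded_map_grade[OF hg that] by (simp add: ks)
    moreover have "h (act P a x) = signed P ((e + 1) * j) (act P a (h x))" if "a \<in> grade A j" "x \<in> carrier P" for a j x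
      using PK.hom_degree_act[OF h(1) that] Ksig[OF K.act_closed[OF A.grade_closed[OF that(1)] hc[OF that(2)]]]
      by (simp add: ks)
    ultimately show ?thesis unfolding hom_degree_def by blast
  qed
  moreover have "diff P (h x) \<oplus>\<^bsub>P\<^esub> h (diff P x) = act P l x" if x: "x \<in> carrier P" for x
  proof -
    have dc: "diff P (h x) \<in> carrier ?K" using K.M.diff_closed[OF hc[OF x]] by (simp add: ks)
    have hd: "h (diff P x) \<in> carrier ?K" by (rule hc[OF M.diff_closed[OF x]])
    have "act P l x = hom_diff P ?K h x" using h(2) x by simp
    also have "\<dots> = diff P (h x) \<ominus>\<^bsub>?K\<^esub> signed ?K (e + 1) (h (diff P x))"
      using PK.hom_diff_eq[OF hg x] by (simp add: ks)
    also have "\<dots> = diff P (h x) \<ominus>\<^bsub>P\<^esub> signed P (e + 1) (h (diff P x))"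
      using Kmin[OF dc] PK.N.signed_closed[OF hd, of "e + 1"] Ksig[OF hd, of "e + 1"] by simp
    \<comment> \<open>The homotopy has the odd degree e + 1, which turns the minus sign of the
      differential into a plus.\<close>
    also have "\<dots> = diff P (h x) \<oplus>\<^bsub>P\<^esub> h (diff P x)"
      using l(2) hd by (simp add: signed_def a_minus_def ks)
    finally show ?thesis by simp
  qed
  ultimately show ?thesis by blast
qed

section \<open>Acyclic tensor products\<close>

lemma tensor_rel_add: "r \<in> tensor_rel A M N \<Longrightarrow> s \<in> tensor_rel A M N \<Longrightarrow> r + s \<in> tensor_rel A M N"
  using tensor_rel.diff[OF _ tensor_rel.diff[OF tensor_rel.zero], of r A M N s] by simp

lemma tensor_rel_minus: "r \<in> tensor_rel A M N \<Longrightarrow> - r \<in> tensor_rel A M N"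
  using tensor_rel.diff[OF tensor_rel.zero] by fastforce

lemma tensor_rel_zero_left:
  assumes "abelian_group M" "y \<in> carrier N"
  shows "frag_of (\<zero>\<^bsub>M\<^esub>, y) \<in> tensor_rel A M N"
proof -
  interpret abelian_group M by fact
  have "- frag_of (\<zero>\<^bsub>M\<^esub>, y) \<in> tensor_rel A M N"
    using tensor_rel.add_left[of "\<zero>\<^bsub>M\<^esub>" M "\<zero>\<^bsub>M\<^esub>" y N A] assms(2) by simp
  then show ?thesis using tensor_rel_minus by fastforce
qed

lemma tensor_rel_zero_right:
  assumes "x \<in> carrier M" "z \<in> carrier N" "z \<oplus>\<^bsub>N\<^esub> z = z"
  shows "frag_of (x, z) \<in> tensor_rel A M N"
proof -
  have "- frag_of (x, z) \<in> tensor_rel A M N"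
    using tensor_rel.add_right[of x M z N z A] assms by simp
  then show ?thesis using tensor_rel_minus by fastforce
qed

lemma tensor_class_eq_iff: "tensor_class A M N c = tensor_class A M N d \<longleftrightarrow> c - d \<in> tensor_rel A M N"
proof
  assume "tensor_class A M N c = tensor_class A M N d"
  moreover have "c \<in> tensor_class A M N c" using tensor_rel.zero by (force simp: tensor_class_def)
  ultimately show "c - d \<in> tensor_rel A M N" by (auto simp: tensor_class_def)
next
  assume cd: "c - d \<in> tensor_rel A M N"
  show "tensor_class A M N c = tensor_class A M N d"
    unfolding tensor_class_def
  proof (intro equalityI subsetI; elim CollectE exE conjE)
    fix x r assume "x = c + r" "r \<in> tensor_rel A M N"
    then show "x \<in> {d + r |r. r \<in> tensor_rel A M N}"
      using tensor_rel_add[OF cd] by (intro CollectI exI[of _ "(c - d) + r"]) auto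
  next
    fix x r assume "x = d + r" "r \<in> tensor_rel A M N"
    then show "x \<in> {c + r |r. r \<in> tensor_rel A M N}"
      using tensor_rel.diff[OF _ cd] by (intro CollectI exI[of _ "r - (c - d)"]) auto
  qed
qed

lemma tensor_class_zero: "tensor_class A M N 0 = tensor_rel A M N"
  by (auto simp: tensor_class_def)

text \<open>If multiplication by \<open>l\<close> is null-homotopic on \<open>P\<close> via \<open>h\<close> and invertible on \<open>N\<close> with inverse \<open>s\<close>,
  then \<open>h \<otimes> s\<close> contracts \<open>P \<otimes> N\<close>.\<close>

theorem tensor_product_contractible:
  fixes A :: "('a, 'b) dg_scheme" and P :: "('a, 'm, 'c) dgm_scheme" and N :: "('a, 'n, 'd) dgm_scheme"
  assumes P: "dg_module A P"
    and even: "\<And>a i. a \<in> grade A i \<Longrightarrow> odd i \<Longrightarrow> a = \<zero>\<^bsub>A\<^esub>"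
    and dA: "\<And>a. a \<in> carrier A \<Longrightarrow> diff A a = \<zero>\<^bsub>A\<^esub>"
    and N: "abelian_group N"
    and dN: "\<And>y. y \<in> carrier N \<Longrightarrow> diff N y = \<zero>\<^bsub>N\<^esub>"
    and actN: "\<And>a y. a \<in> carrier A \<Longrightarrow> y \<in> carrier N \<Longrightarrow> act N a y \<in> carrier N"
    and s: "\<And>y. y \<in> carrier N \<Longrightarrow> s y \<in> carrier N"
      "\<And>y z. y \<in> carrier N \<Longrightarrow> z \<in> carrier N \<Longrightarrow> s (y \<oplus>\<^bsub>N\<^esub> z) = s y \<oplus>\<^bsub>N\<^esub> s z"
      "\<And>a y. a \<in> carrier A \<Longrightarrow> y \<in> carrier N \<Longrightarrow> s (act N a y) = act N a (s y)"
      "\<And>y. y \<in> carrier N \<Longrightarrow> act N l (s y) = y"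
    and l: "l \<in> grade A e"
    and h: "h \<in> hom_degree A P P e'"
      "\<And>x. x \<in> carrier P \<Longrightarrow> diff P (h x) \<oplus>\<^bsub>P\<^esub> h (diff P x) = act P l x"
  shows "acyclic_dg (tensor_product A P N)"
proof -
  interpret dg_module A P by fact
  interpret N: abelian_group N by fact
  let ?R = "tensor_rel A P N" and ?C = "tensor_class A P N" and ?S = "carrier P \<times> carrier N"
  define D where "D = frag_extend (\<lambda>(x, y). frag_of (diff P x, y) + frag_of (parity_twist P x, diff N y))"
  define \<tau> where "\<tau> = frag_extend (\<lambda>(x, y). frag_of (h x, s y))"
  have D_of: "D (frag_of (x, y)) = frag_of (diff P x, y) + frag_of (parity_twist P x, diff N y)" for x y
    by (simp add: D_def)
  have \<tau>_of: "\<tau> (frag_of (x, y)) = frag_of (h x, s y)" for x y by (simp add: \<tau>_def)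
  have D_diff: "D (a - b) = D a - D b" and \<tau>_diff: "\<tau> (a - b) = \<tau> a - \<tau> b"
    and D_add: "D (a + b) = D a + D b" and \<tau>_add: "\<tau> (a + b) = \<tau> a + \<tau> b" 
    and D0: "D 0 = 0" and \<tau>0: "\<tau> 0 = 0" for a b
    by (simp_all add: D_def \<tau>_def frag_extend_diff frag_extend_add)
  have zr: "frag_of (x, \<zero>\<^bsub>N\<^esub>) \<in> ?R" if "x \<in> carrier P" for x
    by (rule tensor_rel_zero_right[OF that]) simp_all
  have zl: "act P \<zero>\<^bsub>A\<^esub> x = \<zero>\<^bsub>P\<^esub>" if "x \<in> carrier P" for x
    using act_l_distr[of "\<zero>\<^bsub>A\<^esub>" "\<zero>\<^bsub>A\<^esub>" x] that act_closed[of "\<zero>\<^bsub>A\<^esub>" x]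
    by (intro M.add_idem_zero) auto
  \<comment> \<open>A homogeneous scalar either has even degree or is zero; in both cases the Koszul
    sign has no effect.\<close>
  have nosign: "signed P (i * j) (act P a x) = act P a x" "signed P (j * i) (act P a x) = act P a x"
      "signed P i (act P a x) = act P a x"
    if "a \<in> grade A i" "x \<in> carrier P" for a i j x
    using even[OF that(1)] zl[OF that(2)] by (auto simp: signed_def)
  note sub = tensor_rel.diff[of _ A P N] and add = tensor_rel_add[of _ A P N]
  have bal: "frag_of (act P a x, y) - frag_of (x, act N a y) \<in> ?R"
    if "a \<in> grade A i" "x \<in> grade P j" "y \<in> carrier N" for a i x j y
    using tensor_rel.balanced[OF that] nosign(1)[OF that(1) M.grade_closed[OF that(2)]] by simp
  have DR: "D r \<in> ?R" if "r \<in> ?R" for r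
    using that
  proof (induction r rule: tensor_rel.induct)
    case (add_left x x' y)
    have "D (frag_of (x \<oplus>\<^bsub>P\<^esub> x', y) - frag_of (x, y) - frag_of (x', y)) =
      (frag_of (diff P x \<oplus>\<^bsub>P\<^esub> diff P x', y) - frag_of (diff P x, y) - frag_of (diff P x', y)) +
      (frag_of (parity_twist P (x \<oplus>\<^bsub>P\<^esub> x'), \<zero>\<^bsub>N\<^esub>) - frag_of (parity_twist P x, \<zero>\<^bsub>N\<^esub>) - frag_of (parity_twist P x', \<zero>\<^bsub>N\<^esub>))"
      using add_left by (simp add: D_diff D_of M.diff_add dN)
    also have "\<dots> \<in> ?R"
    proof (rule add)
      show "frag_of (diff P x \<oplus>\<^bsub>P\<^esub> diff P x', y) - frag_of (diff P x, y) - frag_of (diff P x', y) \<in> ?R"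
        using add_left by (intro tensor_rel.add_left M.diff_closed)
    qed (use add_left in \<open>intro sub zr M.parity_twist_closed M.a_closed\<close>)
    finally show ?case .
  next
    case (add_right x y y')
    have "D (frag_of (x, y \<oplus>\<^bsub>N\<^esub> y') - frag_of (x, y) - frag_of (x, y')) =
      (frag_of (diff P x, y \<oplus>\<^bsub>N\<^esub> y') - frag_of (diff P x, y) - frag_of (diff P x, y')) +
      - frag_of (parity_twist P x, \<zero>\<^bsub>N\<^esub>)"
      using add_right by (simp add: D_diff D_of dN)
    also have "\<dots> \<in> ?R"
    proof (rule add)
      show "frag_of (diff P x, y \<oplus>\<^bsub>N\<^esub> y') - frag_of (diff P x, y) - frag_of (diff P x, y') \<in> ?R"
        using add_right by (intro tensor_rel.add_right M.diff_closed)
    qed (use add_right in \<open>intro tensor_rel_minus zr M.parity_twist_closed\<close>)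
    finally show ?case .
  next
    case (balanced a i x j y)
    have ac: "a \<in> carrier A" and xc: "x \<in> carrier P"
      using balanced A.grade_closed M.grade_closed by blast+
    have d: "diff P (act P a x) = act P a (diff P x)"
      using act_leibniz[OF balanced(1) xc] dA[OF ac] zl[OF xc] nosign(3)[OF balanced(1) M.diff_closed[OF xc]]
        act_closed[OF ac M.diff_closed[OF xc]] by simp
    have "D (frag_of (signed P (i * j) (act P a x), y) - frag_of (x, act N a y)) =
      (frag_of (act P a (diff P x), y) - frag_of (diff P x, act N a y)) +
      (frag_of (parity_twist P (act P a x), \<zero>\<^bsub>N\<^esub>) - frag_of (parity_twist P x, \<zero>\<^bsub>N\<^esub>))"
      using balanced by (simp add: D_diff D_of nosign(1)[OF balanced(1) xc] dN actN ac d)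
    also have "\<dots> \<in> ?R"
    proof (rule add)
      show "frag_of (act P a (diff P x), y) - frag_of (diff P x, act N a y) \<in> ?R"
        using balanced by (intro bal[OF balanced(1) M.diff_grade])
    qed (use ac xc in \<open>intro sub zr M.parity_twist_closed act_closed\<close>)
    finally show ?case .
  qed (simp_all add: D0 D_diff sub tensor_rel.zero)
  note hg = hom_degree_graded_map[OF h(1)]
  have hc: "h x \<in> carrier P" if "x \<in> carrier P" for x using graded_map_closed[OF hg that] .
  have s0: "s \<zero>\<^bsub>N\<^esub> = \<zero>\<^bsub>N\<^esub>" 
    using s(2)[of "\<zero>\<^bsub>N\<^esub>" "\<zero>\<^bsub>N\<^esub>", symmetric] s(1)[of "\<zero>\<^bsub>N\<^esub>"]
    by (intro N.add_idem_zero) simp_all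
  have \<tau>R: "\<tau> r \<in> ?R" if "r \<in> ?R" for r
    using that
  proof (induction r rule: tensor_rel.induct)
    case (add_left x x' y)
    then show ?case
      using tensor_rel.add_left[OF hc hc s(1), of x x' y A]
      by (simp only: \<tau>_diff \<tau>_of additive_map_add[OF graded_map_additive[OF hg]])
  next
    case (add_right x y y')
    then show ?case
      using tensor_rel.add_right[OF hc s(1) s(1), of x y y' A] by (simp only: \<tau>_diff \<tau>_of s(2))
  next
    case (balanced a i x j y)
    have ac: "a \<in> carrier A" and xc: "x \<in> carrier P"
      using balanced A.grade_closed M.grade_closed by blast+
    have "h (act P a x) = act P a (h x)"
    proof -
      have "h (act P a x) = signed P (e' * i) (act P a (h x))"
        using h(1) balanced(1) xc unfolding hom_degree_def by blast
      then show ?thesis using nosign(2)[OF balanced(1) hc[OF xc]] by simp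
    qed
    then show ?case
      using bal[OF balanced(1) graded_map_grade[OF hg balanced(2)] s(1)[OF balanced(3)]] balanced(3)
      by (simp only: \<tau>_diff \<tau>_of nosign(1)[OF balanced(1) xc] s(3)[OF ac] \<open>h (act P a x) = act P a (h x)\<close>)
  qed (simp_all add: \<tau>0 \<tau>_diff sub tensor_rel.zero)
  have lbal: "frag_of (act P l x, y) - frag_of (x, act N l y) \<in> ?R" if "x \<in> carrier P" "y \<in> carrier N" for x y
    using that(1)
  proof (induction x rule: M.graded_induct)
    case (grade i x)
    then show ?case by (rule bal[OF l _ that(2)])
  next
    case (add x x')
    have lc: "l \<in> carrier A" by (rule A.grade_closed[OF l])
    have "frag_of (act P l (x \<oplus>\<^bsub>P\<^esub> x'), y) - frag_of (x \<oplus>\<^bsub>P\<^esub> x', act N l y) =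
      (frag_of (act P l x \<oplus>\<^bsub>P\<^esub> act P l x', y) - frag_of (act P l x, y) - frag_of (act P l x', y)) -
      (frag_of (x \<oplus>\<^bsub>P\<^esub> x', act N l y) - frag_of (x, act N l y) - frag_of (x', act N l y)) +
      ((frag_of (act P l x, y) - frag_of (x, act N l y)) + (frag_of (act P l x', y) - frag_of (x', act N l y)))"
      using add lc by (simp add: act_r_distr)
    also have "\<dots> \<in> ?R"
      by (rule tensor_rel_add[OF sub[OF tensor_rel.add_left tensor_rel.add_left] tensor_rel_add])
        (use add.hyps add.IH that(2) lc in \<open>simp_all add: act_closed actN\<close>)
    finally show ?case .
  qed
  \<comment> \<open>The parity terms carry the differential of \<open>N\<close>, which is zero. What
    remains is (dh + hd) x \<otimes> s y = l x \<otimes> s y = x \<otimes> l (s y) = x \<otimes> y,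
    modulo relations.\<close>
  have gen: "D (\<tau> (frag_of (x, y))) + \<tau> (D (frag_of (x, y))) - frag_of (x, y) \<in> ?R"
    if x: "x \<in> carrier P" and y: "y \<in> carrier N" for x y
  proof -
    have "D (\<tau> (frag_of (x, y))) + \<tau> (D (frag_of (x, y))) - frag_of (x, y) =
      (frag_of (parity_twist P (h x), \<zero>\<^bsub>N\<^esub>) + frag_of (h (parity_twist P x), \<zero>\<^bsub>N\<^esub>)) -
      (frag_of (diff P (h x) \<oplus>\<^bsub>P\<^esub> h (diff P x), s y) - frag_of (diff P (h x), s y) - frag_of (h (diff P x), s y)) +
      (frag_of (act P l x, s y) - frag_of (x, act N l (s y)))"
      using x y by (simp add: D_of \<tau>_of \<tau>_add dN s s0 h(2))
    also have "\<dots> \<in> ?R"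
      by (rule add[OF sub[OF add[OF zr zr] tensor_rel.add_left] lbal])
        (use x y s(1) in \<open>simp_all add: M.parity_twist_closed hc M.diff_closed\<close>)
    finally show ?thesis .
  qed
  have contr: "D (\<tau> c) + \<tau> (D c) - c \<in> ?R" if "Poly_Mapping.keys c \<subseteq> ?S" for c
    using that
  proof (induction c rule: frag_induction)
    case (one p)
    then show ?case using gen by (cases p) auto
  next
    case (diff a b)
    from tensor_rel.diff[OF this] show ?case by (simp add: D_diff \<tau>_diff algebra_simps)
  qed (simp add: D0 \<tau>0 tensor_rel.zero)
  \<comment> \<open>Needed for boundaries to be cycles; it is checked on representatives, as no DG
    structure on the tensor product has been established.\<close>
  have DD: "D (D c) \<in> ?R" if "Poly_Mapping.keys c \<subseteq> ?S" for c
    using that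
  proof (induction c rule: frag_induction)
    case (one p)
    obtain x y where p: "p = (x, y)" "x \<in> carrier P" "y \<in> carrier N" using one by (cases p) auto
    have "D (D (frag_of p)) = frag_of (\<zero>\<^bsub>P\<^esub>, y) + frag_of (parity_twist P (diff P x), \<zero>\<^bsub>N\<^esub>) +
      (frag_of (diff P (parity_twist P x), \<zero>\<^bsub>N\<^esub>) + frag_of (parity_twist P (parity_twist P x), \<zero>\<^bsub>N\<^esub>))"
      using p by (simp add: D_of D_add dN M.diff_diff)
    also have "\<dots> \<in> ?R"
      using p by (intro tensor_rel_add zr tensor_rel_zero_left M.abelian_group_axioms M.parity_twist_closed M.diff_closed)
    finally show ?case .
  next
    case (diff a b)
    from tensor_rel.diff[OF this] show ?case by (simp add: D_diff)
  qed (simp add: D0 tensor_rel.zero)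
  have keysD: "Poly_Mapping.keys (D c) \<subseteq> ?S" if "Poly_Mapping.keys c \<subseteq> ?S" for c
    using that
  proof (induction c rule: frag_induction)
    case (one p)
    obtain x y where p: "p = (x, y)" "x \<in> carrier P" "y \<in> carrier N" using one by (cases p) auto
    then show ?case
      using keys_add[of "frag_of (diff P x, y)" "frag_of (parity_twist P x, diff N y)"]
      by (auto simp: D_of dN keys_frag_of M.diff_closed M.parity_twist_closed)
  next
    case (diff a b)
    then show ?case unfolding D_diff using keys_diff[of "D a" "D b"] by blast
  qed (simp add: D0)
  have keys\<tau>: "Poly_Mapping.keys (\<tau> c) \<subseteq> ?S" if "Poly_Mapping.keys c \<subseteq> ?S" for c
    using that
  proof (induction c rule: frag_induction)
    case (one p)
    then show ?case using hc s(1) by (cases p) (auto simp: \<tau>_of keys_frag_of)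
  next
    case (diff a b)
    then show ?case unfolding \<tau>_diff using keys_diff[of "\<tau> a" "\<tau> b"] by blast
  qed (simp add: \<tau>0)
  \<comment> \<open>The differential of the tensor product is a union over all representatives; it
    collapses to one class because \<open>D\<close> preserves the relations.\<close>
  have dT: "diff (tensor_product A P N) (?C c) = ?C (D c)" for c
  proof -
    have "?C (D c') = ?C (D c)" if "c' \<in> ?C c" for c'
    proof -
      from that obtain r where "c' = c + r" "r \<in> ?R" by (auto simp: tensor_class_def)
      then show ?thesis using DR by (simp add: tensor_class_eq_iff D_add)
    qed
    moreover have "c \<in> ?C c" using tensor_rel.zero by (force simp: tensor_class_def)
    ultimately have "(\<Union>c'\<in>?C c. ?C (D c')) = ?C (D c)" by blast
    then show ?thesis by (simp add: tensor_product_def D_def)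
  qed
  have car: "carrier (tensor_product A P N) = {?C c | c. Poly_Mapping.keys c \<subseteq> ?S}"
    and zero: "\<zero>\<^bsub>tensor_product A P N\<^esub> = ?R"
    by (simp_all add: tensor_product_def)
  have zc: "?C c = ?R \<longleftrightarrow> c \<in> ?R" for c
    using tensor_class_eq_iff[of A P N c 0] by (simp add: tensor_class_zero)
  show ?thesis
    unfolding acyclic_dg_def
  proof (intro equalityI subsetI)
    fix X assume "X \<in> cycles (tensor_product A P N)"
    then obtain c where c: "X = ?C c" "Poly_Mapping.keys c \<subseteq> ?S" "D c \<in> ?R"
      by (auto simp: cycles_def car zero dT zc)
    have "D (\<tau> c) - c = (D (\<tau> c) + \<tau> (D c) - c) - \<tau> (D c)" by simp
    also have "\<dots> \<in> ?R" by (intro tensor_rel.diff contr \<tau>R c)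
    finally have "X = diff (tensor_product A P N) (?C (\<tau> c))"
      unfolding dT c(1) by (simp add: tensor_class_eq_iff[symmetric])
    then show "X \<in> boundaries (tensor_product A P N)"
      using keys\<tau>[OF c(2)] by (auto simp: boundaries_def car)
  next
    fix X assume "X \<in> boundaries (tensor_product A P N)"
    then obtain c where "X = ?C (D c)" "Poly_Mapping.keys c \<subseteq> ?S"
      by (auto simp: boundaries_def car dT)
    then show "X \<in> cycles (tensor_product A P N)"
      using keysD DD by (auto simp: cycles_def car zero dT zc)
  qed
qed

section \<open>Homogeneous localization\<close>

locale graded_prime = dg_ring A + cring A + primeideal p A for A :: "('a, 'b) dg_scheme" (structure) and p
begin

abbreviation "S \<equiv> denominators A p"
abbreviation "L \<equiv> homogeneous_localization A p"
abbreviation "quo \<equiv> fraction A p"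

lemma S_closed: "s \<in> S \<Longrightarrow> s \<in> carrier A"
  by (simp add: denominators_def)

lemma one_S: "\<one> \<in> S"
  using one_grade I_notcarr one_imp_carrier by (auto simp: denominators_def)

lemma mult_S: "s \<in> S \<Longrightarrow> t \<in> S \<Longrightarrow> s \<otimes> t \<in> S"
  using I_prime mult_grade unfolding denominators_def by blast

lemma fraction_rel_iff:
  "((a, s), (b, t)) \<in> fraction_rel A p \<longleftrightarrow> a \<in> carrier A \<and> b \<in> carrier A \<and> s \<in> S \<and> t \<in> S \<and>
     (\<exists>u\<in>S. u \<otimes> (a \<otimes> t) = u \<otimes> (b \<otimes> s))"
proof -
  have "u \<otimes> ((a \<otimes> t) \<ominus> (b \<otimes> s)) = \<zero> \<longleftrightarrow> u \<otimes> (a \<otimes> t) = u \<otimes> (b \<otimes> s)"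
    if "a \<in> carrier A" "b \<in> carrier A" "s \<in> S" "t \<in> S" "u \<in> S" for u
    using that by (simp add: a_minus_def r_distr r_minus S_closed) (simp add: a_minus_def[symmetric] minus_eq_zero_iff S_closed)
  then show ?thesis unfolding fraction_rel_def by blast
qed

lemma equiv_fraction_rel: "equiv (carrier A \<times> S) (fraction_rel A p)"
proof (rule equivI)
  show "fraction_rel A p \<subseteq> (carrier A \<times> S) \<times> (carrier A \<times> S)"
    by (auto simp: fraction_rel_def)
  show "refl_on (carrier A \<times> S) (fraction_rel A p)"
    using one_S by (auto simp: refl_on_def fraction_rel_iff)
  show "sym (fraction_rel A p)"
    by (auto simp: sym_def fraction_rel_iff) metis
  show "trans (fraction_rel A p)"
  proof (rule transI, clarsimp simp: fraction_rel_iff)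
    fix a s b t c w u v
    assume c: "a \<in> carrier A" "b \<in> carrier A" "c \<in> carrier A" "s \<in> S" "t \<in> S" "w \<in> S" "u \<in> S" "v \<in> S"
      and 1: "u \<otimes> (a \<otimes> t) = u \<otimes> (b \<otimes> s)" and 2: "v \<otimes> (b \<otimes> w) = v \<otimes> (c \<otimes> t)"
    note cc = c(1-3) c(4-8)[THEN S_closed]
    \<comment> \<open>Transitivity needs the middle denominator \<open>t\<close> as an extra factor
      of the element that witnesses equality.\<close>
    have "(u \<otimes> v \<otimes> t) \<otimes> (a \<otimes> w) = (v \<otimes> w) \<otimes> (u \<otimes> (a \<otimes> t))" using cc by (simp add: m_ac)
    also have "\<dots> = (u \<otimes> s) \<otimes> (v \<otimes> (b \<otimes> w))" using cc by (simp add: 1) (simp add: m_ac)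
    also have "\<dots> = (u \<otimes> v \<otimes> t) \<otimes> (c \<otimes> s)" using cc by (simp add: 2) (simp add: m_ac)
    finally show "\<exists>u\<in>S. u \<otimes> (a \<otimes> w) = u \<otimes> (c \<otimes> s)" using c by (intro bexI[of _ "u \<otimes> v \<otimes> t"] mult_S)
  qed
qed

lemma frac_eq_iff:
  assumes "a \<in> carrier A" "s \<in> S" "b \<in> carrier A" "t \<in> S"
  shows "quo a s = quo b t \<longleftrightarrow> (\<exists>u\<in>S. u \<otimes> (a \<otimes> t) = u \<otimes> (b \<otimes> s))"
  unfolding fraction_def using eq_equiv_class_iff[OF equiv_fraction_rel, of "(a, s)" "(b, t)"] assms
  by (auto simp: fraction_rel_iff)

lemma frac_eqI:
  assumes "a \<in> carrier A" "s \<in> S" "b \<in> carrier A" "t \<in> S" "a \<otimes> t = b \<otimes> s"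
  shows "quo a s = quo b t"
  using assms one_S by (auto simp: frac_eq_iff)

lemma in_frac: "(b, t) \<in> quo a s \<longleftrightarrow> a \<in> carrier A \<and> b \<in> carrier A \<and> s \<in> S \<and> t \<in> S \<and>
     (\<exists>u\<in>S. u \<otimes> (a \<otimes> t) = u \<otimes> (b \<otimes> s))"
  by (simp add: fraction_def fraction_rel_iff)

text \<open>The operations of the localization are unions over all representatives of two fractions;
  once the value does not depend on the representatives, the union is that single value.\<close>

lemma frac_union:
  assumes "a \<in> carrier A" "s \<in> S" "b \<in> carrier A" "t \<in> S"
    and "\<And>a' s' b' t'. (a', s') \<in> quo a s \<Longrightarrow> (b', t') \<in> quo b t \<Longrightarrow> g a' s' b' t' = g a s b t"
  shows "(\<Union>(a, s)\<in>quo a s. \<Union>(b, t)\<in>quo b t. g a s b t) = g a s b t"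
proof -
  have "(a, s) \<in> quo a s" "(b, t) \<in> quo b t" using assms one_S by (auto simp: in_frac)
  with assms(5) show ?thesis by blast
qed

lemma L_carrier: "carrier L = {quo a s | a s. a \<in> carrier A \<and> s \<in> S}"
  and L_one: "\<one>\<^bsub>L\<^esub> = quo \<one> \<one>" and L_zero: "\<zero>\<^bsub>L\<^esub> = quo \<zero> \<one>"
  by (simp_all add: homogeneous_localization_def)

lemma frac_closed: "a \<in> carrier A \<Longrightarrow> s \<in> S \<Longrightarrow> quo a s \<in> carrier L"
  by (auto simp: L_carrier)

lemma L_mult:
  assumes "a \<in> carrier A" "s \<in> S" "b \<in> carrier A" "t \<in> S"
  shows "quo a s \<otimes>\<^bsub>L\<^esub> quo b t = quo (a \<otimes> b) (s \<otimes> t)"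
proof -
  have "quo (a' \<otimes> b') (s' \<otimes> t') = quo (a \<otimes> b) (s \<otimes> t)"
    if "(a', s') \<in> quo a s" "(b', t') \<in> quo b t" for a' s' b' t'
  proof -
    from that obtain u v where uv: "u \<in> S" "v \<in> S" "u \<otimes> (a \<otimes> s') = u \<otimes> (a' \<otimes> s)" "v \<otimes> (b \<otimes> t') = v \<otimes> (b' \<otimes> t)"
      and c: "a' \<in> carrier A" "b' \<in> carrier A" "s' \<in> S" "t' \<in> S" by (auto simp: in_frac)
    note cc = assms(1,3) c(1,2) assms(2,4)[THEN S_closed] c(3,4)[THEN S_closed] uv(1,2)[THEN S_closed]
    have "(u \<otimes> v) \<otimes> ((a' \<otimes> b') \<otimes> (s \<otimes> t)) = (u \<otimes> (a' \<otimes> s)) \<otimes> (v \<otimes> (b' \<otimes> t))" using cc by (simp add: m_ac)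
    also have "\<dots> = (u \<otimes> v) \<otimes> ((a \<otimes> b) \<otimes> (s' \<otimes> t'))"
      using cc by (simp add: uv(3,4)[symmetric]) (simp add: m_ac)
    finally show ?thesis using assms c uv by (subst frac_eq_iff) (auto intro!: mult_S bexI[of _ "u \<otimes> v"])
  qed
  from frac_union[OF assms, of "\<lambda>a s b t. quo (a \<otimes> b) (s \<otimes> t)", OF this] show ?thesis by (simp add: homogeneous_localization_def)
qed

lemma L_add:
  assumes "a \<in> carrier A" "s \<in> S" "b \<in> carrier A" "t \<in> S"
  shows "quo a s \<oplus>\<^bsub>L\<^esub> quo b t = quo (a \<otimes> t \<oplus> b \<otimes> s) (s \<otimes> t)"
proof -
  have "quo (a' \<otimes> t' \<oplus> b' \<otimes> s') (s' \<otimes> t') = quo (a \<otimes> t \<oplus> b \<otimes> s) (s \<otimes> t)"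
    if "(a', s') \<in> quo a s" "(b', t') \<in> quo b t" for a' s' b' t'
  proof -
    from that obtain u v where uv: "u \<in> S" "v \<in> S" "u \<otimes> (a \<otimes> s') = u \<otimes> (a' \<otimes> s)" "v \<otimes> (b \<otimes> t') = v \<otimes> (b' \<otimes> t)"
      and c: "a' \<in> carrier A" "b' \<in> carrier A" "s' \<in> S" "t' \<in> S" by (auto simp: in_frac)
    note cc = assms(1,3) c(1,2) assms(2,4)[THEN S_closed] c(3,4)[THEN S_closed] uv(1,2)[THEN S_closed]
    have "(u \<otimes> v) \<otimes> ((a' \<otimes> t' \<oplus> b' \<otimes> s') \<otimes> (s \<otimes> t)) =
        (v \<otimes> t \<otimes> t') \<otimes> (u \<otimes> (a' \<otimes> s)) \<oplus> (u \<otimes> s \<otimes> s') \<otimes> (v \<otimes> (b' \<otimes> t))"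
      using cc by (simp add: l_distr r_distr m_ac)
    also have "\<dots> = (v \<otimes> t \<otimes> t') \<otimes> (u \<otimes> (a \<otimes> s')) \<oplus> (u \<otimes> s \<otimes> s') \<otimes> (v \<otimes> (b \<otimes> t'))"
      by (simp only: uv(3,4))
    also have "\<dots> = (u \<otimes> v) \<otimes> ((a \<otimes> t \<oplus> b \<otimes> s) \<otimes> (s' \<otimes> t'))"
      using cc by (simp add: l_distr r_distr m_ac)
    finally show ?thesis using assms c uv cc by (subst frac_eq_iff) (auto intro!: mult_S bexI[of _ "u \<otimes> v"])
  qed
  from frac_union[OF assms, of "\<lambda>a s b t. quo (a \<otimes> t \<oplus> b \<otimes> s) (s \<otimes> t)", OF this] show ?thesis by (simp add: homogeneous_localization_def)
qed

lemma L_cases: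
  assumes "X \<in> carrier L"
  obtains a s where "a \<in> carrier A" "s \<in> S" "X = quo a s"
  using assms by (auto simp: L_carrier)

lemma cring_L: "cring L"
proof (rule cringI)
  note [simp] = S_closed mult_S one_S L_mult L_add frac_closed L_one L_zero
  show "abelian_group L"
  proof (rule abelian_groupI)
    fix X Y assume "X \<in> carrier L" "Y \<in> carrier L"
    then show "X \<oplus>\<^bsub>L\<^esub> Y \<in> carrier L" "X \<oplus>\<^bsub>L\<^esub> Y = Y \<oplus>\<^bsub>L\<^esub> X"
      by (auto elim!: L_cases simp: m_comm a_comm)
  next
    fix X Y Z assume "X \<in> carrier L" "Y \<in> carrier L" "Z \<in> carrier L"
    then show "X \<oplus>\<^bsub>L\<^esub> Y \<oplus>\<^bsub>L\<^esub> Z = X \<oplus>\<^bsub>L\<^esub> (Y \<oplus>\<^bsub>L\<^esub> Z)"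
      by (elim L_cases) (simp add: l_distr r_distr m_ac a_ac)
  next
    fix X assume "X \<in> carrier L"
    then obtain a s where X: "a \<in> carrier A" "s \<in> S" "X = quo a s" by (rule L_cases)
    then show "\<zero>\<^bsub>L\<^esub> \<oplus>\<^bsub>L\<^esub> X = X" by simp
    have "quo (\<ominus> a) s \<oplus>\<^bsub>L\<^esub> X = \<zero>\<^bsub>L\<^esub>"
      using X by (simp, intro frac_eqI) (auto simp: l_minus l_neg)
    then show "\<exists>Y\<in>carrier L. Y \<oplus>\<^bsub>L\<^esub> X = \<zero>\<^bsub>L\<^esub>" using X by (intro bexI[of _ "quo (\<ominus> a) s"]) auto
  qed auto
  show "comm_monoid L"
    by (rule comm_monoidI) (auto elim!: L_cases simp: m_ac)
  fix X Y Z assume "X \<in> carrier L" "Y \<in> carrier L" "Z \<in> carrier L"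
  then show "(X \<oplus>\<^bsub>L\<^esub> Y) \<otimes>\<^bsub>L\<^esub> Z = X \<otimes>\<^bsub>L\<^esub> Z \<oplus>\<^bsub>L\<^esub> Y \<otimes>\<^bsub>L\<^esub> Z"
    by (elim L_cases, simp, intro frac_eqI) (auto simp: l_distr r_distr m_ac)
qed

section \<open>The residue ring at a homogeneous prime\<close>

abbreviation "J \<equiv> genideal L {quo a \<one> | a. a \<in> p}"
abbreviation "K \<equiv> L Quot J"

lemma ideal_J: "ideal J L"
  using frac_closed one_S by (intro ring.genideal_ideal cring.axioms(1) cring_L) auto

lemma cring_K: "cring K"
  by (rule ideal.quotient_is_cring[OF ideal_J cring_L])

abbreviation "\<kappa> \<equiv> residue_module A p"

lemma residue_module_simps:
  "carrier \<kappa> = carrier K" "\<zero>\<^bsub>\<kappa>\<^esub> = \<zero>\<^bsub>K\<^esub>" "add \<kappa> = add K" "diff \<kappa> = (\<lambda>_. \<zero>\<^bsub>K\<^esub>)"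
  "act \<kappa> a x = (J +>\<^bsub>L\<^esub> quo a \<one>) \<otimes>\<^bsub>K\<^esub> x"
  by (simp_all add: residue_module_def Let_def)

lemma coset_K: "a \<in> carrier A \<Longrightarrow> s \<in> S \<Longrightarrow> J +>\<^bsub>L\<^esub> quo a s \<in> carrier K"
  using frac_closed by (auto simp: FactRing_def A_RCOSETS_def')

lemma abelian_group_residue: "abelian_group \<kappa>"
proof -
  interpret K: cring K by (rule cring_K)
  show ?thesis
  proof (rule abelian_groupI)
    fix x assume "x \<in> carrier \<kappa>"
    then show "\<exists>y\<in>carrier \<kappa>. y \<oplus>\<^bsub>\<kappa>\<^esub> x = \<zero>\<^bsub>\<kappa>\<^esub>"
      by (intro bexI[of _ "\<ominus>\<^bsub>K\<^esub> x"]) (simp_all add: residue_module_simps K.l_neg)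
  qed (simp_all add: residue_module_simps K.a_ac)
qed

lemma residue_act_closed: "a \<in> carrier A \<Longrightarrow> y \<in> carrier \<kappa> \<Longrightarrow> act \<kappa> a y \<in> carrier \<kappa>"
  using cring_K coset_K one_S by (simp add: residue_module_simps cring.cring_simprules(5))

text \<open>A homogeneous \<open>l\<close> outside \<open>p\<close> becomes invertible in the
  localization, with inverse 1/l, and \<open>s\<close> is multiplication by the residue class of
  that inverse. The four properties are those required of \<open>s\<close> in
  \<open>tensor_product_contractible\<close>.\<close>

lemma residue_inverse:
  assumes l: "l \<in> S"
  defines "s \<equiv> \<lambda>y. (J +>\<^bsub>L\<^esub> quo \<one> l) \<otimes>\<^bsub>K\<^esub> y"
  shows "y \<in> carrier \<kappa> \<Longrightarrow> s y \<in> carrier \<kappa>"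
    "y \<in> carrier \<kappa> \<Longrightarrow> z \<in> carrier \<kappa> \<Longrightarrow> s (y \<oplus>\<^bsub>\<kappa>\<^esub> z) = s y \<oplus>\<^bsub>\<kappa>\<^esub> s z"
    "a \<in> carrier A \<Longrightarrow> y \<in> carrier \<kappa> \<Longrightarrow> s (act \<kappa> a y) = act \<kappa> a (s y)"
    "y \<in> carrier \<kappa> \<Longrightarrow> act \<kappa> l (s y) = y"
proof -
  interpret K: cring K by (rule cring_K)
  interpret J: ideal J L by (rule ideal_J)
  note cl = coset_K[OF one_closed l]
  have ca: "J +>\<^bsub>L\<^esub> quo a \<one> \<in> carrier K" if "a \<in> carrier A" for a by (rule coset_K[OF that one_S])
  show "y \<in> carrier \<kappa> \<Longrightarrow> s y \<in> carrier \<kappa>"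
    "y \<in> carrier \<kappa> \<Longrightarrow> z \<in> carrier \<kappa> \<Longrightarrow> s (y \<oplus>\<^bsub>\<kappa>\<^esub> z) = s y \<oplus>\<^bsub>\<kappa>\<^esub> s z"
    "a \<in> carrier A \<Longrightarrow> y \<in> carrier \<kappa> \<Longrightarrow> s (act \<kappa> a y) = act \<kappa> a (s y)"
    using cl ca by (simp_all add: s_def residue_module_simps K.r_distr K.m_lcomm)
  have "(J +>\<^bsub>L\<^esub> quo l \<one>) \<otimes>\<^bsub>K\<^esub> (J +>\<^bsub>L\<^esub> quo \<one> l) = J +>\<^bsub>L\<^esub> (quo l \<one> \<otimes>\<^bsub>L\<^esub> quo \<one> l)"
    using frac_closed l one_S S_closed by (simp add: FactRing_def J.rcoset_mult_add)
  also have "quo l \<one> \<otimes>\<^bsub>L\<^esub> quo \<one> l = \<one>\<^bsub>L\<^esub>"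
    using l one_S S_closed by (simp add: L_mult L_one frac_eqI)
  also have "J +>\<^bsub>L\<^esub> \<one>\<^bsub>L\<^esub> = \<one>\<^bsub>K\<^esub>" by (simp add: FactRing_def)
  finally show "y \<in> carrier \<kappa> \<Longrightarrow> act \<kappa> l (s y) = y"
    using cl ca[OF S_closed[OF l]] by (simp add: s_def residue_module_simps K.m_assoc[symmetric])
qed

end

theorem annihilator_in_support:
  fixes A :: "('a, 'b) dg_scheme" and X :: "('a, 'x, 'd) dgm_scheme"
  assumes comm: "\<And>a b. a \<in> carrier A \<Longrightarrow> b \<in> carrier A \<Longrightarrow> a \<otimes>\<^bsub>A\<^esub> b = b \<otimes>\<^bsub>A\<^esub> a"
    and even: "\<And>a i. a \<in> grade A i \<Longrightarrow> odd i \<Longrightarrow> a = \<zero>\<^bsub>A\<^esub>"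
    and dA: "\<And>a. a \<in> carrier A \<Longrightarrow> diff A a = \<zero>\<^bsub>A\<^esub>"
    and X: "abelian_group X" and dX: "\<And>x. x \<in> carrier X \<Longrightarrow> diff X x = \<zero>\<^bsub>X\<^esub>"
    and indep: "independent_grades X"
    and l: "l \<in> grade A e" "even e"
    and ann: "\<And>x. x \<in> carrier X \<Longrightarrow> act X l x = \<zero>\<^bsub>X\<^esub>"
    and p: "p \<in> Supp_plus A X"
  shows "l \<in> p"
proof (rule ccontr)
  assume "l \<notin> p"
  from p obtain P :: "('a, nat \<times> 'a \<times> 'x \<Rightarrow> 'a) dgm" and \<rho> where P: "semiprojective A P" "dg_hom A P X \<rho>"
    "quasi_iso P X \<rho>" "\<not> acyclic_dg (tensor_product A P (residue_module A p))" and pi: "primeideal p A"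
    unfolding Supp_plus_def derived_tensor_nonzero_def Proj_def by blast
  have PA: "dg_module A P" using P(1) by (simp add: semiprojective_def)
  interpret A: dg_ring A using PA by (rule dg_module.axioms)
  interpret A: graded_prime A p
    by (intro graded_prime.intro pi A.dg_ring_axioms cring.intro A.ring_axioms comm_monoid.intro
        A.monoid_axioms comm_monoid_axioms.intro comm)
  have lS: "l \<in> A.S" using l A.grade_closed \<open>l \<notin> p\<close> by (auto simp: denominators_def)
  \<comment> \<open>A prime ideal is proper, so one and zero serve as the two distinct scalars for
    encoding elements as functions.\<close>
  have uv: "\<one>\<^bsub>A\<^esub> \<noteq> \<zero>\<^bsub>A\<^esub>"
    using A.one_S additive_subgroup.zero_closed[OF ideal.axioms(1)[OF primeideal.axioms(1)[OF pi]]]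
    by (auto simp: denominators_def)
  have lc: "l \<in> carrier A" by (rule A.grade_closed[OF l(1)])
  have "\<exists>h\<in>hom_degree A P P (e + 1). \<forall>x\<in>carrier P. diff P (h x) \<oplus>\<^bsub>P\<^esub> h (diff P x) = act P l x"
    by (rule semiprojective_null_homotopy[OF P(1) X dX indep P(2,3) l dA[OF lc] comm[OF _ lc] ann uv])
  then obtain h where h: "h \<in> hom_degree A P P (e + 1)"
    "\<And>x. x \<in> carrier P \<Longrightarrow> diff P (h x) \<oplus>\<^bsub>P\<^esub> h (diff P x) = act P l x"
    by blast
  have "acyclic_dg (tensor_product A P (residue_module A p))"
    by (rule tensor_product_contractible[OF PA even dA A.abelian_group_residue _ A.residue_act_closed
          A.residue_inverse[OF lS] l(1) h])
      (simp_all add: A.residue_module_simps)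
  with P(4) show False by simp
qed

section \<open>Convolution of families indexed by multisets\<close>

lemma finite_submultisets: "finite {K. K \<subseteq># G}"
proof (induction G)
  case (add x G)
  have "{K. K \<subseteq># add_mset x G} \<subseteq> {K. K \<subseteq># G} \<union> add_mset x ` {K. K \<subseteq># G}"
  proof
    fix K assume "K \<in> {K. K \<subseteq># add_mset x G}"
    then have K: "K \<subseteq># add_mset x G" by simp
    show "K \<in> {K. K \<subseteq># G} \<union> add_mset x ` {K. K \<subseteq># G}"
    proof (cases "x \<in># K")
      case True
      then obtain K' where "K = add_mset x K'" by (metis multi_member_split)
      with K show ?thesis by auto
    next
      case False
      then have "K \<subseteq># G" 
        using K unfolding subseteq_mset_def by (metis count_add_mset count_eq_zero_iff zero_le)
      then show ?thesis by simp
    qed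
  qed
  then show ?case using add finite_subset by blast
qed simp

lemma diff_diff_submultiset: "K \<subseteq># G \<Longrightarrow> G - (G - K) = K"
  by (auto simp: multiset_eq_iff subseteq_mset_def)

text \<open>The coefficient at \<chi>^G of the composite of the power series \<Sum> a(K) \<chi>^K
  and \<Sum> b(K) \<chi>^K, the variables commuting with all maps. Restriction to the carrier makes
  the coefficients extensional, as in Hom complexes.\<close>

definition conv :: "('m, 'b) ring_scheme \<Rightarrow> ('n, 'c) ring_scheme \<Rightarrow> ('i multiset \<Rightarrow> 'l \<Rightarrow> 'n) \<Rightarrow>
    ('i multiset \<Rightarrow> 'm \<Rightarrow> 'l) \<Rightarrow> 'i multiset \<Rightarrow> 'm \<Rightarrow> 'n" where
  "conv M N a b G = (\<lambda>x\<in>carrier M. \<Oplus>\<^bsub>N\<^esub>K\<in>{K. K \<subseteq># G}. a K (b (G - K) x))"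

lemma conv_apply: "x \<in> carrier M \<Longrightarrow> conv M N a b G x = (\<Oplus>\<^bsub>N\<^esub>K\<in>{K. K \<subseteq># G}. a K (b (G - K) x))"
  by (simp add: conv_def)

text \<open>Both sides run over the ways of writing G as a sum of three multisets. Additivity of
  \<open>a\<close> is needed to move it past the inner sum.\<close>

lemma conv_assoc:
  fixes G :: "'e multiset"
  assumes N: "abelian_group N" and N1: "abelian_group N1"
    and a: "\<And>G. additive_map N1 N (a G)" and b: "\<And>G. b G \<in> carrier M1 \<rightarrow> carrier N1"
    and c: "\<And>G. c G \<in> carrier M \<rightarrow> carrier M1" and x: "x \<in> carrier M"
  shows "conv M N (conv M1 N a b) c G x = conv M N a (conv M N1 b c) G x"
proof -
  interpret N: abelian_group N by fact
  interpret N1: abelian_group N1 by fact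
  note [simp] = conv_apply finite_submultisets
  have ac: "a G y \<in> carrier N" if "y \<in> carrier N1" for G y using additive_map_closed[OF a that] .
  have bc: "b G y \<in> carrier N1" if "y \<in> carrier M1" for G y using b that by blast
  have cc: "c G x \<in> carrier M1" for G using c x by blast
  define X where "X = Sigma {K. K \<subseteq># G} (\<lambda>K. {J. J \<subseteq># G - K})"
  \<comment> \<open>Replaces the first two parts \<open>K\<close>, \<open>J\<close> of a splitting
    of \<open>G\<close> by the pair of their sum and the first part.\<close>
  define h where "h = (\<lambda>(K, J). (K + J :: 'e multiset, K))"
  have fX: "finite X" by (auto simp: X_def)
  have inj: "inj_on h X" by (auto simp: inj_on_def h_def)
  have hX: "h ` X = Sigma {L. L \<subseteq># G} (\<lambda>L. {K. K \<subseteq># L})"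
  proof (intro equalityI subsetI)
    fix p assume "p \<in> h ` X"
    then show "p \<in> Sigma {L. L \<subseteq># G} (\<lambda>L. {K. K \<subseteq># L})"
      by (auto simp: h_def X_def subset_eq_diff_conv add.commute)
        (metis add.commute subset_mset.le_diff_conv2)
  next
    fix p assume p: "p \<in> Sigma {L. L \<subseteq># G} (\<lambda>L. {K. K \<subseteq># L})"
    obtain L K where LK: "p = (L, K)" by (cases p)
    with p have *: "L \<subseteq># G" "K \<subseteq># L" by auto
    then have "K \<subseteq># G" by (rule subset_mset.order_trans[rotated])
    with * have "(K, L - K) \<in> X" "h (K, L - K) = (L, K)"
      by (auto simp: X_def h_def subseteq_mset_def diff_le_mono)
    then show "p \<in> h ` X" using LK by (metis image_eqI)
  qed
  have "conv M N (conv M1 N a b) c G x =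
      (\<Oplus>\<^bsub>N\<^esub>L\<in>{L. L \<subseteq># G}. \<Oplus>\<^bsub>N\<^esub>K\<in>{K. K \<subseteq># L}. a K (b (L - K) (c (G - L) x)))"
    using x cc by simp
  also have "\<dots> = finsum N (\<lambda>(L, K). a K (b (L - K) (c (G - L) x))) (h ` X)"
    unfolding hX using ac bc cc by (intro N.finsum_Sigma) auto
  also have "\<dots> = (\<Oplus>\<^bsub>N\<^esub>p\<in>X. case h p of (L, K) \<Rightarrow> a K (b (L - K) (c (G - L) x)))"
    using ac bc cc inj by (intro N.finsum_reindex) auto
  also have "\<dots> = finsum N (\<lambda>(K, J). a K (b J (c (G - K - J) x))) X"
    using ac bc cc by (intro N.finsum_cong') (auto simp: h_def)
  also have "\<dots> = (\<Oplus>\<^bsub>N\<^esub>K\<in>{K. K \<subseteq># G}. \<Oplus>\<^bsub>N\<^esub>J\<in>{J. J \<subseteq># G - K}. a K (b J (c (G - K - J) x)))"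
    unfolding X_def using ac bc cc by (intro N.finsum_Sigma[symmetric]) auto
  also have "\<dots> = (\<Oplus>\<^bsub>N\<^esub>K\<in>{K. K \<subseteq># G}. a K (conv M N1 b c (G - K) x))"
  proof (rule N.finsum_cong')
    fix K assume "K \<in> {K. K \<subseteq># G}"
    have "a K (finsum N1 (\<lambda>J. b J (c (G - K - J) x)) {J. J \<subseteq># G - K}) =
        (\<Oplus>\<^bsub>N\<^esub>J\<in>{J. J \<subseteq># G - K}. a K (b J (c (G - K - J) x)))"
      using bc cc by (intro additive_map_finsum[OF N1 N a]) auto
    then show "(\<Oplus>\<^bsub>N\<^esub>J\<in>{J. J \<subseteq># G - K}. a K (b J (c (G - K - J) x))) = a K (conv M N1 b c (G - K) x)"
      using x by simp
  qed (use ac bc cc x in \<open>auto intro!: ac N1.finsum_closed\<close>)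
  finally show ?thesis using x by simp
qed

lemma conv_cong:
  assumes "\<And>K y. K \<subseteq># G \<Longrightarrow> y \<in> carrier L \<Longrightarrow> a K y = a' K y" "\<And>K. K \<subseteq># G \<Longrightarrow> b K x = b' K x"
    "\<And>K. K \<subseteq># G \<Longrightarrow> b' K x \<in> carrier L" "\<And>K y. K \<subseteq># G \<Longrightarrow> y \<in> carrier L \<Longrightarrow> a' K y \<in> carrier N"
    "abelian_group N" "x \<in> carrier M"
  shows "conv M N a b G x = conv M N a' b' G x"
proof -
  interpret N: abelian_group N by fact
  show ?thesis
    using assms by (simp add: conv_apply) (intro N.finsum_cong', auto)
qed

lemma conv_top:
  assumes N: "abelian_group N" and "x \<in> carrier M" "\<And>K. K \<subseteq># G \<Longrightarrow> a K (b (G - K) x) \<in> carrier N"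
  shows "conv M N a b G x = a G (b {#} x) \<oplus>\<^bsub>N\<^esub> (\<Oplus>\<^bsub>N\<^esub>K\<in>{K. K \<subset># G}. a K (b (G - K) x))"
proof -
  interpret N: abelian_group N by fact
  have "{K. K \<subseteq># G} = insert G {K. K \<subset># G}" by (auto simp: subset_mset.le_less)
  moreover have "finite {K. K \<subset># G}"
    by (rule finite_subset[OF _ finite_submultisets[of G]]) (auto simp: subset_mset.less_imp_le)
  moreover have "a G (b {#} x) \<in> carrier N" using assms(3)[of G] by simp
  ultimately show ?thesis
    using assms by (simp add: conv_apply subset_mset.less_imp_le Pi_iff)
qed

lemma submultisets_reflect:
  assumes N: "abelian_group N" and "\<And>K. K \<subseteq># G \<Longrightarrow> g K \<in> carrier N"
  shows "(\<Oplus>\<^bsub>N\<^esub>K\<in>{K. K \<subseteq># G}. g (G - K)) = (\<Oplus>\<^bsub>N\<^esub>K\<in>{K. K \<subseteq># G}. g K)"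
proof -
  interpret N: abelian_group N by fact
  have inj: "inj_on (\<lambda>K. G - K) {K. K \<subseteq># G}"
    by (rule inj_on_inverseI[of _ "\<lambda>K. G - K"]) (simp add: diff_diff_submultiset)
  have im: "(\<lambda>K. G - K) ` {K. K \<subseteq># G} = {K. K \<subseteq># G}"
  proof (intro equalityI subsetI)
    fix K assume "K \<in> {K. K \<subseteq># G}"
    then have "K = G - (G - K)" "G - K \<subseteq># G"
      by (auto simp: diff_diff_submultiset)
    then show "K \<in> (\<lambda>K. G - K) ` {K. K \<subseteq># G}" by blast
  qed auto
  have "(\<Oplus>\<^bsub>N\<^esub>K\<in>(\<lambda>K. G - K) ` {K. K \<subseteq># G}. g K) = (\<Oplus>\<^bsub>N\<^esub>K\<in>{K. K \<subseteq># G}. g (G - K))"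
    using inj assms im by (intro N.finsum_reindex) auto
  then show ?thesis unfolding im by simp
qed

text \<open>As a power series: multiplication by the scalar \<Sum> t(G) \<chi>^G.\<close>

definition scalar_family :: "('a, 'm, 'c) dgm_scheme \<Rightarrow> ('i multiset \<Rightarrow> 'a) \<Rightarrow> 'i multiset \<Rightarrow> 'm \<Rightarrow> 'm" where
  "scalar_family M t G = (\<lambda>x\<in>carrier M. act M (t G) x)"

text \<open>\<open>conv\<close> treats \<open>K\<close> and \<open>G - K\<close> asymmetrically;
  reflecting the sum exchanges their roles, after which linearity applies termwise.\<close>

lemma conv_scalar_commute:
  assumes N: "abelian_group N" and M: "\<And>G x. x \<in> carrier M \<Longrightarrow> act M (t G) x \<in> carrier M"
    and a: "\<And>G x. x \<in> carrier M \<Longrightarrow> a G x \<in> carrier N"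
    and lin: "\<And>G H x. x \<in> carrier M \<Longrightarrow> a G (act M (t H) x) = act N (t H) (a G x)"
    and x: "x \<in> carrier M"
  shows "conv M N a (scalar_family M t) G x = conv M N (scalar_family N t) a G x"
proof -
  interpret N: abelian_group N by fact
  have "conv M N a (scalar_family M t) G x = (\<Oplus>\<^bsub>N\<^esub>K\<in>{K. K \<subseteq># G}. a K (act M (t (G - K)) x))"
    using x by (simp add: conv_apply scalar_family_def)
  also have "\<dots> = (\<Oplus>\<^bsub>N\<^esub>K\<in>{K. K \<subseteq># G}. a (G - K) (act M (t (G - (G - K))) x))"
    using a M x by (intro submultisets_reflect[OF N, symmetric]) auto
  also have "\<dots> = (\<Oplus>\<^bsub>N\<^esub>K\<in>{K. K \<subseteq># G}. act N (t K) (a (G - K) x))"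
  proof (rule N.finsum_cong')
    fix K assume "K \<in> {K. K \<subseteq># G}"
    then have "G - (G - K) = K" by (simp add: diff_diff_submultiset)
    then show "a (G - K) (act M (t (G - (G - K))) x) = act N (t K) (a (G - K) x)" using lin x by simp
  qed (use lin[symmetric] a M x in auto)
  finally show ?thesis using x a by (simp add: conv_apply scalar_family_def)
qed

section \<open>Graded \<open>Q\<close>-linear maps and the degree of a convolution\<close>

lemma degree_zero_ring_simps:
  "carrier (degree_zero_ring Q) = carrier Q" "grade (degree_zero_ring Q) i = (if i = 0 then carrier Q else {\<zero>\<^bsub>Q\<^esub>})"
  "zero (degree_zero_ring Q) = \<zero>\<^bsub>Q\<^esub>" "one (degree_zero_ring Q) = \<one>\<^bsub>Q\<^esub>" "mult (degree_zero_ring Q) = mult Q"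
  "add (degree_zero_ring Q) = add Q" "diff (degree_zero_ring Q) = (\<lambda>_. \<zero>\<^bsub>Q\<^esub>)"
  by (simp_all add: degree_zero_ring_def)

lemma hom_degree_linear:
  "\<phi> \<in> hom_degree (degree_zero_ring Q) M N i \<Longrightarrow> q \<in> carrier Q \<Longrightarrow> x \<in> carrier M \<Longrightarrow>
     \<phi> (act M q x) = act N q (\<phi> x)"
proof -
  assume *: "\<phi> \<in> hom_degree (degree_zero_ring Q) M N i" "q \<in> carrier Q" "x \<in> carrier M"
  have "q \<in> grade (degree_zero_ring Q) 0" using *(2) by (simp add: degree_zero_ring_simps)
  with * have "\<phi> (act M q x) = signed N (i * 0) (act N q (\<phi> x))"
    unfolding hom_degree_def by blast
  then show ?thesis by (simp add: signed_def)
qed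

lemma (in dg_module) zero_act: "x \<in> carrier M \<Longrightarrow> act M \<zero>\<^bsub>A\<^esub> x = \<zero>\<^bsub>M\<^esub>"
  using act_l_distr[of "\<zero>\<^bsub>A\<^esub>" "\<zero>\<^bsub>A\<^esub>" x] act_closed[of "\<zero>\<^bsub>A\<^esub>" x]
  by (intro M.add_idem_zero) auto

lemma hom_degree_linearI:
  assumes "dg_module (degree_zero_ring Q) M" "dg_module (degree_zero_ring Q) N" "\<phi> \<in> graded_map M N i"
    "\<And>q x. q \<in> carrier Q \<Longrightarrow> x \<in> carrier M \<Longrightarrow> \<phi> (act M q x) = act N q (\<phi> x)"
  shows "\<phi> \<in> hom_degree (degree_zero_ring Q) M N i"
proof -
  interpret hom_setting "degree_zero_ring Q" M N by (rule dg_module_setting[OF assms(1,2)])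
  interpret DM: dg_module "degree_zero_ring Q" M by fact
  interpret DN: dg_module "degree_zero_ring Q" N by fact
  show ?thesis
  proof (rule hom_degreeI[OF assms(3)])
    fix j a x assume a: "a \<in> grade (degree_zero_ring Q) j" and x: "x \<in> carrier M"
    have ac: "a \<in> carrier Q" using a DM.A.zero_closed by (auto simp: degree_zero_ring_simps split: if_splits)
    show "\<phi> (act M a x) = signed N (i * j) (act N a (\<phi> x))"
    proof (cases "j = 0")
      case True
      then show ?thesis using assms(4)[OF ac x] by (simp add: signed_def)
    next
      case False
      then have "a = \<zero>\<^bsub>degree_zero_ring Q\<^esub>" using a by (simp add: degree_zero_ring_simps)
      then have "act N a (\<phi> x) = \<zero>\<^bsub>N\<^esub>" using DN.zero_act graded_map_closed[OF assms(3) x] by simp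
      then show ?thesis using assms(4)[OF ac x] by simp
    qed
  qed
qed

text \<open>The monomial \<chi>^G has homological degree -2|G|, so a series is homogeneous of degree
  d when its coefficient at \<chi>^G has degree d + 2|G|. Degrees of series add under
  composition.\<close>

lemma conv_hom_degree:
  fixes Q :: "('q, 'b) ring_scheme"
  assumes M: "dg_module (degree_zero_ring Q) M" and N1: "dg_module (degree_zero_ring Q) N1"
    and N: "dg_module (degree_zero_ring Q) N"
    and a: "\<And>G. a G \<in> hom_degree (degree_zero_ring Q) N1 N (d + 2 * int (size G))"
    and b: "\<And>G. b G \<in> hom_degree (degree_zero_ring Q) M N1 (e + 2 * int (size G))"
  shows "conv M N a b G \<in> hom_degree (degree_zero_ring Q) M N (d + e + 2 * int (size G))"
proof -
  interpret DM: dg_module "degree_zero_ring Q" M by fact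
  interpret DN: dg_module "degree_zero_ring Q" N by fact
  interpret DN1: dg_module "degree_zero_ring Q" N1 by fact
  note ga = hom_degree_graded_map[OF a] and gb = hom_degree_graded_map[OF b]
  have bc: "b K x \<in> carrier N1" if "x \<in> carrier M" for K x using graded_map_closed[OF gb that] .
  have c: "a K (b L x) \<in> carrier N" if "x \<in> carrier M" for K L x
    using graded_map_closed[OF ga bc[OF that]] .
  show ?thesis
  proof (rule hom_degree_linearI[OF M N])
    show "conv M N a b G \<in> graded_map M N (d + e + 2 * int (size G))"
    proof (rule graded_mapI)
      show "conv M N a b G \<in> extensional (carrier M)" by (simp add: conv_def)
      show "additive_map M N (conv M N a b G)"
        unfolding additive_map_def
      proof (intro conjI ballI)
        show "conv M N a b G \<in> carrier M \<rightarrow> carrier N"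
          using c by (auto simp: conv_apply intro!: DN.M.finsum_closed)
        fix x y assume xy: "x \<in> carrier M" "y \<in> carrier M"
        have "a K (b L (x \<oplus>\<^bsub>M\<^esub> y)) = a K (b L x) \<oplus>\<^bsub>N\<^esub> a K (b L y)" for K L
          using xy bc by (simp add: additive_map_add[OF graded_map_additive[OF ga]] additive_map_add[OF graded_map_additive[OF gb]])
        then show "conv M N a b G (x \<oplus>\<^bsub>M\<^esub> y) = conv M N a b G x \<oplus>\<^bsub>N\<^esub> conv M N a b G y"
          using xy c by (simp add: conv_apply DN.M.finsum_addf Pi_iff)
      qed
      fix x j assume x: "x \<in> grade M j"
      have "a K (b (G - K) x) \<in> grade N (d + e + 2 * int (size G) + j)" if "K \<subseteq># G" for K
      proof -
        have "size (G - K) = size G - size K" "size K \<le> size G"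
          using that by (simp_all add: size_Diff_submset size_mset_mono)
        then show ?thesis
          using graded_map_grade[OF ga graded_map_grade[OF gb x], of K "G - K"] by (simp add: algebra_simps of_nat_diff)
      qed
      then show "conv M N a b G x \<in> grade N (d + e + 2 * int (size G) + j)"
        using DM.M.grade_closed[OF x] by (auto simp: conv_apply intro!: DN.M.grade_finsum)
    qed
    fix q x assume q: "q \<in> carrier Q" and x: "x \<in> carrier M"
    have qa: "q \<in> carrier (degree_zero_ring Q)" using q by (simp add: degree_zero_ring_simps)
    have add: "additive_map N N (act N q)"
      using qa by (auto simp: additive_map_def DN.act_closed DN.act_r_distr)
    have "conv M N a b G (act M q x) = (\<Oplus>\<^bsub>N\<^esub>K\<in>{K. K \<subseteq># G}. act N q (a K (b (G - K) x)))"
      using x q bc[OF x] by (simp add: conv_apply DM.act_closed[OF qa] hom_degree_linear[OF b] hom_degree_linear[OF a])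
    also have "\<dots> = act N q (conv M N a b G x)"
      using x c by (simp add: conv_apply additive_map_finsum[OF DN.M.abelian_group_axioms DN.M.abelian_group_axioms add])
    finally show "conv M N a b G (act M q x) = act N q (conv M N a b G x)" .
  qed
qed

text \<open>The coefficients of \<open>\<sigma>\<close> are constructed by recursion on the multiset \<open>G\<close>.  If all smaller coefficients of
  \<open>o = t - (\<sigma>\<delta> + \<delta>\<sigma>)\<close> vanish, then \<open>o\<close> commuting with \<open>\<delta>\<close> (as \<open>\<delta>\<^sup>2\<close> is central) shows that its coefficient
  at \<open>G\<close> is a chain map into the acyclic module \<open>ker \<alpha>\<close>, hence null-homotopic.\<close>

theorem lift_homotopy:
  fixes Q :: "('q, 'b) ring_scheme" and M :: "('q, 'm, 'c) dgm_scheme" and N :: "('q, 'n, 'd) dgm_scheme"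
    and \<kappa> :: "'n \<Rightarrow> nat \<times> 'q \<times> 'm \<Rightarrow> 'q" and \<delta> :: "'i multiset \<Rightarrow> 'm \<Rightarrow> 'm"
  defines "A \<equiv> degree_zero_ring Q"
  assumes sp: "semiprojective A M" and N: "dg_module A N" and dN: "\<And>y. y \<in> carrier N \<Longrightarrow> diff N y = \<zero>\<^bsub>N\<^esub>"
    and \<alpha>: "dg_hom A M N \<alpha>" "quasi_iso M N \<alpha>" and \<kappa>: "inj_on \<kappa> (carrier N)" and uv: "(u :: 'q) \<noteq> v"
    and \<delta>: "\<And>G. \<delta> G \<in> hom_degree A M M (- 1 + 2 * int (size G))"
    and \<delta>0: "\<And>x. x \<in> carrier M \<Longrightarrow> \<delta> {#} x = diff M x"
    and \<alpha>\<delta>: "\<And>G x. x \<in> carrier M \<Longrightarrow> \<alpha> (\<delta> G x) = \<zero>\<^bsub>N\<^esub>"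
    and \<delta>\<delta>: "\<And>G x. x \<in> carrier M \<Longrightarrow> conv M M \<delta> \<delta> G x = scalar_family M s G x"
    and s: "\<And>G. s G \<in> carrier Q" and t: "\<And>G. t G \<in> carrier Q"
    and tdeg: "\<And>G. scalar_family M t G \<in> hom_degree A M M (- 2 + 2 * int (size G))"
    and \<nu>: "\<And>G. \<nu> G \<in> hom_degree A M N (- 1 + 2 * int (size G))"
    and \<nu>\<delta>: "\<And>G x. x \<in> carrier M \<Longrightarrow> conv M N \<nu> \<delta> G x = \<alpha> (scalar_family M t G x)"
  shows "\<exists>\<sigma>. \<forall>G. \<sigma> G \<in> hom_degree A M M (- 1 + 2 * int (size G)) \<and>
    (\<forall>x\<in>carrier M. conv M M \<sigma> \<delta> G x \<oplus>\<^bsub>M\<^esub> conv M M \<delta> \<sigma> G x = scalar_family M t G x)"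
proof -
  have M: "dg_module A M" using sp by (simp add: semiprojective_def)
  interpret DM: dg_module A M by fact
  interpret DN: dg_module A N by fact
  interpret MM: hom_setting A M M by (rule dg_module_setting[OF M M])
  let ?D = "\<lambda>G :: 'i multiset. - 1 + 2 * int (size G)"
  have \<alpha>add: "additive_map M N \<alpha>" by (rule dg_hom_additive[OF \<alpha>(1)])
  note \<alpha>c = additive_map_closed[OF \<alpha>add]
  have \<alpha>d: "\<alpha> (diff M x) = diff N (\<alpha> x)" if "x \<in> carrier M" for x
    using \<alpha>(1) that by (auto simp: dg_hom_def)
  have ab: "abelian_group M" "abelian_group N" by (rule DM.M.abelian_group_axioms DN.M.abelian_group_axioms)+
  have surj: "\<alpha> ` carrier M = carrier N"
    by (rule quasi_iso_kernel(1)[OF M ab(2) \<alpha>add dN \<alpha>d \<alpha>(2)])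
  have enc: "inj_on (\<lambda>x (n :: nat, b :: 'q, y). if y = x then u else v) S" for S :: "'m set"
    using uv by (auto simp: inj_on_def fun_eq_iff split: if_splits)
  let ?K = "kernel_dgm M N \<alpha>"
  note ks = kernel_dgm_simps
  have \<alpha>g: "\<alpha> x \<in> grade N i" if "x \<in> grade M i" for x i
    using \<alpha>(1) that unfolding dg_hom_def by blast
  have comp: "\<alpha> (component M x i) = \<zero>\<^bsub>N\<^esub>" if x: "x \<in> carrier M" "\<alpha> x = \<zero>\<^bsub>N\<^esub>" for x i
  proof -
    let ?I = "insert i {i. component M x i \<noteq> \<zero>\<^bsub>M\<^esub>}"
    have fin: "finite ?I" using DM.M.finite_component[OF x(1)] by simp
    have g: "component M x i \<in> grade M i" for i using DM.M.component_in_grade[OF x(1)] .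
    have "finsum N (\<lambda>i. \<alpha> (component M x i)) ?I = \<alpha> (finsum M (component M x) ?I)"
      by (rule additive_map_finsum[symmetric, OF ab \<alpha>add]) (auto intro: DM.M.grade_closed g)
    also have "\<dots> = \<zero>\<^bsub>N\<^esub>"
      using DM.M.finsum_component_superset[OF x(1) fin subset_insertI] x(2) by simp
    finally show ?thesis
      using fin g by (intro DN.M.finsum_zero_components[of ?I "\<lambda>i. \<alpha> (component M x i)" i]) (auto intro: \<alpha>g)
  qed
  have actN0: "act N a \<zero>\<^bsub>N\<^esub> = \<zero>\<^bsub>N\<^esub>" if "a \<in> carrier A" for a
    using additive_map_zero[OF ab(2) ab(2), of "act N a"] that DN.act_closed DN.act_r_distr
    by (auto simp: additive_map_def)
  have \<alpha>act: "\<alpha> (act M a x) = act N a (\<alpha> x)" if "a \<in> carrier A" "x \<in> carrier M" for a x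
    using \<alpha>(1) that by (auto simp: dg_hom_def)
  have K: "dg_module A ?K"
    by (rule kernel_dg_module(1)[OF M ab(2) \<alpha>add _ _ comp]) (simp_all add: \<alpha>act actN0 \<alpha>d dN)
  have Ksig: "signed ?K i x = signed M i x" if "x \<in> carrier ?K" for i x
    by (rule kernel_dg_module(2)[OF M ab(2) \<alpha>add _ _ comp]) (simp_all add: \<alpha>act actN0 \<alpha>d dN that)
  have Kmin: "x \<ominus>\<^bsub>?K\<^esub> y = x \<ominus>\<^bsub>M\<^esub> y" if "x \<in> carrier ?K" "y \<in> carrier ?K" for x y
    by (rule kernel_dg_module(3)[OF M ab(2) \<alpha>add _ _ comp]) (simp_all add: \<alpha>act actN0 \<alpha>d dN that)
  interpret DK: dg_module A ?K by (rule K)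
  interpret MK: hom_setting A M ?K by (rule dg_module_setting[OF M K])
  have Kac: "\<exists>w\<in>carrier ?K. diff ?K w = z" if "z \<in> carrier ?K" "diff ?K z = \<zero>\<^bsub>?K\<^esub>" for z
    using quasi_iso_kernel(2)[OF M ab(2) \<alpha>add dN \<alpha>d \<alpha>(2), of z] that by (auto simp: ks)

  note \<delta>g = hom_degree_graded_map[OF \<delta>]
  note \<delta>c = graded_map_closed[OF \<delta>g] and \<delta>add = graded_map_additive[OF \<delta>g]
  have scal: "act M (r G) x \<in> carrier M" if "\<And>G. r G \<in> carrier Q" "x \<in> carrier M" for r :: "'i multiset \<Rightarrow> 'q" and G x
    using DM.act_closed that by (simp add: A_def degree_zero_ring_simps)
  have scal': "scalar_family M r G x \<in> carrier M" if "\<And>G. r G \<in> carrier Q" "x \<in> carrier M" for r :: "'i multiset \<Rightarrow> 'q" and G x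
    using scal[OF that] that by (simp add: scalar_family_def)
  have commute: "conv M M a (scalar_family M r) G x = conv M M (scalar_family M r) a G x"
    if "\<And>G. a G \<in> hom_degree A M M (?D G)" "\<And>G. r G \<in> carrier Q" "x \<in> carrier M"
    for a :: "'i multiset \<Rightarrow> 'm \<Rightarrow> 'm" and r G x
    using that hom_degree_linear[OF that(1)[unfolded A_def]] graded_map_closed[OF hom_degree_graded_map[OF that(1)]] scal
    by (intro conv_scalar_commute ab) auto
  have conv_closed: "conv M M a b G x \<in> carrier M"
    if "\<And>G x. x \<in> carrier M \<Longrightarrow> a G x \<in> carrier M" "\<And>G x. x \<in> carrier M \<Longrightarrow> b G x \<in> carrier M" "x \<in> carrier M"
    for a b G x
    using that by (auto simp: conv_apply intro!: DM.M.finsum_closed)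

  \<comment> \<open>A family as seen at stage \<open>G\<close>: the candidate \<open>r\<close> at
    \<open>G\<close>, the values already constructed at smaller sizes, and zero elsewhere. Only
    submultisets of \<open>G\<close> enter the equation at \<open>G\<close>, so the zeros do no
    harm.\<close>
  define cut where "cut = (\<lambda>(\<phi> :: 'i multiset \<Rightarrow> 'm \<Rightarrow> 'm) G r H. if H = G then r
      else if size H < size G then \<phi> H else (\<lambda>x\<in>carrier M. \<zero>\<^bsub>M\<^esub>))"
  let ?P = "\<lambda>\<phi> G r. r \<in> hom_degree A M M (?D G) \<and> (\<forall>x\<in>carrier M. \<alpha> (r x) = \<nu> G x) \<and>
      (\<forall>x\<in>carrier M. conv M M (cut \<phi> G r) \<delta> G x \<oplus>\<^bsub>M\<^esub> conv M M \<delta> (cut \<phi> G r) G x = scalar_family M t G x)"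
  have step: "\<exists>r. ?P \<phi> G r" if IH: "\<And>H. size H < size G \<Longrightarrow> ?P \<phi> H (\<phi> H)"
    for G and \<phi> :: "'i multiset \<Rightarrow> 'm \<Rightarrow> 'm"
  proof -
    \<comment> \<open>A provisional coefficient, which only satisfies the condition over \<alpha>;
      the homotopy equation is repaired afterwards within the kernel of \<alpha>.\<close>
    obtain r0 where r0: "r0 \<in> hom_degree A M M (?D G)" "\<And>x. x \<in> carrier M \<Longrightarrow> \<alpha> (r0 x) = \<nu> G x"
      using semiprojective_lift[OF sp M N \<alpha>(1) surj \<alpha>(2) enc \<kappa> \<nu>] by blast
    define \<psi> where "\<psi> = cut \<phi> G r0"
    have \<psi>: "\<psi> H \<in> hom_degree A M M (?D H)" for H
      using r0 IH MM.zero_hom_degree by (simp add: \<psi>_def cut_def)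
    note \<psi>g = hom_degree_graded_map[OF \<psi>]
    note \<psi>c = graded_map_closed[OF \<psi>g] and \<psi>add = graded_map_additive[OF \<psi>g]
    define w1 where "w1 = conv M M \<psi> \<delta>"
    define w2 where "w2 = conv M M \<delta> \<psi>"
    have w1: "w1 H \<in> hom_degree A M M (- 2 + 2 * int (size H))" for H
      using conv_hom_degree[OF M[unfolded A_def] M[unfolded A_def] M[unfolded A_def] \<psi>[unfolded A_def] \<delta>[unfolded A_def], of H]
      by (simp add: w1_def A_def)
    have w2: "w2 H \<in> hom_degree A M M (- 2 + 2 * int (size H))" for H
      using conv_hom_degree[OF M[unfolded A_def] M[unfolded A_def] M[unfolded A_def] \<delta>[unfolded A_def] \<psi>[unfolded A_def], of H]
      by (simp add: w2_def A_def)
    note wc = graded_map_closed[OF hom_degree_graded_map[OF w1]] graded_map_closed[OF hom_degree_graded_map[OF w2]]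
    define ob where "ob = (\<lambda>H. \<lambda>x\<in>carrier M. scalar_family M t H x \<oplus>\<^bsub>M\<^esub>
      (\<lambda>x\<in>carrier M. \<ominus>\<^bsub>M\<^esub> (\<lambda>x\<in>carrier M. w1 H x \<oplus>\<^bsub>M\<^esub> w2 H x) x) x)"
    have ob: "ob H \<in> hom_degree A M M (- 2 + 2 * int (size H))" for H
      unfolding ob_def by (intro MM.add_hom_degree MM.neg_hom_degree tdeg w1 w2)
    note obg = hom_degree_graded_map[OF ob]
    note obc = graded_map_closed[OF obg]
    have ob_eq: "ob H x = scalar_family M t H x \<ominus>\<^bsub>M\<^esub> (w1 H x \<oplus>\<^bsub>M\<^esub> w2 H x)" if "x \<in> carrier M" for H x
      using that by (simp add: ob_def a_minus_def)
    have ob0: "ob H x = \<zero>\<^bsub>M\<^esub>" if "size H < size G" "x \<in> carrier M" for H x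
    proof -
      have *: "cut \<phi> H (\<phi> H) K = \<psi> K" if "K \<subseteq># H" for K
        using that mset_subset_size[of K H] \<open>size H < size G\<close>
        by (auto simp: \<psi>_def cut_def subset_mset.le_less)
      have "conv M M (cut \<phi> H (\<phi> H)) \<delta> H x = w1 H x" "conv M M \<delta> (cut \<phi> H (\<phi> H)) H x = w2 H x"
        using that(2) \<delta>c \<psi>c ab unfolding w1_def w2_def
        by (auto intro!: conv_cong[where L = M] simp: *)
      moreover have "conv M M (cut \<phi> H (\<phi> H)) \<delta> H x \<oplus>\<^bsub>M\<^esub> conv M M \<delta> (cut \<phi> H (\<phi> H)) H x = scalar_family M t H x"
        using IH[OF that(1)] that(2) by blast
      ultimately have "w1 H x \<oplus>\<^bsub>M\<^esub> w2 H x = scalar_family M t H x" by simp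
      then show ?thesis using scal'[of t, OF t that(2)] that(2)
        by (simp add: ob_eq DM.M.minus_eq_zero_iff)
    qed
    \<comment> \<open>By associativity, (\<psi>\<delta>)\<delta> = \<psi>(\<delta>\<delta>) =
      (\<delta>\<delta>)\<psi> = \<delta>(\<delta>\<psi>), the middle equality because
      \<delta>\<delta> is a scalar series; the two mixed terms agree by associativity alone.\<close>
    have comm_w: "conv M M w1 \<delta> H x \<oplus>\<^bsub>M\<^esub> conv M M w2 \<delta> H x = conv M M \<delta> w1 H x \<oplus>\<^bsub>M\<^esub> conv M M \<delta> w2 H x"
      if x: "x \<in> carrier M" for H x
    proof -
      have "conv M M w1 \<delta> H x = conv M M \<psi> (conv M M \<delta> \<delta>) H x"
        unfolding w1_def using \<psi>add \<delta>c x by (intro conv_assoc ab) auto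
      also have "\<dots> = conv M M \<psi> (scalar_family M s) H x"
        using \<delta>\<delta> x \<psi>c scal' s ab by (intro conv_cong[where L = M]) auto
      also have "\<dots> = conv M M (scalar_family M s) \<psi> H x" by (rule commute[OF \<psi> s x])
      also have "\<dots> = conv M M (conv M M \<delta> \<delta>) \<psi> H x"
        using \<delta>\<delta> x \<psi>c scal' s ab by (intro conv_cong[where L = M, symmetric]) (auto intro: conv_closed \<delta>c)
      also have "\<dots> = conv M M \<delta> w2 H x"
        unfolding w2_def using \<psi>c \<delta>add \<delta>c x by (intro conv_assoc ab) auto
      finally have 1: "conv M M w1 \<delta> H x = conv M M \<delta> w2 H x" .
      have 2: "conv M M w2 \<delta> H x = conv M M \<delta> w1 H x"
        unfolding w1_def w2_def using \<psi>c \<delta>add \<delta>c x by (intro conv_assoc ab) auto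
      show ?thesis
        unfolding 1 2 using x wc \<delta>c by (intro DM.M.a_comm conv_closed) auto
    qed
    have left: "conv M M ob \<delta> G x = conv M M (scalar_family M t) \<delta> G x \<ominus>\<^bsub>M\<^esub> (conv M M w1 \<delta> G x \<oplus>\<^bsub>M\<^esub> conv M M w2 \<delta> G x)"
      if x: "x \<in> carrier M" for x
      using x \<delta>c wc scal'[of t, OF t] finite_submultisets
      by (simp add: conv_apply ob_eq DM.M.finsum_minus DM.M.finsum_addf Pi_iff)
    have right: "conv M M \<delta> ob G x = conv M M \<delta> (scalar_family M t) G x \<ominus>\<^bsub>M\<^esub> (conv M M \<delta> w1 G x \<oplus>\<^bsub>M\<^esub> conv M M \<delta> w2 G x)"
      if x: "x \<in> carrier M" for x
      using x \<delta>c wc scal'[of t, OF t] finite_submultisets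
      by (simp add: conv_apply ob_eq DM.M.finsum_minus DM.M.finsum_addf Pi_iff
          additive_map_minus[OF ab(1) ab(1) \<delta>add] additive_map_add[OF \<delta>add])
    \<comment> \<open>In the coefficients at \<open>G\<close> of \<open>ob\<close> after \<delta>
      and of \<delta> after \<open>ob\<close>, every term except the one with \<delta> at the empty
      multiset contains \<open>ob\<close> at a smaller multiset and vanishes.\<close>
    have ob_chain: "ob G (diff M x) = diff M (ob G x)" if x: "x \<in> carrier M" for x
    proof -
      have sz: "size K < size G" if "K \<subset># G" for K using that by (rule mset_subset_size)
      have "conv M M ob \<delta> G x = ob G (\<delta> {#} x) \<oplus>\<^bsub>M\<^esub> (\<Oplus>\<^bsub>M\<^esub>K\<in>{K. K \<subset># G}. ob K (\<delta> (G - K) x))"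
        using x obc \<delta>c by (intro conv_top ab) auto
      also have "(\<Oplus>\<^bsub>M\<^esub>K\<in>{K. K \<subset># G}. ob K (\<delta> (G - K) x)) = \<zero>\<^bsub>M\<^esub>"
        using x ob0 sz \<delta>c by (intro DM.M.finsum_all_zero) auto
      finally have l: "conv M M ob \<delta> G x = ob G (diff M x)"
        using x obc DM.M.diff_closed by (simp add: \<delta>0)
      have "conv M M \<delta> ob G x = (\<Oplus>\<^bsub>M\<^esub>K\<in>{K. K \<subseteq># G}. \<delta> K (ob (G - K) x))" using x by (simp add: conv_apply)
      also have "\<dots> = \<delta> {#} (ob (G - {#}) x)"
      proof (rule DM.M.finsum_single)
        fix K assume "K \<in> {K. K \<subseteq># G} - {{#}}"
        then have "size (G - K) < size G" by (auto simp: size_Diff_submset) 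
          (metis Suc_leI diff_less nonempty_has_size order_less_le_trans size_mset_mono subset_mset.order_refl zero_less_Suc)
        then show "\<delta> K (ob (G - K) x) = \<zero>\<^bsub>M\<^esub>"
          using ob0 x additive_map_zero[OF ab(1) ab(1) \<delta>add] by simp
      qed (use finite_submultisets x obc \<delta>c in auto)
      finally have r: "conv M M \<delta> ob G x = diff M (ob G x)" using x obc by (simp add: \<delta>0)
      have "conv M M ob \<delta> G x = conv M M \<delta> ob G x"
        unfolding left[OF x] right[OF x] comm_w[OF x] commute[OF \<delta> t x] ..
      with l r show ?thesis by simp
    qed
    \<comment> \<open>\<alpha> kills \<delta>\<psi>, and it turns \<psi>\<delta> into \<nu>\<delta>,
      which is \<alpha> after \<open>t\<close> by assumption; so both parts of the obstruction
      cancel.\<close>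
    have ob\<alpha>: "\<alpha> (ob G x) = \<zero>\<^bsub>N\<^esub>" if x: "x \<in> carrier M" for x
    proof -
      have z: "\<alpha> (w2 G x) = \<zero>\<^bsub>N\<^esub>"
      proof -
        have "\<alpha> (w2 G x) = (\<Oplus>\<^bsub>N\<^esub>K\<in>{K. K \<subseteq># G}. \<alpha> (\<delta> K (\<psi> (G - K) x)))"
          unfolding w2_def using x \<delta>c \<psi>c by (simp add: conv_apply additive_map_finsum[OF ab \<alpha>add])
        then show ?thesis using x \<alpha>\<delta> \<psi>c by (simp add: DN.M.finsum_zero)
      qed
      have "\<alpha> (w1 G x) = (\<Oplus>\<^bsub>N\<^esub>K\<in>{K. K \<subseteq># G}. \<alpha> (\<psi> K (\<delta> (G - K) x)))"
        unfolding w1_def using x \<delta>c \<psi>c by (simp add: conv_apply additive_map_finsum[OF ab \<alpha>add])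
      also have "\<dots> = (\<Oplus>\<^bsub>N\<^esub>K\<in>{K. K \<subseteq># G}. \<nu> K (\<delta> (G - K) x))"
      proof (rule DN.M.finsum_cong')
        fix K assume "K \<in> {K. K \<subseteq># G}"
        then have "K = G \<or> size K < size G" using mset_subset_size by (auto simp: subset_mset.le_less)
        then show "\<alpha> (\<psi> K (\<delta> (G - K) x)) = \<nu> K (\<delta> (G - K) x)"
          using r0 IH \<delta>c[OF x] by (auto simp: \<psi>_def cut_def)
      qed (use x \<delta>c graded_map_closed[OF hom_degree_graded_map[OF \<nu>]] in auto)
      also have "\<dots> = \<alpha> (scalar_family M t G x)" using \<nu>\<delta>[OF x] x by (simp add: conv_apply)
      finally have "\<alpha> (ob G x) = \<alpha> (scalar_family M t G x) \<ominus>\<^bsub>N\<^esub> (\<alpha> (scalar_family M t G x) \<oplus>\<^bsub>N\<^esub> \<zero>\<^bsub>N\<^esub>)"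
        using x wc scal'[of t, OF t] z
        by (simp add: ob_eq additive_map_minus[OF ab \<alpha>add] additive_map_add[OF \<alpha>add])
      then show ?thesis
        using \<alpha>c[OF scal'[of t, OF t x]] DN.M.abelian_group_axioms
        by (simp add: abelian_group.minus_eq_zero_iff)
    qed
    have obK: "ob G \<in> hom_degree A M ?K (- 2 + 2 * int (size G))"
      unfolding A_def
    proof (rule hom_degree_linearI[OF M[unfolded A_def] K[unfolded A_def]])
      show "ob G \<in> graded_map M ?K (- 2 + 2 * int (size G))"
        using ob\<alpha> obc additive_map_add[OF graded_map_additive[OF obg]] graded_map_ext[OF obg] graded_map_grade[OF obg]
        by (intro graded_mapI) (auto simp: additive_map_def kernel_dgm_simps dest: DM.M.grade_closed)
      show "ob G (act M q x) = act ?K q (ob G x)" if "q \<in> carrier Q" "x \<in> carrier M" for q x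
        using hom_degree_linear[OF ob[unfolded A_def] that] by (simp add: ks)
    qed
    have "hom_diff M ?K (ob G) x = \<zero>\<^bsub>?K\<^esub>" if x: "x \<in> carrier M" for x
    proof -
      have "hom_diff M ?K (ob G) x = diff M (ob G x) \<ominus>\<^bsub>?K\<^esub> diff M (ob G x)"
        using MK.hom_diff_eq[OF hom_degree_graded_map[OF obK] x] ob_chain[OF x]
        by (simp add: ks(5) signed_def)
      moreover have "diff M (ob G x) \<in> carrier ?K"
        using obc[OF x] ob\<alpha>[OF x] by (simp add: ks DM.M.diff_closed \<alpha>d dN)
      ultimately show ?thesis by (simp add: DK.M.minus_eq_zero_iff)
    qed
    then obtain r1 where r1: "r1 \<in> hom_degree A M ?K (- 2 + 2 * int (size G) + 1)" "hom_diff M ?K r1 = ob G"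
      using semiprojective_cycle_boundary[OF sp K enc Kac obK] by blast
    note r1g = hom_degree_graded_map[OF r1(1)]
    note r1K = graded_map_closed[OF r1g]
    have r1c: "r1 x \<in> carrier M" "\<alpha> (r1 x) = \<zero>\<^bsub>N\<^esub>" if "x \<in> carrier M" for x using r1K[OF that] by (auto simp: ks)
    have r1M: "r1 \<in> hom_degree A M M (?D G)"
      unfolding A_def
    proof (rule hom_degree_linearI[OF M[unfolded A_def] M[unfolded A_def]])
      show "r1 \<in> graded_map M M (?D G)"
        using r1c(1) additive_map_add[OF graded_map_additive[OF r1g]] graded_map_ext[OF r1g] graded_map_grade[OF r1g]
        by (intro graded_mapI) (auto simp: additive_map_def kernel_dgm_simps algebra_simps)
      show "r1 (act M q x) = act M q (r1 x)" if "q \<in> carrier Q" "x \<in> carrier M" for q x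
        using hom_degree_linear[OF r1(1)[unfolded A_def] that] by (simp add: ks)
    qed
    have r1eq: "diff M (r1 x) \<oplus>\<^bsub>M\<^esub> r1 (diff M x) = ob G x" if x: "x \<in> carrier M" for x
    proof -
      have dK: "diff M (r1 x) \<in> carrier ?K" using DK.M.diff_closed[OF r1K[OF x]] by (simp add: ks)
      note rK = r1K[OF DM.M.diff_closed[OF x]]
      have "ob G x = diff M (r1 x) \<ominus>\<^bsub>?K\<^esub> signed ?K (- 2 + 2 * int (size G) + 1) (r1 (diff M x))"
        using MK.hom_diff_eq[OF r1g x] r1(2) by (simp add: ks(5))
      also have "\<dots> = diff M (r1 x) \<ominus>\<^bsub>M\<^esub> signed M (- 2 + 2 * int (size G) + 1) (r1 (diff M x))"
        using Kmin[OF dK] DK.M.signed_closed[OF rK] Ksig[OF rK] by metis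
      also have "\<dots> = diff M (r1 x) \<oplus>\<^bsub>M\<^esub> r1 (diff M x)"
        using r1c(1)[OF DM.M.diff_closed[OF x]] by (simp add: signed_def a_minus_def)
      finally show ?thesis by simp
    qed
    \<comment> \<open>Values of \<open>r1\<close> lie in the kernel of \<alpha>, so the condition
      over \<alpha> is preserved. At \<open>G\<close> the correction meets only \<delta> at the
      empty multiset, that is \<partial>, and so contributes r1 \<partial> + \<partial> r1, which is
      the obstruction.\<close>
    define r where "r = (\<lambda>x\<in>carrier M. r0 x \<oplus>\<^bsub>M\<^esub> r1 x)"
    have r: "r \<in> hom_degree A M M (?D G)" unfolding r_def by (rule MM.add_hom_degree[OF r0(1) r1M])
    note r0c = graded_map_closed[OF hom_degree_graded_map[OF r0(1)]]
    have \<psi>G: "\<psi> G = r0" by (simp add: \<psi>_def cut_def)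
    have low: "(cut \<phi> G r) K = \<psi> K" if "K \<subset># G" for K
      using mset_subset_size[OF that] that by (auto simp: \<psi>_def cut_def)
    have rG: "cut \<phi> G r G = r" by (simp add: cut_def)
    have \<alpha>r: "\<alpha> (r x) = \<nu> G x" if "x \<in> carrier M" for x
      using that r0(2) r1c r0c graded_map_closed[OF hom_degree_graded_map[OF \<nu>] that]
      by (simp add: r_def additive_map_add[OF \<alpha>add])
    have rc: "r x \<in> carrier M" if "x \<in> carrier M" for x using that r0c r1c by (simp add: r_def)
    have lowc: "(cut \<phi> G r) K x \<in> carrier M" if "K \<subseteq># G" "x \<in> carrier M" for K x
      using that low[of K] \<psi>c[OF that(2)] rc[OF that(2)] by (cases "K = G") (auto simp: subset_mset.le_less rG)
    have "conv M M (cut \<phi> G r) \<delta> G x = w1 G x \<oplus>\<^bsub>M\<^esub> r1 (diff M x)" if x: "x \<in> carrier M" for x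
    proof -
      let ?S = "\<Oplus>\<^bsub>M\<^esub>K\<in>{K. K \<subset># G}. \<psi> K (\<delta> (G - K) x)"
      have Sc: "?S \<in> carrier M" using \<psi>c \<delta>c x by (intro DM.M.finsum_closed) auto
      have "conv M M (cut \<phi> G r) \<delta> G x = r (\<delta> {#} x) \<oplus>\<^bsub>M\<^esub> (\<Oplus>\<^bsub>M\<^esub>K\<in>{K. K \<subset># G}. (cut \<phi> G r) K (\<delta> (G - K) x))"
        using x lowc \<delta>c by (subst conv_top[OF ab(1)]) (auto simp: rG)
      also have "(\<Oplus>\<^bsub>M\<^esub>K\<in>{K. K \<subset># G}. (cut \<phi> G r) K (\<delta> (G - K) x)) = ?S"
        using \<psi>c \<delta>c x low by (intro DM.M.finsum_cong') auto
      also have "r (\<delta> {#} x) = r0 (diff M x) \<oplus>\<^bsub>M\<^esub> r1 (diff M x)"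
        using x DM.M.diff_closed by (simp add: \<delta>0 r_def)
      also have "w1 G x = r0 (diff M x) \<oplus>\<^bsub>M\<^esub> ?S"
        unfolding w1_def using x \<psi>c \<delta>c \<psi>G by (subst conv_top[OF ab(1)]) (auto simp: \<delta>0)
      ultimately show ?thesis
        using x Sc r0c r1c DM.M.diff_closed by (simp add: DM.M.a_ac)
    qed
    moreover have "conv M M \<delta> (cut \<phi> G r) G x = w2 G x \<oplus>\<^bsub>M\<^esub> diff M (r1 x)" if x: "x \<in> carrier M" for x
    proof -
      have fin: "finite ({K. K \<subseteq># G} - {{#}})" using finite_submultisets by simp
      have ins: "{K. K \<subseteq># G} = insert {#} ({K. K \<subseteq># G} - {{#}})" by auto
      let ?S = "\<Oplus>\<^bsub>M\<^esub>K\<in>{K. K \<subseteq># G} - {{#}}. \<delta> K (\<psi> (G - K) x)"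
      have Sc: "?S \<in> carrier M" using \<psi>c \<delta>c x by (intro DM.M.finsum_closed) auto
      have lt: "G - K \<subset># G" if "K \<in> {K. K \<subseteq># G} - {{#}}" for K
        using that by (auto simp: subset_mset.less_le) (metis diff_diff_submultiset diff_empty cancel_comm_monoid_add_class.diff_cancel)
      have top: "conv M M \<delta> \<eta> G x = \<delta> {#} (\<eta> G x) \<oplus>\<^bsub>M\<^esub> (\<Oplus>\<^bsub>M\<^esub>K\<in>{K. K \<subseteq># G} - {{#}}. \<delta> K (\<eta> (G - K) x))"
        if "\<And>K. K \<subseteq># G \<Longrightarrow> \<eta> K x \<in> carrier M" for \<eta>
        using that x fin \<delta>c by (simp add: conv_apply) (subst ins, subst DM.M.finsum_insert, auto)
      have "conv M M \<delta> (cut \<phi> G r) G x = \<delta> {#} (r x) \<oplus>\<^bsub>M\<^esub>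
          (\<Oplus>\<^bsub>M\<^esub>K\<in>{K. K \<subseteq># G} - {{#}}. \<delta> K ((cut \<phi> G r) (G - K) x))"
        using x lowc by (subst top) (auto simp: rG)
      moreover have "(\<Oplus>\<^bsub>M\<^esub>K\<in>{K. K \<subseteq># G} - {{#}}. \<delta> K ((cut \<phi> G r) (G - K) x)) = ?S"
      proof (rule DM.M.finsum_cong')
        fix K assume "K \<in> {K. K \<subseteq># G} - {{#}}"
        from low[OF lt[OF this]] show "\<delta> K ((cut \<phi> G r) (G - K) x) = \<delta> K (\<psi> (G - K) x)" by simp
      qed (use \<psi>c \<delta>c x in auto)
      moreover have "\<delta> {#} (r x) = diff M (r0 x) \<oplus>\<^bsub>M\<^esub> diff M (r1 x)"
        using x r0c r1c by (simp add: \<delta>0 r_def DM.M.diff_add)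
      moreover have "w2 G x = diff M (r0 x) \<oplus>\<^bsub>M\<^esub> ?S"
        unfolding w2_def using x \<psi>c \<psi>G r0c by (subst top) (auto simp: \<delta>0)
      ultimately show ?thesis
        using x Sc r0c r1c DM.M.diff_closed by (simp add: DM.M.a_ac)
    qed
    moreover have "(w1 G x \<oplus>\<^bsub>M\<^esub> r1 (diff M x)) \<oplus>\<^bsub>M\<^esub> (w2 G x \<oplus>\<^bsub>M\<^esub> diff M (r1 x)) = scalar_family M t G x"
      if x: "x \<in> carrier M" for x
    proof -
      note c = wc[OF x] r1c(1)[OF DM.M.diff_closed[OF x]] DM.M.diff_closed[OF r1c(1)[OF x]] scal'[of t, OF t x, of G]
      have "(w1 G x \<oplus>\<^bsub>M\<^esub> r1 (diff M x)) \<oplus>\<^bsub>M\<^esub> (w2 G x \<oplus>\<^bsub>M\<^esub> diff M (r1 x)) = ob G x \<oplus>\<^bsub>M\<^esub> (w1 G x \<oplus>\<^bsub>M\<^esub> w2 G x)"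
        unfolding r1eq[OF x, symmetric] using c by (simp add: DM.M.a_ac)
      also have "\<dots> = scalar_family M t G x"
        unfolding ob_eq[OF x] using c by (simp add: a_minus_def DM.M.a_assoc DM.M.l_neg)
      finally show ?thesis .
    qed
    ultimately show ?thesis using r \<alpha>r by (intro exI[of _ r]) auto
  qed
  have "\<exists>\<sigma>. \<forall>G. ?P \<sigma> G (\<sigma> G)"
  \<comment> \<open>Well-founded choice applies because the requirement at \<open>G\<close> sees the
    family only through \<open>cut\<close>, that is, through multisets of smaller size.\<close>
  proof (rule dependent_wf_choice[of "measure size"])
    fix \<phi> \<psi> :: "'i multiset \<Rightarrow> 'm \<Rightarrow> 'm" and G r
    assume "\<And>H. (H, G) \<in> measure size \<Longrightarrow> \<phi> H = \<psi> H"
    then have "cut \<phi> G r = cut \<psi> G r" by (auto simp: cut_def fun_eq_iff)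
    then show "?P \<phi> G r = ?P \<psi> G r" by simp
  qed (use step in auto)
  then obtain \<sigma> where \<sigma>: "\<And>G. ?P \<sigma> G (\<sigma> G)" by blast
  have "conv M M \<sigma> \<delta> G x = conv M M (cut \<sigma> G (\<sigma> G)) \<delta> G x" "conv M M \<delta> \<sigma> G x = conv M M \<delta> (cut \<sigma> G (\<sigma> G)) G x"
    if x: "x \<in> carrier M" for G x
  proof -
    have *: "cut \<sigma> G (\<sigma> G) K = \<sigma> K" if "K \<subseteq># G" for K
      using that mset_subset_size[of K G] by (auto simp: cut_def subset_mset.le_less)
    have c: "\<sigma> K y \<in> carrier M" if "y \<in> carrier M" for K y
      using graded_map_closed[OF hom_degree_graded_map that] \<sigma> by blast
    show "conv M M \<sigma> \<delta> G x = conv M M (cut \<sigma> G (\<sigma> G)) \<delta> G x" "conv M M \<delta> \<sigma> G x = conv M M \<delta> (cut \<sigma> G (\<sigma> G)) G x"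
      using x c \<delta>c ab by (auto intro!: conv_cong[where L = M] simp: *)
  qed
  with \<sigma> show ?thesis by (intro exI[of _ \<sigma>]) auto
qed

section \<open>Modules over the Koszul complex\<close>

lemma koszul_simps:
  "carrier (koszul Q n f) = {e. (\<forall>J. e J \<in> carrier Q) \<and> (\<forall>J. \<not> J \<subseteq> {..<n} \<longrightarrow> e J = \<zero>\<^bsub>Q\<^esub>)}"
  "mult (koszul Q n f) = (\<lambda>d e J. \<Oplus>\<^bsub>Q\<^esub>K\<in>Pow J. signed Q (inversions K (J - K)) (d K \<otimes>\<^bsub>Q\<^esub> e (J - K)))"
  "one (koszul Q n f) = kos_const Q \<one>\<^bsub>Q\<^esub>" "zero (koszul Q n f) = (\<lambda>J. \<zero>\<^bsub>Q\<^esub>)"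
  "add (koszul Q n f) = (\<lambda>d e J. d J \<oplus>\<^bsub>Q\<^esub> e J)"
  "grade (koszul Q n f) i = {e \<in> carrier (koszul Q n f). \<forall>J. e J \<noteq> \<zero>\<^bsub>Q\<^esub> \<longrightarrow> i = int (card J)}"
  "diff (koszul Q n f) = (\<lambda>e J. \<Oplus>\<^bsub>Q\<^esub>j\<in>{..<n} - J. signed Q (inversions {j} J) (f j \<otimes>\<^bsub>Q\<^esub> e (insert j J)))"
  by (simp_all add: koszul_def Let_def kos_const_def)

lemma inversions_empty [simp]: "inversions {} J = 0" "inversions J {} = 0"
  by (simp_all add: inversions_def)

lemma inversions_singleton: "inversions {i} {j} = (if j < i then 1 else 0)"
proof -
  have "{(j', k). j' \<in> {i} \<and> k \<in> {j} \<and> k < j'} = (if j < i then {(i, j)} else {})" by auto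
  then show ?thesis by (simp add: inversions_def)
qed

text \<open>Coefficients in the Koszul complex are indexed by all sets of naturals, also infinite
  ones. For infinite \<open>J\<close> the sum ranges over an infinite set and is zero by convention,
  hence the case distinction.\<close>

lemma (in abelian_group) finsum_Pow_single:
  assumes "\<And>K. K \<in> Pow J - {K0} \<Longrightarrow> g K = \<zero>" "g K0 \<in> carrier G"
  shows "(\<Oplus>K\<in>Pow J. g K) = (if finite J \<and> K0 \<subseteq> J then g K0 else \<zero>)"
proof (cases "finite J \<and> K0 \<subseteq> J")
  case True
  then show ?thesis using assms by (simp, intro finsum_single) auto
next
  case False
  then have "(\<Oplus>K\<in>Pow J. g K) = \<zero>"
  proof (cases "finite J")
    case True
    with False show ?thesis using assms by (intro finsum_all_zero) auto
  qed (simp add: finsum_infinite)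
  with False show ?thesis by auto
qed

lemma restrict_scalars_simps:
  "carrier (restrict_scalars Q F) = carrier F" "zero (restrict_scalars Q F) = zero F"
  "add (restrict_scalars Q F) = add F" "grade (restrict_scalars Q F) = grade F"
  "diff (restrict_scalars Q F) = diff F" "act (restrict_scalars Q F) q = act F (kos_const Q q)"
  by (simp_all add: restrict_scalars_def)

lemma restrict_scalars_group:
  "finsum (restrict_scalars Q F) = finsum F" "a_inv (restrict_scalars Q F) = a_inv F"
  "signed (restrict_scalars Q F) = signed F" "a_minus (restrict_scalars Q F) = a_minus F"
  by (auto simp: finsum_def finprod_def a_inv_def m_inv_def restrict_scalars_def signed_def a_minus_def fun_eq_iff)

locale koszul_module = Q: cring Q + E: dg_module "koszul Q n f" F
  for Q :: "('q, 'b) ring_scheme" and n :: nat and f :: "nat \<Rightarrow> 'q" and F :: "(nat set \<Rightarrow> 'q, 'm, 'c) dgm_scheme" +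
  assumes f_closed: "i < n \<Longrightarrow> f i \<in> carrier Q"
    and restricted: "dg_module (degree_zero_ring Q) (restrict_scalars Q F)"
begin

abbreviation "KE \<equiv> koszul Q n f"
abbreviation "F0 \<equiv> restrict_scalars Q F"
abbreviation "const \<equiv> kos_const Q"
abbreviation "xi \<equiv> kos_xi Q"

sublocale F0: dg_module "degree_zero_ring Q" F0 by (rule restricted)

lemma const_closed: "q \<in> carrier Q \<Longrightarrow> const q \<in> carrier KE"
  by (simp add: koszul_simps kos_const_def)

lemma const_grade: "q \<in> carrier Q \<Longrightarrow> const q \<in> grade KE 0"
  using const_closed by (simp add: koszul_simps(6) kos_const_def)

lemma xi_closed: "i < n \<Longrightarrow> xi i \<in> carrier KE"
  by (simp add: koszul_simps kos_xi_def)

lemma xi_grade: "i < n \<Longrightarrow> xi i \<in> grade KE 1"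
  using xi_closed by (simp add: koszul_simps(6) kos_xi_def)

lemma const_mult_xi: "q \<in> carrier Q \<Longrightarrow> i < n \<Longrightarrow> const q \<otimes>\<^bsub>KE\<^esub> xi i = (\<lambda>J. if J = {i} then q else \<zero>\<^bsub>Q\<^esub>)"
  by (subst koszul_simps, rule ext, subst Q.finsum_Pow_single[of _ "{}"])
    (auto simp: kos_const_def kos_xi_def signed_def)

lemma xi_mult_const: "q \<in> carrier Q \<Longrightarrow> i < n \<Longrightarrow> xi i \<otimes>\<^bsub>KE\<^esub> const q = (\<lambda>J. if J = {i} then q else \<zero>\<^bsub>Q\<^esub>)"
  by (subst koszul_simps, rule ext, subst Q.finsum_Pow_single[of _ "{i}"])
    (auto simp: kos_const_def kos_xi_def signed_def)

lemma xi_mult_xi: "xi i \<otimes>\<^bsub>KE\<^esub> xi j =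
    (\<lambda>J. if J = {i, j} \<and> i \<noteq> j then signed Q (if j < i then 1 else 0) \<one>\<^bsub>Q\<^esub> else \<zero>\<^bsub>Q\<^esub>)"
proof -
  have *: "K \<subseteq> J \<Longrightarrow> K \<noteq> {i} \<Longrightarrow> signed Q (inversions K (J - K)) (xi i K \<otimes>\<^bsub>Q\<^esub> xi j (J - K)) = \<zero>\<^bsub>Q\<^esub>" for J K
    by (auto simp: kos_xi_def)
  have **: "i \<in> J \<and> J - {i} = {j} \<longleftrightarrow> J = {i, j} \<and> i \<noteq> j" for J by auto
  show ?thesis
    apply (subst koszul_simps, rule ext, subst Q.finsum_Pow_single[of _ "{i}"])
    using * ** by (auto simp: kos_xi_def inversions_singleton Q.finsum_closed)
qed

lemma xi_anticommute: "(xi i \<otimes>\<^bsub>KE\<^esub> xi j) \<oplus>\<^bsub>KE\<^esub> (xi j \<otimes>\<^bsub>KE\<^esub> xi i) = \<zero>\<^bsub>KE\<^esub>"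
  unfolding xi_mult_xi by (subst koszul_simps, subst koszul_simps)
    (auto simp: fun_eq_iff signed_def insert_commute Q.r_neg Q.l_neg)

lemma xi_square: "xi i \<otimes>\<^bsub>KE\<^esub> xi i = \<zero>\<^bsub>KE\<^esub>"
  unfolding xi_mult_xi by (simp add: koszul_simps)

lemma diff_xi: "i < n \<Longrightarrow> diff KE (xi i) = const (f i)"
proof (subst koszul_simps, rule ext)
  fix J assume i: "i < n"
  show "(\<Oplus>\<^bsub>Q\<^esub>j\<in>{..<n} - J. signed Q (inversions {j} J) (f j \<otimes>\<^bsub>Q\<^esub> xi i (insert j J))) = const (f i) J"
  proof (cases "J = {}")
    case True
    then show ?thesis
      using i f_closed by (subst Q.finsum_single[of _ i]) (auto simp: kos_xi_def kos_const_def signed_def)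
  next
    case False
    then have "insert j J \<noteq> {i}" if "j \<in> {..<n} - J" for j using that by auto
    then show ?thesis
      using False f_closed by (subst Q.finsum_all_zero) (auto simp: kos_xi_def kos_const_def)
  qed
qed

section \<open>The operators \<lambda>_i and the series \<delta> that they define\<close>

definition lam :: "nat \<Rightarrow> 'm \<Rightarrow> 'm" where "lam i = act F (xi i)"

lemma lam_closed: "i < n \<Longrightarrow> x \<in> carrier F \<Longrightarrow> lam i x \<in> carrier F"
  unfolding lam_def by (rule E.act_closed[OF xi_closed])

lemma lam_add: "i < n \<Longrightarrow> x \<in> carrier F \<Longrightarrow> y \<in> carrier F \<Longrightarrow> lam i (x \<oplus>\<^bsub>F\<^esub> y) = lam i x \<oplus>\<^bsub>F\<^esub> lam i y"
  unfolding lam_def by (rule E.act_r_distr[OF xi_closed])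

lemma lam_grade: "i < n \<Longrightarrow> x \<in> grade F j \<Longrightarrow> lam i x \<in> grade F (1 + j)"
  unfolding lam_def by (rule E.act_grade[OF xi_grade])

lemma lam_lam: 
  assumes "i < n" "j < n" "x \<in> carrier F"
  shows "lam i (lam j x) \<oplus>\<^bsub>F\<^esub> lam j (lam i x) = \<zero>\<^bsub>F\<^esub>" "lam i (lam i x) = \<zero>\<^bsub>F\<^esub>"
proof -
  note c = xi_closed[OF assms(1)] xi_closed[OF assms(2)]
  have "lam i (lam j x) \<oplus>\<^bsub>F\<^esub> lam j (lam i x) = act F (xi i \<otimes>\<^bsub>KE\<^esub> xi j \<oplus>\<^bsub>KE\<^esub> xi j \<otimes>\<^bsub>KE\<^esub> xi i) x"
    using c assms(3) by (simp add: lam_def E.act_assoc E.act_l_distr)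
  then show "lam i (lam j x) \<oplus>\<^bsub>F\<^esub> lam j (lam i x) = \<zero>\<^bsub>F\<^esub>"
    using assms(3) by (simp add: xi_anticommute E.zero_act)
  have "lam i (lam i x) = act F (xi i \<otimes>\<^bsub>KE\<^esub> xi i) x"
    using c assms(3) by (simp add: lam_def E.act_assoc)
  then show "lam i (lam i x) = \<zero>\<^bsub>F\<^esub>"
    using assms(3) by (simp add: xi_square E.zero_act)
qed

lemma lam_const:
  assumes "i < n" "q \<in> carrier Q" "x \<in> carrier F"
  shows "lam i (act F (const q) x) = act F (const q) (lam i x)"
  using E.act_assoc[OF xi_closed[OF assms(1)] const_closed[OF assms(2)] assms(3)]
    E.act_assoc[OF const_closed[OF assms(2)] xi_closed[OF assms(1)] assms(3)]
    const_mult_xi[OF assms(2,1)] xi_mult_const[OF assms(2,1)] by (simp add: lam_def)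

text \<open>The Leibniz rule for \<xi>_i, which has degree 1 and boundary f_i: the operator
  \<lambda>_i is a null-homotopy of multiplication by f_i.\<close>

lemma diff_lam:
  assumes "i < n" "x \<in> carrier F"
  shows "diff F (lam i x) \<oplus>\<^bsub>F\<^esub> lam i (diff F x) = act F (const (f i)) x"
proof -
  note c = E.act_closed[OF const_closed[OF f_closed[OF assms(1)]] assms(2)] lam_closed[OF assms(1) E.M.diff_closed[OF assms(2)]]
  have "diff F (lam i x) = act F (const (f i)) x \<oplus>\<^bsub>F\<^esub> \<ominus>\<^bsub>F\<^esub> lam i (diff F x)"
    using E.act_leibniz[OF xi_grade[OF assms(1)] assms(2)] assms(1) by (simp add: diff_xi lam_def signed_def)
  then show ?thesis using c by (simp add: E.M.a_assoc E.M.l_neg)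
qed

text \<open>A series of order at most one. As the index type contains all multisets of naturals,
  singletons with index at least \<open>n\<close> have to be given the value zero
  explicitly.\<close>

definition delta :: "nat multiset \<Rightarrow> 'm \<Rightarrow> 'm" where
  "delta G = (\<lambda>x\<in>carrier F. if G = {#} then diff F x
     else if size G = 1 \<and> set_mset G \<subseteq> {..<n} then lam (the_elem (set_mset G)) x else \<zero>\<^bsub>F\<^esub>)"

lemma delta_empty: "x \<in> carrier F \<Longrightarrow> delta {#} x = diff F x"
  by (simp add: delta_def)

lemma delta_single: "x \<in> carrier F \<Longrightarrow> i < n \<Longrightarrow> delta {#i#} x = lam i x"
  by (simp add: delta_def)

lemma delta_zero: "x \<in> carrier F \<Longrightarrow> G \<noteq> {#} \<Longrightarrow> \<not> (\<exists>i<n. G = {#i#}) \<Longrightarrow> delta G x = \<zero>\<^bsub>F\<^esub>"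
  by (auto simp: delta_def size_1_singleton_mset) (metis lessThan_iff set_mset_single singleton_insert_inj_eq size_1_singleton_mset insert_subset One_nat_def)

lemma delta_cases:
  obtains "G = {#}" | i where "i < n" "G = {#i#}" | "G \<noteq> {#}" "\<not> (\<exists>i<n. G = {#i#})"
  by blast

lemma delta_hom_degree: "delta G \<in> hom_degree (degree_zero_ring Q) F0 F0 (- 1 + 2 * int (size G))"
proof (cases G rule: delta_cases)
  case 1
  show ?thesis
  proof (rule hom_degree_linearI[OF restricted restricted])
    show "delta G \<in> graded_map F0 F0 (- 1 + 2 * int (size G))"
      using 1 E.M.diff_grade by (intro graded_mapI)
        (auto simp: restrict_scalars_simps additive_map_def delta_empty E.M.diff_closed E.M.diff_add E.M.grade_closed, auto simp: delta_def)
    fix q x assume qx: "q \<in> carrier Q" "x \<in> carrier F0"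
    then have "diff F0 (act F0 q x) = act F0 q (diff F0 x)"
      using F0.act_leibniz[of q 0 x] F0.zero_act[OF qx(2)] F0.act_closed[of q "diff F0 x"] F0.M.diff_closed
      by (simp add: degree_zero_ring_simps signed_def)
    then show "delta G (act F0 q x) = act F0 q (delta G x)"
      using qx 1 F0.act_closed[of q x] by (simp add: restrict_scalars_simps delta_empty degree_zero_ring_simps)
  qed
next
  case (2 i)
  show ?thesis
  proof (rule hom_degree_linearI[OF restricted restricted])
    show "delta G \<in> graded_map F0 F0 (- 1 + 2 * int (size G))"
      using 2 lam_grade by (intro graded_mapI)
        (auto simp: restrict_scalars_simps additive_map_def delta_single lam_closed lam_add E.M.grade_closed, auto simp: delta_def)
    fix q x assume qx: "q \<in> carrier Q" "x \<in> carrier F0"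
    then show "delta G (act F0 q x) = act F0 q (delta G x)"
      using 2 F0.act_closed[of q x] by (simp add: restrict_scalars_simps delta_single degree_zero_ring_simps lam_const)
  qed
next
  case 3
  interpret hom_setting "degree_zero_ring Q" F0 F0 by (rule dg_module_setting[OF restricted restricted])
  have "delta G = (\<lambda>x\<in>carrier F0. \<zero>\<^bsub>F0\<^esub>)"
    using 3 delta_zero by (intro extensionalityI[of _ "carrier F"]) (auto simp: restrict_scalars_simps delta_def)
  then show ?thesis using zero_hom_degree by simp
qed

lemma delta_closed: "x \<in> carrier F \<Longrightarrow> delta G x \<in> carrier F"
  using graded_map_closed[OF hom_degree_graded_map[OF delta_hom_degree], of x G] by (simp add: restrict_scalars_simps)

lemma delta_at_zero: "delta G \<zero>\<^bsub>F\<^esub> = \<zero>\<^bsub>F\<^esub>"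
  using additive_map_zero[OF F0.M.abelian_group_axioms F0.M.abelian_group_axioms
      graded_map_additive[OF hom_degree_graded_map[OF delta_hom_degree]], of G]
  by (simp add: restrict_scalars_simps)

lemma linear_form_simps:
  "i < n \<Longrightarrow> linear_form Q n c {#i#} = c i" "\<not> (\<exists>i<n. G = {#i#}) \<Longrightarrow> linear_form Q n c G = \<zero>\<^bsub>Q\<^esub>"
  by (auto simp: linear_form_def)

lemma linear_form_closed: "(\<And>i. i < n \<Longrightarrow> c i \<in> carrier Q) \<Longrightarrow> linear_form Q n c G \<in> carrier Q"
  by (auto simp: linear_form_def)

text \<open>Order by order: \<partial>\<partial> = 0; \<partial>\<lambda>_i + \<lambda>_i\<partial>
  = f_i; the \<lambda>_i anticommute and square to zero; there is nothing in order three or more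
  because \<delta> has order at most one.\<close>

lemma delta_conv_delta:
  assumes x: "x \<in> carrier F"
  shows "conv F0 F0 delta delta G x = scalar_family F0 (linear_form Q n f) G x"
proof -
  let ?g = "\<lambda>K. delta K (delta (G - K) x)"
  have gc: "?g K \<in> carrier F" for K using x by (intro delta_closed)
  have gz: "?g K = \<zero>\<^bsub>F\<^esub>" if "\<not> (G - K = {#} \<or> size (G - K) = 1) \<or> \<not> (K = {#} \<or> size K = 1)" for K
  proof -
    have one: "\<not> (\<exists>i<n. L = {#i#})" if "size L \<noteq> 1" for L :: "nat multiset" using that by auto
    from that show ?thesis
    proof
      assume "\<not> (G - K = {#} \<or> size (G - K) = 1)"
      then have "delta (G - K) x = \<zero>\<^bsub>F\<^esub>" using one[of "G - K"] by (intro delta_zero x) blast+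
      then show ?thesis by (simp only: delta_at_zero)
    next
      assume "\<not> (K = {#} \<or> size K = 1)"
      then show ?thesis using one[of K] by (intro delta_zero delta_closed x) blast+
    qed
  qed
  have conv: "conv F0 F0 delta delta G x = (\<Oplus>\<^bsub>F\<^esub>K\<in>{K. K \<subseteq># G}. ?g K)"
    using x by (simp add: conv_apply restrict_scalars_simps restrict_scalars_group)
  have sc: "scalar_family F0 (linear_form Q n f) G x = act F (const (linear_form Q n f G)) x"
    using x by (simp add: scalar_family_def restrict_scalars_simps)
  have z: "act F (const \<zero>\<^bsub>Q\<^esub>) x = \<zero>\<^bsub>F\<^esub>"
    using F0.zero_act[of x] x by (simp add: restrict_scalars_simps degree_zero_ring_simps)
  consider (0) "G = {#}" | (1) "size G = 1" | (2) "size G = 2" | (3) "size G > 2"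
    using nonempty_has_size[of G] by linarith
  then show ?thesis
  proof cases
    case 0
    then show ?thesis unfolding conv sc using x z E.M.diff_diff
      by (simp add: linear_form_simps(2) delta_empty E.M.diff_closed)
  next
    case 1
    then obtain i where G: "G = {#i#}" by (metis One_nat_def size_1_singleton_mset)
    have sub: "{K. K \<subseteq># {#i#}} = {{#}, {#i#}}"
    proof (intro equalityI subsetI)
      fix K assume "K \<in> {K. K \<subseteq># {#i#}}"
      then have K: "K \<subseteq># {#i#}" by simp
      show "K \<in> {{#}, {#i#}}"
      proof (cases K)
        case (add a L)
        then have "a = i" using K mset_subset_eqD[of K "{#i#}" a] by simp
        then show ?thesis using K add by simp
      qed simp
    qed auto
    have "(\<Oplus>\<^bsub>F\<^esub>K\<in>{K. K \<subseteq># G}. ?g K) = diff F (delta {#i#} x) \<oplus>\<^bsub>F\<^esub> delta {#i#} (diff F x)"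
      unfolding G sub using gc x delta_closed E.M.diff_closed by (subst E.M.finsum_insert) (auto simp: delta_empty)
    also have "\<dots> = act F (const (linear_form Q n f G)) x"
    proof (cases "i < n")
      case True
      then show ?thesis using G x diff_lam by (simp add: delta_single linear_form_simps E.M.diff_closed)
    next
      case False
      then show ?thesis using G x z by (simp add: delta_zero linear_form_simps(2) E.M.diff_closed E.M.diff_zero)
    qed
    finally show ?thesis unfolding conv sc .
  next
    case 2
    \<comment> \<open>In order two only splittings into two singletons can contribute.\<close>
    have sing: "?g K = \<zero>\<^bsub>F\<^esub>" if "K \<subseteq># G" "K \<notin> (\<lambda>i. {#i#}) ` set_mset G" for K
    proof (cases "size K = 1")
      case True
      then obtain i where "K = {#i#}" by (metis One_nat_def size_1_singleton_mset)
      with that show ?thesis by auto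
    next
      case False
      have "size (G - K) = 2 - size K" using 2 that(1) by (simp add: size_Diff_submset)
      with False show ?thesis by (intro gz) auto
    qed
    obtain i j where G: "G = {#i, j#}"
      using 2 by (metis numeral_2_eq_2 size_eq_Suc_imp_eq_union size_1_singleton_mset One_nat_def diff_Suc_1 size_add_mset)
    have "(\<Oplus>\<^bsub>F\<^esub>K\<in>{K. K \<subseteq># G}. ?g K) = (\<Oplus>\<^bsub>F\<^esub>K\<in>(\<lambda>i. {#i#}) ` set_mset G. ?g K)"
      using gc sing finite_submultisets by (intro E.M.finsum_neutral_cong) auto
    also have "\<dots> = \<zero>\<^bsub>F\<^esub>"
    \<comment> \<open>For i = j there is a single splitting, so \<lambda>_i \<lambda>_i = 0 itself
      is needed; anticommutation would only give twice this.\<close>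
    proof (cases "i = j")
      case True
      then have "(\<Oplus>\<^bsub>F\<^esub>K\<in>(\<lambda>i. {#i#}) ` set_mset G. ?g K) = delta {#i#} (delta {#i#} x)"
        using G gc x delta_closed by simp
      then show ?thesis
        using lam_lam(2)[of i] x by (cases "i < n") (auto simp: delta_single lam_closed delta_zero delta_closed)
    next
      case False
      then have "(\<Oplus>\<^bsub>F\<^esub>K\<in>(\<lambda>i. {#i#}) ` set_mset G. ?g K) =
          delta {#i#} (delta {#j#} x) \<oplus>\<^bsub>F\<^esub> delta {#j#} (delta {#i#} x)"
        using G gc x delta_closed by (simp add: E.M.finsum_insert)
      then show ?thesis
        using lam_lam(1)[of i j x] x delta_at_zero
        by (cases "i < n"; cases "j < n") (auto simp: delta_single lam_closed delta_zero delta_closed)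
    qed
    finally show ?thesis unfolding conv sc using G z by (simp add: linear_form_simps(2))
  next
    case 3
    have "?g K = \<zero>\<^bsub>F\<^esub>" if "K \<subseteq># G" for K
    proof (rule gz)
      have "size (G - K) = size G - size K" using that by (simp add: size_Diff_submset)
      with 3 show "\<not> (G - K = {#} \<or> size (G - K) = 1) \<or> \<not> (K = {#} \<or> size K = 1)" by auto
    qed
    then have "(\<Oplus>\<^bsub>F\<^esub>K\<in>{K. K \<subseteq># G}. ?g K) = \<zero>\<^bsub>F\<^esub>" by (intro E.M.finsum_all_zero) auto
    moreover have "linear_form Q n f G = \<zero>\<^bsub>Q\<^esub>" using 3 by (intro linear_form_simps) auto
    ultimately show ?thesis unfolding conv sc using z by simp
  qed
qed

end

section \<open>The resolution \<open>U\<^sub>E(F)\<close>\<close>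

lemma (in abelian_group) finsum_add_cong:
  assumes "\<And>i. i \<in> A \<Longrightarrow> c i = a i \<oplus> b i" "\<And>i. i \<in> A \<Longrightarrow> a i \<in> carrier G" "\<And>i. i \<in> A \<Longrightarrow> b i \<in> carrier G"
  shows "finsum G c A = finsum G a A \<oplus> finsum G b A"
proof -
  have "finsum G c A = finsum G (\<lambda>i. a i \<oplus> b i) A" using assms by (intro finsum_cong') auto
  also have "\<dots> = finsum G a A \<oplus> finsum G b A" using assms by (intro finsum_addf) auto
  finally show ?thesis .
qed

context koszul_module
begin

abbreviation "U \<equiv> UE Q n f F"

lemma UE_carrier:
  "u \<in> carrier U \<longleftrightarrow> (\<forall>J H. u J H \<in> carrier F) \<and> finite {(J, H). u J H \<noteq> \<zero>\<^bsub>F\<^esub>} \<and>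
     (\<forall>J H. u J H \<noteq> \<zero>\<^bsub>F\<^esub> \<longrightarrow> J \<subseteq> {..<n} \<and> set_mset H \<subseteq> {..<n})"
  by (simp add: UE_def)

lemma UE_simps:
  "zero U = (\<lambda>J H. \<zero>\<^bsub>F\<^esub>)" "add U = (\<lambda>u v J H. u J H \<oplus>\<^bsub>F\<^esub> v J H)"
  "grade U i = {u \<in> carrier U. \<forall>J H. u J H \<in> grade F (i - int (card J) - 2 * int (size H))}"
  "act U e u = (\<lambda>J H. \<Oplus>\<^bsub>F\<^esub>K\<in>Pow J.
        signed F (inversions K (J - K)) (act F (const (e K)) (u (J - K) H)))"
  by (simp_all add: UE_def Let_def)

lemma UE_diff:
  "diff U u J H =
        (\<Oplus>\<^bsub>F\<^esub>j\<in>{..<n} - J. signed F (inversions {j} J) (act F (const (f j)) (u (insert j J) H)))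
        \<oplus>\<^bsub>F\<^esub> signed F (int (card J)) (diff F (u J H))
        \<oplus>\<^bsub>F\<^esub> (\<Oplus>\<^bsub>F\<^esub>i\<in>{..<n}. signed F (int (card J)) (lam i (u J (add_mset i H))))
        \<ominus>\<^bsub>F\<^esub> (\<Oplus>\<^bsub>F\<^esub>i\<in>J. signed F (inversions {i} (J - {i})) (u (J - {i}) (add_mset i H)))"
  by (simp add: UE_def Let_def lam_def)

lemma UE_closed: "u \<in> carrier U \<Longrightarrow> u J H \<in> carrier F"
  by (simp add: UE_carrier)

lemma UE_zero: "u \<in> carrier U \<Longrightarrow> \<not> (J \<subseteq> {..<n} \<and> set_mset H \<subseteq> {..<n}) \<Longrightarrow> u J H = \<zero>\<^bsub>F\<^esub>"
  unfolding UE_carrier by blast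

lemma UE_I:
  assumes "\<And>J H. u J H \<in> carrier F" "finite S" "\<And>J H. u J H \<noteq> \<zero>\<^bsub>F\<^esub> \<Longrightarrow> (J, H) \<in> S"
    "\<And>J H. \<not> (J \<subseteq> {..<n} \<and> set_mset H \<subseteq> {..<n}) \<Longrightarrow> u J H = \<zero>\<^bsub>F\<^esub>"
  shows "u \<in> carrier U"
proof -
  have "{(J, H). u J H \<noteq> \<zero>\<^bsub>F\<^esub>} \<subseteq> S" using assms(3) by auto
  then show ?thesis using assms finite_subset unfolding UE_carrier by blast
qed

abbreviation "supp u \<equiv> {(J, H). u J H \<noteq> \<zero>\<^bsub>F\<^esub>}"

lemma UE_finite: "u \<in> carrier U \<Longrightarrow> finite (supp u)"
  by (simp add: UE_carrier)

lemma const_act_closed: "q \<in> carrier Q \<Longrightarrow> x \<in> carrier F \<Longrightarrow> act F (const q) x \<in> carrier F"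
  by (rule E.act_closed[OF const_closed])

lemma const_act_zero: "q \<in> carrier Q \<Longrightarrow> act F (const q) \<zero>\<^bsub>F\<^esub> = \<zero>\<^bsub>F\<^esub>"
  using additive_map_zero[OF E.M.abelian_group_axioms E.M.abelian_group_axioms, of "act F (const q)"]
  by (simp add: additive_map_def const_act_closed E.act_r_distr[OF const_closed])

lemma zero_const_act: "x \<in> carrier F \<Longrightarrow> act F (const \<zero>\<^bsub>Q\<^esub>) x = \<zero>\<^bsub>F\<^esub>"
  using F0.zero_act[of x] by (simp add: restrict_scalars_simps degree_zero_ring_simps)

lemma const_act_grade: "q \<in> carrier Q \<Longrightarrow> x \<in> grade F i \<Longrightarrow> act F (const q) x \<in> grade F i"
  using E.act_grade[OF const_grade, of q x i] by simp

lemma lam_zero: "i < n \<Longrightarrow> lam i \<zero>\<^bsub>F\<^esub> = \<zero>\<^bsub>F\<^esub>"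
  using additive_map_zero[OF E.M.abelian_group_axioms E.M.abelian_group_axioms, of "lam i"]
  by (simp add: additive_map_def lam_closed lam_add)

lemma UE_abelian_group: "abelian_group U"
proof (rule abelian_groupI)
  fix u v assume u: "u \<in> carrier U" and v: "v \<in> carrier U"
  show "u \<oplus>\<^bsub>U\<^esub> v \<in> carrier U"
    by (rule UE_I[of _ "supp u \<union> supp v"])
      (use UE_closed[OF u] UE_closed[OF v] UE_finite[OF u] UE_finite[OF v] UE_zero[OF u] UE_zero[OF v] in
        \<open>auto simp: UE_simps\<close>)
  show "u \<oplus>\<^bsub>U\<^esub> v = v \<oplus>\<^bsub>U\<^esub> u"
    using UE_closed[OF u] UE_closed[OF v] by (simp add: UE_simps E.M.a_comm)
next
  show "\<zero>\<^bsub>U\<^esub> \<in> carrier U" by (rule UE_I[of _ "{}"]) (auto simp: UE_simps)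
next
  fix u v w assume "u \<in> carrier U" "v \<in> carrier U" "w \<in> carrier U"
  then show "u \<oplus>\<^bsub>U\<^esub> v \<oplus>\<^bsub>U\<^esub> w = u \<oplus>\<^bsub>U\<^esub> (v \<oplus>\<^bsub>U\<^esub> w)"
    using UE_closed by (simp add: UE_simps E.M.a_assoc)
next
  fix u assume u: "u \<in> carrier U"
  then show "\<zero>\<^bsub>U\<^esub> \<oplus>\<^bsub>U\<^esub> u = u" using UE_closed by (simp add: UE_simps)
  have "(\<lambda>J H. \<ominus>\<^bsub>F\<^esub> u J H) \<in> carrier U"
    by (rule UE_I[of _ "supp u"])
      (use UE_closed[OF u] UE_finite[OF u] UE_zero[OF u] in \<open>auto\<close>)
  then show "\<exists>v\<in>carrier U. v \<oplus>\<^bsub>U\<^esub> u = \<zero>\<^bsub>U\<^esub>"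
    using UE_closed[OF u] by (intro bexI) (auto simp: UE_simps E.M.l_neg)
qed

sublocale UG: abelian_group U by (rule UE_abelian_group)

lemma eval_additive: "additive_map U F (\<lambda>u. u J H)"
  by (simp add: additive_map_def UE_closed UE_simps)

lemma UE_finsum_eval: "(\<And>i. i \<in> I \<Longrightarrow> c i \<in> carrier U) \<Longrightarrow> finsum U c I J H = (\<Oplus>\<^bsub>F\<^esub>i\<in>I. c i J H)"
  using additive_map_finsum[OF UE_abelian_group E.M.abelian_group_axioms eval_additive, of c I J H] by (auto simp: Pi_def)

lemma UE_neg_eval: "u \<in> carrier U \<Longrightarrow> (\<ominus>\<^bsub>U\<^esub> u) J H = \<ominus>\<^bsub>F\<^esub> u J H"
  by (rule additive_map_neg[OF UE_abelian_group E.M.abelian_group_axioms eval_additive])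

text \<open>The element \<xi>_J \<otimes> y^(H) \<otimes> x.\<close>

definition single :: "nat set \<Rightarrow> nat multiset \<Rightarrow> 'm \<Rightarrow> nat set \<Rightarrow> nat multiset \<Rightarrow> 'm" where
  "single J H x = (\<lambda>J' H'. if J' = J \<and> H' = H then x else \<zero>\<^bsub>F\<^esub>)"

lemma single_closed:
  "x \<in> carrier F \<Longrightarrow> J \<subseteq> {..<n} \<Longrightarrow> set_mset H \<subseteq> {..<n} \<Longrightarrow> single J H x \<in> carrier U"
  by (rule UE_I[of _ "{(J, H)}"]) (auto simp: single_def split: if_splits)

text \<open>Since \<xi>_J \<otimes> y^(H) has degree |J| + 2|H|, components are taken
  coefficientwise after shifting by this number, which is \<open>?d J H\<close>. Finite support
  leaves only finitely many degrees.\<close>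

lemma UE_graded_group: "graded_group U"
proof (intro graded_group.intro graded_group_axioms.intro UE_abelian_group)
  fix i
  show "additive_subgroup (grade U i) U"
    by (intro additive_subgroup.intro UG.add.subgroupI)
      (auto simp: UE_simps(3) UE_neg_eval E.M.grade_neg, auto simp: UE_simps E.M.grade_add UG.a_closed[unfolded UE_simps]
        intro!: exI[of _ "\<zero>\<^bsub>U\<^esub>"] UG.zero_closed[unfolded UE_simps])
next
  fix u assume u: "u \<in> carrier U"
  note uc = UE_closed[OF u]
  let ?d = "\<lambda>J H. int (card (J :: nat set)) + 2 * int (size (H :: nat multiset))"
  let ?c = "\<lambda>i J H. component F (u J H) (i - ?d J H)"
  have z: "component F \<zero>\<^bsub>F\<^esub> i = \<zero>\<^bsub>F\<^esub>" for i
    using E.M.component_grade[OF E.M.grade_zero[of 0]] by (simp add: fun_eq_iff split: if_splits)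
  have cc: "?c i \<in> grade U i" for i
  proof -
    have "?c i \<in> carrier U"
      by (rule UE_I[of _ "supp u"])
        (use uc UE_finite[OF u] UE_zero[OF u] z E.M.grade_closed E.M.component_in_grade in auto, metis+)
    then show ?thesis using E.M.component_in_grade[OF uc] by (simp add: UE_simps(3) algebra_simps)
  qed
  then have ccl: "?c i \<in> carrier U" for i by (simp add: UE_simps(3))
  let ?I = "{i. ?c i \<noteq> \<zero>\<^bsub>U\<^esub>}"
  have "?I \<subseteq> (\<Union>(J, H)\<in>supp u. (\<lambda>k. k + ?d J H) ` {k. component F (u J H) k \<noteq> \<zero>\<^bsub>F\<^esub>})"
  proof
    fix i assume "i \<in> ?I"
    then obtain J H where JH: "?c i J H \<noteq> \<zero>\<^bsub>F\<^esub>" by (auto simp: UE_simps fun_eq_iff)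
    then have "(J, H) \<in> supp u" using z by auto
    moreover have "i \<in> (\<lambda>k. k + ?d J H) ` {k. component F (u J H) k \<noteq> \<zero>\<^bsub>F\<^esub>}"
      using JH by (intro image_eqI[of _ _ "i - ?d J H"]) auto
    ultimately show "i \<in> (\<Union>(J, H)\<in>supp u. (\<lambda>k. k + ?d J H) ` {k. component F (u J H) k \<noteq> \<zero>\<^bsub>F\<^esub>})"
      by blast
  qed
  then have fin: "finite ?I"
    by (rule finite_subset) (use UE_finite[OF u] E.M.finite_component[OF uc] in auto)
  have sum: "(\<Oplus>\<^bsub>F\<^esub>i\<in>I. g (i - d)) = (\<Oplus>\<^bsub>F\<^esub>k\<in>(\<lambda>i. i - d) ` I. g k)"
    if "\<And>i. i \<in> I \<Longrightarrow> g (i - d) \<in> carrier F" for I g and d :: int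
    using that by (subst E.M.finsum_reindex) (auto simp: inj_on_def)
  show "\<exists>!c. is_decomposition U u c"
  proof (rule ex1I)
    have "finsum U ?c ?I J H = u J H" for J H
    proof -
      have "finsum U ?c ?I J H = (\<Oplus>\<^bsub>F\<^esub>i\<in>?I. component F (u J H) (i - ?d J H))"
        by (rule UE_finsum_eval) (rule ccl)
      also have "\<dots> = (\<Oplus>\<^bsub>F\<^esub>k\<in>(\<lambda>i. i - ?d J H) ` ?I. component F (u J H) k)"
        by (intro sum E.M.grade_closed[OF E.M.component_in_grade[OF uc]])
      also have "\<dots> = u J H"
      proof (rule E.M.finsum_component_superset[OF uc])
        show "{k. component F (u J H) k \<noteq> \<zero>\<^bsub>F\<^esub>} \<subseteq> (\<lambda>i. i - ?d J H) ` ?I"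
        proof
          fix k assume "k \<in> {k. component F (u J H) k \<noteq> \<zero>\<^bsub>F\<^esub>}"
          then have nz: "?c (k + ?d J H) J H \<noteq> \<zero>\<^bsub>F\<^esub>" by simp
          have "?c (k + ?d J H) \<noteq> (\<lambda>J H. \<zero>\<^bsub>F\<^esub>)"
          proof
            assume "?c (k + ?d J H) = (\<lambda>J H. \<zero>\<^bsub>F\<^esub>)"
            from fun_cong[OF fun_cong[OF this, of J], of H] nz show False by blast
          qed
          then have "k + ?d J H \<in> ?I" unfolding UE_simps(1) by blast
          then show "k \<in> (\<lambda>i. i - ?d J H) ` ?I" by (rule image_eqI[rotated]) simp
        qed
      qed (use fin in simp)
      finally show ?thesis .
    qed
    then have "finsum U ?c ?I = u" by (intro ext)
    then show "is_decomposition U u ?c" using fin cc by (simp add: is_decomposition_def)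
  next
    fix c assume c: "is_decomposition U u c"
    let ?I = "{i. c i \<noteq> \<zero>\<^bsub>U\<^esub>}"
    from c have cg: "\<And>i. c i \<in> grade U i" and cf: "finite ?I" and cu: "u = finsum U c ?I"
      by (auto simp: is_decomposition_def)
    have ccl: "c i \<in> carrier U" for i using cg by (simp add: UE_simps(3))
    have "c i J H = ?c i J H" for i J H
    proof -
      have cgJH: "c i J H \<in> grade F (i - ?d J H)" for i using cg[of i] by (simp add: UE_simps(3) algebra_simps)
      let ?g = "\<lambda>k. c (k + ?d J H) J H"
      have gg: "?g k \<in> grade F k" for k using cgJH[of "k + ?d J H"] by simp
      have "u J H = (\<Oplus>\<^bsub>F\<^esub>i\<in>?I. ?g (i - ?d J H))"
        using arg_cong[OF cu, of "\<lambda>u. u J H"] ccl by (simp add: UE_finsum_eval)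
      also have "\<dots> = (\<Oplus>\<^bsub>F\<^esub>k\<in>(\<lambda>i. i - ?d J H) ` ?I. ?g k)"
        by (rule sum) (rule E.M.grade_closed[OF gg])
      finally have "component F (u J H) = (\<lambda>k. if k \<in> (\<lambda>i. i - ?d J H) ` ?I then ?g k else \<zero>\<^bsub>F\<^esub>)"
        using E.M.component_finsum[of "(\<lambda>i. i - ?d J H) ` ?I" ?g] cf gg by simp
      moreover have "c i J H = \<zero>\<^bsub>F\<^esub>" if "i - ?d J H \<notin> (\<lambda>i. i - ?d J H) ` ?I"
      proof -
        have "c i = \<zero>\<^bsub>U\<^esub>" using that by blast
        then show ?thesis by (simp add: UE_simps)
      qed
      ultimately show ?thesis by auto
    qed
    then show "c = ?c" by (intro ext)
  qed
qed

lemma diff_terms_closed: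
  assumes u: "u \<in> carrier U"
  shows "j < n \<Longrightarrow> act F (const (f j)) (u J H) \<in> carrier F" "diff F (u J H) \<in> carrier F"
    "i < n \<Longrightarrow> lam i (u J H) \<in> carrier F" "u J H \<in> carrier F"
  using UE_closed[OF u] f_closed by (auto intro: const_act_closed E.M.diff_closed lam_closed)

lemma UE_diff_value_closed:
  assumes u: "u \<in> carrier U"
  shows "diff U u J H \<in> carrier F"
  unfolding UE_diff using diff_terms_closed[OF u]
  by (intro E.M.minus_closed E.M.a_closed E.M.finsum_closed) auto

lemma UE_diff_zero:
  assumes "\<And>j. j \<in> {..<n} - J \<Longrightarrow> u (insert j J) H = \<zero>\<^bsub>F\<^esub>" "u J H = \<zero>\<^bsub>F\<^esub>"
    "\<And>i. i < n \<Longrightarrow> u J (add_mset i H) = \<zero>\<^bsub>F\<^esub>" "\<And>i. i \<in> J \<Longrightarrow> u (J - {i}) (add_mset i H) = \<zero>\<^bsub>F\<^esub>"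
  shows "diff U u J H = \<zero>\<^bsub>F\<^esub>"
proof -
  have "(\<Oplus>\<^bsub>F\<^esub>j\<in>{..<n} - J. signed F (inversions {j} J) (act F (const (f j)) (u (insert j J) H))) = \<zero>\<^bsub>F\<^esub>"
    using assms(1) by (intro E.M.finsum_all_zero) (auto simp: const_act_zero[OF f_closed])
  moreover have "(\<Oplus>\<^bsub>F\<^esub>i\<in>{..<n}. signed F (int (card J)) (lam i (u J (add_mset i H)))) = \<zero>\<^bsub>F\<^esub>"
    using assms(3) by (intro E.M.finsum_all_zero) (auto simp: lam_zero)
  moreover have "(\<Oplus>\<^bsub>F\<^esub>i\<in>J. signed F (inversions {i} (J - {i})) (u (J - {i}) (add_mset i H))) = \<zero>\<^bsub>F\<^esub>"
    using assms(4) by (intro E.M.finsum_all_zero) auto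
  ultimately show ?thesis by (simp add: UE_diff assms(2) E.M.diff_zero a_minus_def)
qed

lemma UE_diff_zero_outside:
  assumes u: "u \<in> carrier U" and JH: "\<not> (J \<subseteq> {..<n} \<and> set_mset H \<subseteq> {..<n})"
  shows "diff U u J H = \<zero>\<^bsub>F\<^esub>"
proof -
  have "u (insert j J) H = \<zero>\<^bsub>F\<^esub>" "u J H = \<zero>\<^bsub>F\<^esub>" "u J (add_mset i H) = \<zero>\<^bsub>F\<^esub>"
    "u (J - {i}) (add_mset i H) = \<zero>\<^bsub>F\<^esub>" for i j
    using JH by (auto intro!: UE_zero[OF u])
  then show ?thesis by (rule UE_diff_zero)
qed

lemma UE_diff_closed:
  assumes u: "u \<in> carrier U"
  shows "diff U u \<in> carrier U"
proof (rule UE_I)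
  \<comment> \<open>The positions that the four summands of the differential can reach from the
    support of \<open>u\<close>.\<close>
  let ?S = "(\<lambda>((J, H), j). (J - {j}, H)) ` (supp u \<times> {..<n}) \<union> supp u \<union>
    (\<lambda>((J, H), i). (J, H - {#i#})) ` (supp u \<times> {..<n}) \<union>
    (\<lambda>((J, H), i). (insert i J, H - {#i#})) ` (supp u \<times> {..<n})"
  show "finite ?S" using UE_finite[OF u] by simp
  show "(J, H) \<in> ?S" if "diff U u J H \<noteq> \<zero>\<^bsub>F\<^esub>" for J H
  proof (rule ccontr)
    assume n: "(J, H) \<notin> ?S"
    have 1: "u (insert j J) H = \<zero>\<^bsub>F\<^esub>" if "j \<in> {..<n} - J" for j
    proof (rule ccontr)
      assume "u (insert j J) H \<noteq> \<zero>\<^bsub>F\<^esub>"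
      then have "((insert j J, H), j) \<in> supp u \<times> {..<n}" using that by simp
      moreover have "(J, H) = (\<lambda>((J, H), j). (J - {j}, H)) ((insert j J, H), j)" using that by auto
      ultimately show False using n by blast
    qed
    have 2: "u J H = \<zero>\<^bsub>F\<^esub>" using n by auto
    have 3: "u J (add_mset i H) = \<zero>\<^bsub>F\<^esub>" if "i < n" for i
    proof (rule ccontr)
      assume "u J (add_mset i H) \<noteq> \<zero>\<^bsub>F\<^esub>"
      then have "((J, add_mset i H), i) \<in> supp u \<times> {..<n}" using that by simp
      moreover have "(J, H) = (\<lambda>((J, H), i). (J, H - {#i#})) ((J, add_mset i H), i)" by auto
      ultimately show False using n by blast
    qed
    have 4: "u (J - {i}) (add_mset i H) = \<zero>\<^bsub>F\<^esub>" if "i \<in> J" for i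
    proof (rule ccontr)
      assume nz: "u (J - {i}) (add_mset i H) \<noteq> \<zero>\<^bsub>F\<^esub>"
      then have "i < n" using UE_zero[OF u, of "J - {i}" "add_mset i H"] by auto
      then have "((J - {i}, add_mset i H), i) \<in> supp u \<times> {..<n}" using nz by simp
      moreover have "(J, H) = (\<lambda>((J, H), i). (insert i J, H - {#i#})) ((J - {i}, add_mset i H), i)" using that by auto
      ultimately show False using n by blast
    qed
    have "diff U u J H = \<zero>\<^bsub>F\<^esub>"
      using 1 2 3 4 by (rule UE_diff_zero)
    with that show False by simp
  qed
qed (use UE_diff_value_closed[OF u] UE_diff_zero_outside[OF u] in auto)

lemma UE_graded_diff_group: "graded_diff_group U"
proof (intro graded_diff_group.intro graded_diff_group_axioms.intro UE_graded_group UE_diff_closed)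
  fix u i assume ui: "u \<in> grade U i"
  then have u: "u \<in> carrier U" and g: "\<And>J H. u J H \<in> grade F (i - int (card J) - 2 * int (size H))"
    by (auto simp: UE_simps(3))
  have "diff U u J H \<in> grade F (i - 1 - int (card J) - 2 * int (size H))" for J H
  proof (cases "J \<subseteq> {..<n} \<and> set_mset H \<subseteq> {..<n}")
    case True
    then have fJ: "finite J" using finite_subset by blast
    have 1: "u (insert j J) H \<in> grade F (i - 1 - int (card J) - 2 * int (size H))" if "j \<in> {..<n} - J" for j
      using g[of "insert j J" H] fJ that by (simp add: algebra_simps)
    have 2: "diff F (u J H) \<in> grade F (i - 1 - int (card J) - 2 * int (size H))"
      using E.M.diff_grade[OF g[of J H]] by (simp add: algebra_simps)
    have 3: "lam k (u J (add_mset k H)) \<in> grade F (i - 1 - int (card J) - 2 * int (size H))" if "k < n" for k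
      using lam_grade[OF that g[of J "add_mset k H"]] by (simp add: algebra_simps)
    have 4: "u (J - {k}) (add_mset k H) \<in> grade F (i - 1 - int (card J) - 2 * int (size H))" if "k \<in> J" for k
    proof -
      have "int (card J) = int (card (J - {k})) + 1" using card_Suc_Diff1[OF fJ that] by simp
      then show ?thesis using g[of "J - {k}" "add_mset k H"] by (simp add: algebra_simps)
    qed
    show ?thesis
      unfolding UE_diff
      using 1 2 3 4 f_closed
      by (intro E.M.grade_minus E.M.grade_add E.M.grade_finsum E.M.grade_signed const_act_grade) auto
  next
    case False
    then show ?thesis using UE_diff_zero_outside[OF u] by simp
  qed
  then show "diff U u \<in> grade U (i - 1)" using UE_diff_closed[OF u] by (simp add: UE_simps(3))
next
  fix u v assume u: "u \<in> carrier U" and v: "v \<in> carrier U"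
  note cu = diff_terms_closed[OF u] and cv = diff_terms_closed[OF v]
  show "diff U (u \<oplus>\<^bsub>U\<^esub> v) = diff U u \<oplus>\<^bsub>U\<^esub> diff U v"
  proof (intro ext)
    fix J H
    have A: "(\<Oplus>\<^bsub>F\<^esub>j\<in>{..<n} - J. signed F (inversions {j} J) (act F (const (f j)) (u (insert j J) H \<oplus>\<^bsub>F\<^esub> v (insert j J) H)))
      = (\<Oplus>\<^bsub>F\<^esub>j\<in>{..<n} - J. signed F (inversions {j} J) (act F (const (f j)) (u (insert j J) H)))
        \<oplus>\<^bsub>F\<^esub> (\<Oplus>\<^bsub>F\<^esub>j\<in>{..<n} - J. signed F (inversions {j} J) (act F (const (f j)) (v (insert j J) H)))"
      using cu cv by (intro E.M.finsum_add_cong) (auto simp: E.act_r_distr[OF const_closed[OF f_closed]] E.M.signed_add)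
    have B: "(\<Oplus>\<^bsub>F\<^esub>i\<in>{..<n}. signed F (int (card J)) (lam i (u J (add_mset i H) \<oplus>\<^bsub>F\<^esub> v J (add_mset i H))))
      = (\<Oplus>\<^bsub>F\<^esub>i\<in>{..<n}. signed F (int (card J)) (lam i (u J (add_mset i H))))
        \<oplus>\<^bsub>F\<^esub> (\<Oplus>\<^bsub>F\<^esub>i\<in>{..<n}. signed F (int (card J)) (lam i (v J (add_mset i H))))"
      using cu cv by (intro E.M.finsum_add_cong) (auto simp: lam_add E.M.signed_add)
    have C: "(\<Oplus>\<^bsub>F\<^esub>i\<in>J. signed F (inversions {i} (J - {i})) (u (J - {i}) (add_mset i H) \<oplus>\<^bsub>F\<^esub> v (J - {i}) (add_mset i H)))
      = (\<Oplus>\<^bsub>F\<^esub>i\<in>J. signed F (inversions {i} (J - {i})) (u (J - {i}) (add_mset i H)))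
        \<oplus>\<^bsub>F\<^esub> (\<Oplus>\<^bsub>F\<^esub>i\<in>J. signed F (inversions {i} (J - {i})) (v (J - {i}) (add_mset i H)))"
      using cu cv by (intro E.M.finsum_add_cong) (auto simp: E.M.signed_add)
    have cl: "(\<Oplus>\<^bsub>F\<^esub>j\<in>{..<n} - J. signed F (inversions {j} J) (act F (const (f j)) (w (insert j J) H))) \<in> carrier F"
      "(\<Oplus>\<^bsub>F\<^esub>i\<in>{..<n}. signed F (int (card J)) (lam i (w J (add_mset i H)))) \<in> carrier F"
      "(\<Oplus>\<^bsub>F\<^esub>i\<in>J. signed F (inversions {i} (J - {i})) (w (J - {i}) (add_mset i H))) \<in> carrier F"
      "signed F (int (card J)) (diff F (w J H)) \<in> carrier F"
      if "w \<in> carrier U" for w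
      using diff_terms_closed[OF that] by (auto intro!: E.M.finsum_closed)
    show "diff U (u \<oplus>\<^bsub>U\<^esub> v) J H = (diff U u \<oplus>\<^bsub>U\<^esub> diff U v) J H"
      unfolding UE_diff UE_simps(2) A B C
      using cl[OF u] cl[OF v] cu cv
      by (simp add: E.M.diff_add E.M.signed_add a_minus_def E.M.minus_add E.M.a_ac)
  qed
qed

lemma UE_act_closed:
  assumes e: "e \<in> carrier KE" and u: "u \<in> carrier U"
  shows "act U e u \<in> carrier U"
proof (rule UE_I)
  have eQ: "e K \<in> carrier Q" for K using e by (simp add: koszul_simps)
  have e0: "e K = \<zero>\<^bsub>Q\<^esub>" if "\<not> K \<subseteq> {..<n}" for K using e that by (simp add: koszul_simps)
  note uc = UE_closed[OF u]
  let ?S = "(\<lambda>(K, (J, H)). (K \<union> J, H)) ` (Pow {..<n} \<times> supp u)"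
  show "act U e u J H \<in> carrier F" for J H
    using eQ uc by (auto simp: UE_simps intro!: E.M.finsum_closed const_act_closed)
  show "finite ?S" using UE_finite[OF u] by simp
  have ex: "\<exists>K. K \<subseteq> J \<and> K \<subseteq> {..<n} \<and> u (J - K) H \<noteq> \<zero>\<^bsub>F\<^esub>" if nz: "act U e u J H \<noteq> \<zero>\<^bsub>F\<^esub>" for J H
  proof (rule ccontr)
    assume "\<not> (\<exists>K. K \<subseteq> J \<and> K \<subseteq> {..<n} \<and> u (J - K) H \<noteq> \<zero>\<^bsub>F\<^esub>)"
    then have "act F (const (e K)) (u (J - K) H) = \<zero>\<^bsub>F\<^esub>" if "K \<subseteq> J" for K
      using that e0[of K] const_act_zero[OF eQ, of K] zero_const_act uc by (cases "K \<subseteq> {..<n}") auto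
    then have "act U e u J H = \<zero>\<^bsub>F\<^esub>" unfolding UE_simps(4) by (intro E.M.finsum_all_zero) auto
    with nz show False by simp
  qed
  show "(J, H) \<in> ?S" if "act U e u J H \<noteq> \<zero>\<^bsub>F\<^esub>" for J H
  proof -
    from ex[OF that] obtain K where "K \<subseteq> J" "K \<subseteq> {..<n}" "u (J - K) H \<noteq> \<zero>\<^bsub>F\<^esub>" by blast
    then have "(J, H) = (\<lambda>(K, (J, H)). (K \<union> J, H)) (K, (J - K, H))" "(K, (J - K, H)) \<in> Pow {..<n} \<times> supp u" by auto
    then show ?thesis by (rule image_eqI)
  qed
  show "act U e u J H = \<zero>\<^bsub>F\<^esub>" if "\<not> (J \<subseteq> {..<n} \<and> set_mset H \<subseteq> {..<n})" for J H
    using ex[of J H] UE_zero[OF u, of _ H] that by blast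
qed

lemma UE_op_closed:
  assumes s: "\<And>G. s G \<in> carrier Q" "finite {G. s G \<noteq> \<zero>\<^bsub>Q\<^esub>}" and u: "u \<in> carrier U"
  shows "UE_op Q F s u \<in> carrier U"
proof (rule UE_I)
  note uc = UE_closed[OF u]
  let ?S = "(\<lambda>(G, (J, H)). (J, H - G)) ` ({G. s G \<noteq> \<zero>\<^bsub>Q\<^esub>} \<times> supp u)"
  show "UE_op Q F s u J H \<in> carrier F" for J H
    using s uc by (auto simp: UE_op_def intro!: E.M.finsum_closed const_act_closed)
  show "finite ?S" using UE_finite[OF u] s by simp
  have ex: "\<exists>G. s G \<noteq> \<zero>\<^bsub>Q\<^esub> \<and> u J (H + G) \<noteq> \<zero>\<^bsub>F\<^esub>" if nz: "UE_op Q F s u J H \<noteq> \<zero>\<^bsub>F\<^esub>" for J H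
  proof (rule ccontr)
    assume "\<not> (\<exists>G. s G \<noteq> \<zero>\<^bsub>Q\<^esub> \<and> u J (H + G) \<noteq> \<zero>\<^bsub>F\<^esub>)"
    then have "UE_op Q F s u J H = \<zero>\<^bsub>F\<^esub>"
      unfolding UE_op_def using const_act_zero s by (intro E.M.finsum_all_zero) auto
    with nz show False by simp
  qed
  show "(J, H) \<in> ?S" if nz: "UE_op Q F s u J H \<noteq> \<zero>\<^bsub>F\<^esub>" for J H
  proof -
    from ex[OF that] obtain G where "s G \<noteq> \<zero>\<^bsub>Q\<^esub>" "u J (H + G) \<noteq> \<zero>\<^bsub>F\<^esub>" by blast
    then have "(J, H) = (\<lambda>(G, (J, H)). (J, H - G)) (G, (J, H + G))" "(G, (J, H + G)) \<in> {G. s G \<noteq> \<zero>\<^bsub>Q\<^esub>} \<times> supp u" by auto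
    then show ?thesis by (rule image_eqI)
  qed
  show "UE_op Q F s u J H = \<zero>\<^bsub>F\<^esub>" if "\<not> (J \<subseteq> {..<n} \<and> set_mset H \<subseteq> {..<n})" for J H
  proof (rule ccontr)
    assume "UE_op Q F s u J H \<noteq> \<zero>\<^bsub>F\<^esub>"
    from ex[OF this] obtain G where "u J (H + G) \<noteq> \<zero>\<^bsub>F\<^esub>" by blast
    then have "J \<subseteq> {..<n} \<and> set_mset (H + G) \<subseteq> {..<n}" using UE_zero[OF u] by blast
    with that show False by simp
  qed
qed

end

section \<open>The complex \<open>Hom\<^sub>E(U\<^sub>E(F), B)\<close>\<close>

lemma concentrated_dg_group:
  fixes M :: "('m, 'b) dg_scheme"
  assumes M: "abelian_group M" and g: "\<And>i. grade M i = (if i = 0 then carrier M else {\<zero>\<^bsub>M\<^esub>})"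
    and d: "\<And>x. diff M x = \<zero>\<^bsub>M\<^esub>"
  shows "dg_group M"
proof (intro dg_group.intro dg_group_axioms.intro M)
  interpret abelian_group M by fact
  show "additive_subgroup (grade M i) M" for i
    by (intro additive_subgroup.intro add.subgroupI) (auto simp: g)
  show "\<exists>!c. is_decomposition M x c" if x: "x \<in> carrier M" for x
  proof (rule ex1I)
    have "{i :: int. (if i = 0 then x else \<zero>\<^bsub>M\<^esub>) \<noteq> \<zero>\<^bsub>M\<^esub>} = (if x = \<zero>\<^bsub>M\<^esub> then {} else {0})" by auto
    then show "is_decomposition M x (\<lambda>i. if i = 0 then x else \<zero>\<^bsub>M\<^esub>)"
      using x by (auto simp: is_decomposition_def g)
  next
    fix c assume c: "is_decomposition M x c"
    then have z: "c i = \<zero>\<^bsub>M\<^esub>" if "i \<noteq> 0" for i using that by (auto simp: is_decomposition_def g split: if_splits)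
    have c0: "c 0 \<in> carrier M" using c by (auto simp: is_decomposition_def g split: if_splits)
    have "{i. c i \<noteq> \<zero>\<^bsub>M\<^esub>} = (if c 0 = \<zero>\<^bsub>M\<^esub> then {} else {0})"
      using z by (cases "c 0 = \<zero>\<^bsub>M\<^esub>") (auto, metis)
    then have "x = c 0" using c c0 by (auto simp: is_decomposition_def split: if_splits)
    then show "c = (\<lambda>i. if i = 0 then x else \<zero>\<^bsub>M\<^esub>)" using z by auto
  qed
qed (auto simp: g d abelian_monoid.zero_closed abelian_monoid.l_zero abelian_group.axioms(1)[OF M])

lemma inflation_simps:
  "carrier (inflation B \<phi>) = carrier B" "zero (inflation B \<phi>) = zero B" "add (inflation B \<phi>) = add B"
  "grade (inflation B \<phi>) i = (if i = 0 then carrier B else {\<zero>\<^bsub>B\<^esub>})" "diff (inflation B \<phi>) x = \<zero>\<^bsub>B\<^esub>"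
  "act (inflation B \<phi>) e b = \<phi> (e {}) \<otimes>\<^bsub>B\<^esub> b"
  by (simp_all add: inflation_def)

lemma inflation_group:
  "finsum (inflation B \<phi>) = finsum B" "a_inv (inflation B \<phi>) = a_inv B" "signed (inflation B \<phi>) = signed B"
  by (auto simp: finsum_def finprod_def a_inv_def m_inv_def inflation_def signed_def fun_eq_iff)

lemma inflation_abelian_group:
  assumes "abelian_group B" shows "abelian_group (inflation B \<phi>)"
proof -
  interpret abelian_group B by fact
  show ?thesis
  proof (rule abelian_groupI)
    fix x assume "x \<in> carrier (inflation B \<phi>)"
    then show "\<exists>y\<in>carrier (inflation B \<phi>). y \<oplus>\<^bsub>inflation B \<phi>\<^esub> x = \<zero>\<^bsub>inflation B \<phi>\<^esub>"
      by (intro bexI[of _ "\<ominus>\<^bsub>B\<^esub> x"]) (auto simp: inflation_simps l_neg)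
  qed (auto simp: inflation_simps a_ac)
qed

lemma inflation_dg_group: "abelian_group B \<Longrightarrow> dg_group (inflation B \<phi>)"
  by (rule concentrated_dg_group) (auto simp: inflation_simps inflation_abelian_group)

lemma inflation_dg_module:
  assumes Q: "dg_ring (degree_zero_ring Q)" and B: "cring B" and \<phi>: "\<phi> \<in> ring_hom Q B"
  shows "dg_module (degree_zero_ring Q) (restrict_scalars Q (inflation B \<phi>))"
proof -
  let ?N = "restrict_scalars Q (inflation B \<phi>)"
  interpret B: cring B by fact
  note s = restrict_scalars_simps inflation_simps degree_zero_ring_simps
  have [simp]: "\<phi> q \<in> carrier B" if "q \<in> carrier Q" for q using ring_hom_closed[OF \<phi> that] .
  have c: "kos_const Q q {} = q" for q by (simp add: kos_const_def)
  have "abelian_group ?N"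
  proof (rule abelian_groupI)
    fix x assume "x \<in> carrier ?N"
    then show "\<exists>y\<in>carrier ?N. y \<oplus>\<^bsub>?N\<^esub> x = \<zero>\<^bsub>?N\<^esub>"
      by (intro bexI[of _ "\<ominus>\<^bsub>B\<^esub> x"]) (auto simp: s B.l_neg)
  qed (auto simp: s B.a_ac)
  then have N: "dg_group ?N" by (rule concentrated_dg_group) (auto simp: s)
  interpret Q0: dg_ring "degree_zero_ring Q" by fact
  have z: "\<phi> \<zero>\<^bsub>Q\<^esub> = \<zero>\<^bsub>B\<^esub>"
  proof -
    have "\<phi> \<zero>\<^bsub>Q\<^esub> \<oplus>\<^bsub>B\<^esub> \<phi> \<zero>\<^bsub>Q\<^esub> = \<phi> \<zero>\<^bsub>Q\<^esub>"
      using ring_hom_add[OF \<phi>, of "\<zero>\<^bsub>Q\<^esub>" "\<zero>\<^bsub>Q\<^esub>"] Q0.zero_closed Q0.l_zero[OF Q0.zero_closed] by (simp add: s)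
    then show ?thesis using Q0.zero_closed by (intro B.add_idem_zero) (auto simp: s)
  qed
  show ?thesis
  proof (intro dg_module.intro dg_module_axioms.intro Q N)
    fix a i x j assume "a \<in> grade (degree_zero_ring Q) i" "x \<in> grade ?N j"
    then show "act ?N a x \<in> grade ?N (i + j)"
      using Q0.zero_closed by (auto simp: s c z split: if_splits)
  next
    fix a i x assume "a \<in> grade (degree_zero_ring Q) i" "x \<in> carrier ?N"
    moreover have "signed ?N i \<zero>\<^bsub>B\<^esub> = \<zero>\<^bsub>B\<^esub>" for i
      by (simp add: restrict_scalars_group inflation_group)
    ultimately show "diff ?N (act ?N a x) = act ?N (diff (degree_zero_ring Q) a) x \<oplus>\<^bsub>?N\<^esub> signed ?N i (act ?N a (diff ?N x))"
      using Q0.grade_closed[of a i] by (simp add: s c z)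
  qed (use \<phi> in \<open>auto simp: s c ring_hom_add ring_hom_mult ring_hom_one B.l_distr B.r_distr B.m_assoc\<close>)
qed

text \<open>Instantiated twice with the same \<open>F\<close>: with \<open>B\<close> the completion,
  where \<alpha> takes its values and the homotopy is produced, and with \<open>B\<close> the
  residue field, where Ext is computed. The homotopy lives on \<open>F\<close> alone and so passes
  from one instance to the other.\<close>

locale koszul_ext = koszul_module Q n f F + B: cring B
  for Q :: "('q, 'b) ring_scheme" and n f and F :: "(nat set \<Rightarrow> 'q, 'm, 'c) dgm_scheme"
    and B :: "('r, 'd) ring_scheme" and \<phi> :: "'q \<Rightarrow> 'r" +
  assumes \<phi>: "\<phi> \<in> ring_hom Q B" and \<phi>_f: "i < n \<Longrightarrow> \<phi> (f i) = \<zero>\<^bsub>B\<^esub>"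
begin

abbreviation "N \<equiv> inflation B \<phi>"
abbreviation "N0 \<equiv> restrict_scalars Q N"
abbreviation "Q0 \<equiv> degree_zero_ring Q"

lemmas N_simps = restrict_scalars_simps inflation_simps

sublocale N: dg_group N by (rule inflation_dg_group) (rule B.abelian_group_axioms)

sublocale N0: dg_module Q0 N0
  by (rule inflation_dg_module[OF dg_module.axioms(1)[OF restricted] B.cring_axioms \<phi>])

lemma \<phi>_closed: "q \<in> carrier Q \<Longrightarrow> \<phi> q \<in> carrier B"
  by (rule ring_hom_closed[OF \<phi>])

lemma \<phi>_zero: "\<phi> \<zero>\<^bsub>Q\<^esub> = \<zero>\<^bsub>B\<^esub>"
  using ring_hom_zero[OF \<phi> Q.ring_axioms B.ring_axioms] .

sublocale UN: hom_setting KE U N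
proof (intro hom_setting.intro graded_pair.intro hom_setting_axioms.intro UE_graded_diff_group N.graded_diff_group)
  fix e j u assume e: "e \<in> grade KE j"
  then have ec: "e \<in> carrier KE" by (simp add: koszul_simps(6))
  show "act U e u \<in> carrier U" if "u \<in> carrier U" by (rule UE_act_closed[OF ec that])
  have "e {} \<in> carrier Q" using ec by (simp add: koszul_simps(1))
  then show "additive_map N N (act N e)"
    by (auto simp: additive_map_def inflation_simps \<phi>_closed B.r_distr)
qed

text \<open>Coordinates on the part of degree \<open>d\<close> of the Hom complex out of
  \<open>U\<close>: the member at \<open>H\<close> is the restriction to y^(H) \<otimes> F, and 2|H|
  is the degree of y^(H).\<close>

definition fam :: "int \<Rightarrow> (nat multiset \<Rightarrow> 'm \<Rightarrow> 'r) set" where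
  "fam d = {\<psi>. \<forall>H. \<psi> H \<in> hom_degree Q0 F0 N0 (d + 2 * int (size H))}"

lemma famD: "\<psi> \<in> fam d \<Longrightarrow> \<psi> H \<in> hom_degree Q0 F0 N0 (d + 2 * int (size H))"
  by (simp add: fam_def)

lemma fam_closed: "\<psi> \<in> fam d \<Longrightarrow> x \<in> carrier F \<Longrightarrow> \<psi> H x \<in> carrier B"
  using graded_map_closed[OF hom_degree_graded_map[OF famD], of \<psi> d x H] by (simp add: N_simps)

lemma fam_additive: "\<psi> \<in> fam d \<Longrightarrow> additive_map F N (\<psi> H)"
  using graded_map_additive[OF hom_degree_graded_map[OF famD], of \<psi> d H] by (simp add: N_simps additive_map_def)

lemma fam_additive0: "\<psi> \<in> fam d \<Longrightarrow> additive_map F0 N0 (\<psi> H)"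
  using graded_map_additive[OF hom_degree_graded_map[OF famD]] .

lemma fam_zero: "\<psi> \<in> fam d \<Longrightarrow> \<psi> H \<zero>\<^bsub>F\<^esub> = \<zero>\<^bsub>B\<^esub>"
  using additive_map_zero[OF E.M.abelian_group_axioms N.abelian_group_axioms fam_additive] by (simp add: N_simps)

lemma fam_linear: "\<psi> \<in> fam d \<Longrightarrow> q \<in> carrier Q \<Longrightarrow> x \<in> carrier F \<Longrightarrow> \<psi> H (act F (const q) x) = \<phi> q \<otimes>\<^bsub>B\<^esub> \<psi> H x"
  using hom_degree_linear[OF famD, of \<psi> d q x H] by (simp add: N_simps) (simp add: kos_const_def)

lemma fam_grade: "\<psi> \<in> fam d \<Longrightarrow> x \<in> grade F j \<Longrightarrow> \<psi> H x \<in> grade N (d + 2 * int (size H) + j)"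
  using graded_map_grade[OF hom_degree_graded_map[OF famD], of \<psi> d x j H] by (simp add: restrict_scalars_simps)

text \<open>The \<open>E\<close>-linear map determined by a family. Only the row with
  \<open>J\<close> empty appears, because \<xi>_J with J nonempty acts as zero on
  \<open>N\<close>.\<close>

definition ext :: "(nat multiset \<Rightarrow> 'm \<Rightarrow> 'r) \<Rightarrow> (nat set \<Rightarrow> nat multiset \<Rightarrow> 'm) \<Rightarrow> 'r" where
  "ext \<psi> = (\<lambda>u\<in>carrier U. \<Oplus>\<^bsub>N\<^esub>H\<in>{H. u {} H \<noteq> \<zero>\<^bsub>F\<^esub>}. \<psi> H (u {} H))"

lemma finite_row: "u \<in> carrier U \<Longrightarrow> finite {H. u J H \<noteq> \<zero>\<^bsub>F\<^esub>}"
proof -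
  assume u: "u \<in> carrier U"
  have "{H. u J H \<noteq> \<zero>\<^bsub>F\<^esub>} \<subseteq> snd ` supp u" by force
  then show ?thesis using UE_finite[OF u] finite_subset by blast
qed

lemma ext_superset:
  assumes \<psi>: "\<psi> \<in> fam d" and u: "u \<in> carrier U" and W: "finite W" "{H. u {} H \<noteq> \<zero>\<^bsub>F\<^esub>} \<subseteq> W"
  shows "ext \<psi> u = (\<Oplus>\<^bsub>N\<^esub>H\<in>W. \<psi> H (u {} H))"
proof -
  have "(\<Oplus>\<^bsub>N\<^esub>H\<in>W. \<psi> H (u {} H)) = (\<Oplus>\<^bsub>N\<^esub>H\<in>{H. u {} H \<noteq> \<zero>\<^bsub>F\<^esub>}. \<psi> H (u {} H))"
    using W fam_closed[OF \<psi> UE_closed[OF u]] fam_zero[OF \<psi>]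
    by (intro N.finsum_neutral_cong) (auto simp: inflation_simps)
  then show ?thesis using u by (simp add: ext_def)
qed

lemma ext_closed: "\<psi> \<in> fam d \<Longrightarrow> u \<in> carrier U \<Longrightarrow> ext \<psi> u \<in> carrier N"
  unfolding ext_def using fam_closed[OF _ UE_closed] by (simp, intro N.finsum_closed) (auto simp: inflation_simps(1))

lemma ext_single:
  assumes "\<psi> \<in> fam d" "x \<in> carrier F" "set_mset H \<subseteq> {..<n}"
  shows "ext \<psi> (single {} H x) = \<psi> H x"
proof -
  have "{H'. single {} H x {} H' \<noteq> \<zero>\<^bsub>F\<^esub>} \<subseteq> {H}" by (auto simp: single_def split: if_splits)
  then have "ext \<psi> (single {} H x) = (\<Oplus>\<^bsub>N\<^esub>H'\<in>{H}. \<psi> H' (single {} H x {} H'))"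
    using single_closed[OF assms(2) _ assms(3), of "{}"] by (intro ext_superset[OF assms(1)]) auto
  then show ?thesis using fam_closed[OF assms(1,2), of H] by (simp add: single_def inflation_simps)
qed

lemma ext_hom_degree:
  assumes \<psi>: "\<psi> \<in> fam d"
  shows "ext \<psi> \<in> hom_degree KE U N d"
proof (rule UN.hom_degreeI)
  note c = fam_closed[OF \<psi> UE_closed]
  show "ext \<psi> \<in> graded_map U N d"
  proof (rule graded_mapI)
    show "additive_map U N (ext \<psi>)"
      unfolding additive_map_def
    proof (intro conjI ballI)
      show "ext \<psi> \<in> carrier U \<rightarrow> carrier N" using ext_closed[OF \<psi>] by blast
      fix u v assume u: "u \<in> carrier U" and v: "v \<in> carrier U"
      let ?W = "{H. u {} H \<noteq> \<zero>\<^bsub>F\<^esub>} \<union> {H. v {} H \<noteq> \<zero>\<^bsub>F\<^esub>}"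
      have fW: "finite ?W" using finite_row u v by blast
      have "ext \<psi> (u \<oplus>\<^bsub>U\<^esub> v) = (\<Oplus>\<^bsub>N\<^esub>H\<in>?W. \<psi> H ((u \<oplus>\<^bsub>U\<^esub> v) {} H))"
        by (rule ext_superset[OF \<psi> UG.a_closed[OF u v] fW]) (auto simp: UE_simps)
      also have "\<dots> = (\<Oplus>\<^bsub>N\<^esub>H\<in>?W. \<psi> H (u {} H)) \<oplus>\<^bsub>N\<^esub> (\<Oplus>\<^bsub>N\<^esub>H\<in>?W. \<psi> H (v {} H))"
        using c u v UE_closed additive_map_add[OF fam_additive[OF \<psi>]]
        by (intro N.finsum_add_cong) (auto simp: UE_simps inflation_simps)
      also have "\<dots> = ext \<psi> u \<oplus>\<^bsub>N\<^esub> ext \<psi> v"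
        using ext_superset[OF \<psi> u fW] ext_superset[OF \<psi> v fW] by simp
      finally show "ext \<psi> (u \<oplus>\<^bsub>U\<^esub> v) = ext \<psi> u \<oplus>\<^bsub>N\<^esub> ext \<psi> v" .
    qed
    fix u j assume u: "u \<in> grade U j"
    then have "u J H \<in> grade F (j - int (card J) - 2 * int (size H))" for J H by (simp add: UE_simps(3))
    from this[of "{}"] have ug: "u {} H \<in> grade F (j - 2 * int (size H))" for H by simp
    have "\<psi> H (u {} H) \<in> grade N (d + j)" for H using fam_grade[OF \<psi> ug[of H], of H] by (simp add: algebra_simps)
    then show "ext \<psi> u \<in> grade N (d + j)" using u by (simp add: ext_def UE_simps(3) N.grade_finsum)
  qed (simp add: ext_def)
  fix j e u assume e: "e \<in> grade KE j" and u: "u \<in> carrier U"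
  have ec: "e \<in> carrier KE" and e0: "j \<noteq> 0 \<Longrightarrow> e {} = \<zero>\<^bsub>Q\<^esub>" using e by (auto simp: koszul_simps(6))
  have eQ: "e {} \<in> carrier Q" using ec by (simp add: koszul_simps(1))
  have act: "act U e u {} H = act F (const (e {})) (u {} H)" for H
    using UE_closed[OF u] eQ by (simp add: UE_simps signed_def const_act_closed)
  have au: "act U e u \<in> carrier U" by (rule UE_act_closed[OF ec u])
  let ?W = "{H. u {} H \<noteq> \<zero>\<^bsub>F\<^esub>}"
  have "ext \<psi> (act U e u) = (\<Oplus>\<^bsub>N\<^esub>H\<in>?W. \<psi> H (act U e u {} H))"
    by (rule ext_superset[OF \<psi> au finite_row[OF u]]) (auto simp: act const_act_zero[OF eQ])
  also have "\<dots> = (\<Oplus>\<^bsub>N\<^esub>H\<in>?W. act N e (\<psi> H (u {} H)))"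
    using UE_closed[OF u] by (simp add: act fam_linear[OF \<psi> eQ] inflation_simps)
  also have "\<dots> = act N e (ext \<psi> u)"
    using additive_map_finsum[OF N.abelian_group_axioms N.abelian_group_axioms UN.act_N[OF e], of "\<lambda>H. \<psi> H (u {} H)" ?W] c u
    by (simp add: ext_def inflation_simps Pi_iff)
  also have "\<dots> = signed N (d * j) (act N e (ext \<psi> u))"
  proof (cases "j = 0")
    case False
    then have "act N e (ext \<psi> u) = \<zero>\<^bsub>N\<^esub>" using e0 ext_closed[OF \<psi> u] by (simp add: inflation_simps \<phi>_zero)
    then show ?thesis by simp
  qed (simp add: signed_def)
  finally show "ext \<psi> (act U e u) = signed N (d * j) (act N e (ext \<psi> u))" .
qed

text \<open>If, as seen by \<psi>, the row J = {} of \<open>v\<close> arises from that of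
  \<open>u\<close> by applying \<Sum> b(G) \<chi>^G, the operator can be moved across the pairing
  and composed with \<psi>. The double sum over (H, G) is reindexed by H + G and H. Both the
  differential of \<open>U\<close> and the action of operators have this shape.\<close>

lemma ext_pairing:
  assumes \<psi>: "\<psi> \<in> fam d" and u: "u \<in> carrier U" and v: "v \<in> carrier U" and S: "finite S"
    and conv: "conv F0 N0 \<psi> b \<in> fam d'"
    and b: "\<And>G x. x \<in> carrier F \<Longrightarrow> b G x \<in> carrier F" "\<And>G. b G \<zero>\<^bsub>F\<^esub> = \<zero>\<^bsub>F\<^esub>"
      "\<And>G x. x \<in> carrier F \<Longrightarrow> G \<notin> S \<Longrightarrow> b G x = \<zero>\<^bsub>F\<^esub>"
    and eq: "\<And>H. \<psi> H (v {} H) = (\<Oplus>\<^bsub>N\<^esub>G\<in>S. \<psi> H (b G (u {} (H + G))))"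
  shows "ext \<psi> v = ext (conv F0 N0 \<psi> b) u"
proof -
  note c = fam_closed[OF \<psi>] and uc = UE_closed[OF u] and z = fam_zero[OF \<psi>]
  \<comment> \<open>A finite set of multisets that contains both supports and is closed under
    submultisets, so that the reindexed sum stays inside it.\<close>
  define W where "W = (\<Union>H\<in>{H. u {} H \<noteq> \<zero>\<^bsub>F\<^esub>} \<union> {H. v {} H \<noteq> \<zero>\<^bsub>F\<^esub>}. {K. K \<subseteq># H})"
  have fW: "finite W" using finite_row[OF u] finite_row[OF v] by (auto simp: W_def finite_submultisets)
  have uW: "{H. u {} H \<noteq> \<zero>\<^bsub>F\<^esub>} \<subseteq> W" and vW: "{H. v {} H \<noteq> \<zero>\<^bsub>F\<^esub>} \<subseteq> W" by (auto simp: W_def)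
  have down: "K \<in> W" if "H \<in> W" "K \<subseteq># H" for H K
    using that subset_mset.order_trans unfolding W_def by blast
  define p where "p = (\<lambda>(H, G). \<psi> H (b G (u {} (H + G))))"
  define q where "q = (\<lambda>(H, K). \<psi> K (b (H - K) (u {} H)))"
  have pc: "p x \<in> carrier N" and qc: "q x \<in> carrier N" for x
    using c b uc by (auto simp: p_def q_def inflation_simps split: prod.splits)
  have "ext \<psi> v = (\<Oplus>\<^bsub>N\<^esub>H\<in>W. \<Oplus>\<^bsub>N\<^esub>G\<in>S. p (H, G))"
    unfolding ext_superset[OF \<psi> v fW vW] eq p_def by simp
  also have "\<dots> = finsum N p (W \<times> S)"
    using N.finsum_Sigma[OF fW, of "\<lambda>_. S" "\<lambda>H G. p (H, G)"] S pc by (simp add: case_prod_unfold)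
  also have "\<dots> = finsum N p {(H, G). H \<in> W \<and> G \<in> S \<and> H + G \<in> W}"
  proof (rule N.finsum_neutral_cong)
    fix x assume "x \<in> W \<times> S - {(H, G). H \<in> W \<and> G \<in> S \<and> H + G \<in> W}"
    then obtain H G where "x = (H, G)" "H + G \<notin> W" by auto
    moreover from this have "u {} (H + G) = \<zero>\<^bsub>F\<^esub>" using uW by blast
    ultimately show "p x = \<zero>\<^bsub>N\<^esub>" using b z by (simp add: p_def inflation_simps)
  qed (use fW S pc in auto)
  also have "\<dots> = finsum N q ((\<lambda>(H, G). (H + G, H)) ` {(H, G). H \<in> W \<and> G \<in> S \<and> H + G \<in> W})"
    using qc by (subst N.finsum_reindex) (auto simp: inj_on_def p_def q_def intro!: N.finsum_cong' c b uc simp: inflation_simps)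
  also have "(\<lambda>(H, G). (H + G, H)) ` {(H, G). H \<in> W \<and> G \<in> S \<and> H + G \<in> W} = {(H, K). H \<in> W \<and> K \<subseteq># H \<and> H - K \<in> S}"
  proof (intro equalityI subsetI)
    fix x assume "x \<in> {(H, K). H \<in> W \<and> K \<subseteq># H \<and> H - K \<in> S}"
    then obtain H K where x: "x = (H, K)" "H \<in> W" "K \<subseteq># H" "H - K \<in> S" by auto
    then have "(K, H - K) \<in> {(H, G). H \<in> W \<and> G \<in> S \<and> H + G \<in> W}" using down by simp
    moreover have "x = (\<lambda>(H, G). (H + G, H)) (K, H - K)" using x by simp
    ultimately show "x \<in> (\<lambda>(H, G). (H + G, H)) ` {(H, G). H \<in> W \<and> G \<in> S \<and> H + G \<in> W}" by (rule rev_image_eqI)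
  qed auto
  also have "finsum N q \<dots> = finsum N q (Sigma W (\<lambda>H. {K. K \<subseteq># H}))"
  proof (rule N.finsum_neutral_cong[symmetric])
    fix x assume "x \<in> Sigma W (\<lambda>H. {K. K \<subseteq># H}) - {(H, K). H \<in> W \<and> K \<subseteq># H \<and> H - K \<in> S}"
    then obtain H K where "x = (H, K)" "H - K \<notin> S" by auto
    then show "q x = \<zero>\<^bsub>N\<^esub>" using b(3)[OF uc] z by (simp add: q_def inflation_simps)
  qed (use fW qc finite_submultisets in auto)
  also have "\<dots> = (\<Oplus>\<^bsub>N\<^esub>H\<in>W. \<Oplus>\<^bsub>N\<^esub>K\<in>{K. K \<subseteq># H}. q (H, K))"
    using N.finsum_Sigma[OF fW, of "\<lambda>H. {K. K \<subseteq># H}" "\<lambda>H K. q (H, K)", OF finite_submultisets qc]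
    by (simp add: case_prod_unfold)
  also have "\<dots> = (\<Oplus>\<^bsub>N\<^esub>H\<in>W. conv F0 N0 \<psi> b H (u {} H))"
    using uc by (simp add: conv_apply restrict_scalars_simps restrict_scalars_group q_def)
  also have "\<dots> = ext (conv F0 N0 \<psi> b) u"
    by (rule ext_superset[OF conv u fW uW, symmetric])
  finally show ?thesis .
qed

lemma conv_delta_fam:
  assumes "\<psi> \<in> fam d" shows "conv F0 N0 \<psi> delta \<in> fam (d - 1)"
  using conv_hom_degree[OF restricted restricted N0.dg_module_axioms famD[OF assms] delta_hom_degree]
  by (simp add: fam_def)

text \<open>On the row J = {} the last sum of the differential is empty, and the terms with f_j die
  under \<psi> because \<phi> kills f_j; \<partial> and the \<chi>_i \<lambda>_i remain, which make
  up \<delta>.\<close>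

lemma ext_diff:
  assumes \<psi>: "\<psi> \<in> fam d" and u: "u \<in> carrier U"
  shows "ext \<psi> (diff U u) = ext (conv F0 N0 \<psi> delta) u"
proof (rule ext_pairing[OF \<psi> u UE_diff_closed[OF u] _ conv_delta_fam[OF \<psi>] delta_closed delta_at_zero])
  \<comment> \<open>The multisets at which \<delta> can be nonzero.\<close>
  let ?S = "insert {#} ((\<lambda>i. {#i#}) ` {..<n})"
  show "finite ?S" by simp
  show "delta G x = \<zero>\<^bsub>F\<^esub>" if "x \<in> carrier F" "G \<notin> ?S" for G x
    using that by (intro delta_zero) auto
  fix H
  note uc = UE_closed[OF u] and c = fam_closed[OF \<psi>] and add = fam_additive[OF \<psi>]
  note sum = additive_map_finsum[OF E.M.abelian_group_axioms N.abelian_group_axioms add]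
  define A where "A = (\<Oplus>\<^bsub>F\<^esub>j\<in>{..<n}. act F (const (f j)) (u {j} H))"
  define C where "C = (\<Oplus>\<^bsub>F\<^esub>i\<in>{..<n}. lam i (u {} (add_mset i H)))"
  have Ac: "A \<in> carrier F" and Cc: "C \<in> carrier F"
    using uc f_closed by (auto simp: A_def C_def intro!: E.M.finsum_closed const_act_closed lam_closed)
  have dc: "diff F (u {} H) \<in> carrier F" using uc E.M.diff_closed by blast
  have "\<psi> H A = (\<Oplus>\<^bsub>N\<^esub>j\<in>{..<n}. \<psi> H (act F (const (f j)) (u {j} H)))"
    unfolding A_def by (rule sum) (auto intro!: const_act_closed f_closed uc)
  also have "\<dots> = \<zero>\<^bsub>N\<^esub>"
    using uc c f_closed by (intro N.finsum_all_zero) (auto simp: fam_linear[OF \<psi>] \<phi>_f inflation_simps)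
  finally have 1: "\<psi> H A = \<zero>\<^bsub>N\<^esub>" .
  have 2: "\<psi> H C = (\<Oplus>\<^bsub>N\<^esub>i\<in>{..<n}. \<psi> H (lam i (u {} (add_mset i H))))"
    unfolding C_def by (rule sum) (auto intro!: lam_closed uc)
  have "diff U u {} H = A \<oplus>\<^bsub>F\<^esub> diff F (u {} H) \<oplus>\<^bsub>F\<^esub> C"
    using Ac Cc dc by (simp add: UE_diff A_def C_def signed_def a_minus_def)
  then have "\<psi> H (diff U u {} H) = \<psi> H (diff F (u {} H)) \<oplus>\<^bsub>N\<^esub> \<psi> H C"
    using Ac Cc dc 1 c by (simp add: additive_map_add[OF add] inflation_simps)
  moreover have "(\<Oplus>\<^bsub>N\<^esub>G\<in>?S. \<psi> H (delta G (u {} (H + G)))) =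
      \<psi> H (delta {#} (u {} (H + {#}))) \<oplus>\<^bsub>N\<^esub> (\<Oplus>\<^bsub>N\<^esub>G\<in>(\<lambda>i. {#i#}) ` {..<n}. \<psi> H (delta G (u {} (H + G))))"
    using c delta_closed uc by (intro N.finsum_insert) (auto simp: inflation_simps)
  moreover have "(\<Oplus>\<^bsub>N\<^esub>G\<in>(\<lambda>i. {#i#}) ` {..<n}. \<psi> H (delta G (u {} (H + G)))) =
      (\<Oplus>\<^bsub>N\<^esub>i\<in>{..<n}. \<psi> H (delta {#i#} (u {} (H + {#i#}))))"
    using c delta_closed uc by (intro N.finsum_reindex) (auto simp: inflation_simps inj_on_def)
  moreover have "(\<Oplus>\<^bsub>N\<^esub>i\<in>{..<n}. \<psi> H (delta {#i#} (u {} (H + {#i#})))) = \<psi> H C"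
    unfolding 2 using c uc lam_closed by (intro N.finsum_cong') (auto simp: inflation_simps delta_single)
  ultimately show "\<psi> H (diff U u {} H) = (\<Oplus>\<^bsub>N\<^esub>G\<in>?S. \<psi> H (delta G (u {} (H + G))))"
    using uc by (simp add: delta_empty)
qed

lemma hom_diff_ext:
  assumes \<psi>: "\<psi> \<in> fam d" and u: "u \<in> carrier U"
  shows "hom_diff U N (ext \<psi>) u = \<ominus>\<^bsub>N\<^esub> signed N d (ext (conv F0 N0 \<psi> delta) u)"
proof -
  have "diff N (ext \<psi> u) = \<zero>\<^bsub>N\<^esub>" by (simp add: inflation_simps)
  then have "hom_diff U N (ext \<psi>) u = \<zero>\<^bsub>N\<^esub> \<ominus>\<^bsub>N\<^esub> signed N d (ext (conv F0 N0 \<psi> delta) u)"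
    using UN.hom_diff_eq[OF hom_degree_graded_map[OF ext_hom_degree[OF \<psi>]] u] ext_diff[OF \<psi> u] by simp
  then show ?thesis
    using ext_closed[OF conv_delta_fam[OF \<psi>] u] by (simp add: a_minus_def)
qed

lemma basis_act_single:
  assumes "x \<in> carrier F" "q \<in> carrier Q"
  shows "act U (\<lambda>K. if K = J then q else \<zero>\<^bsub>Q\<^esub>) (single {} H x) J' H' =
    (if finite J' \<and> J' = J \<and> H' = H then act F (const q) x else \<zero>\<^bsub>F\<^esub>)"
proof -
  have sc: "single {} H x J'' H'' \<in> carrier F" for J'' H'' using assms by (simp add: single_def)
  show ?thesis
    unfolding UE_simps
    using sc assms zero_const_act const_act_closed const_act_zero[OF assms(2)]
    by (subst E.M.finsum_Pow_single[of _ J]) (auto simp: single_def signed_def)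
qed

text \<open>\<open>U\<close> is generated over \<open>E\<close> by the elements y^(H) \<otimes> x,
  so restricting \<eta> to these recovers it.\<close>

lemma hom_degree_ext:
  assumes \<eta>: "\<eta> \<in> hom_degree KE U N d"
  shows "\<exists>\<psi>\<in>fam d. \<eta> = ext \<psi>"
proof -
  note g = hom_degree_graded_map[OF \<eta>]
  \<comment> \<open>If \<open>H\<close> involves an index that is at least \<open>n\<close>, there
    is no y^(H) in \<open>U\<close>, and the coefficient is set to zero so that the family is
    defined at every multiset.\<close>
  define \<psi> where "\<psi> = (\<lambda>H. \<lambda>x\<in>carrier F. if set_mset H \<subseteq> {..<n} then \<eta> (single {} H x) else \<zero>\<^bsub>N\<^esub>)"
  have sc: "single {} H x \<in> carrier U" if "x \<in> carrier F" "set_mset H \<subseteq> {..<n}" for H x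
    using single_closed that by blast
  have "\<psi> H \<in> hom_degree Q0 F0 N0 (d + 2 * int (size H))" for H
  proof (cases "set_mset H \<subseteq> {..<n}")
    case False
    interpret h: hom_setting Q0 F0 N0 by (rule dg_module_setting[OF restricted N0.dg_module_axioms])
    have "\<psi> H = (\<lambda>x\<in>carrier F0. \<zero>\<^bsub>N0\<^esub>)" using False by (auto simp: \<psi>_def N_simps)
    then show ?thesis using h.zero_hom_degree by simp
  next
    case True
    show ?thesis
    proof (rule hom_degree_linearI[OF restricted N0.dg_module_axioms graded_mapI])
      have "single {} H (x \<oplus>\<^bsub>F\<^esub> y) = single {} H x \<oplus>\<^bsub>U\<^esub> single {} H y" for x y
        by (auto simp: single_def UE_simps fun_eq_iff)
      then show "additive_map F0 N0 (\<psi> H)"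
        using True sc graded_map_closed[OF g] UN.map_add[OF g] by (auto simp: additive_map_def \<psi>_def N_simps)
      show "\<psi> H x \<in> grade N0 (d + 2 * int (size H) + j)" if x: "x \<in> grade F0 j" for x j
      proof -
        have xc: "x \<in> carrier F" and xg: "x \<in> grade F j" using x E.M.grade_closed by (auto simp: restrict_scalars_simps)
        have "single {} H x \<in> grade U (j + 2 * int (size H))"
          using sc[OF xc True] xg by (auto simp: UE_simps(3)) (auto simp: single_def)
        from graded_map_grade[OF g this] show ?thesis
          using xc True by (simp add: \<psi>_def restrict_scalars_simps algebra_simps)
      qed
      show "\<psi> H \<in> extensional (carrier F0)" by (simp add: \<psi>_def restrict_scalars_simps)
      fix q x assume q: "q \<in> carrier Q" and "x \<in> carrier F0"
      then have x: "x \<in> carrier F" by (simp add: restrict_scalars_simps)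
      have "const q = (\<lambda>K. if K = {} then q else \<zero>\<^bsub>Q\<^esub>)" by (simp add: kos_const_def)
      then have "act U (const q) (single {} H x) J' H' = single {} H (act F (const q) x) J' H'" for J' H'
        by (simp only: basis_act_single[OF x q]) (auto simp: single_def)
      then have "act U (const q) (single {} H x) = single {} H (act F (const q) x)" by (intro HOL.ext)
      then have "\<eta> (single {} H (act F (const q) x)) = act N (const q) (\<eta> (single {} H x))"
        using UN.hom_degree_act[OF \<eta> const_grade[OF q] sc[OF x True]] by (simp add: signed_def)
      then show "\<psi> H (act F0 q x) = act N0 q (\<psi> H x)"
        using True x q by (simp add: \<psi>_def restrict_scalars_simps const_act_closed)
    qed
  qed
  then have \<psi>: "\<psi> \<in> fam d" by (simp add: fam_def)
  have "\<eta> u = ext \<psi> u" if u: "u \<in> carrier U" for u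
  proof -
    note uc = UE_closed[OF u] and fin = UE_finite[OF u]
    have ok: "J \<subseteq> {..<n} \<and> set_mset H \<subseteq> {..<n}" if "(J, H) \<in> supp u" for J H
      using that UE_zero[OF u] by blast
    have cl: "(\<lambda>(J, H). single J H (u J H)) p \<in> carrier U" if "p \<in> supp u" for p
      using that ok uc single_closed by (cases p) auto
    have dec: "u = finsum U (\<lambda>(J, H). single J H (u J H)) (supp u)"
    proof (intro HOL.ext)
      fix J H
      have "finsum U (\<lambda>(J, H). single J H (u J H)) (supp u) J H =
          (\<Oplus>\<^bsub>F\<^esub>p\<in>supp u. (case p of (J', H') \<Rightarrow> single J' H' (u J' H')) J H)"
        by (rule UE_finsum_eval[OF cl])
      also have "\<dots> = u J H"
      proof (cases "(J, H) \<in> supp u")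
        case True
        then show ?thesis using fin uc by (subst E.M.finsum_single[of _ "(J, H)"]) (auto simp: single_def split: if_splits)
      next
        case False
        then show ?thesis using uc by (subst E.M.finsum_all_zero) (auto simp: single_def split: if_splits)
      qed
      finally show "u J H = finsum U (\<lambda>(J, H). single J H (u J H)) (supp u) J H" by simp
    qed
    have "\<eta> u = (\<Oplus>\<^bsub>N\<^esub>p\<in>supp u. \<eta> (case p of (J, H) \<Rightarrow> single J H (u J H)))"
      by (subst dec, rule UN.map_finsum[OF g]) (use cl in auto)
    also have "\<dots> = (\<Oplus>\<^bsub>N\<^esub>p\<in>Pair {} ` {H. u {} H \<noteq> \<zero>\<^bsub>F\<^esub>}. \<eta> (case p of (J, H) \<Rightarrow> single J H (u J H)))"
    proof (rule N.finsum_neutral_cong[OF fin])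
      fix p assume p: "p \<in> supp u - Pair {} ` {H. u {} H \<noteq> \<zero>\<^bsub>F\<^esub>}"
      then obtain J H where JH: "p = (J, H)" "(J, H) \<in> supp u" by (cases p) auto
      with p have J: "J \<noteq> {}" by auto
      have fJ: "finite J" "J \<subseteq> {..<n}" "set_mset H \<subseteq> {..<n}" using ok[OF JH(2)] finite_subset by blast+
      \<comment> \<open>This is \<xi>_J. It carries y^(H) \<otimes> x to \<xi>_J \<otimes> y^(H)
        \<otimes> x and acts as zero on \<open>N\<close>, so \<eta> vanishes on all terms with J
        nonempty.\<close>
      let ?e = "\<lambda>K. if K = J then \<one>\<^bsub>Q\<^esub> else \<zero>\<^bsub>Q\<^esub>"
      have e: "?e \<in> grade KE (int (card J))" using fJ by (simp add: koszul_simps(1,6))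
      have one: "act F (const \<one>\<^bsub>Q\<^esub>) x = x" if "x \<in> carrier F" for x
        using F0.act_one[of x] that by (simp add: restrict_scalars_simps degree_zero_ring_simps)
      have "act U ?e (single {} H (u J H)) = single J H (u J H)"
        using basis_act_single[OF uc Q.one_closed, of J H J H] fJ one[OF uc]
        by (auto simp: fun_eq_iff basis_act_single[OF uc Q.one_closed] single_def)
      then have "\<eta> (single J H (u J H)) = signed N (d * int (card J)) (act N ?e (\<eta> (single {} H (u J H))))"
        using UN.hom_degree_act[OF \<eta> e sc[OF uc[of J H] fJ(3)]] by simp
      also have "act N ?e (\<eta> (single {} H (u J H))) = \<zero>\<^bsub>N\<^esub>"
        using J graded_map_closed[OF g sc[OF uc[of J H] fJ(3)]] by (simp add: inflation_simps \<phi>_zero)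
      finally show "\<eta> (case p of (J, H) \<Rightarrow> single J H (u J H)) = \<zero>\<^bsub>N\<^esub>" using JH by simp
    qed (use cl graded_map_closed[OF g] in auto)
    also have "\<dots> = (\<Oplus>\<^bsub>N\<^esub>H\<in>{H. u {} H \<noteq> \<zero>\<^bsub>F\<^esub>}. \<eta> (single {} H (u {} H)))"
      using cl graded_map_closed[OF g] by (subst N.finsum_reindex) (auto simp: inj_on_def)
    also have "\<dots> = (\<Oplus>\<^bsub>N\<^esub>H\<in>{H. u {} H \<noteq> \<zero>\<^bsub>F\<^esub>}. \<psi> H (u {} H))"
    proof (rule N.finsum_cong')
      fix H assume "H \<in> {H. u {} H \<noteq> \<zero>\<^bsub>F\<^esub>}"
      then show "\<eta> (single {} H (u {} H)) = \<psi> H (u {} H)" using ok[of "{}" H] uc by (simp add: \<psi>_def)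
    qed (use fam_closed[OF \<psi> uc] in \<open>auto simp: inflation_simps\<close>)
    finally show ?thesis using u by (simp add: ext_def)
  qed
  then have "\<eta> = ext \<psi>" using graded_map_ext[OF g] by (intro extensionalityI[of _ "carrier U"]) (auto simp: ext_def)
  with \<psi> show ?thesis by blast
qed

end

section \<open>Operators on Ext\<close>

lemma homology_simps:
  "zero (homology M) = boundaries M" "add (homology M) = set_add M" "diff (homology M) x = boundaries M"
  "carrier (homology M) = (\<lambda>z. boundaries M +>\<^bsub>M\<^esub> z) ` cycles M"
  "grade (homology M) i = (\<lambda>z. boundaries M +>\<^bsub>M\<^esub> z) ` (cycles M \<inter> grade M i)"
  "act (homology M) a X = boundaries M <+>\<^bsub>M\<^esub> act M a ` X"
  by (simp_all add: homology_def)

context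
  fixes M :: "('a, 'm, 'c) dgm_scheme"
  assumes M: "diff_group M"
begin

interpretation M: diff_group M by (rule M)
interpretation B: abelian_subgroup "boundaries M" M by (rule M.boundaries_subgroup)

lemma cycles_add: "z \<in> cycles M \<Longrightarrow> w \<in> cycles M \<Longrightarrow> z \<oplus>\<^bsub>M\<^esub> w \<in> cycles M"
  by (simp add: cycles_def M.diff_add)

lemma homology_add:
  "z \<in> cycles M \<Longrightarrow> w \<in> cycles M \<Longrightarrow>
     (boundaries M +>\<^bsub>M\<^esub> z) \<oplus>\<^bsub>homology M\<^esub> (boundaries M +>\<^bsub>M\<^esub> w) = boundaries M +>\<^bsub>M\<^esub> (z \<oplus>\<^bsub>M\<^esub> w)"
  by (simp add: homology_simps B.a_rcos_sum M.cycles_closed)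

lemma boundary_coset: "b \<in> boundaries M \<Longrightarrow> boundaries M +>\<^bsub>M\<^esub> b = boundaries M"
  by (rule B.a_rcos_const)

lemma zero_cycle: "\<zero>\<^bsub>M\<^esub> \<in> cycles M"
  by (simp add: cycles_def M.diff_zero)

lemma homology_abelian_group: "abelian_group (homology M)"
proof (rule abelian_groupI)
  have z: "\<zero>\<^bsub>homology M\<^esub> = boundaries M +>\<^bsub>M\<^esub> \<zero>\<^bsub>M\<^esub>" by (simp add: homology_simps boundary_coset)
  show "\<zero>\<^bsub>homology M\<^esub> \<in> carrier (homology M)"
    unfolding z by (simp add: homology_simps zero_cycle)
  fix X assume "X \<in> carrier (homology M)"
  then obtain x where x: "x \<in> cycles M" "X = boundaries M +>\<^bsub>M\<^esub> x" by (auto simp: homology_simps)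
  then show "\<zero>\<^bsub>homology M\<^esub> \<oplus>\<^bsub>homology M\<^esub> X = X"
    unfolding z using zero_cycle M.cycles_closed by (simp add: homology_add)
  have n: "\<ominus>\<^bsub>M\<^esub> x \<in> cycles M" using x by (simp add: cycles_def M.diff_neg)
  then have "(boundaries M +>\<^bsub>M\<^esub> \<ominus>\<^bsub>M\<^esub> x) \<oplus>\<^bsub>homology M\<^esub> X = \<zero>\<^bsub>homology M\<^esub>"
    unfolding z using x M.cycles_closed by (simp add: homology_add M.l_neg)
  then show "\<exists>Y\<in>carrier (homology M). Y \<oplus>\<^bsub>homology M\<^esub> X = \<zero>\<^bsub>homology M\<^esub>"
    using n by (intro bexI[of _ "boundaries M +>\<^bsub>M\<^esub> \<ominus>\<^bsub>M\<^esub> x"]) (auto simp: homology_simps)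
  fix Y assume "Y \<in> carrier (homology M)"
  then obtain y where y: "y \<in> cycles M" "Y = boundaries M +>\<^bsub>M\<^esub> y" by (auto simp: homology_simps)
  show "X \<oplus>\<^bsub>homology M\<^esub> Y = Y \<oplus>\<^bsub>homology M\<^esub> X"
    using x y M.cycles_closed by (simp add: homology_add M.a_comm)
  show "X \<oplus>\<^bsub>homology M\<^esub> Y \<in> carrier (homology M)"
    using x y cycles_add by (simp add: homology_add) (simp add: homology_simps)
  fix Z assume "Z \<in> carrier (homology M)"
  then obtain w where w: "w \<in> cycles M" "Z = boundaries M +>\<^bsub>M\<^esub> w" by (auto simp: homology_simps)
  show "X \<oplus>\<^bsub>homology M\<^esub> Y \<oplus>\<^bsub>homology M\<^esub> Z = X \<oplus>\<^bsub>homology M\<^esub> (Y \<oplus>\<^bsub>homology M\<^esub> Z)"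
    using x y w M.cycles_closed cycles_add by (simp add: homology_add M.a_assoc)
qed

lemma homology_finsum:
  assumes "finite I" "\<And>i. i \<in> I \<Longrightarrow> z i \<in> cycles M"
  shows "finsum (homology M) (\<lambda>i. boundaries M +>\<^bsub>M\<^esub> z i) I = boundaries M +>\<^bsub>M\<^esub> finsum M z I"
proof -
  interpret H: abelian_group "homology M" by (rule homology_abelian_group)
  have c: "(\<lambda>i. boundaries M +>\<^bsub>M\<^esub> z i) \<in> I \<rightarrow> carrier (homology M)"
    using assms by (auto simp: homology_simps)
  have "finsum M z I \<in> cycles M \<and> finsum (homology M) (\<lambda>i. boundaries M +>\<^bsub>M\<^esub> z i) I = boundaries M +>\<^bsub>M\<^esub> finsum M z I"
    using assms c
  proof (induction I)
    case empty
    have "\<zero>\<^bsub>M\<^esub> \<in> boundaries M" by (rule B.zero_closed)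
    then show ?case by (simp add: zero_cycle homology_simps(1) boundary_coset)
  next
    case (insert a I)
    then have IH: "finsum M z I \<in> cycles M"
      "finsum (homology M) (\<lambda>i. boundaries M +>\<^bsub>M\<^esub> z i) I = boundaries M +>\<^bsub>M\<^esub> finsum M z I" by auto
    have "finsum M z (insert a I) = z a \<oplus>\<^bsub>M\<^esub> finsum M z I"
      using insert M.cycles_closed by (intro M.finsum_insert) auto
    moreover have "finsum (homology M) (\<lambda>i. boundaries M +>\<^bsub>M\<^esub> z i) (insert a I) =
       (boundaries M +>\<^bsub>M\<^esub> z a) \<oplus>\<^bsub>homology M\<^esub> finsum (homology M) (\<lambda>i. boundaries M +>\<^bsub>M\<^esub> z i) I"
      using insert by (intro H.finsum_insert) auto
    ultimately show ?case using IH insert by (simp add: homology_add cycles_add)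
  qed
  then show ?thesis by simp
qed

text \<open>The action is applied to a whole coset, all of whose elements are cycles; therefore
  every cycle, not just one representative, has to be sent to a boundary.\<close>

lemma homology_act_zero:
  assumes x: "x \<in> carrier (homology M)" and s: "\<And>z. z \<in> cycles M \<Longrightarrow> act M s z \<in> boundaries M"
  shows "act (homology M) s x = \<zero>\<^bsub>homology M\<^esub>"
proof -
  obtain z where z: "z \<in> cycles M" "x = boundaries M +>\<^bsub>M\<^esub> z" using x by (auto simp: homology_simps)
  have "y \<in> cycles M" if "y \<in> x" for y
    using that z cycles_add M.boundaries_cycles by (auto simp: a_r_coset_def')
  then have sub: "act M s ` x \<subseteq> boundaries M" using s by auto
  have "z \<in> x" using z B.a_rcos_self M.cycles_closed by simp
  then obtain y where y: "y \<in> act M s ` x" by auto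
  have "boundaries M <+>\<^bsub>M\<^esub> act M s ` x = boundaries M"
  proof (intro equalityI subsetI)
    fix b assume "b \<in> boundaries M <+>\<^bsub>M\<^esub> act M s ` x"
    then obtain c d where "b = c \<oplus>\<^bsub>M\<^esub> d" "c \<in> boundaries M" "d \<in> act M s ` x" by (auto simp: set_add_def')
    then show "b \<in> boundaries M" using sub by blast
  next
    fix b assume b: "b \<in> boundaries M"
    have yb: "y \<in> boundaries M" using y sub by blast
    have "b = (b \<ominus>\<^bsub>M\<^esub> y) \<oplus>\<^bsub>M\<^esub> y" using b yb B.a_Hcarr by (simp add: a_minus_def M.a_assoc M.l_neg)
    moreover have "b \<ominus>\<^bsub>M\<^esub> y \<in> boundaries M" using b yb by (simp add: a_minus_def B.a_inv_closed)
    ultimately show "b \<in> boundaries M <+>\<^bsub>M\<^esub> act M s ` x" using y unfolding set_add_def' by blast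
  qed
  then show ?thesis by (simp add: homology_simps)
qed

end

context koszul_ext
begin

text \<open>Agreement is demanded only at multisets of indices below \<open>n\<close>: evaluation on
  elements of \<open>U\<close> gives no information about a family elsewhere.\<close>

lemma ext_cong:
  assumes "\<And>H x. set_mset H \<subseteq> {..<n} \<Longrightarrow> x \<in> carrier F \<Longrightarrow> \<psi> H x = \<psi>' H x" "\<And>H x. x \<in> carrier F \<Longrightarrow> \<psi>' H x \<in> carrier B"
    and u: "u \<in> carrier U"
  shows "ext \<psi> u = ext \<psi>' u"
proof -
  have "(\<Oplus>\<^bsub>N\<^esub>H\<in>{H. u {} H \<noteq> \<zero>\<^bsub>F\<^esub>}. \<psi> H (u {} H)) = (\<Oplus>\<^bsub>N\<^esub>H\<in>{H. u {} H \<noteq> \<zero>\<^bsub>F\<^esub>}. \<psi>' H (u {} H))"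
  proof (rule N.finsum_cong')
    fix H assume "H \<in> {H. u {} H \<noteq> \<zero>\<^bsub>F\<^esub>}"
    then have "set_mset H \<subseteq> {..<n}" using UE_zero[OF u, of "{}" H] by blast
    then show "\<psi> H (u {} H) = \<psi>' H (u {} H)" using assms(1) UE_closed[OF u] by blast
  qed (use assms(2) UE_closed[OF u] in \<open>auto simp: inflation_simps\<close>)
  then show ?thesis using u by (simp add: ext_def)
qed

lemma \<phi>_linear_form_f: "\<phi> (linear_form Q n f G) = \<zero>\<^bsub>B\<^esub>"
  by (cases "\<exists>i<n. G = {#i#}") (auto simp: linear_form_simps \<phi>_f \<phi>_zero)

text \<open>Here \<psi>\<delta>\<delta> is \<psi> after multiplication by \<Sum> f_i \<chi>_i, and
  linearity of \<psi> turns f_i into \<phi>(f_i) = 0.\<close>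

lemma conv_delta_delta:
  assumes \<psi>: "\<psi> \<in> fam d" and x: "x \<in> carrier F"
  shows "conv F0 N0 (conv F0 N0 \<psi> delta) delta G x = \<zero>\<^bsub>B\<^esub>"
proof -
  note ab0 = F0.M.abelian_group_axioms N0.M.abelian_group_axioms
  have sc: "scalar_family F0 (linear_form Q n f) K x = act F (const (linear_form Q n f K)) x" for K
    using x by (simp add: scalar_family_def restrict_scalars_simps)
  have lc: "linear_form Q n f K \<in> carrier Q" for K by (rule linear_form_closed[OF f_closed])
  have "conv F0 N0 (conv F0 N0 \<psi> delta) delta G x = conv F0 N0 \<psi> (conv F0 F0 delta delta) G x"
    using fam_additive0[OF \<psi>] delta_closed x by (intro conv_assoc ab0) (auto simp: restrict_scalars_simps)
  also have "\<dots> = (\<Oplus>\<^bsub>N0\<^esub>K\<in>{K. K \<subseteq># G}. \<psi> K (conv F0 F0 delta delta (G - K) x))"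
    using x by (simp add: conv_apply restrict_scalars_simps)
  also have "\<dots> = \<zero>\<^bsub>N0\<^esub>"
    using x lc fam_closed[OF \<psi> x] by (intro N0.M.finsum_all_zero)
      (simp add: delta_conv_delta sc fam_linear[OF \<psi>] \<phi>_linear_form_f N_simps)
  finally show ?thesis by (simp add: N_simps)
qed

text \<open>In coordinates the differential is \<psi> \<mapsto> \<psi>\<delta> up to sign. This
  shows at once that it preserves \<open>E\<close>-linear maps and, as \<psi>\<delta>\<delta> = 0,
  that it squares to zero.\<close>

lemma hom_diff_hom_degree:
  assumes \<eta>: "\<eta> \<in> hom_degree KE U N d"
  shows "hom_diff U N \<eta> \<in> hom_degree KE U N (d - 1)"
    and "\<And>u. u \<in> carrier U \<Longrightarrow> hom_diff U N (hom_diff U N \<eta>) u = \<zero>\<^bsub>N\<^esub>"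
proof -
  obtain \<psi> where \<psi>: "\<psi> \<in> fam d" "\<eta> = ext \<psi>" using hom_degree_ext[OF \<eta>] by blast
  let ?\<chi> = "conv F0 N0 \<psi> delta"
  note \<chi> = conv_delta_fam[OF \<psi>(1)]
  note e = ext_hom_degree[OF \<chi>]
  have c: "ext ?\<chi> u \<in> carrier N" if "u \<in> carrier U" for u by (rule ext_closed[OF \<chi> that])
  have hd: "hom_diff U N \<eta> u = \<ominus>\<^bsub>N\<^esub> signed N d (ext ?\<chi> u)" if "u \<in> carrier U" for u
    unfolding \<psi>(2) by (rule hom_diff_ext[OF \<psi>(1) that])
  show D: "hom_diff U N \<eta> \<in> hom_degree KE U N (d - 1)"
  proof (cases "even d")
    case True
    have "hom_diff U N \<eta> = (\<lambda>u\<in>carrier U. \<ominus>\<^bsub>N\<^esub> ext ?\<chi> u)"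
      using hd True UN.hom_diff_ext by (intro extensionalityI[of _ "carrier U"]) (auto simp: signed_def)
    then show ?thesis using UN.neg_hom_degree[OF e] by simp
  next
    case False
    have "hom_diff U N \<eta> = ext ?\<chi>"
      using hd False c UN.hom_diff_ext by (intro extensionalityI[of _ "carrier U"]) (auto simp: signed_def ext_def)
    then show ?thesis using e by simp
  qed
  fix u assume u: "u \<in> carrier U"
  have "ext ?\<chi> (diff U u) = ext (conv F0 N0 ?\<chi> delta) u" by (rule ext_diff[OF \<chi> u])
  also have "\<dots> = \<zero>\<^bsub>N\<^esub>"
    using u conv_delta_delta[OF \<psi>(1) UE_closed[OF u]]
    by (simp add: ext_def N.finsum_all_zero inflation_simps)
  finally have "hom_diff U N \<eta> (diff U u) = \<zero>\<^bsub>N\<^esub>" using hd[OF UE_diff_closed[OF u]] by simp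
  moreover have "diff N x = \<zero>\<^bsub>N\<^esub>" for x by (simp add: inflation_simps)
  ultimately show "hom_diff U N (hom_diff U N \<eta>) u = \<zero>\<^bsub>N\<^esub>"
    using UN.hom_diff_eq[OF hom_degree_graded_map[OF D] u] by (simp add: a_minus_def)
qed

lemma T_diff_closed:
  assumes "\<eta> \<in> carrier UN.T"
  shows "hom_diff U N \<eta> \<in> carrier UN.T" and "hom_diff U N (hom_diff U N \<eta>) = \<zero>\<^bsub>UN.T\<^esub>"
proof -
  obtain I \<psi> where "finite I" "{} \<subseteq> I" "\<And>i. \<psi> i \<in> hom_degree KE U N i"
    "\<And>u. u \<in> carrier U \<Longrightarrow> \<eta> u = finsum N (\<lambda>i. \<psi> i u) I"
    by (rule UN.T_finsumE[OF assms finite.emptyI], rule that) assumption+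
  note \<psi> = this(1,3,4)
  have c: "\<psi> i \<in> carrier U \<rightarrow> carrier N" for i using graded_map_closed[OF hom_degree_graded_map[OF \<psi>(2)]] by blast
  have D: "hom_diff U N (\<psi> (i + 1)) \<in> hom_degree KE U N i" for i using hom_diff_hom_degree(1)[OF \<psi>(2)[of "i + 1"]] by simp
  have cD: "hom_diff U N (\<psi> i) \<in> carrier U \<rightarrow> carrier N" for i using UN.hom_diff_closed[OF c] by blast
  have sum: "hom_diff U N \<eta> u = finsum N (\<lambda>i. hom_diff U N (\<psi> i) u) I" if "u \<in> carrier U" for u
    by (rule UN.hom_diff_finsum[OF that \<psi>(3) c])
  show "hom_diff U N \<eta> \<in> carrier UN.T"
  proof (rule UN.T_I[of "(\<lambda>i. i - 1) ` I", OF _ D UN.hom_diff_ext])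
    fix u assume u: "u \<in> carrier U"
    have "finsum N (\<lambda>i. hom_diff U N (\<psi> (i + 1)) u) ((\<lambda>i. i - 1) ` I) = finsum N (\<lambda>i. hom_diff U N (\<psi> i) u) I"
      using cD u by (subst N.finsum_reindex) (auto simp: inj_on_def)
    then show "hom_diff U N \<eta> u = finsum N (\<lambda>i. hom_diff U N (\<psi> (i + 1)) u) ((\<lambda>i. i - 1) ` I)"
      using sum[OF u] by simp
  qed (use \<psi>(1) in auto)
  have "hom_diff U N (hom_diff U N \<eta>) u = \<zero>\<^bsub>N\<^esub>" if u: "u \<in> carrier U" for u
  proof -
    have "hom_diff U N (hom_diff U N \<eta>) u = finsum N (\<lambda>i. hom_diff U N (hom_diff U N (\<psi> i)) u) I"
      by (rule UN.hom_diff_finsum[OF u sum cD])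
    also have "\<dots> = \<zero>\<^bsub>N\<^esub>" using hom_diff_hom_degree(2)[OF \<psi>(2) u] by (intro N.finsum_all_zero)
    finally show ?thesis .
  qed
  then show "hom_diff U N (hom_diff U N \<eta>) = \<zero>\<^bsub>UN.T\<^esub>"
    using UN.hom_diff_ext by (intro extensionalityI[of _ "carrier U"]) (auto simp: hom_complex_simps)
qed

section \<open>Ext as the homology of a complex with operators\<close>

definition op_hom_complex ::
    "(nat multiset \<Rightarrow> 'q, (nat set \<Rightarrow> nat multiset \<Rightarrow> 'm) \<Rightarrow> 'r) dgm" where
  "op_hom_complex = \<lparr>carrier = carrier UN.T, mult = mult UN.T, one = one UN.T, zero = zero UN.T,
     add = add UN.T, grade = grade UN.T, diff = diff UN.T,
     act = (\<lambda>s \<phi>. \<lambda>u\<in>carrier U. \<phi> (UE_op Q F s u))\<rparr>"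

abbreviation "T' \<equiv> op_hom_complex"

lemma T'_simps:
  "carrier T' = carrier UN.T" "zero T' = zero UN.T" "add T' = add UN.T" "grade T' = hom_degree KE U N"
  "diff T' = hom_diff U N" "act T' s z = (\<lambda>u\<in>carrier U. z (UE_op Q F s u))"
  by (simp_all add: op_hom_complex_def hom_complex_simps)

lemma Ext_E_homology: "Ext_E Q n f F N = homology T'"
  by (simp add: Ext_E_def op_hom_complex_def Let_def)

lemma T'_diff_group: "diff_group T'"
proof (intro diff_group.intro diff_group_axioms.intro)
  interpret T: abelian_group UN.T by (rule UN.T_abelian_group)
  show "abelian_group T'"
  proof (rule abelian_groupI)
    fix x assume "x \<in> carrier T'"
    then show "\<exists>y\<in>carrier T'. y \<oplus>\<^bsub>T'\<^esub> x = \<zero>\<^bsub>T'\<^esub>"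
      by (intro bexI[of _ "\<ominus>\<^bsub>UN.T\<^esub> x"]) (simp_all add: T'_simps T.l_neg)
  qed (simp_all add: T'_simps T.a_ac)
next
  fix x y assume x: "x \<in> carrier T'" and y: "y \<in> carrier T'"
  then have "diff T' (x \<oplus>\<^bsub>T'\<^esub> y) = (\<lambda>u\<in>carrier U. hom_diff U N x u \<oplus>\<^bsub>N\<^esub> hom_diff U N y u)"
    using UN.T_diff_additive[of x y] by (simp add: T'_simps)
  then show "diff T' (x \<oplus>\<^bsub>T'\<^esub> y) = diff T' x \<oplus>\<^bsub>T'\<^esub> diff T' y"
    by (simp add: T'_simps hom_complex_simps)
qed (use T_diff_closed in \<open>simp_all add: T'_simps\<close>)

lemma T'_finsum: 
  assumes "\<And>i. i \<in> I \<Longrightarrow> z i \<in> carrier UN.T" "u \<in> carrier U"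
  shows "finsum T' z I u = finsum N (\<lambda>i. z i u) I"
proof -
  interpret T': diff_group T' by (rule T'_diff_group)
  have "additive_map T' N (\<lambda>z. z u)"
    using assms(2) UN.carrier_T_closed by (auto simp: additive_map_def T'_simps hom_complex_simps)
  from additive_map_finsum[OF T'.abelian_group_axioms N.abelian_group_axioms this, of z I] assms(1)
  show ?thesis by (auto simp: T'_simps)
qed

lemma Ext_E_group: "abelian_group (Ext_E Q n f F N)"
  unfolding Ext_E_homology by (rule homology_abelian_group[OF T'_diff_group])

lemma Ext_E_diff: "diff (Ext_E Q n f F N) x = \<zero>\<^bsub>Ext_E Q n f F N\<^esub>"
  unfolding Ext_E_homology by (simp add: homology_simps)

text \<open>If homogeneous classes add up to zero, the sum of their homogeneous representatives is a
  boundary, and then each representative is a boundary by comparison of degrees.\<close>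

lemma Ext_E_independent: "independent_grades (Ext_E Q n f F N)"
  unfolding independent_grades_def
proof (intro allI impI ballI; elim conjE)
  interpret T': diff_group T' by (rule T'_diff_group)
  let ?H = "Ext_E Q n f F N"
  fix I c i assume I: "finite I" "\<forall>i\<in>I. c i \<in> grade ?H i \<inter> carrier ?H" "finsum ?H c I = \<zero>\<^bsub>?H\<^esub>" "i \<in> I"
  then have "\<forall>i\<in>I. \<exists>z. z \<in> cycles T' \<and> z \<in> hom_degree KE U N i \<and> c i = boundaries T' +>\<^bsub>T'\<^esub> z"
    unfolding Ext_E_homology homology_simps by (auto simp: T'_simps)
  then obtain z where z: "\<And>i. i \<in> I \<Longrightarrow> z i \<in> cycles T'" "\<And>i. i \<in> I \<Longrightarrow> z i \<in> hom_degree KE U N i"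
    "\<And>i. i \<in> I \<Longrightarrow> c i = boundaries T' +>\<^bsub>T'\<^esub> z i" by metis
  interpret H: abelian_group ?H by (rule Ext_E_group)
  have "finsum ?H c I = finsum ?H (\<lambda>i. boundaries T' +>\<^bsub>T'\<^esub> z i) I"
    using z I(2) by (intro H.finsum_cong') auto
  also have "\<dots> = boundaries T' +>\<^bsub>T'\<^esub> finsum T' z I"
    unfolding Ext_E_homology by (rule homology_finsum[OF T'_diff_group I(1) z(1)])
  finally have "boundaries T' +>\<^bsub>T'\<^esub> finsum T' z I = boundaries T'"
    using I(3) by (simp add: Ext_E_homology homology_simps)
  moreover have "finsum T' z I \<in> carrier T'" using z(1) T'.cycles_closed by (intro T'.finsum_closed) auto
  ultimately have "finsum T' z I \<in> boundaries T'"
    using abelian_subgroup.a_rcos_self[OF T'.boundaries_subgroup] by blast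
  then obtain \<eta> where \<eta>: "\<eta> \<in> carrier UN.T" "finsum T' z I = hom_diff U N \<eta>"
    by (auto simp: boundaries_def T'_simps)
  have zT: "z i \<in> carrier UN.T" if "i \<in> I" for i using UN.hom_degree_T[OF z(2)[OF that]] .
  have "\<exists>\<eta>'\<in>hom_degree KE U N (i + 1). hom_diff U N \<eta>' = z i"
  proof (rule UN.hom_boundary_component[OF I(1) hom_degree_graded_map[OF z(2)] \<eta>(1) _ I(4)])
    fix u assume "u \<in> carrier U"
    then show "finsum N (\<lambda>i. z i u) I = hom_diff U N \<eta> u" using T'_finsum[where z = z and I = I and u = u, OF zT] \<eta>(2) by simp
  qed
  then obtain \<eta>' where "\<eta>' \<in> hom_degree KE U N (i + 1)" "z i = hom_diff U N \<eta>'" by metis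
  then have "z i \<in> boundaries T'" unfolding boundaries_def T'_simps by (intro image_eqI UN.hom_degree_T)
  then show "c i = \<zero>\<^bsub>?H\<^esub>"
    using z(3)[OF I(4)] boundary_coset[OF T'_diff_group] by (simp add: Ext_E_homology homology_simps)
qed

text \<open>If \<open>\<sigma>\<close> is a null-homotopy of \<open>t\<close> on \<open>\<Gamma> \<otimes> F\<close>, then composition with \<open>\<sigma>\<close> is one on the Hom complex.\<close>

lemma cycle_op_boundary:
  assumes \<sigma>: "\<And>G. \<sigma> G \<in> hom_degree Q0 F0 F0 (- 1 + 2 * int (size G))"
    "\<And>G x. x \<in> carrier F \<Longrightarrow> conv F0 F0 \<sigma> delta G x \<oplus>\<^bsub>F\<^esub> conv F0 F0 delta \<sigma> G x = scalar_family F0 t G x"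
    and t: "\<And>G. t G \<in> carrier Q" "\<And>G. scalar_family F0 t G \<in> hom_degree Q0 F0 F0 (- 2 + 2 * int (size G))"
    and s: "\<And>G. s G \<in> carrier Q" "finite {G. s G \<noteq> \<zero>\<^bsub>Q\<^esub>}" "\<And>G. \<phi> (s G) = \<phi> (t G)"
    and \<eta>: "\<eta> \<in> hom_degree KE U N d" "\<And>u. u \<in> carrier U \<Longrightarrow> hom_diff U N \<eta> u = \<zero>\<^bsub>N\<^esub>"
  shows "\<exists>\<zeta>\<in>hom_degree KE U N (d - 1). \<forall>u\<in>carrier U. hom_diff U N \<zeta> u = \<eta> (UE_op Q F s u)"
proof -
  obtain \<psi> where \<psi>: "\<psi> \<in> fam d" "\<eta> = ext \<psi>" using hom_degree_ext[OF \<eta>(1)] by blast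
  note c = fam_closed[OF \<psi>(1)]
  note ab0 = F0.M.abelian_group_axioms N0.M.abelian_group_axioms
  note add0 = fam_additive0[OF \<psi>(1)]
  have \<sigma>c: "\<sigma> G x \<in> carrier F" if "x \<in> carrier F" for G x
    using graded_map_closed[OF hom_degree_graded_map[OF \<sigma>(1)], of x G] that by (simp add: restrict_scalars_simps)
  \<comment> \<open>\<open>s\<close> and \<open>t\<close> have the same image under \<phi>, and
    \<psi> is linear with values in \<open>N\<close>, so it cannot distinguish them.\<close>
  have conv_sc: "conv F0 N0 \<psi> (scalar_family F0 s) = conv F0 N0 \<psi> (scalar_family F0 t)"
    using s(1,3) t(1)
    by (simp add: conv_def fun_eq_iff restrict_def scalar_family_def restrict_scalars_simps fam_linear[OF \<psi>(1)])
  have fam_t: "conv F0 N0 \<psi> (scalar_family F0 t) \<in> fam (d - 2)"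
    using conv_hom_degree[OF restricted restricted N0.dg_module_axioms famD[OF \<psi>(1)] t(2)] by (simp add: fam_def)
  have op: "\<eta> (UE_op Q F s u) = ext (conv F0 N0 \<psi> (scalar_family F0 t)) u" if u: "u \<in> carrier U" for u
    unfolding \<psi>(2) conv_sc[symmetric]
  proof (rule ext_pairing[OF \<psi>(1) u UE_op_closed[OF s(1,2) u] s(2)])
    show "conv F0 N0 \<psi> (scalar_family F0 s) \<in> fam (d - 2)" unfolding conv_sc by (rule fam_t)
    show "scalar_family F0 s G x \<in> carrier F" if "x \<in> carrier F" for G x
      using that s(1) by (simp add: scalar_family_def restrict_scalars_simps const_act_closed)
    show "scalar_family F0 s G \<zero>\<^bsub>F\<^esub> = \<zero>\<^bsub>F\<^esub>" for G
      using s(1) by (simp add: scalar_family_def restrict_scalars_simps const_act_zero)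
    show "scalar_family F0 s G x = \<zero>\<^bsub>F\<^esub>" if "x \<in> carrier F" "G \<notin> {G. s G \<noteq> \<zero>\<^bsub>Q\<^esub>}" for G x
      using that by (simp add: scalar_family_def restrict_scalars_simps zero_const_act)
    fix H
    have "\<psi> H (UE_op Q F s u {} H) = (\<Oplus>\<^bsub>N\<^esub>G\<in>{G. s G \<noteq> \<zero>\<^bsub>Q\<^esub>}. \<psi> H (act F (const (s G)) (u {} (H + G))))"
      unfolding UE_op_def
      by (rule additive_map_finsum[OF E.M.abelian_group_axioms N.abelian_group_axioms fam_additive[OF \<psi>(1)]])
        (use s(1) UE_closed[OF u] const_act_closed in auto)
    then show "\<psi> H (UE_op Q F s u {} H) = (\<Oplus>\<^bsub>N\<^esub>G\<in>{G. s G \<noteq> \<zero>\<^bsub>Q\<^esub>}. \<psi> H (scalar_family F0 s G (u {} (H + G))))"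
      using UE_closed[OF u] by (simp add: scalar_family_def restrict_scalars_simps)
  qed
  \<comment> \<open>The cycle condition, evaluated on the elements y^(K) \<otimes> x, says that
    \<psi>\<delta> vanishes at multisets of indices below \<open>n\<close>.\<close>
  have z: "conv F0 N0 \<psi> delta K x = \<zero>\<^bsub>B\<^esub>" if "x \<in> carrier F" "set_mset K \<subseteq> {..<n}" for K x
  proof -
    note sc = single_closed[OF that(1) empty_subsetI that(2)]
    have "\<ominus>\<^bsub>N\<^esub> signed N d (ext (conv F0 N0 \<psi> delta) (single {} K x)) = \<zero>\<^bsub>N\<^esub>"
      using hom_diff_ext[OF \<psi>(1) sc] \<eta>(2)[OF sc] \<psi>(2) by simp
    then have "ext (conv F0 N0 \<psi> delta) (single {} K x) = \<zero>\<^bsub>N\<^esub>"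
      using ext_closed[OF conv_delta_fam[OF \<psi>(1)] sc]
      by (metis N.minus_minus N.neg_zero N.signed_eq_zero_iff N.signed_closed)
    then show ?thesis using ext_single[OF conv_delta_fam[OF \<psi>(1)] that] by (simp add: inflation_simps)
  qed
  define \<zeta> where "\<zeta> = conv F0 N0 \<psi> \<sigma>"
  have \<zeta>: "\<zeta> \<in> fam (d - 1)"
    using conv_hom_degree[OF restricted restricted N0.dg_module_axioms famD[OF \<psi>(1)] \<sigma>(1)] by (simp add: fam_def \<zeta>_def)
  \<comment> \<open>With \<zeta> = \<psi>\<sigma>: \<psi>t = \<psi>(\<sigma>\<delta> +
    \<delta>\<sigma>) = \<zeta>\<delta> + (\<psi>\<delta>)\<sigma>, and the last summand is zero
    because \<psi>\<delta> is.\<close>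
  have main: "conv F0 N0 \<psi> (scalar_family F0 t) H x = conv F0 N0 \<zeta> delta H x"
    if H: "set_mset H \<subseteq> {..<n}" and x: "x \<in> carrier F" for H x
  proof -
    have cc: "conv F0 F0 \<sigma> delta K x \<in> carrier F" "conv F0 F0 delta \<sigma> K x \<in> carrier F" for K
      using x \<sigma>c delta_closed by (auto simp: conv_apply restrict_scalars_simps intro!: F0.M.finsum_closed[unfolded restrict_scalars_simps])
    have "conv F0 N0 \<psi> (scalar_family F0 t) H x =
      (\<Oplus>\<^bsub>N0\<^esub>K\<in>{K. K \<subseteq># H}. \<psi> K (conv F0 F0 \<sigma> delta (H - K) x \<oplus>\<^bsub>F\<^esub> conv F0 F0 delta \<sigma> (H - K) x))"
      using x by (simp add: conv_apply[of x F0 N0] restrict_scalars_simps \<sigma>(2))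
    also have "\<dots> = (\<Oplus>\<^bsub>N0\<^esub>K\<in>{K. K \<subseteq># H}. \<psi> K (conv F0 F0 \<sigma> delta (H - K) x))
        \<oplus>\<^bsub>N0\<^esub> (\<Oplus>\<^bsub>N0\<^esub>K\<in>{K. K \<subseteq># H}. \<psi> K (conv F0 F0 delta \<sigma> (H - K) x))"
      using cc c additive_map_add[OF add0] by (intro N0.M.finsum_add_cong) (auto simp: N_simps)
    also have "(\<Oplus>\<^bsub>N0\<^esub>K\<in>{K. K \<subseteq># H}. \<psi> K (conv F0 F0 \<sigma> delta (H - K) x)) = conv F0 N0 \<psi> (conv F0 F0 \<sigma> delta) H x"
      using x by (simp add: conv_apply[of x F0 N0] restrict_scalars_simps)
    also have "\<dots> = conv F0 N0 \<zeta> delta H x"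
      unfolding \<zeta>_def using add0 \<sigma>c delta_closed x by (intro conv_assoc[symmetric] ab0) (auto simp: restrict_scalars_simps)
    also have "(\<Oplus>\<^bsub>N0\<^esub>K\<in>{K. K \<subseteq># H}. \<psi> K (conv F0 F0 delta \<sigma> (H - K) x)) = conv F0 N0 \<psi> (conv F0 F0 delta \<sigma>) H x"
      using x by (simp add: conv_apply[of x F0 N0] restrict_scalars_simps)
    also have "\<dots> = conv F0 N0 (conv F0 N0 \<psi> delta) \<sigma> H x"
      using add0 \<sigma>c delta_closed x by (intro conv_assoc[symmetric] ab0) (auto simp: restrict_scalars_simps)
    also have "\<dots> = (\<Oplus>\<^bsub>N0\<^esub>K\<in>{K. K \<subseteq># H}. conv F0 N0 \<psi> delta K (\<sigma> (H - K) x))"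
      using x by (simp add: conv_apply[of x F0 N0] restrict_scalars_simps)
    also have "\<dots> = \<zero>\<^bsub>N0\<^esub>"
    proof (rule N0.M.finsum_all_zero)
      fix K assume "K \<in> {K. K \<subseteq># H}"
      then have "set_mset K \<subseteq> {..<n}" using H set_mset_mono by blast
      from z[OF \<sigma>c[OF x] this] show "conv F0 N0 \<psi> delta K (\<sigma> (H - K) x) = \<zero>\<^bsub>N0\<^esub>" by (simp add: N_simps)
    qed
    also have "conv F0 N0 \<zeta> delta H x \<oplus>\<^bsub>N0\<^esub> \<zero>\<^bsub>N0\<^esub> = conv F0 N0 \<zeta> delta H x"
      using fam_closed[OF conv_delta_fam[OF \<zeta>] x] by (simp add: N_simps)
    finally show ?thesis .
  qed
  note e\<zeta> = ext_hom_degree[OF \<zeta>] and c\<zeta> = fam_closed[OF conv_delta_fam[OF \<zeta>]]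
  have hd: "hom_diff U N (ext \<zeta>) u = \<ominus>\<^bsub>N\<^esub> signed N (d - 1) (\<eta> (UE_op Q F s u))" if u: "u \<in> carrier U" for u
    using hom_diff_ext[OF \<zeta> u] op[OF u] ext_cong[OF main c\<zeta> u] by simp
  have \<eta>c: "\<eta> (UE_op Q F s u) \<in> carrier N" if "u \<in> carrier U" for u
    using graded_map_closed[OF hom_degree_graded_map[OF \<eta>(1)] UE_op_closed[OF s(1,2) that]] .
  show ?thesis
  \<comment> \<open>The differential of the Hom complex carries the sign -(-1)^(d-1) on
    \<open>ext \<zeta>\<close>, so for odd \<open>d\<close> the homotopy has to be negated.\<close>
  proof (cases "even d")
    case True
    then show ?thesis using hd e\<zeta> \<eta>c by (intro bexI[of _ "ext \<zeta>"]) (auto simp: signed_def)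
  next
    case False
    let ?\<zeta> = "\<lambda>u\<in>carrier U. \<ominus>\<^bsub>N\<^esub> ext \<zeta> u"
    note n = UN.neg_hom_degree[OF e\<zeta>]
    have dN: "diff N x = \<zero>\<^bsub>N\<^esub>" for x by (simp add: inflation_simps)
    have "hom_diff U N ?\<zeta> u = \<eta> (UE_op Q F s u)" if u: "u \<in> carrier U" for u
    proof -
      have "ext \<zeta> (diff U u) = \<eta> (UE_op Q F s u)"
        using ext_diff[OF \<zeta> u] op[OF u] ext_cong[OF main c\<zeta> u] by simp
      then show ?thesis
        using UN.hom_diff_eq[OF hom_degree_graded_map[OF n] u] False UE_diff_closed[OF u] \<eta>c[OF u]
        by (simp add: dN signed_def a_minus_def)
    qed
    then show ?thesis using n by blast
  qed
qed

text \<open>An arbitrary cycle is split into homogeneous ones, each of which is sent to a boundary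
  by composition with \<sigma>. Allowing any \<open>s\<close> with the same image as
  \<open>t\<close> under \<phi> covers all lifts of one form over the residue field.\<close>

theorem Ext_E_op_zero:
  assumes \<sigma>: "\<And>G. \<sigma> G \<in> hom_degree Q0 F0 F0 (- 1 + 2 * int (size G))"
    "\<And>G x. x \<in> carrier F \<Longrightarrow> conv F0 F0 \<sigma> delta G x \<oplus>\<^bsub>F\<^esub> conv F0 F0 delta \<sigma> G x = scalar_family F0 t G x"
    and t: "\<And>G. t G \<in> carrier Q" "\<And>G. scalar_family F0 t G \<in> hom_degree Q0 F0 F0 (- 2 + 2 * int (size G))"
    and s: "\<And>G. s G \<in> carrier Q" "finite {G. s G \<noteq> \<zero>\<^bsub>Q\<^esub>}" "\<And>G. \<phi> (s G) = \<phi> (t G)"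
    and x: "x \<in> carrier (Ext_E Q n f F N)"
  shows "act (Ext_E Q n f F N) s x = \<zero>\<^bsub>Ext_E Q n f F N\<^esub>"
  unfolding Ext_E_homology
proof (rule homology_act_zero[OF T'_diff_group x[unfolded Ext_E_homology]])
  fix z assume z: "z \<in> cycles T'"
  have zT: "z \<in> carrier UN.T" and zd: "hom_diff U N z = \<zero>\<^bsub>UN.T\<^esub>"
    using z by (simp_all add: cycles_def T'_simps)
  obtain I \<psi> where "finite I" "{} \<subseteq> I" "\<And>i. \<psi> i \<in> hom_degree KE U N i"
    "\<And>u. u \<in> carrier U \<Longrightarrow> z u = finsum N (\<lambda>i. \<psi> i u) I"
    by (rule UN.T_finsumE[OF zT finite.emptyI], rule that) assumption+
  note \<psi> = this(1,3,4)
  note g = hom_degree_graded_map[OF \<psi>(2)]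
  have c: "\<psi> i \<in> carrier U \<rightarrow> carrier N" for i using graded_map_closed[OF g] by blast
  have Dg: "hom_diff U N (\<psi> (i + 1)) \<in> graded_map U N i" for i using UN.hom_diff_graded_map[OF g[of "i + 1"]] by simp
  \<comment> \<open>The differentials of the homogeneous parts of \<open>z\<close> lie in distinct
    degrees and add up to zero, so each part is itself a cycle.\<close>
  have cyc: "hom_diff U N (\<psi> i) u = \<zero>\<^bsub>N\<^esub>" if i: "i \<in> I" and u: "u \<in> carrier U" for i u
  proof -
    have "hom_diff U N (\<psi> (i - 1 + 1)) u = \<zero>\<^bsub>N\<^esub>"
    proof (rule UN.graded_map_independent[of "(\<lambda>i. i - 1) ` I" "\<lambda>i. hom_diff U N (\<psi> (i + 1))"])
      fix u assume u: "u \<in> carrier U"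
      have "finsum N (\<lambda>i. hom_diff U N (\<psi> (i + 1)) u) ((\<lambda>i. i - 1) ` I) = finsum N (\<lambda>i. hom_diff U N (\<psi> i) u) I"
        using UN.hom_diff_closed[OF c u] by (subst N.finsum_reindex) (auto simp: inj_on_def)
      also have "\<dots> = hom_diff U N z u" using UN.hom_diff_finsum[OF u \<psi>(3) c] by simp
      also have "\<dots> = \<zero>\<^bsub>N\<^esub>" using zd u by (simp add: hom_complex_simps)
      finally show "finsum N (\<lambda>i. hom_diff U N (\<psi> (i + 1)) u) ((\<lambda>i. i - 1) ` I) = \<zero>\<^bsub>N\<^esub>" .
    next
      show "finite ((\<lambda>i. i - 1) ` I)" using \<psi>(1) by (rule finite_imageI)
      show "i - 1 \<in> (\<lambda>i. i - 1) ` I" using i by (rule imageI)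
    qed (rule Dg, rule u)
    then show ?thesis by simp
  qed
  have "\<exists>\<zeta>. \<zeta> \<in> hom_degree KE U N (i - 1) \<and> (\<forall>u\<in>carrier U. hom_diff U N \<zeta> u = \<psi> i (UE_op Q F s u))"
    if "i \<in> I" for i
    using cycle_op_boundary[OF \<sigma> t s \<psi>(2) cyc[OF that]] by blast
  then have "\<forall>i\<in>I. \<exists>\<zeta>. \<zeta> \<in> hom_degree KE U N (i - 1) \<and> (\<forall>u\<in>carrier U. hom_diff U N \<zeta> u = \<psi> i (UE_op Q F s u))"
    by blast
  from bchoice[OF this] obtain \<zeta> where \<zeta>: "\<And>i. i \<in> I \<Longrightarrow> \<zeta> i \<in> hom_degree KE U N (i - 1)"
    "\<And>i u. i \<in> I \<Longrightarrow> u \<in> carrier U \<Longrightarrow> hom_diff U N (\<zeta> i) u = \<psi> i (UE_op Q F s u)" by blast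
  interpret T': diff_group T' by (rule T'_diff_group)
  have \<zeta>T: "\<zeta> i \<in> carrier UN.T" if "i \<in> I" for i using UN.hom_degree_T[OF \<zeta>(1)[OF that]] .
  have sumT: "finsum T' \<zeta> I \<in> carrier UN.T" using T'.finsum_closed[of \<zeta> I] \<zeta>T by (auto simp: T'_simps)
  have "act T' s z = hom_diff U N (finsum T' \<zeta> I)"
  proof (rule extensionalityI[of _ "carrier U"])
    fix u assume u: "u \<in> carrier U"
    have "hom_diff U N (finsum T' \<zeta> I) u = finsum N (\<lambda>i. hom_diff U N (\<zeta> i) u) I"
      by (rule UN.hom_diff_finsum[OF u T'_finsum[where z = \<zeta> and I = I, OF \<zeta>T] UN.carrier_T_closed[OF \<zeta>T]])
    also have "\<dots> = finsum N (\<lambda>i. \<psi> i (UE_op Q F s u)) I"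
    proof (rule N.finsum_cong')
      show "(\<lambda>i. \<psi> i (UE_op Q F s u)) \<in> I \<rightarrow> carrier N"
        using graded_map_closed[OF g UE_op_closed[OF s(1,2) u]] by blast
    qed (simp_all only: \<zeta>(2)[OF _ u])
    also have "\<dots> = z (UE_op Q F s u)" by (rule \<psi>(3)[OF UE_op_closed[OF s(1,2) u], symmetric])
    finally have h: "hom_diff U N (finsum T' \<zeta> I) u = z (UE_op Q F s u)" .
    have "act T' s z u = z (UE_op Q F s u)" using u by (simp add: T'_simps)
    then show "act T' s z u = hom_diff U N (finsum T' \<zeta> I) u" using h[symmetric] by (rule trans)
  qed (simp_all add: UN.hom_diff_ext T'_simps)
  also have "\<dots> = diff T' (finsum T' \<zeta> I)" by (simp add: T'_simps)
  finally have "act T' s z = diff T' (finsum T' \<zeta> I)" .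
  moreover have "finsum T' \<zeta> I \<in> carrier T'" using sumT by (simp add: T'_simps)
  ultimately show "act T' s z \<in> boundaries T'" unfolding boundaries_def by (rule image_eqI)
qed

end

section \<open>Null-homotopies from embedded deformations\<close>

text \<open>Every ring law is pulled back along the surjection. Applied to \<pi>, this makes the
  completion a commutative ring without any work with inverse limits. That zero goes to zero has to
  be assumed, since \<open>ring_hom\<close> does not contain it.\<close>

lemma surjective_ring_hom_cring:
  assumes Q: "cring Q" and \<pi>: "\<pi> \<in> ring_hom Q S" "\<pi> ` carrier Q = carrier S" "\<pi> \<zero>\<^bsub>Q\<^esub> = \<zero>\<^bsub>S\<^esub>"
  shows "cring S"
proof -
  interpret Q: cring Q by fact
  have ex: "\<exists>q\<in>carrier Q. x = \<pi> q" if "x \<in> carrier S" for x using that \<pi>(2) by auto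
  have c: "\<pi> q \<in> carrier S" if "q \<in> carrier Q" for q using that \<pi>(2) by auto
  have add: "\<pi> q \<oplus>\<^bsub>S\<^esub> \<pi> r = \<pi> (q \<oplus>\<^bsub>Q\<^esub> r)" and mult: "\<pi> q \<otimes>\<^bsub>S\<^esub> \<pi> r = \<pi> (q \<otimes>\<^bsub>Q\<^esub> r)"
    if "q \<in> carrier Q" "r \<in> carrier Q" for q r
    using that \<pi>(1) by (simp_all add: ring_hom_add ring_hom_mult)
  have one: "\<one>\<^bsub>S\<^esub> = \<pi> \<one>\<^bsub>Q\<^esub>" using \<pi>(1) by (simp add: ring_hom_one)
  note s = add mult one \<pi>(3)[symmetric]
  show ?thesis
  proof (rule cringI)
    show "abelian_group S"
    proof (rule abelian_groupI)
      fix x assume "x \<in> carrier S"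
      then obtain q where "q \<in> carrier Q" "x = \<pi> q" using ex by blast
      then show "\<exists>y\<in>carrier S. y \<oplus>\<^bsub>S\<^esub> x = \<zero>\<^bsub>S\<^esub>"
        by (intro bexI[of _ "\<pi> (\<ominus>\<^bsub>Q\<^esub> q)"]) (auto simp: s c Q.l_neg)
    qed (auto dest!: ex simp: s c Q.a_ac)
    show "comm_monoid S"
      by (rule comm_monoidI) (auto dest!: ex simp: s c Q.m_ac)
  qed (auto dest!: ex simp: s c Q.l_distr)
qed

text \<open>The complex \<open>I \<rightarrow> Q\<close> in degrees \<open>1\<close> and \<open>0\<close>, a resolution of \<open>Q/I\<close>.\<close>

definition two_term :: "('q, 'b) ring_scheme \<Rightarrow> 'q set \<Rightarrow> ('q, 'q \<times> 'q) dgm" where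
  "two_term Q I =
    \<lparr>carrier = I \<times> carrier Q, mult = undefined, one = undefined, zero = (\<zero>\<^bsub>Q\<^esub>, \<zero>\<^bsub>Q\<^esub>),
     add = (\<lambda>(b, a) (b', a'). (b \<oplus>\<^bsub>Q\<^esub> b', a \<oplus>\<^bsub>Q\<^esub> a')),
     grade = (\<lambda>i. if i = 0 then {\<zero>\<^bsub>Q\<^esub>} \<times> carrier Q else if i = 1 then I \<times> {\<zero>\<^bsub>Q\<^esub>} else {(\<zero>\<^bsub>Q\<^esub>, \<zero>\<^bsub>Q\<^esub>)}),
     diff = (\<lambda>(b, a). (\<zero>\<^bsub>Q\<^esub>, b)),
     act = (\<lambda>q (b, a). (q \<otimes>\<^bsub>Q\<^esub> b, q \<otimes>\<^bsub>Q\<^esub> a))\<rparr>"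

lemma two_term_simps:
  "carrier (two_term Q I) = I \<times> carrier Q" "zero (two_term Q I) = (\<zero>\<^bsub>Q\<^esub>, \<zero>\<^bsub>Q\<^esub>)"
  "(b, a) \<oplus>\<^bsub>two_term Q I\<^esub> (b', a') = (b \<oplus>\<^bsub>Q\<^esub> b', a \<oplus>\<^bsub>Q\<^esub> a')"
  "grade (two_term Q I) i = (if i = 0 then {\<zero>\<^bsub>Q\<^esub>} \<times> carrier Q else if i = 1 then I \<times> {\<zero>\<^bsub>Q\<^esub>} else {(\<zero>\<^bsub>Q\<^esub>, \<zero>\<^bsub>Q\<^esub>)})"
  "diff (two_term Q I) (b, a) = (\<zero>\<^bsub>Q\<^esub>, b)" "act (two_term Q I) q (b, a) = (q \<otimes>\<^bsub>Q\<^esub> b, q \<otimes>\<^bsub>Q\<^esub> a)"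
  by (simp_all add: two_term_def)

lemma two_term_dg_module:
  assumes Q0: "dg_ring (degree_zero_ring Q)" and Q: "cring Q" and I: "ideal I Q"
  shows "dg_module (degree_zero_ring Q) (two_term Q I)"
proof -
  interpret Q: cring Q by fact
  interpret I: ideal I Q by fact
  let ?D = "two_term Q I"
  note s = two_term_simps
  have neg: "\<ominus>\<^bsub>Q\<^esub> b \<in> I" if "b \<in> I" for b using that I.a_inv_closed by blast
  have Ic: "b \<in> carrier Q" if "b \<in> I" for b using that by (rule I.a_Hcarr)
  have I_ne: "I \<noteq> {}" using I.zero_closed by blast
  have ag: "abelian_group ?D"
  proof (rule abelian_groupI)
    fix x assume "x \<in> carrier ?D"
    then obtain b a where "x = (b, a)" "b \<in> I" "a \<in> carrier Q" by (auto simp: s)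
    then show "\<exists>y\<in>carrier ?D. y \<oplus>\<^bsub>?D\<^esub> x = \<zero>\<^bsub>?D\<^esub>"
      using neg Ic by (intro bexI[of _ "(\<ominus>\<^bsub>Q\<^esub> b, \<ominus>\<^bsub>Q\<^esub> a)"]) (auto simp: s Q.l_neg)
  qed (auto simp: s Ic Q.a_ac)
  interpret D: abelian_group ?D by (rule ag)
  have dneg: "\<ominus>\<^bsub>?D\<^esub> (b, a) = (\<ominus>\<^bsub>Q\<^esub> b, \<ominus>\<^bsub>Q\<^esub> a)" if "b \<in> I" "a \<in> carrier Q" for b a
    using that neg Ic by (intro D.minus_equality) (auto simp: s Q.l_neg)
  have gc: "x \<in> carrier ?D" if "x \<in> grade ?D i" for x i
    using that by (auto simp: s Ic split: if_splits)
  have dec: "is_decomposition ?D x c \<longleftrightarrow> (\<forall>i. c i \<in> grade ?D i) \<and> x = c 0 \<oplus>\<^bsub>?D\<^esub> c 1" for x c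
  proof (cases "\<forall>i. c i \<in> grade ?D i")
    case True
    then have cc: "c i \<in> carrier ?D" for i using gc by blast
    have "c i = \<zero>\<^bsub>?D\<^esub>" if "i \<noteq> 0" "i \<noteq> 1" for i using True[rule_format, of i] that by (simp add: s)
    then have sub: "{i. c i \<noteq> \<zero>\<^bsub>?D\<^esub>} \<subseteq> {0, 1}" by auto
    then have fin: "finite {i. c i \<noteq> \<zero>\<^bsub>?D\<^esub>}" by (rule finite_subset) simp
    have "finsum ?D c {0, 1} = finsum ?D c {i. c i \<noteq> \<zero>\<^bsub>?D\<^esub>}"
      using sub cc by (intro D.finsum_neutral_cong) auto
    moreover have "finsum ?D c {0, 1} = c 0 \<oplus>\<^bsub>?D\<^esub> c 1" using cc by (simp add: D.finsum_insert)
    ultimately show ?thesis using True fin by (simp add: is_decomposition_def)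
  qed (unfold is_decomposition_def, blast)
  have D: "dg_group ?D"
  proof (intro dg_group.intro dg_group_axioms.intro ag)
    show "additive_subgroup (grade ?D i) ?D" for i
      using I_ne by (intro additive_subgroup.intro D.add.subgroupI) (auto simp: s dneg neg Ic split: if_splits)
    fix x assume "x \<in> carrier ?D"
    then obtain b a where x: "x = (b, a)" "b \<in> I" "a \<in> carrier Q" by (auto simp: s)
    show "\<exists>!c. is_decomposition ?D x c"
    proof (rule ex1I)
      show "is_decomposition ?D x (\<lambda>i. if i = 0 then (\<zero>\<^bsub>Q\<^esub>, a) else if i = 1 then (b, \<zero>\<^bsub>Q\<^esub>) else (\<zero>\<^bsub>Q\<^esub>, \<zero>\<^bsub>Q\<^esub>))"
        unfolding dec using x Ic by (auto simp: s)
      fix c assume "is_decomposition ?D x c"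
      then have c: "\<And>i. c i \<in> grade ?D i" "x = c 0 \<oplus>\<^bsub>?D\<^esub> c 1" unfolding dec by auto
      obtain a' where a': "c 0 = (\<zero>\<^bsub>Q\<^esub>, a')" "a' \<in> carrier Q" using c(1)[of 0] by (auto simp: s)
      obtain b' where b': "c 1 = (b', \<zero>\<^bsub>Q\<^esub>)" "b' \<in> I" using c(1)[of 1] by (auto simp: s)
      have "x = (b', a')" using c(2) a' b' Ic by (simp add: s)
      moreover have "c i = (\<zero>\<^bsub>Q\<^esub>, \<zero>\<^bsub>Q\<^esub>)" if "i \<noteq> 0" "i \<noteq> 1" for i using c(1)[of i] that by (simp add: s)
      ultimately show "c = (\<lambda>i. if i = 0 then (\<zero>\<^bsub>Q\<^esub>, a) else if i = 1 then (b, \<zero>\<^bsub>Q\<^esub>) else (\<zero>\<^bsub>Q\<^esub>, \<zero>\<^bsub>Q\<^esub>))"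
        using a' b' x by auto
    qed
  qed (auto simp: s Ic split: if_splits)
  have sgn: "signed ?D i x = x" if "i = 0" for i x using that by (simp add: signed_def)
  show ?thesis
  proof (intro dg_module.intro dg_module_axioms.intro Q0 D)
    fix a i x assume a: "a \<in> grade (degree_zero_ring Q) i" and x: "x \<in> carrier ?D"
    obtain b a' where x': "x = (b, a')" "b \<in> I" "a' \<in> carrier Q" using x by (auto simp: s)
    show "diff ?D (act ?D a x) = act ?D (diff (degree_zero_ring Q) a) x \<oplus>\<^bsub>?D\<^esub> signed ?D i (act ?D a (diff ?D x))"
    proof (cases "i = 0")
      case True
      then show ?thesis using a x' Ic by (simp add: s degree_zero_ring_simps sgn)
    next
      case False
      then have "a = \<zero>\<^bsub>Q\<^esub>" using a by (simp add: degree_zero_ring_simps)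
      moreover have "signed ?D i (\<zero>\<^bsub>Q\<^esub>, \<zero>\<^bsub>Q\<^esub>) = (\<zero>\<^bsub>Q\<^esub>, \<zero>\<^bsub>Q\<^esub>)" using D.signed_zero[of i] by (simp add: s)
      ultimately show ?thesis using x' Ic by (simp add: s degree_zero_ring_simps)
    qed
  next
    fix a i x j assume "a \<in> grade (degree_zero_ring Q) i" "x \<in> grade ?D j"
    then show "act ?D a x \<in> grade ?D (i + j)"
      by (auto simp: s degree_zero_ring_simps Ic I.I_l_closed split: if_splits)
  qed (auto simp: s degree_zero_ring_simps Ic I.I_l_closed Q.l_distr Q.r_distr Q.m_assoc)
qed

text \<open>Multiplication by \<open>c i\<close> has degree 0, which equals -2 + 2|G| when
  \<open>G\<close> is a singleton; at all other \<open>G\<close> the map is zero, and zero has every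
  degree.\<close>

lemma (in koszul_module) linear_form_hom_degree:
  assumes c: "\<And>i. i < n \<Longrightarrow> c i \<in> carrier Q"
  shows "scalar_family F0 (linear_form Q n c) G \<in> hom_degree (degree_zero_ring Q) F0 F0 (- 2 + 2 * int (size G))"
proof (cases "\<exists>i<n. G = {#i#}")
  case True
  then obtain i where i: "i < n" "G = {#i#}" by blast
  have eq: "scalar_family F0 (linear_form Q n c) G x = act F (const (c i)) x" if "x \<in> carrier F" for x
    using i that by (simp add: scalar_family_def restrict_scalars_simps linear_form_simps)
  note ci = c[OF i(1)]
  show ?thesis
  proof (rule hom_degree_linearI[OF restricted restricted])
    show "scalar_family F0 (linear_form Q n c) G \<in> graded_map F0 F0 (- 2 + 2 * int (size G))"
    proof (rule graded_mapI)
      show "additive_map F0 F0 (scalar_family F0 (linear_form Q n c) G)"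
        using ci by (auto simp: additive_map_def restrict_scalars_simps eq const_act_closed E.act_r_distr[OF const_closed])
      show "scalar_family F0 (linear_form Q n c) G x \<in> grade F0 (- 2 + 2 * int (size G) + j)" if "x \<in> grade F0 j" for x j
      proof -
        have x: "x \<in> grade F j" using that by (simp add: restrict_scalars_simps)
        then show ?thesis
          using eq[OF E.M.grade_closed[OF x]] const_act_grade[OF ci x] i(2) by (simp add: restrict_scalars_simps)
      qed
    qed (simp add: scalar_family_def)
    fix q x assume "q \<in> carrier Q" "x \<in> carrier F0"
    then show "scalar_family F0 (linear_form Q n c) G (act F0 q x) = act F0 q (scalar_family F0 (linear_form Q n c) G x)"
      using F0.act_assoc[of "c i" q x] F0.act_assoc[of q "c i" x] ci Q.m_comm[of q "c i"]
      by (simp add: restrict_scalars_simps eq const_act_closed degree_zero_ring_simps)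
  qed
next
  case False
  interpret h: hom_setting "degree_zero_ring Q" F0 F0 by (rule dg_module_setting[OF restricted restricted])
  have "scalar_family F0 (linear_form Q n c) G = (\<lambda>x\<in>carrier F0. \<zero>\<^bsub>F0\<^esub>)"
    using False zero_const_act by (auto simp: scalar_family_def restrict_scalars_simps linear_form_simps(2) fun_eq_iff)
  then show ?thesis using h.zero_hom_degree by simp
qed

context koszul_ext
begin

text \<open>With a graded lift \<open>\<epsilon> : F \<rightarrow> Q\<close> of \<open>\<alpha>\<close>, the family \<open>\<nu> = \<theta> \<circ> \<epsilon> \<circ> \<delta>\<close> satisfies
  \<open>\<nu>\<delta> = \<theta> \<circ> \<epsilon> \<circ> \<Sum> f\<^sub>i \<chi>\<^sub>i = \<Sum> \<theta>(f\<^sub>i) \<chi>\<^sub>i \<alpha>\<close>.\<close>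

theorem null_homotopy_of_functional:
  fixes \<theta> :: "'q \<Rightarrow> 'r"
  defines "I \<equiv> {q \<in> carrier Q. \<phi> q = \<zero>\<^bsub>B\<^esub>}"
  assumes sp: "semiprojective Q0 F0" and \<alpha>: "dg_hom KE F N \<alpha>" "quasi_iso F N \<alpha>"
    and surj: "\<phi> ` carrier Q = carrier B" and nontriv: "\<one>\<^bsub>Q\<^esub> \<noteq> \<zero>\<^bsub>Q\<^esub>"
    and \<theta>: "\<And>x. x \<in> I \<Longrightarrow> \<theta> x \<in> carrier B" "\<And>x y. x \<in> I \<Longrightarrow> y \<in> I \<Longrightarrow> \<theta> (x \<oplus>\<^bsub>Q\<^esub> y) = \<theta> x \<oplus>\<^bsub>B\<^esub> \<theta> y"
      "\<And>q x. q \<in> carrier Q \<Longrightarrow> x \<in> I \<Longrightarrow> \<theta> (q \<otimes>\<^bsub>Q\<^esub> x) = \<phi> q \<otimes>\<^bsub>B\<^esub> \<theta> x"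
      "\<And>i. i < n \<Longrightarrow> \<theta> (f i) = \<phi> (c i)" and c: "\<And>i. i < n \<Longrightarrow> c i \<in> carrier Q"
  shows "\<exists>\<sigma>. \<forall>G. \<sigma> G \<in> hom_degree Q0 F0 F0 (- 1 + 2 * int (size G)) \<and>
    (\<forall>x\<in>carrier F. conv F0 F0 \<sigma> delta G x \<oplus>\<^bsub>F\<^esub> conv F0 F0 delta \<sigma> G x = scalar_family F0 (linear_form Q n c) G x)"
proof -
  have \<alpha>add: "additive_map F N \<alpha>" by (rule dg_hom_additive[OF \<alpha>(1)])
  have \<alpha>c: "\<alpha> x \<in> carrier B" if "x \<in> carrier F" for x using additive_map_closed[OF \<alpha>add that] by (simp add: inflation_simps)
  have \<alpha>act: "\<alpha> (act F e x) = \<phi> (e {}) \<otimes>\<^bsub>B\<^esub> \<alpha> x" if "e \<in> carrier KE" "x \<in> carrier F" for e x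
    using \<alpha>(1) that by (auto simp: dg_hom_def inflation_simps)
  have \<alpha>const: "\<alpha> (act F (const q) x) = \<phi> q \<otimes>\<^bsub>B\<^esub> \<alpha> x" if "q \<in> carrier Q" "x \<in> carrier F" for q x
    using \<alpha>act[OF const_closed[OF that(1)] that(2)] by (simp add: kos_const_def)
  have \<alpha>0: "dg_hom Q0 F0 N0 \<alpha>"
    using \<alpha>(1) \<alpha>const unfolding dg_hom_def
    by (simp add: N_simps degree_zero_ring_simps) (simp add: kos_const_def inflation_simps)
  have q0: "quasi_iso F0 N0 \<alpha>"
    using \<alpha>(2) by (simp add: quasi_iso_def boundaries_def cycles_def a_r_coset_def' set_add_def' restrict_scalars_simps)
  have \<alpha>\<delta>: "\<alpha> (delta G x) = \<zero>\<^bsub>N0\<^esub>" if x: "x \<in> carrier F0" for G x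
  proof -
    have x: "x \<in> carrier F" using x by (simp add: restrict_scalars_simps)
    show ?thesis
    proof (cases G rule: delta_cases)
      case 1
      then show ?thesis using \<alpha>(1) x by (simp add: delta_empty dg_hom_def N_simps)
    next
      case (2 i)
      then show ?thesis using \<alpha>act[OF xi_closed x] \<alpha>c[OF x] x
        by (simp add: delta_single lam_def N_simps) (simp add: kos_xi_def \<phi>_zero)
    next
      case 3
      then show ?thesis using x additive_map_zero[OF E.M.abelian_group_axioms N.abelian_group_axioms \<alpha>add]
        by (simp add: delta_zero N_simps)
    qed
  qed
  \<comment> \<open>An element of the quotient is encoded by the indicator function of its fibre
    under \<phi>; fibres are nonempty by surjectivity.\<close>
  define \<kappa> where "\<kappa> = (\<lambda>r (k :: nat, q, y :: 'm). if \<phi> q = r then \<one>\<^bsub>Q\<^esub> else \<zero>\<^bsub>Q\<^esub>)"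
  have \<kappa>: "inj_on \<kappa> (carrier N0)"
  proof (rule inj_onI)
    fix r r' assume r: "r \<in> carrier N0" "r' \<in> carrier N0" and eq: "\<kappa> r = \<kappa> r'"
    obtain q where "q \<in> carrier Q" "r = \<phi> q" using r(1) surj by (auto simp: N_simps)
    then show "r = r'" using fun_cong[OF eq, of "(0, q, undefined)"] nontriv by (simp add: \<kappa>_def split: if_splits)
  qed
  have Ic: "b \<in> carrier Q" "\<phi> b = \<zero>\<^bsub>B\<^esub>" if "b \<in> I" for b using that by (simp_all add: I_def)
  have I_iff: "b \<in> I \<longleftrightarrow> b \<in> carrier Q \<and> \<phi> b = \<zero>\<^bsub>B\<^esub>" for b by (simp add: I_def)
  have idI: "ideal I Q"
  proof -
    have eq: "I = a_kernel Q B \<phi>" by (auto simp: I_def a_kernel_def')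
    interpret h: ring_hom_ring Q B \<phi> by (rule ring_hom_ringI2[OF Q.ring_axioms B.ring_axioms \<phi>])
    show ?thesis using h.kernel_is_ideal eq by simp
  qed
  interpret I: ideal I Q by (rule idI)
  have \<phi>_add: "\<phi> (a \<oplus>\<^bsub>Q\<^esub> b) = \<phi> a \<oplus>\<^bsub>B\<^esub> \<phi> b" if "a \<in> carrier Q" "b \<in> carrier Q" for a b
    using \<phi> that by (rule ring_hom_add)
  \<comment> \<open>The complex I \<rightarrow> Q maps onto the quotient by a surjective
    quasi-isomorphism, as lifting requires; projection to the quotient uses only the second
    coordinate.\<close>
  let ?D = "two_term Q I" and ?\<beta> = "\<lambda>(b, a). \<phi> a"
  have D: "dg_module Q0 ?D" by (rule two_term_dg_module[OF dg_module.axioms(1)[OF restricted] Q.cring_axioms idI])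
  have \<beta>: "dg_hom Q0 ?D N0 ?\<beta>"
    unfolding dg_hom_def
  proof (intro conjI allI ballI)
    show "?\<beta> \<in> carrier ?D \<rightarrow> carrier N0" by (auto simp: two_term_simps N_simps \<phi>_closed)
    fix x y assume "x \<in> carrier ?D" "y \<in> carrier ?D"
    then show "?\<beta> (x \<oplus>\<^bsub>?D\<^esub> y) = ?\<beta> x \<oplus>\<^bsub>N0\<^esub> ?\<beta> y" by (auto simp: two_term_simps N_simps \<phi>_add)
  next
    fix q x assume "q \<in> carrier Q0" "x \<in> carrier ?D"
    then show "?\<beta> (act ?D q x) = act N0 q (?\<beta> x)"
      by (cases x) (simp add: two_term_simps N_simps degree_zero_ring_simps ring_hom_mult[OF \<phi>] kos_const_def)
  next
    fix i show "?\<beta> ` grade ?D i \<subseteq> grade N0 i" by (auto simp: two_term_simps N_simps \<phi>_closed \<phi>_zero)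
  next
    fix x assume "x \<in> carrier ?D"
    then show "?\<beta> (diff ?D x) = diff N0 (?\<beta> x)" by (auto simp: two_term_simps N_simps Ic)
  qed
  have \<beta>s: "?\<beta> ` carrier ?D = carrier N0"
  proof (intro equalityI subsetI)
    fix w assume "w \<in> carrier N0"
    then obtain q where "q \<in> carrier Q" "w = \<phi> q" using surj by (auto simp: N_simps)
    then show "w \<in> ?\<beta> ` carrier ?D"
      using I.zero_closed by (intro image_eqI[of _ _ "(\<zero>\<^bsub>Q\<^esub>, q)"]) (simp_all add: two_term_simps)
  qed (auto simp: two_term_simps N_simps \<phi>_closed)
  have dgD: "diff_group ?D"
  proof -
    interpret D: dg_module Q0 ?D by (rule D)
    show ?thesis by (rule D.M.diff_group)
  qed
  have \<beta>q: "quasi_iso ?D N0 ?\<beta>"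
  proof (subst quasi_iso_iff[OF dgD N0.M.diff_group dg_hom_additive[OF \<beta>]], goal_cases)
    case 2
    have bN: "boundaries N0 = {\<zero>\<^bsub>B\<^esub>}" using B.zero_closed by (auto simp: boundaries_def N_simps)
    have bD: "boundaries ?D = {\<zero>\<^bsub>Q\<^esub>} \<times> I"
      by (force simp: boundaries_def two_term_simps image_iff)
    have cD: "cycles ?D = {\<zero>\<^bsub>Q\<^esub>} \<times> carrier Q" by (auto simp: cycles_def two_term_simps)
    have "\<exists>z\<in>cycles ?D. w \<ominus>\<^bsub>N0\<^esub> ?\<beta> z \<in> boundaries N0" if w: "w \<in> cycles N0" for w
    proof -
      have wB: "w \<in> carrier N0" using w by (simp add: cycles_def)
      then obtain q where q: "q \<in> carrier Q" "w = \<phi> q" using surj by (auto simp: N_simps)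
      then have "w \<ominus>\<^bsub>N0\<^esub> ?\<beta> (\<zero>\<^bsub>Q\<^esub>, q) = \<zero>\<^bsub>N0\<^esub>" using wB by (simp add: N0.M.minus_eq_zero_iff)
      then show ?thesis using q(1) unfolding bN cD by (intro bexI[of _ "(\<zero>\<^bsub>Q\<^esub>, q)"]) (auto simp: N_simps)
    qed
    then show ?case unfolding bN bD cD by (auto simp: I_iff)
  qed (use \<beta> in \<open>auto simp: dg_hom_def\<close>)
  \<comment> \<open>The number argument selects the coordinate: 0 returns the one in I, any other
    value the one in Q.\<close>
  define \<iota> where "\<iota> = (\<lambda>(b, a) (k :: nat, q :: 'q, y :: 'm). if k = 0 then b else (a :: 'q))"
  have \<iota>: "inj_on \<iota> (carrier ?D)"
  proof (rule inj_onI)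
    fix x y assume eq: "\<iota> x = \<iota> y"
    show "x = y"
      using fun_cong[OF eq, of "(0, undefined, undefined)"] fun_cong[OF eq, of "(1, undefined, undefined)"]
      by (cases x; cases y) (simp add: \<iota>_def)
  qed
  have \<alpha>hom: "(\<lambda>x\<in>carrier F0. \<alpha> x) \<in> hom_degree Q0 F0 N0 0"
  proof (rule hom_degree_linearI[OF restricted N0.dg_module_axioms graded_mapI])
    show "additive_map F0 N0 (\<lambda>x\<in>carrier F0. \<alpha> x)"
      using dg_hom_additive[OF \<alpha>0] by (auto simp: additive_map_def Pi_iff)
    show "(\<lambda>x\<in>carrier F0. \<alpha> x) x \<in> grade N0 (0 + j)" if "x \<in> grade F0 j" for x j
      using that \<alpha>0 F0.M.grade_closed[OF that] unfolding dg_hom_def by (simp add: image_subset_iff)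
    show "(\<lambda>x\<in>carrier F0. \<alpha> x) (act F0 q x) = act N0 q ((\<lambda>x\<in>carrier F0. \<alpha> x) x)" if "q \<in> carrier Q" "x \<in> carrier F0" for q x
      using that \<alpha>0 F0.act_closed[of q x] unfolding dg_hom_def by (simp add: degree_zero_ring_simps)
  qed simp
  obtain \<alpha>' where \<alpha>': "\<alpha>' \<in> hom_degree Q0 F0 ?D 0" "\<And>x. x \<in> carrier F0 \<Longrightarrow> ?\<beta> (\<alpha>' x) = \<alpha> x"
    using semiprojective_lift[OF sp D N0.dg_module_axioms \<beta> \<beta>s \<beta>q \<iota> \<kappa> \<alpha>hom] by auto
  note g' = hom_degree_graded_map[OF \<alpha>'(1)]
  \<comment> \<open>The component in Q of the lift: linear and graded, but not a chain map.\<close>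
  define \<epsilon> where "\<epsilon> = (\<lambda>x. snd (\<alpha>' x))"
  have \<alpha>'c: "\<alpha>' x \<in> I \<times> carrier Q" if "x \<in> carrier F" for x
    using graded_map_closed[OF g', of x] that by (simp add: two_term_simps restrict_scalars_simps)
  have \<epsilon>c: "\<epsilon> x \<in> carrier Q" if "x \<in> carrier F" for x using \<alpha>'c[OF that] by (auto simp: \<epsilon>_def)
  have \<epsilon>\<alpha>: "\<phi> (\<epsilon> x) = \<alpha> x" if "x \<in> carrier F" for x
    using \<alpha>'(2)[of x] that by (simp add: \<epsilon>_def restrict_scalars_simps split: prod.splits)
  have \<epsilon>add: "additive_map F Q \<epsilon>"
  proof -
    have "\<epsilon> (x \<oplus>\<^bsub>F\<^esub> y) = \<epsilon> x \<oplus>\<^bsub>Q\<^esub> \<epsilon> y" if "x \<in> carrier F" "y \<in> carrier F" for x y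
      using additive_map_add[OF graded_map_additive[OF g'], of x y] that
      by (cases "\<alpha>' x"; cases "\<alpha>' y") (simp add: restrict_scalars_simps two_term_simps \<epsilon>_def)
    then show ?thesis using \<epsilon>c by (auto simp: additive_map_def)
  qed
  have \<epsilon>lin: "\<epsilon> (act F (const q) x) = q \<otimes>\<^bsub>Q\<^esub> \<epsilon> x" if "q \<in> carrier Q" "x \<in> carrier F" for q x
    using hom_degree_linear[OF \<alpha>'(1) that(1), of x] that(2)
    by (cases "\<alpha>' x") (simp add: restrict_scalars_simps two_term_simps \<epsilon>_def)
  have \<epsilon>g: "\<epsilon> x = \<zero>\<^bsub>Q\<^esub>" if "x \<in> grade F j" "j \<noteq> 0" for x j
    using graded_map_grade[OF g', of x j] that
    by (auto simp: restrict_scalars_simps two_term_simps \<epsilon>_def split: if_splits)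
  \<comment> \<open>\<alpha> commutes with \<partial> and with the \<xi>_i, all of which act as zero
    on \<open>N\<close>, so \<epsilon> after \<delta> has values in the kernel of \<phi>, which is
    the domain of \<theta>.\<close>
  have \<epsilon>I: "\<epsilon> (delta G x) \<in> I" if "x \<in> carrier F" for G x
    using \<alpha>\<delta>[of x G] \<epsilon>\<alpha>[OF delta_closed[OF that]] \<epsilon>c[OF delta_closed[OF that]] that
    by (simp add: I_iff N_simps)
  have \<theta>z: "\<theta> \<zero>\<^bsub>Q\<^esub> = \<zero>\<^bsub>B\<^esub>"
    using \<theta>(2)[OF I.zero_closed I.zero_closed, symmetric] \<theta>(1)[OF I.zero_closed]
    by (intro B.add_idem_zero) simp_all
  define \<nu> where "\<nu> = (\<lambda>G. \<lambda>x\<in>carrier F0. \<theta> (\<epsilon> (delta G x)))"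
  have dadd: "delta G (x \<oplus>\<^bsub>F\<^esub> y) = delta G x \<oplus>\<^bsub>F\<^esub> delta G y" if "x \<in> carrier F" "y \<in> carrier F" for G x y
    using additive_map_add[OF graded_map_additive[OF hom_degree_graded_map[OF delta_hom_degree]], of x y G] that
    by (simp add: restrict_scalars_simps)
  have \<nu>: "\<nu> G \<in> hom_degree Q0 F0 N0 (- 1 + 2 * int (size G))" for G
  proof (rule hom_degree_linearI[OF restricted N0.dg_module_axioms graded_mapI])
    show "additive_map F0 N0 (\<nu> G)"
      using \<theta>(1,2) \<epsilon>I dadd delta_closed additive_map_add[OF \<epsilon>add]
      by (auto simp: additive_map_def \<nu>_def N_simps)
    show "\<nu> G \<in> extensional (carrier F0)" by (simp add: \<nu>_def)
    show "\<nu> G x \<in> grade N0 (- 1 + 2 * int (size G) + j)" if x: "x \<in> grade F0 j" for x j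
    proof -
      have xc: "x \<in> carrier F" using F0.M.grade_closed[OF x] by (simp add: restrict_scalars_simps)
      have "delta G x \<in> grade F (- 1 + 2 * int (size G) + j)"
        using graded_map_grade[OF hom_degree_graded_map[OF delta_hom_degree] x] by (simp add: restrict_scalars_simps)
      then show ?thesis
        using \<epsilon>g \<theta>z \<theta>(1)[OF \<epsilon>I[OF xc]] xc by (auto simp: \<nu>_def N_simps)
    qed
    show "\<nu> G (act F0 q x) = act N0 q (\<nu> G x)" if q: "q \<in> carrier Q" and x: "x \<in> carrier F0" for q x
    proof -
      have xc: "x \<in> carrier F" using x by (simp add: restrict_scalars_simps)
      have "delta G (act F (const q) x) = act F (const q) (delta G x)"
        using hom_degree_linear[OF delta_hom_degree q x] by (simp add: restrict_scalars_simps)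
      then show ?thesis
        using q xc \<epsilon>lin[OF q delta_closed[OF xc]] \<theta>(3)[OF q \<epsilon>I[OF xc]] const_act_closed
        by (simp add: \<nu>_def N_simps) (simp add: kos_const_def)
    qed
  qed
  have \<nu>\<delta>: "conv F0 N0 \<nu> delta G x = \<alpha> (scalar_family F0 (linear_form Q n c) G x)" if x: "x \<in> carrier F0" for G x
  proof -
    have xc: "x \<in> carrier F" using x by (simp add: restrict_scalars_simps)
    let ?r = "\<lambda>K. \<epsilon> (delta K (delta (G - K) x))"
    have rI: "?r K \<in> I" for K by (rule \<epsilon>I[OF delta_closed[OF xc]])
    have fin: "(\<Oplus>\<^bsub>Q\<^esub>K\<in>\<K>. ?r K) \<in> I \<and> \<theta> (\<Oplus>\<^bsub>Q\<^esub>K\<in>\<K>. ?r K) = (\<Oplus>\<^bsub>B\<^esub>K\<in>\<K>. \<theta> (?r K))" if "finite \<K>" for \<K>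
      using that
    proof (induction \<K>)
      case (insert K \<K>)
      then show ?case
        using rI Ic(1)[OF rI] \<theta>(1)[OF rI] \<theta>(2)[OF rI]
        by (simp add: Q.finsum_insert B.finsum_insert Pi_iff I.a_closed)
    qed (simp add: \<theta>z I.zero_closed)
    have "conv F0 N0 \<nu> delta G x = (\<Oplus>\<^bsub>N0\<^esub>K\<in>{K. K \<subseteq># G}. \<theta> (?r K))"
      using xc delta_closed by (simp add: conv_apply \<nu>_def restrict_scalars_simps)
    also have "\<dots> = (\<Oplus>\<^bsub>B\<^esub>K\<in>{K. K \<subseteq># G}. \<theta> (?r K))" by (simp add: restrict_scalars_group inflation_group)
    also have "\<dots> = \<theta> (\<Oplus>\<^bsub>Q\<^esub>K\<in>{K. K \<subseteq># G}. ?r K)" using fin[OF finite_submultisets] by simp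
    also have "(\<Oplus>\<^bsub>Q\<^esub>K\<in>{K. K \<subseteq># G}. ?r K) = \<epsilon> (\<Oplus>\<^bsub>F\<^esub>K\<in>{K. K \<subseteq># G}. delta K (delta (G - K) x))"
      using delta_closed xc by (intro additive_map_finsum[symmetric, OF E.M.abelian_group_axioms Q.abelian_group_axioms \<epsilon>add]) auto
    also have "(\<Oplus>\<^bsub>F\<^esub>K\<in>{K. K \<subseteq># G}. delta K (delta (G - K) x)) = conv F0 F0 delta delta G x"
      using x by (simp add: conv_apply restrict_scalars_group)
    also have "\<dots> = act F (const (linear_form Q n f G)) x"
      using delta_conv_delta[OF xc] xc by (simp add: scalar_family_def restrict_scalars_simps)
    also have "\<epsilon> \<dots> = linear_form Q n f G \<otimes>\<^bsub>Q\<^esub> \<epsilon> x"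
      by (rule \<epsilon>lin[OF linear_form_closed[OF f_closed] xc])
    also have "\<theta> \<dots> = \<phi> (linear_form Q n c G) \<otimes>\<^bsub>B\<^esub> \<alpha> x"
    proof (cases "\<exists>i<n. G = {#i#}")
      case True
      then obtain i where i: "i < n" "G = {#i#}" by blast
      have "f i \<in> I" using f_closed[OF i(1)] \<phi>_f[OF i(1)] by (simp add: I_iff)
      \<comment> \<open>The product is read with \<epsilon> x as scalar and f_i as element of I, the
        only way in which linearity of \<theta> applies.\<close>
      then have "\<theta> (\<epsilon> x \<otimes>\<^bsub>Q\<^esub> f i) = \<phi> (\<epsilon> x) \<otimes>\<^bsub>B\<^esub> \<phi> (c i)" using \<theta>(3)[OF \<epsilon>c[OF xc]] \<theta>(4)[OF i(1)] by simp
      then show ?thesis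
        using i f_closed c \<epsilon>c[OF xc] \<epsilon>\<alpha>[OF xc] \<phi>_closed[OF c] \<alpha>c[OF xc]
        by (simp add: linear_form_simps Q.m_comm B.m_comm)
    next
      case False
      then show ?thesis using \<epsilon>c[OF xc] \<alpha>c[OF xc] by (simp add: linear_form_simps(2) \<theta>z \<phi>_zero)
    qed
    also have "\<dots> = \<alpha> (scalar_family F0 (linear_form Q n c) G x)"
      using \<alpha>const[OF linear_form_closed[OF c] xc] xc by (simp add: scalar_family_def restrict_scalars_simps)
    finally show ?thesis .
  qed
  have "\<exists>\<sigma>. \<forall>G. \<sigma> G \<in> hom_degree Q0 F0 F0 (- 1 + 2 * int (size G)) \<and>
    (\<forall>x\<in>carrier F0. conv F0 F0 \<sigma> delta G x \<oplus>\<^bsub>F0\<^esub> conv F0 F0 delta \<sigma> G x = scalar_family F0 (linear_form Q n c) G x)"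
    by (rule lift_homotopy[OF sp N0.dg_module_axioms _ \<alpha>0 q0 \<kappa> nontriv delta_hom_degree _ \<alpha>\<delta> _
          linear_form_closed[OF f_closed] linear_form_closed[OF c] linear_form_hom_degree[OF c] \<nu> \<nu>\<delta>])
      (simp_all add: N_simps delta_empty delta_conv_delta)
  then show ?thesis by (simp add: restrict_scalars_simps)
qed

end

section \<open>The functional dual to the regular generator\<close>

lemma (in ideal) coset_eq_iff: "a \<in> carrier R \<Longrightarrow> I +> a = I \<longleftrightarrow> a \<in> I"
  using rcos_const_imp_mem[of a] a_rcos_const[of a] by blast

text \<open>This set is the ideal J + Pg. With \<open>P\<close> the whole ring it contains (g_0,
  ..., g_m); with \<open>P\<close> maximal it serves to find a unit among the coefficients.\<close>

lemma (in cring) multiples_modulo_ideal: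
  assumes J: "ideal J R" and P: "ideal P R" and g: "g \<in> carrier R"
  shows "ideal {x \<in> carrier R. \<exists>q\<in>P. x \<ominus> q \<otimes> g \<in> J} R"
proof -
  interpret J: ideal J R by fact
  interpret P: ideal P R by fact
  let ?K = "{x \<in> carrier R. \<exists>q\<in>P. x \<ominus> q \<otimes> g \<in> J}"
  have mult: "s \<otimes> x \<in> ?K" if s: "s \<in> carrier R" and x: "x \<in> ?K" for s x
  proof -
    obtain q where q: "q \<in> P" "x \<ominus> q \<otimes> g \<in> J" and xc: "x \<in> carrier R" using x by blast
    have "(s \<otimes> x) \<ominus> (s \<otimes> q) \<otimes> g = s \<otimes> (x \<ominus> q \<otimes> g)"
      using s xc g P.Icarr[OF q(1)] by (simp add: minus_eq r_distr r_minus m_assoc)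
    then have "(s \<otimes> x) \<ominus> (s \<otimes> q) \<otimes> g \<in> J" using J.I_l_closed[OF q(2) s] by simp
    then show ?thesis using s xc P.I_l_closed[OF q(1) s] by blast
  qed
  have add: "x \<oplus> y \<in> ?K" if x: "x \<in> ?K" and y: "y \<in> ?K" for x y
  proof -
    obtain q where q: "q \<in> P" "x \<ominus> q \<otimes> g \<in> J" and xc: "x \<in> carrier R" using x by blast
    obtain r where r: "r \<in> P" "y \<ominus> r \<otimes> g \<in> J" and yc: "y \<in> carrier R" using y by blast
    have "(x \<oplus> y) \<ominus> (q \<oplus> r) \<otimes> g = (x \<ominus> q \<otimes> g) \<oplus> (y \<ominus> r \<otimes> g)"
      using xc yc g P.Icarr[OF q(1)] P.Icarr[OF r(1)] by (simp add: minus_eq l_distr minus_add a_ac)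
    then have "(x \<oplus> y) \<ominus> (q \<oplus> r) \<otimes> g \<in> J" using J.a_closed[OF q(2) r(2)] by simp
    then show ?thesis using xc yc P.a_closed[OF q(1) r(1)] by blast
  qed
  have zero: "\<zero> \<in> ?K" using g P.zero_closed J.zero_closed by (intro CollectI conjI bexI[of _ "\<zero>"]) (simp_all add: minus_eq)
  have neg: "\<ominus> x \<in> ?K" if "x \<in> ?K" for x
  proof -
    have "\<ominus> x = (\<ominus> \<one>) \<otimes> x" using that by (simp add: l_minus)
    then show ?thesis using mult[OF _ that, of "\<ominus> \<one>"] by simp
  qed
  show ?thesis
  proof (rule idealI[OF ring_axioms])
    show "subgroup ?K (add_monoid R)"
      by (rule add.subgroupI) (use zero neg add in \<open>auto simp: a_inv_def[symmetric]\<close>)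
    fix a x assume a: "a \<in> ?K" and x: "x \<in> carrier R"
    show "x \<otimes> a \<in> ?K" by (rule mult[OF x a])
    then show "a \<otimes> x \<in> ?K" using a x m_comm[of a x] by simp
  qed
qed

text \<open>Modulo \<open>J\<close> the ideal \<open>I\<close> is generated by the regular element \<open>g\<close>, hence free, and \<open>\<theta>\<close> is the coefficient
  of \<open>g\<close> reduced to \<open>S\<close>.  Not all \<open>c i\<close> lie in \<open>P\<close>, since the \<open>f i\<close> generate \<open>g\<close>.\<close>

lemma (in cring) quotient_functional:
  assumes J: "ideal J R" and P: "ideal P R" "\<one> \<notin> P" "J \<subseteq> P" and g: "g \<in> carrier R"
    and reg: "\<And>q. q \<in> carrier R \<Longrightarrow> g \<otimes> q \<in> J \<Longrightarrow> q \<in> J"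
    and \<pi>: "\<pi> \<in> ring_hom R S" "ring S"
    and I: "I = {q \<in> carrier R. \<pi> q = \<zero>\<^bsub>S\<^esub>}" "J \<subseteq> I" "g \<in> I" "I \<subseteq> {x \<in> carrier R. \<exists>q\<in>carrier R. x \<ominus> q \<otimes> g \<in> J}"
    and gen: "I = genideal R (f ` {..<n})" and f: "f ` {..<n} \<subseteq> carrier R"
  obtains \<theta> c where "\<And>x. x \<in> I \<Longrightarrow> \<theta> x \<in> carrier S" "\<And>x y. x \<in> I \<Longrightarrow> y \<in> I \<Longrightarrow> \<theta> (x \<oplus> y) = \<theta> x \<oplus>\<^bsub>S\<^esub> \<theta> y"
    "\<And>q x. q \<in> carrier R \<Longrightarrow> x \<in> I \<Longrightarrow> \<theta> (q \<otimes> x) = \<pi> q \<otimes>\<^bsub>S\<^esub> \<theta> x"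
    "\<And>i. i < n \<Longrightarrow> \<theta> (f i) = \<pi> (c i)" "\<And>i. i < n \<Longrightarrow> c i \<in> carrier R" "\<exists>i<n. c i \<notin> P"
proof -
  interpret J: ideal J R by fact
  interpret P: ideal P R by fact
  interpret S: ring S by fact
  define rel where "rel = (\<lambda>x q. q \<in> carrier R \<and> x \<ominus> q \<otimes> g \<in> J)"
  have Ic: "x \<in> carrier R" if "x \<in> I" for x using that I(1) by blast
  have ex: "\<exists>q. rel x q" if "x \<in> I" for x using that I(4) by (auto simp: rel_def)
  \<comment> \<open>The difference of the two representations of \<open>x\<close> is g (q - r),
    which lies in \<open>J\<close>; regularity of \<open>g\<close> modulo \<open>J\<close> then
    makes coefficients unique modulo \<open>J\<close>.\<close>
  have diff: "q \<ominus> r \<in> J" if x: "x \<in> carrier R" and qr: "rel x q" "rel x r" for x q r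
  proof -
    have c: "q \<in> carrier R" "r \<in> carrier R" using qr by (auto simp: rel_def)
    define e w where "e = x \<ominus> q \<otimes> g" and "w = g \<otimes> (q \<ominus> r)"
    have w: "w = q \<otimes> g \<oplus> \<ominus> (r \<otimes> g)" using c g by (simp add: w_def minus_eq r_distr r_minus m_comm)
    have ec: "e \<in> carrier R" "w \<in> carrier R" using x c g by (simp_all add: e_def w_def)
    have "e \<oplus> w = x \<ominus> r \<otimes> g" unfolding e_def w using x c g by (simp add: minus_eq a_assoc r_neg1)
    then have ew: "e \<oplus> w \<in> J" using qr(2) by (simp add: rel_def)
    have "e \<in> J" using qr(1) by (simp add: rel_def e_def)
    then have "\<ominus> e \<oplus> (e \<oplus> w) \<in> J" by (rule J.a_closed[OF J.a_inv_closed ew])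
    then have "w \<in> J" using ec by (simp add: r_neg1)
    then show ?thesis using reg[of "q \<ominus> r"] c by (simp add: w_def)
  qed
  have \<pi>_eq: "\<pi> q = \<pi> r" if "x \<in> I" "rel x q" "rel x r" for x q r
  proof -
    have c: "q \<in> carrier R" "r \<in> carrier R" using that by (auto simp: rel_def)
    have "\<pi> (q \<ominus> r) = \<zero>\<^bsub>S\<^esub>" using diff[OF Ic[OF that(1)] that(2,3)] I(1,2) by blast
    moreover have "\<pi> q = \<pi> ((q \<ominus> r) \<oplus> r)" using c by (simp add: minus_eq a_assoc l_neg)
    moreover have "\<dots> = \<pi> (q \<ominus> r) \<oplus>\<^bsub>S\<^esub> \<pi> r" using c by (intro ring_hom_add[OF \<pi>(1)]) auto
    ultimately show ?thesis using ring_hom_closed[OF \<pi>(1) c(2)] by simp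
  qed
  define \<theta> where "\<theta> = (\<lambda>x. \<pi> (SOME q. rel x q))"
  have \<theta>: "\<theta> x = \<pi> q" if "x \<in> I" "rel x q" for x q
    unfolding \<theta>_def using that(1) someI[of "rel x", OF that(2)] that(2) by (rule \<pi>_eq)
  have rel_add: "rel (x \<oplus> y) (q \<oplus> r)" if "x \<in> I" "y \<in> I" "rel x q" "rel y r" for x y q r
  proof -
    have c: "q \<in> carrier R" "r \<in> carrier R" using that by (auto simp: rel_def)
    have "(x \<oplus> y) \<ominus> (q \<oplus> r) \<otimes> g = (x \<ominus> q \<otimes> g) \<oplus> (y \<ominus> r \<otimes> g)"
      using Ic[OF that(1)] Ic[OF that(2)] g c by (simp add: minus_eq l_distr minus_add a_ac)
    then show ?thesis using that(3,4) by (simp add: rel_def J.a_closed)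
  qed
  have rel_mult: "rel (s \<otimes> x) (s \<otimes> q)" if "s \<in> carrier R" "x \<in> I" "rel x q" for s x q
  proof -
    have c: "q \<in> carrier R" using that by (auto simp: rel_def)
    have "(s \<otimes> x) \<ominus> (s \<otimes> q) \<otimes> g = s \<otimes> (x \<ominus> q \<otimes> g)"
      using that(1) Ic[OF that(2)] g c by (simp add: minus_eq r_distr r_minus m_assoc)
    then show ?thesis using that by (simp add: rel_def J.I_l_closed)
  qed
  have idI: "ideal I R" unfolding gen by (rule genideal_ideal[OF f])
  interpret I: ideal I R by (rule idI)
  have fI: "f i \<in> I" if "i < n" for i using genideal_self[OF f] that gen by auto
  have "\<forall>i\<in>{..<n}. \<exists>q. rel (f i) q" using ex fI by blast
  from bchoice[OF this] obtain c where c: "\<And>i. i < n \<Longrightarrow> rel (f i) (c i)" by blast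
  \<comment> \<open>Otherwise all f_i, hence all of I, would lie in J + Pg. Then \<open>g\<close>
    would have coefficients 1 and q with q in \<open>P\<close>, and uniqueness modulo
    \<open>J\<close>, which lies in \<open>P\<close>, would put 1 into \<open>P\<close>.\<close>
  have c_notin: "\<exists>i<n. c i \<notin> P"
  proof (rule ccontr)
    assume "\<not> (\<exists>i<n. c i \<notin> P)"
    then have "f ` {..<n} \<subseteq> {x \<in> carrier R. \<exists>q\<in>P. x \<ominus> q \<otimes> g \<in> J}"
      using c f by (auto simp: rel_def)
    then have "I \<subseteq> {x \<in> carrier R. \<exists>q\<in>P. x \<ominus> q \<otimes> g \<in> J}"
      unfolding gen by (rule genideal_minimal[OF multiples_modulo_ideal[OF J P(1) g]])
    then obtain q where q: "q \<in> P" "g \<ominus> q \<otimes> g \<in> J" using I(3) by blast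
    have qc: "q \<in> carrier R" by (rule P.Icarr[OF q(1)])
    have "rel g \<one>" using g J.zero_closed by (simp add: rel_def minus_eq r_neg)
    moreover have "rel g q" using q qc by (simp add: rel_def)
    ultimately have "\<one> \<ominus> q \<in> P" using diff[OF g] P(3) by blast
    then have "(\<one> \<ominus> q) \<oplus> q \<in> P" using q(1) by (rule P.a_closed)
    moreover have "(\<one> \<ominus> q) \<oplus> q = \<one>" using qc by (simp add: minus_eq a_assoc l_neg)
    ultimately show False using P(2) by simp
  qed
  show thesis
  proof (rule that)
    show "\<theta> x \<in> carrier S" if x: "x \<in> I" for x
    proof -
      obtain q where q: "rel x q" using ex[OF x] by blast
      then have "q \<in> carrier R" by (simp add: rel_def)
      then show ?thesis using \<theta>[OF x q] ring_hom_closed[OF \<pi>(1)] by simp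
    qed
    show "\<theta> (x \<oplus> y) = \<theta> x \<oplus>\<^bsub>S\<^esub> \<theta> y" if xy: "x \<in> I" "y \<in> I" for x y
    proof -
      obtain q r where qr: "rel x q" "rel y r" using ex[OF xy(1)] ex[OF xy(2)] by blast
      then have qc: "q \<in> carrier R" "r \<in> carrier R" by (auto simp: rel_def)
      have "\<theta> (x \<oplus> y) = \<pi> (q \<oplus> r)" by (rule \<theta>[OF I.a_closed[OF xy] rel_add[OF xy qr]])
      also have "\<dots> = \<pi> q \<oplus>\<^bsub>S\<^esub> \<pi> r" by (rule ring_hom_add[OF \<pi>(1) qc])
      finally show ?thesis using \<theta>[OF xy(1) qr(1)] \<theta>[OF xy(2) qr(2)] by simp
    qed
    show "\<theta> (q \<otimes> x) = \<pi> q \<otimes>\<^bsub>S\<^esub> \<theta> x" if q: "q \<in> carrier R" and x: "x \<in> I" for q x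
    proof -
      obtain r where r: "rel x r" using ex[OF x] by blast
      then have rc: "r \<in> carrier R" by (auto simp: rel_def)
      have "\<theta> (q \<otimes> x) = \<pi> (q \<otimes> r)" by (rule \<theta>[OF I.I_l_closed[OF x q] rel_mult[OF q x r]])
      also have "\<dots> = \<pi> q \<otimes>\<^bsub>S\<^esub> \<pi> r" by (rule ring_hom_mult[OF \<pi>(1) q rc])
      finally show ?thesis using \<theta>[OF x r] by simp
    qed
    show "\<theta> (f i) = \<pi> (c i)" if "i < n" for i by (rule \<theta>[OF fI[OF that] c[OF that]])
    show "c i \<in> carrier R" if "i < n" for i using c[OF that] by (simp add: rel_def)
    show "\<exists>i<n. c i \<notin> P" by (rule c_notin)
  qed
qed

lemma (in cring) ideal_square_subset:
  assumes P: "ideal P R"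
  shows "ideal_pow R P 2 \<subseteq> P"
proof -
  have "ideal (P \<cdot>\<^bsub>R\<^esub> carrier R) R" by (rule ideal_prod_is_ideal[OF P oneideal])
  then show ?thesis using ideal_prod_inter[OF P] by (auto simp: numeral_2_eq_2)
qed

text \<open>The isomorphism in the definition is compatible with \<pi>, so the kernel of \<pi> is
  exactly (g_0, ..., g_m). The g_i lie in the square of the maximal ideal, hence in that ideal, and
  so does J.\<close>

lemma embedded_deformation_functional:
  assumes Q: "cring Q" and P: "maximalideal P Q" and \<pi>: "\<pi> \<in> ring_hom Q S" and S: "ring S"
    and f: "minimally_generates Q n f (a_kernel Q S \<pi>)" and emb: "embedded_deformation Q P S \<pi>"
  obtains \<theta> c where "\<And>x. x \<in> a_kernel Q S \<pi> \<Longrightarrow> \<theta> x \<in> carrier S"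
    "\<And>x y. x \<in> a_kernel Q S \<pi> \<Longrightarrow> y \<in> a_kernel Q S \<pi> \<Longrightarrow> \<theta> (x \<oplus>\<^bsub>Q\<^esub> y) = \<theta> x \<oplus>\<^bsub>S\<^esub> \<theta> y"
    "\<And>q x. q \<in> carrier Q \<Longrightarrow> x \<in> a_kernel Q S \<pi> \<Longrightarrow> \<theta> (q \<otimes>\<^bsub>Q\<^esub> x) = \<pi> q \<otimes>\<^bsub>S\<^esub> \<theta> x"
    "\<And>i. i < n \<Longrightarrow> \<theta> (f i) = \<pi> (c i)" "\<And>i. i < n \<Longrightarrow> c i \<in> carrier Q" "\<exists>i<n. c i \<notin> P"
proof -
  interpret Q: cring Q by fact
  interpret P: maximalideal P Q by fact
  interpret S: ring S by fact
  from emb obtain m :: nat and g h where g2: "\<forall>i\<le>m. g i \<in> ideal_pow Q P 2"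
    and h: "h \<in> ring_iso (Q Quot genideal Q (g ` {..m})) S"
      "\<forall>q\<in>carrier Q. h (genideal Q (g ` {..m}) +>\<^bsub>Q\<^esub> q) = \<pi> q"
    and reg: "\<forall>x\<in>carrier (Q Quot genideal Q (g ` {..<m})).
        (genideal Q (g ` {..<m}) +>\<^bsub>Q\<^esub> g m) \<otimes>\<^bsub>Q Quot genideal Q (g ` {..<m})\<^esub> x
          = \<zero>\<^bsub>Q Quot genideal Q (g ` {..<m})\<^esub> \<longrightarrow> x = \<zero>\<^bsub>Q Quot genideal Q (g ` {..<m})\<^esub>"
    unfolding embedded_deformation_def Let_def by blast
  let ?G = "genideal Q (g ` {..m})" and ?J = "genideal Q (g ` {..<m})"
  have gP: "g i \<in> P" if "i \<le> m" for i
    using g2 that Q.ideal_square_subset[OF P.ideal_axioms] by blast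
  have gc: "g ` {..m} \<subseteq> carrier Q" "g ` {..<m} \<subseteq> carrier Q" using gP P.Icarr by auto
  have idG: "ideal ?G Q" by (rule Q.genideal_ideal[OF gc(1)])
  have idJ: "ideal ?J Q" by (rule Q.genideal_ideal[OF gc(2)])
  have gG: "g i \<in> ?G" if "i \<le> m" for i using Q.genideal_self[OF gc(1)] that by auto
  have gJ: "g i \<in> ?J" if "i < m" for i using Q.genideal_self[OF gc(2)] that by auto
  have gm: "g m \<in> carrier Q" using gc(1) by auto
  have JG: "?J \<subseteq> ?G" using gG by (intro Q.genideal_minimal[OF idG]) auto
  have JP: "?J \<subseteq> P" using gP by (intro Q.genideal_minimal[OF P.ideal_axioms]) auto
  \<comment> \<open>\<open>h\<close> is injective and sends zero to zero, so \<pi> kills q exactly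
    when the coset of q is zero.\<close>
  have ker: "\<pi> q = \<zero>\<^bsub>S\<^esub> \<longleftrightarrow> q \<in> ?G" if q: "q \<in> carrier Q" for q
  proof -
    interpret G: ideal ?G Q by (rule idG)
    let ?B = "Q Quot ?G"
    have hz: "h \<zero>\<^bsub>?B\<^esub> = \<zero>\<^bsub>S\<^esub>"
      using h(1) by (intro ring_hom_zero[OF _ G.quotient_is_ring S]) (simp add: ring_iso_def)
    have inj: "inj_on h (carrier ?B)" using h(1) by (auto simp: ring_iso_def bij_betw_def)
    have "\<zero>\<^bsub>?B\<^esub> \<in> carrier ?B" by (rule ring.ring_simprules(2)[OF G.quotient_is_ring])
    moreover have "?G +>\<^bsub>Q\<^esub> q \<in> carrier ?B" by (rule ring_hom_closed[OF G.rcos_ring_hom q])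
    ultimately have "\<pi> q = \<zero>\<^bsub>S\<^esub> \<longleftrightarrow> ?G +>\<^bsub>Q\<^esub> q = \<zero>\<^bsub>?B\<^esub>"
      using h(2) q hz inj_on_eq_iff[OF inj] by metis
    then show ?thesis using G.coset_eq_iff[OF q] by (simp add: FactRing_def)
  qed
  have kerG: "a_kernel Q S \<pi> = ?G"
    using ker ideal.Icarr[OF idG] by (auto simp: a_kernel_def')
  have one: "\<one>\<^bsub>Q\<^esub> \<notin> P" using P.one_imp_carrier P.I_notcarr by auto
  have regJ: "q \<in> ?J" if q: "q \<in> carrier Q" and qJ: "g m \<otimes>\<^bsub>Q\<^esub> q \<in> ?J" for q
  proof -
    interpret J: ideal ?J Q by (rule idJ)
    have "(?J +>\<^bsub>Q\<^esub> g m) \<otimes>\<^bsub>Q Quot ?J\<^esub> (?J +>\<^bsub>Q\<^esub> q) = ?J +>\<^bsub>Q\<^esub> (g m \<otimes>\<^bsub>Q\<^esub> q)"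
      using ring_hom_mult[OF J.rcos_ring_hom gm q] by simp
    also have "\<dots> = \<zero>\<^bsub>Q Quot ?J\<^esub>" using qJ J.coset_eq_iff[of "g m \<otimes>\<^bsub>Q\<^esub> q"] gm q by (simp add: FactRing_def)
    finally have "?J +>\<^bsub>Q\<^esub> q = \<zero>\<^bsub>Q Quot ?J\<^esub>" using reg ring_hom_closed[OF J.rcos_ring_hom q] by blast
    then show ?thesis using J.coset_eq_iff[OF q] by (simp add: FactRing_def)
  qed
  have mod: "?G \<subseteq> {x \<in> carrier Q. \<exists>q\<in>carrier Q. x \<ominus>\<^bsub>Q\<^esub> q \<otimes>\<^bsub>Q\<^esub> g m \<in> ?J}"
  proof (rule Q.genideal_minimal[OF Q.multiples_modulo_ideal[OF idJ Q.oneideal gm]], rule subsetI)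
    fix x assume "x \<in> g ` {..m}"
    then obtain i where i: "x = g i" "i \<le> m" by auto
    have xc: "x \<in> carrier Q" using i gc by auto
    have zJ: "\<zero>\<^bsub>Q\<^esub> \<in> ?J" by (rule additive_subgroup.zero_closed[OF ideal.axioms(1)[OF idJ]])
    show "x \<in> {x \<in> carrier Q. \<exists>q\<in>carrier Q. x \<ominus>\<^bsub>Q\<^esub> q \<otimes>\<^bsub>Q\<^esub> g m \<in> ?J}"
    proof (cases "i = m")
      case True
      then have "x \<ominus>\<^bsub>Q\<^esub> \<one>\<^bsub>Q\<^esub> \<otimes>\<^bsub>Q\<^esub> g m \<in> ?J" using i gm zJ by (simp add: Q.minus_eq Q.r_neg)
      then show ?thesis using xc by blast
    next
      case False
      then have "x \<in> ?J" using i gJ by simp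
      then have "x \<ominus>\<^bsub>Q\<^esub> \<zero>\<^bsub>Q\<^esub> \<otimes>\<^bsub>Q\<^esub> g m \<in> ?J" using xc gm by (simp add: Q.minus_eq)
      then show ?thesis using xc by blast
    qed
  qed
  have fg: "a_kernel Q S \<pi> = genideal Q (f ` {..<n})" "f ` {..<n} \<subseteq> carrier Q"
    using f by (auto simp: minimally_generates_def)
  have K: "a_kernel Q S \<pi> = {q \<in> carrier Q. \<pi> q = \<zero>\<^bsub>S\<^esub>}" by (rule a_kernel_def')
  have sub: "?J \<subseteq> a_kernel Q S \<pi>" "g m \<in> a_kernel Q S \<pi>"
    "a_kernel Q S \<pi> \<subseteq> {x \<in> carrier Q. \<exists>q\<in>carrier Q. x \<ominus>\<^bsub>Q\<^esub> q \<otimes>\<^bsub>Q\<^esub> g m \<in> ?J}"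
    unfolding kerG using JG gG mod by auto
  show thesis
    by (rule Q.quotient_functional[OF idJ P.ideal_axioms one JP gm regJ \<pi> S K sub fg], assumption+, rule that) assumption+
qed

section \<open>Reduction to the residue field\<close>

lemma op_ring_simps:
  "carrier (op_ring R n) = {s. (\<forall>H. s H \<in> carrier R) \<and> finite {H. s H \<noteq> \<zero>\<^bsub>R\<^esub>} \<and>
     (\<forall>H. s H \<noteq> \<zero>\<^bsub>R\<^esub> \<longrightarrow> set_mset H \<subseteq> {..<n})}"
  "mult (op_ring R n) s t = (\<lambda>H. \<Oplus>\<^bsub>R\<^esub>G\<in>{G. G \<subseteq># H}. s G \<otimes>\<^bsub>R\<^esub> t (H - G))"
  "zero (op_ring R n) = (\<lambda>H. \<zero>\<^bsub>R\<^esub>)"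
  "grade (op_ring R n) i = {s \<in> carrier (op_ring R n). \<forall>H. s H \<noteq> \<zero>\<^bsub>R\<^esub> \<longrightarrow> i = - 2 * int (size H)}"
  "diff (op_ring R n) s = (\<lambda>_. \<zero>\<^bsub>R\<^esub>)"
  by (simp_all add: op_ring_def Let_def)

lemma op_ring_commute:
  assumes "cring R" and s: "s \<in> carrier (op_ring R n)" and t: "t \<in> carrier (op_ring R n)"
  shows "s \<otimes>\<^bsub>op_ring R n\<^esub> t = t \<otimes>\<^bsub>op_ring R n\<^esub> s"
proof
  interpret R: cring R by fact
  have c: "s G \<in> carrier R" "t G \<in> carrier R" for G using s t by (simp_all add: op_ring_simps(1))
  fix H
  have "(\<Oplus>\<^bsub>R\<^esub>G\<in>{G. G \<subseteq># H}. s G \<otimes>\<^bsub>R\<^esub> t (H - G)) = (\<Oplus>\<^bsub>R\<^esub>G\<in>{G. G \<subseteq># H}. t (H - G) \<otimes>\<^bsub>R\<^esub> s (H - (H - G)))"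
    using c by (intro R.finsum_cong') (auto simp: diff_diff_submultiset R.m_comm)
  also have "\<dots> = (\<Oplus>\<^bsub>R\<^esub>G\<in>{G. G \<subseteq># H}. t G \<otimes>\<^bsub>R\<^esub> s (H - G))"
    using c by (intro submultisets_reflect[where g = "\<lambda>G. t G \<otimes>\<^bsub>R\<^esub> s (H - G)"] R.abelian_group_axioms) auto
  finally show "(s \<otimes>\<^bsub>op_ring R n\<^esub> t) H = (t \<otimes>\<^bsub>op_ring R n\<^esub> s) H" by (simp add: op_ring_simps(2))
qed

lemma linear_form_grade:
  assumes "ring R" and c: "\<And>i. i < n \<Longrightarrow> c i \<in> carrier R"
  shows "linear_form R n c \<in> grade (op_ring R n) (- 2)"
proof -
  interpret R: ring R by fact
  have nz: "\<exists>i<n. H = {#i#}" if "linear_form R n c H \<noteq> \<zero>\<^bsub>R\<^esub>" for H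
    using that by (auto simp: linear_form_def split: if_splits)
  then have "{H. linear_form R n c H \<noteq> \<zero>\<^bsub>R\<^esub>} \<subseteq> (\<lambda>i. {#i#}) ` {..<n}" by blast
  then have "finite {H. linear_form R n c H \<noteq> \<zero>\<^bsub>R\<^esub>}" by (rule finite_subset) simp
  moreover have "linear_form R n c H \<in> carrier R" for H using c by (auto simp: linear_form_def)
  moreover have "set_mset H \<subseteq> {..<n} \<and> (- 2 :: int) = - 2 * int (size H)" if "linear_form R n c H \<noteq> \<zero>\<^bsub>R\<^esub>" for H
    using nz[OF that] by auto
  ultimately show ?thesis unfolding op_ring_simps(4,1) by blast
qed

lemma linear_form_coset:
  assumes "ideal P R"
  shows "P +>\<^bsub>R\<^esub> linear_form R n c H = linear_form (R Quot P) n (\<lambda>i. P +>\<^bsub>R\<^esub> c i) H"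
proof -
  interpret P: ideal P R by fact
  have "P +>\<^bsub>R\<^esub> \<zero>\<^bsub>R\<^esub> = P" using P.coset_eq_iff[OF P.zero_closed] P.zero_closed by simp
  then show ?thesis by (auto simp: linear_form_def FactRing_def)
qed

lemma reduce_scalars_simps:
  "carrier (reduce_scalars Q P n X) = carrier X" "zero (reduce_scalars Q P n X) = zero X"
  "add (reduce_scalars Q P n X) = add X" "grade (reduce_scalars Q P n X) = grade X"
  "diff (reduce_scalars Q P n X) = diff X" "finsum (reduce_scalars Q P n X) = finsum X"
  by (simp_all add: reduce_scalars_def finsum_def finprod_def fun_eq_iff)

lemma reduce_scalars_abelian_group:
  assumes "abelian_group X"
  shows "abelian_group (reduce_scalars Q P n X)"
proof -
  interpret X: abelian_group X by fact
  show ?thesis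
  proof (rule abelian_groupI)
    fix x assume "x \<in> carrier (reduce_scalars Q P n X)"
    then show "\<exists>y\<in>carrier (reduce_scalars Q P n X). y \<oplus>\<^bsub>reduce_scalars Q P n X\<^esub> x = \<zero>\<^bsub>reduce_scalars Q P n X\<^esub>"
      by (intro bexI[of _ "\<ominus>\<^bsub>X\<^esub> x"]) (simp_all add: reduce_scalars_simps X.l_neg)
  qed (simp_all add: reduce_scalars_simps X.a_ac)
qed

text \<open>The reduced action is a definite description over all lifts of \<open>a\<close>. One
  lift is needed for existence, and the vanishing for every lift for uniqueness.\<close>

lemma reduce_scalars_act_zero:
  assumes s: "s \<in> carrier (op_ring Q n)" "(\<lambda>H. P +>\<^bsub>Q\<^esub> s H) = a"
    and z: "\<And>s. s \<in> carrier (op_ring Q n) \<Longrightarrow> (\<lambda>H. P +>\<^bsub>Q\<^esub> s H) = a \<Longrightarrow> act X s x = \<zero>\<^bsub>X\<^esub>"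
  shows "act (reduce_scalars Q P n X) a x = \<zero>\<^bsub>X\<^esub>"
proof -
  have "(THE y. \<exists>s\<in>carrier (op_ring Q n). (\<lambda>H. P +>\<^bsub>Q\<^esub> s H) = a \<and> act X s x = y) = \<zero>\<^bsub>X\<^esub>"
    using s z by (intro the_equality) blast+
  then show ?thesis by (simp add: reduce_scalars_def)
qed

theorem proposition5p3p7:
  fixes R :: "'r ring" and Q :: "'q ring" and F :: "(nat set \<Rightarrow> 'q, 'm) dgm"
    and \<mm> :: "'r set" and \<nn> :: "'q set" and n :: nat and f :: "nat \<Rightarrow> 'q"
    and \<pi> :: "'q \<Rightarrow> nat \<Rightarrow> 'r set" and \<alpha> :: "'m \<Rightarrow> nat \<Rightarrow> 'r set"
  assumes "noetherian_local_ring R \<mm>"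
    and "regular_local_ring Q \<nn>" and "adically_complete Q \<nn>"
    and "\<And>i. i < n \<Longrightarrow> f i \<in> ideal_pow Q \<nn> 2"
    and "\<pi> \<in> ring_hom Q (adic_completion R \<mm>)"
    and "\<pi> ` carrier Q = carrier (adic_completion R \<mm>)"
    and "minimally_generates Q n f (a_kernel Q (adic_completion R \<mm>) \<pi>)"
    and "Q_semiprojective_resolution Q n f F (inflation (adic_completion R \<mm>) \<pi>) \<alpha>"
    and "embedded_deformation Q \<nn> (adic_completion R \<mm>) \<pi>"
  shows "\<exists>Z. hyperplane (Q Quot \<nn>) n Z \<and> cohomological_support Q \<nn> n f F \<subseteq> Z"
proof -
  let ?S = "adic_completion R \<mm>" and ?k = "Q Quot \<nn>" and ?\<phi> = "\<lambda>q. \<nn> +>\<^bsub>Q\<^esub> q"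
  let ?Q0 = "degree_zero_ring Q" and ?F0 = "restrict_scalars Q F" and ?I = "a_kernel Q ?S \<pi>"
  let ?E = "Ext_E Q n f F (inflation ?k ?\<phi>)"
  have Q: "cring Q" and P: "maximalideal \<nn> Q"
    using assms(2) by (auto simp: regular_local_ring_def noetherian_local_ring_def)
  interpret Q: cring Q by (rule Q)
  interpret P: maximalideal \<nn> Q by (rule P)
  have gen: "f ` {..<n} \<subseteq> carrier Q" "genideal Q (f ` {..<n}) = ?I"
    using assms(7) by (auto simp: minimally_generates_def)
  \<comment> \<open>That \<pi> sends zero to zero is obtained from the assumption that its kernel is
    a generated ideal, since nothing is known yet about the ring structure of the
    completion.\<close>
  have "\<zero>\<^bsub>Q\<^esub> \<in> ?I"
    using additive_subgroup.zero_closed[OF ideal.axioms(1)[OF Q.genideal_ideal[OF gen(1)]]] gen(2) by simp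
  then have \<pi>0: "\<pi> \<zero>\<^bsub>Q\<^esub> = \<zero>\<^bsub>?S\<^esub>" by (simp add: a_kernel_def')
  have S: "cring ?S" by (rule surjective_ring_hom_cring[OF Q assms(5,6) \<pi>0])
  have one: "\<one>\<^bsub>Q\<^esub> \<noteq> \<zero>\<^bsub>Q\<^esub>" using P.one_imp_carrier P.I_notcarr P.zero_closed by auto
  have fc: "f i \<in> carrier Q" and fI: "\<pi> (f i) = \<zero>\<^bsub>?S\<^esub>" if "i < n" for i
    using gen Q.genideal_self[OF gen(1)] that by (auto simp: a_kernel_def')
  \<comment> \<open>The f_i lie in the square of the maximal ideal, hence vanish in the residue
    field, as the instance of \<open>koszul_ext\<close> over that field demands.\<close>
  have f\<nn>: "?\<phi> (f i) = \<zero>\<^bsub>?k\<^esub>" if "i < n" for i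
    using P.coset_eq_iff[OF fc[OF that]] assms(4)[OF that] Q.ideal_square_subset[OF P.ideal_axioms]
    by (auto simp: FactRing_def)
  have res: "dg_module (koszul Q n f) F" "semiprojective ?Q0 ?F0"
    "dg_hom (koszul Q n f) F (inflation ?S \<pi>) \<alpha>" "quasi_iso F (inflation ?S \<pi>) \<alpha>"
    using assms(8) by (auto simp: Q_semiprojective_resolution_def)
  have km: "koszul_module Q n f F"
    using res(1,2) fc by (intro koszul_module.intro koszul_module_axioms.intro Q) (auto simp: semiprojective_def)
  have kS: "koszul_ext Q n f F ?S \<pi>"
    by (intro koszul_ext.intro koszul_ext_axioms.intro km S assms(5) fI)
  have kk: "koszul_ext Q n f F ?k ?\<phi>"
    by (intro koszul_ext.intro koszul_ext_axioms.intro km P.quotient_is_cring Q P.rcos_ring_hom f\<nn>)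
  obtain \<theta> c where \<theta>: "\<And>x. x \<in> ?I \<Longrightarrow> \<theta> x \<in> carrier ?S"
    "\<And>x y. x \<in> ?I \<Longrightarrow> y \<in> ?I \<Longrightarrow> \<theta> (x \<oplus>\<^bsub>Q\<^esub> y) = \<theta> x \<oplus>\<^bsub>?S\<^esub> \<theta> y"
    "\<And>q x. q \<in> carrier Q \<Longrightarrow> x \<in> ?I \<Longrightarrow> \<theta> (q \<otimes>\<^bsub>Q\<^esub> x) = \<pi> q \<otimes>\<^bsub>?S\<^esub> \<theta> x"
    "\<And>i. i < n \<Longrightarrow> \<theta> (f i) = \<pi> (c i)" and c: "\<And>i. i < n \<Longrightarrow> c i \<in> carrier Q" "\<exists>i<n. c i \<notin> \<nn>"
    by (rule embedded_deformation_functional[OF Q P assms(5) cring.axioms(1)[OF S] assms(7,9)], rule that) assumption+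
  let ?t = "linear_form Q n c" and ?c = "\<lambda>i. \<nn> +>\<^bsub>Q\<^esub> c i"
  let ?l = "linear_form ?k n ?c" and ?X = "reduce_scalars Q \<nn> n ?E"
  note K = a_kernel_def'[of Q ?S \<pi>]
  obtain \<sigma> where \<sigma>: "\<And>G. \<sigma> G \<in> hom_degree ?Q0 ?F0 ?F0 (- 1 + 2 * int (size G))"
    "\<And>G x. x \<in> carrier F \<Longrightarrow> conv ?F0 ?F0 \<sigma> (koszul_module.delta Q n F) G x \<oplus>\<^bsub>F\<^esub>
      conv ?F0 ?F0 (koszul_module.delta Q n F) \<sigma> G x = scalar_family ?F0 ?t G x"
    using koszul_ext.null_homotopy_of_functional[OF kS res(2,3,4) assms(6) one \<theta>[unfolded K] c(1)] by blast
  have t: "?t \<in> carrier (op_ring Q n)" using linear_form_grade[OF Q.ring_axioms c(1)] by (simp add: op_ring_simps(4))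
  have tl: "(\<lambda>H. \<nn> +>\<^bsub>Q\<^esub> ?t H) = ?l" by (simp add: linear_form_coset[OF P.ideal_axioms])
  \<comment> \<open>Any two lifts of the form agree modulo the maximal ideal, so the homotopy for
    \<open>?t\<close> annihilates the action of every lift.\<close>
  have zero: "act ?E s x = \<zero>\<^bsub>?E\<^esub>"
    if s: "s \<in> carrier (op_ring Q n)" "(\<lambda>H. \<nn> +>\<^bsub>Q\<^esub> s H) = ?l" and x: "x \<in> carrier ?E" for s x
  proof (rule koszul_ext.Ext_E_op_zero[OF kk \<sigma> _ koszul_module.linear_form_hom_degree[OF km c(1)] _ _ _ x])
    show "\<nn> +>\<^bsub>Q\<^esub> s G = \<nn> +>\<^bsub>Q\<^esub> ?t G" for G using s(2) tl by metis
  qed (use s(1) t in \<open>simp_all add: op_ring_simps(1)\<close>)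
  have ann: "act ?X ?l x = \<zero>\<^bsub>?X\<^esub>" if "x \<in> carrier ?X" for x
    unfolding reduce_scalars_simps
    by (rule reduce_scalars_act_zero[OF t tl zero]) (use that in \<open>simp_all add: reduce_scalars_simps\<close>)
  have cc: "?c i \<in> carrier ?k" if "i < n" for i by (rule ring_hom_closed[OF P.rcos_ring_hom c(1)[OF that]])
  \<comment> \<open>A coefficient outside the maximal ideal is nonzero in the residue field, so the
    linear form does define a hyperplane.\<close>
  have cnz: "\<exists>i<n. ?c i \<noteq> \<zero>\<^bsub>?k\<^esub>" using c P.coset_eq_iff by (auto simp: FactRing_def)
  let ?A = "op_ring ?k n"
  have "?l \<in> p" if p: "p \<in> Supp_plus ?A ?X" for p
  proof (rule annihilator_in_support[OF op_ring_commute[OF P.quotient_is_cring[OF Q]] _ _ _ _ _ linear_form_grade[OF P.quotient_is_ring cc] _ ann p])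
    show "a = \<zero>\<^bsub>?A\<^esub>" if "a \<in> grade ?A i" "odd i" for a i
      using that by (fastforce simp: op_ring_simps(3,4))
    show "diff ?A a = \<zero>\<^bsub>?A\<^esub>" for a by (simp add: op_ring_simps)
    show "abelian_group ?X" by (rule reduce_scalars_abelian_group[OF koszul_ext.Ext_E_group[OF kk]])
    show "diff ?X x = \<zero>\<^bsub>?X\<^esub>" for x by (simp add: reduce_scalars_simps koszul_ext.Ext_E_diff[OF kk])
    show "independent_grades ?X"
      using koszul_ext.Ext_E_independent[OF kk] by (simp add: independent_grades_def reduce_scalars_simps)
  qed simp_all
  moreover have "p \<in> Proj ?A" if "p \<in> Supp_plus ?A ?X" for p using that by (simp add: Supp_plus_def)
  ultimately have "cohomological_support Q \<nn> n f F \<subseteq> {p \<in> Proj ?A. ?l \<in> p}"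
    unfolding cohomological_support_def Let_def by (intro subsetI CollectI conjI)
  moreover have "hyperplane ?k n {p \<in> Proj ?A. ?l \<in> p}"
    unfolding hyperplane_def by (rule exI[of _ ?c]) (simp add: cc cnz)
  ultimately show ?thesis by (intro exI conjI)
qed

end
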